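(* Let $K$ be a knot in $S^3$ and let $L=(L_1,\ldots,L_n)$ be a link in $S^3$. Assume that $K$ bounds a Seifert surface $\Sigma$ with the property that there exist Seifert surfaces $\Sigma_1,\ldots,\Sigma_n$ for $L_1,\ldots,L_n$, respectively, each disjoint from a neighborhood of $\Sigma$. Let $p,q,k$ be integers with $q\ge 1$, $|p|\ge 1$, $k>1$, and $kp$ and $q$ relatively prime, and let $I=(i_1,\ldots,i_n)$ with $i_j\in\{1,-1\}$ for each $j$. Let $M$ be the 3-manifold obtained by $kp/q$-Dehn surgery on $K$ in $S^3$ followed by surgery on $L$ with surgery coefficients $I$. Let $\tilde M$ be the 3-manifold obtained by $p/q$-Dehn surgery on the lift $\overline K$ of $K$ to the $k$-fold branched cyclic cover $\overline S^3_K$ of $S^3$ branched along $K$, followed by surgery on the $k$ disjoint lifts of each $L_j$ to $\overline S^3_K$, with surgery coefficient $i_j$ on every lift of $L_j$. Then $\tilde M$ is a regular $k$-fold cyclic covering space of $M$.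
   Context: The cover $\overline S^3_K$ is the $k$-fold cyclic covering space of $S^3$ branched along $K$; $\overline K$ is the preimage of $K$. Each $L_j$ has $k$ disjoint lifts to $\overline S^3_K$ because $L_j$ bounds a Seifert surface disjoint from $\Sigma$; these lifts bound lifts of $\Sigma_j$. Surgery coefficients are taken with respect to preferred longitudes. Thus $kp/q$-surgery on $K$ glues a solid torus to the exterior of $K$, sending a meridian of the solid torus to $m^{kp}l^q$, where $m$ is the meridian and $l$ the preferred longitude of $K$. Likewise $p/q$-surgery on $\overline K$ sends the meridian of the glued-in solid torus to $\overline m^{\,p}\,\overline l^{\,q}$, where $\overline m$ is the meridian of $\overline K$ and $\overline l$ is a longitude of $\overline K$ lifting $l$. Coefficients on $L_j$ and on its lifts are with respect to the longitudes determined by $\Sigma_j$ and by its lifts. A regular $k$-fold cyclic covering is a regular (unbranched) covering with group of deck transformations $\mathbb Z/k\mathbb Z$. *)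

theory Defs
  imports
    "HOL-Analysis.Analysis"
    "HOL-Algebra.Bij"
    "HOL-Homology.Homology"
begin

text \<open>
  Spaces are subsets of topological spaces with the subspace topology; all constructions that
  topology regards as defined up to homeomorphism (surgered manifolds, branched covers) are
  given as predicates on arbitrary spaces. Knots and surfaces are in the tame topological
  category: a (tame) knot is a set that has a tubular neighbourhood.
\<close>

abbreviation S3 :: "(real ^ 4) set" where
  "S3 \<equiv> sphere 0 1"

definition solid_torus :: "(complex \<times> complex) set" where
  "solid_torus = sphere 0 1 \<times> cball 0 1"

definition open_solid_torus :: "(complex \<times> complex) set" where
  "open_solid_torus = sphere 0 1 \<times> ball 0 1"

definition torus :: "(complex \<times> complex) set" where
  "torus = sphere 0 1 \<times> sphere 0 1"

definition closed_embedding ::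
    "'a::topological_space set \<Rightarrow> 'b::topological_space set \<Rightarrow> ('a \<Rightarrow> 'b) \<Rightarrow> bool" where
  "closed_embedding S Y f \<longleftrightarrow>
     embedding_map (top_of_set S) (top_of_set Y) f \<and> closed_map (top_of_set S) (top_of_set Y) f"

definition open_embedding ::
    "'a::topological_space set \<Rightarrow> 'b::topological_space set \<Rightarrow> ('a \<Rightarrow> 'b) \<Rightarrow> bool" where
  "open_embedding S Y f \<longleftrightarrow>
     embedding_map (top_of_set S) (top_of_set Y) f \<and> open_map (top_of_set S) (top_of_set Y) f"


section \<open>Tubular neighbourhoods, exteriors, Dehn surgery\<close>

text \<open>
  A parametrised tubular neighbourhood \<open>\<theta>\<close> of \<open>C\<close> carries a meridian
  \<open>v \<mapsto> \<theta> (1, v)\<close> and a longitude \<open>u \<mapsto> \<theta> (u, 1)\<close>, with \<open>u\<close>, \<open>v\<close> on the unit circle.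
\<close>

definition tubular_nbhd ::
    "'a::topological_space set \<Rightarrow> 'a set \<Rightarrow> (complex \<times> complex \<Rightarrow> 'a) \<Rightarrow> bool" where
  "tubular_nbhd X C \<theta> \<longleftrightarrow>
     closed_embedding solid_torus X \<theta> \<and>
     openin (top_of_set X) (\<theta> ` open_solid_torus) \<and>
     \<theta> ` (sphere 0 1 \<times> {0}) = C"

definition exterior ::
    "'a set \<Rightarrow> 'j set \<Rightarrow> ('j \<Rightarrow> complex \<times> complex \<Rightarrow> 'a) \<Rightarrow> 'a set" where
  "exterior X J \<theta> = X - (\<Union>j\<in>J. \<theta> j ` open_solid_torus)"

text \<open>
  \<open>dehn_surgery X J \<theta> a b Y e\<close>: for a finite family of pairwise disjoint tubular neighbourhoods
  \<open>\<theta> j\<close> in \<open>X\<close>, the space \<open>Y\<close> is (a copy of) the union of the exterior, included by \<open>e\<close>, and of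
  solid tori, included by \<open>g j\<close>, glued along their boundary tori. The gluing homeomorphism is
  arbitrary subject to the meridian \<open>v \<mapsto> (1, v)\<close> of the glued-in solid torus going to
  \<open>m\<^sup>a l\<^sup>b\<close>, i.e. the surgery coefficient is \<open>a j / b j\<close> with respect to the meridian \<open>m\<close> and the
  longitude \<open>l\<close> of \<open>\<theta> j\<close>.

  The sign of a coefficient depends on the orientation of the pair \<open>(l, m)\<close>. No orientation
  is imposed on \<open>\<theta> j\<close>: an orientation reversing parametrisation turns \<open>a/b\<close> into \<open>-a/b\<close>.
\<close>

definition dehn_surgery ::
    "'a::topological_space set \<Rightarrow> 'j set \<Rightarrow> ('j \<Rightarrow> complex \<times> complex \<Rightarrow> 'a) \<Rightarrow>
     ('j \<Rightarrow> int) \<Rightarrow> ('j \<Rightarrow> int) \<Rightarrow> 'b::topological_space set \<Rightarrow> ('a \<Rightarrow> 'b) \<Rightarrow> bool" where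
  "dehn_surgery X J \<theta> a b Y e \<longleftrightarrow>
     closed_embedding (exterior X J \<theta>) Y e \<and>
     (\<exists>g. (\<forall>j\<in>J. closed_embedding solid_torus Y (g j) \<and>
                 g j ` torus = e ` \<theta> j ` torus \<and>
                 e ` exterior X J \<theta> \<inter> g j ` solid_torus = g j ` torus \<and>
                 (\<forall>v\<in>sphere 0 1. g j (1, v) = e (\<theta> j (v powi b j, v powi a j)))) \<and>
          (\<forall>i\<in>J. \<forall>j\<in>J. i \<noteq> j \<longrightarrow> g i ` solid_torus \<inter> g j ` solid_torus = {}) \<and>
          Y = e ` exterior X J \<theta> \<union> (\<Union>j\<in>J. g j ` solid_torus))"


section \<open>Seifert surfaces and longitudes\<close>

text \<open>
  \<open>B\<close> is determined by \<open>F\<close>: it is the set of points sent to the boundary line of the closed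
  upper half plane by the charts.
\<close>

definition surface_with_boundary :: "'a::topological_space set \<Rightarrow> 'a set \<Rightarrow> bool" where
  "surface_with_boundary F B \<longleftrightarrow> B \<subseteq> F \<and>
     (\<forall>x\<in>F. \<exists>U V h h'. x \<in> U \<and> openin (top_of_set F) U \<and>
        openin (top_of_set {z::complex. 0 \<le> Im z}) V \<and>
        homeomorphism U V h h' \<and> U \<inter> B = {y\<in>U. Im (h y) = 0})"

text \<open>
  Seifert surfaces as in Rolfsen: compact, connected, bicollared (hence orientable, and with a
  choice of side oriented) surfaces in the 3-sphere.
\<close>

definition seifert_surface :: "(real ^ 4) set \<Rightarrow> (real ^ 4) set \<Rightarrow> bool" where
  "seifert_surface F C \<longleftrightarrow>
     F \<subseteq> S3 \<and> compact F \<and> connected F \<and> surface_with_boundary F C \<and>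
     (\<exists>c. closed_embedding (F \<times> {-1..1::real}) S3 c \<and> (\<forall>x\<in>F. c (x, 0) = x))"

text \<open>The loop \<open>\<gamma>\<close> on \<open>[0,1]\<close> represents 0 in the first singular homology group of \<open>U\<close>.\<close>

definition null_homologous_loop :: "'a::topological_space set \<Rightarrow> (real \<Rightarrow> 'a) \<Rightarrow> bool" where
  "null_homologous_loop U \<gamma> \<longleftrightarrow>
     singular_relboundary 1 (top_of_set U) {} (frag_of (\<lambda>s\<in>standard_simplex 1. \<gamma> (s 1)))"

text \<open>The longitude of \<open>\<theta>\<close> is the preferred one: it is null-homologous in the exterior.\<close>

definition preferred_longitude :: "(complex \<times> complex \<Rightarrow> real ^ 4) \<Rightarrow> bool" where
  "preferred_longitude \<theta> \<longleftrightarrow>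
     null_homologous_loop (exterior S3 {()} (\<lambda>_. \<theta>)) (\<lambda>t. \<theta> (cis (2 * pi * t), 1))"

text \<open>
  The longitude of \<open>\<theta>\<close> is the one determined by the surface \<open>F\<close>: the tubular neighbourhood meets
  \<open>F\<close> in a collar of the boundary of \<open>F\<close>, whose other end \<open>F \<inter> \<theta> ` torus\<close> is the longitude.
\<close>

definition surface_longitude :: "'a set \<Rightarrow> (complex \<times> complex \<Rightarrow> 'a) \<Rightarrow> bool" where
  "surface_longitude F \<theta> \<longleftrightarrow>
     F \<inter> \<theta> ` solid_torus = \<theta> ` (sphere 0 1 \<times> (of_real ` {0..1}))"


section \<open>Regular cyclic coverings and branched cyclic covers\<close>

definition deck_transformations ::
    "'a::topological_space set \<Rightarrow> ('a \<Rightarrow> 'b) \<Rightarrow> ('a \<Rightarrow> 'a) set" where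
  "deck_transformations E \<pi> =
     {\<tau> \<in> extensional E. (\<exists>\<tau>'. homeomorphism E E \<tau> \<tau>') \<and> (\<forall>y\<in>E. \<pi> (\<tau> y) = \<pi> y)}"

definition deck_group :: "'a::topological_space set \<Rightarrow> ('a \<Rightarrow> 'b) \<Rightarrow> ('a \<Rightarrow> 'a) monoid" where
  "deck_group E \<pi> = (BijGroup E)\<lparr>carrier := deck_transformations E \<pi>\<rparr>"

definition regular_cyclic_covering ::
    "nat \<Rightarrow> 'a::topological_space set \<Rightarrow> ('a \<Rightarrow> 'b::topological_space) \<Rightarrow> 'b set \<Rightarrow> bool" where
  "regular_cyclic_covering k E \<pi> B \<longleftrightarrow>
     connected E \<and> covering_space E \<pi> B \<and>
     (\<forall>x\<in>B. card {y\<in>E. \<pi> y = x} = k) \<and>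
     (\<forall>y\<in>E. \<forall>z\<in>E. \<pi> y = \<pi> z \<longrightarrow> (\<exists>\<tau>\<in>deck_transformations E \<pi>. \<tau> y = z)) \<and>
     deck_group E \<pi> \<cong> integer_mod_group k"

text \<open>
  \<open>\<pi> : X \<rightarrow> S3\<close> is a \<open>k\<close>-fold cyclic covering branched along the knot \<open>K\<close>: a regular cyclic
  covering of the knot complement, which near every point over \<open>K\<close> looks like
  \<open>(t, w) \<mapsto> (t, w\<^sup>k)\<close>. As the first homology of the knot complement is infinite cyclic, generated
  by a meridian, this determines \<open>(X, \<pi>)\<close> up to isomorphism.
\<close>

definition branched_cyclic_cover ::
    "nat \<Rightarrow> 'a::topological_space set \<Rightarrow> ('a \<Rightarrow> real ^ 4) \<Rightarrow> (real ^ 4) set \<Rightarrow> bool" where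
  "branched_cyclic_cover k X \<pi> K \<longleftrightarrow>
     Hausdorff_space (top_of_set X) \<and> continuous_on X \<pi> \<and> \<pi> ` X = S3 \<and>
     regular_cyclic_covering k (X - \<pi> -` K) \<pi> (S3 - K) \<and>
     (\<forall>x \<in> X \<inter> \<pi> -` K. \<exists>\<alpha> \<beta>. let D = {-1<..<1::real} \<times> ball (0::complex) 1 in
        open_embedding D X \<alpha> \<and> open_embedding D S3 \<beta> \<and> \<alpha> (0, 0) = x \<and>
        D \<inter> \<beta> -` K = {-1<..<1} \<times> {0} \<and>
        (\<forall>(t, w)\<in>D. \<pi> (\<alpha> (t, w)) = \<beta> (t, w ^ k)))"

text \<open>
  A tubular neighbourhood of the branch set lying over the tubular neighbourhood \<open>\<theta>\<close> of \<open>K\<close>: its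
  longitude is a lift of the longitude of \<open>\<theta>\<close>, its meridian covers the meridian of \<open>\<theta>\<close> \<open>k\<close> times.
\<close>

definition branch_tubular_nbhd ::
    "nat \<Rightarrow> 'a::topological_space set \<Rightarrow> ('a \<Rightarrow> real ^ 4) \<Rightarrow> (real ^ 4) set \<Rightarrow>
     (complex \<times> complex \<Rightarrow> real ^ 4) \<Rightarrow> (complex \<times> complex \<Rightarrow> 'a) \<Rightarrow> bool" where
  "branch_tubular_nbhd k X \<pi> K \<theta> \<psi> \<longleftrightarrow>
     tubular_nbhd X (X \<inter> \<pi> -` K) \<psi> \<and>
     (\<forall>(u, w)\<in>solid_torus. \<pi> (\<psi> (u, w)) = \<theta> (u, w ^ k))"

text \<open>
  All lifts of a tubular neighbourhood \<open>\<theta>\<close>. When the core of \<open>\<theta>\<close> bounds a Seifert surface disjoint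
  from one of the branch set, these are the disjoint tubular neighbourhoods of the \<open>k\<close> lifts
  of the core; and if \<open>\<theta>\<close> has the longitude determined by a surface, each lift of \<open>\<theta>\<close> has
  the longitude determined by the corresponding lift of the surface.
\<close>

definition lifts ::
    "'a::topological_space set \<Rightarrow> ('a \<Rightarrow> 'b) \<Rightarrow> (complex \<times> complex \<Rightarrow> 'b) \<Rightarrow>
     (complex \<times> complex \<Rightarrow> 'a) set" where
  "lifts X \<pi> \<theta> =
     {f \<in> extensional solid_torus. continuous_on solid_torus f \<and> f ` solid_torus \<subseteq> X \<and>
        (\<forall>z\<in>solid_torus. \<pi> (f z) = \<theta> z)}"

end

theory Submission imports Defs
begin

text \<open>
  The exterior of \<open>K\<close> and \<open>L\<close> is covered by its preimage, and the deck group of this covering is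
  generated by one transformation \<open>t\<close> of order \<open>k\<close>. The proof extends \<open>t\<close> to a free action of the
  cyclic group of order \<open>k\<close> on the upper surgered manifold and recognises the lower one as its
  quotient; such a quotient is a regular cyclic covering (\<open>free_cyclic_quotient\<close>). Two things have
  to be understood: what the covering does near each \<open>L\<^sub>j\<close>, and how it extends over the solid torus
  glued in along \<open>K\<close>.

  The monodromy of the covering along a loop is a \<open>k\<close>-th root of unity; it must
  be \<open>1\<close> along \<open>L\<^sub>j\<close>. All that is known about \<open>L\<^sub>j\<close> is that it avoids the Seifert surface
  \<open>F\<close> of \<open>K\<close>. Counting crossings with \<open>F\<close> defines another local system on the complement of
  \<open>K\<close>, with monodromy \<open>1\<close> along \<open>L\<^sub>j\<close>. A local system is described here by a \<open>flat\<close>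
  cocycle, and its triviality by the existence of a \<open>parallel\<close> section. For a suitable exponent
  \<open>d\<close>, the \<open>d\<close>-th power of the covering cocycle and the crossing cocycle have the same
  monodromy along a meridian of \<open>K\<close>. Their quotient therefore extends over \<open>K\<close>, up to a change of
  gauge and a twist along \<open>K\<close>, to a local system on the whole simply connected 3-sphere, and so it
  is trivial (\<open>extend_over_core\<close>): the two monodromies agree along every loop. There is a loop
  crossing \<open>F\<close> exactly once (\<open>seifert_crossing\<close>); it shows that \<open>d\<close> is invertible modulo \<open>k\<close>, and
  the monodromy of the covering along \<open>L\<^sub>j\<close>, whose \<open>d\<close>-th power is \<open>1\<close>, is \<open>1\<close>
  (\<open>lift_over_knot\<close>).

  As for the solid torus at \<open>K\<close>, a surgery coefficient only prescribes the image of a meridian, but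
  a homeomorphism of the torus that fixes a meridian extends over the solid torus
  (\<open>torus_homeo_extends\<close>), so the gluing map may be assumed linear, with any second column that
  makes the determinant \<open>1\<close>. Choose \<open>c\<close>, \<open>d\<close> with \<open>c k p - d q = 1\<close>. Below, glue by
  \<open>(u, v) \<mapsto> (u\<^sup>c v\<^sup>q, u\<^sup>d v\<^sup>k\<^sup>p)\<close>, and above by \<open>(u, v) \<mapsto> (u\<^sup>k\<^sup>c v\<^sup>q, u\<^sup>d v\<^sup>p)\<close>. Near \<open>K\<close> the
  branched covering is \<open>(x, y) \<mapsto> (x, y\<^sup>k)\<close>, and this corresponds under the two gluings to
  \<open>(u, v) \<mapsto> (u\<^sup>k, v)\<close> (\<open>linear_wrap\<close>), which is an unbranched covering of solid tori: this is what
  the factor \<open>k\<close> in the coefficient \<open>kp/q\<close> achieves. Likewise \<open>t\<close>, which is \<open>(x, y) \<mapsto> (x, \<xi> y)\<close> near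
  the branch set with \<open>\<xi>\<close> a primitive root of unity, corresponds to \<open>(u, v) \<mapsto> (\<xi>\<^sup>-\<^sup>q u, v)\<close>, which acts
  freely. The solid tori at the lifts of \<open>L\<^sub>j\<close> are permuted by \<open>t\<close> and mapped identically to the one
  at \<open>L\<^sub>j\<close>. All pieces are put together in \<open>filling_covering\<close>.
\<close>

section \<open>Flat cocycles and parallel sections\<close>

definition nbhds_in :: "'a::topological_space set \<Rightarrow> 'a \<Rightarrow> 'a filter" where
  "nbhds_in S y = inf (nhds y) (principal S)"

lemma eventually_nbhds_in:
  "eventually P (nbhds_in S y) \<longleftrightarrow> (\<exists>U. open U \<and> y \<in> U \<and> (\<forall>x\<in>U \<inter> S. P x))"
  unfolding nbhds_in_def eventually_inf_principal eventually_nhds by blast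

lemma eventually_nbhds_in_self: "eventually P (nbhds_in S y) \<Longrightarrow> y \<in> S \<Longrightarrow> P y"
  by (auto simp: eventually_nbhds_in)

lemma eventually_nbhds_in_mem: "eventually (\<lambda>x. x \<in> S) (nbhds_in S y)"
  by (auto simp: eventually_nbhds_in)

lemma eventually_nbhds_in_subset:
  "eventually P (nbhds_in S y) \<Longrightarrow> R \<subseteq> S \<Longrightarrow> eventually P (nbhds_in R y)"
  unfolding eventually_nbhds_in by (meson IntD1 IntD2 IntI subsetD)

lemma eventually_nbhds_in_Un:
  "eventually P (nbhds_in (A \<union> B) y) \<longleftrightarrow> eventually P (nbhds_in A y) \<and> eventually P (nbhds_in B y)"
proof -
  have "nbhds_in (A \<union> B) y = sup (nbhds_in A y) (nbhds_in B y)"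
    unfolding nbhds_in_def by (simp add: inf_sup_distrib1 flip: sup_principal)
  then show ?thesis by (simp add: eventually_sup)
qed

lemma eventually_nbhds_in_openin:
  assumes "openin (top_of_set S) U" "y \<in> U" "\<And>x. x \<in> U \<Longrightarrow> P x"
  shows "eventually P (nbhds_in S y)"
  using assms by (auto simp: eventually_nbhds_in openin_open)

lemma nbhds_in_openin:
  assumes "openin (top_of_set S) U" "y \<in> U"
  shows "nbhds_in U y = nbhds_in S y"
proof -
  obtain V where V: "open V" "U = S \<inter> V" using assms(1) by (auto simp: openin_open)
  have "principal U = inf (principal V) (principal S)" using V(2) by (simp add: Int_commute)
  moreover have "inf (nhds y) (principal V) = nhds y"
    using V assms(2) by (simp add: inf_absorb1 le_principal eventually_nhds_in_open)
  ultimately show ?thesis unfolding nbhds_in_def by (metis inf_assoc)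
qed

lemma eventually_nbhds_in_closedin:
  assumes "closedin (top_of_set S) A" "y \<in> S" "y \<notin> A"
  shows "eventually P (nbhds_in A y)"
proof -
  obtain C where "closed C" "A = S \<inter> C" using assms(1) by (auto simp: closedin_closed)
  then show ?thesis using assms(2,3) by (auto simp: eventually_nbhds_in intro!: exI[of _ "- C"])
qed

lemma filterlim_nbhds_in:
  assumes "continuous_on Z f" "f ` Z \<subseteq> S" "z \<in> Z"
  shows "filterlim f (nbhds_in S (f z)) (nbhds_in Z z)"
  unfolding filterlim_iff
proof (intro allI impI)
  fix P assume "eventually P (nbhds_in S (f z))"
  then obtain U where U: "open U" "f z \<in> U" "\<forall>x\<in>U \<inter> S. P x" by (auto simp: eventually_nbhds_in)
  then obtain V where "open V" "z \<in> V" "\<forall>y\<in>Z. y \<in> V \<longrightarrow> f y \<in> U"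
    using assms(1,3) unfolding continuous_on_topological by metis
  then show "eventually (\<lambda>x. P (f x)) (nbhds_in Z z)"
    unfolding eventually_nbhds_in using U(3) assms(2) by (intro exI[of _ V]) blast
qed

lemma eventually_nbhds_in_compose:
  assumes "eventually P (nbhds_in S (f z))" "continuous_on Z f" "f ` Z \<subseteq> S" "z \<in> Z"
  shows "eventually (\<lambda>x. P (f x)) (nbhds_in Z z)"
  using filterlim_nbhds_in[OF assms(2-4)] assms(1) by (simp add: filterlim_iff)

lemma connected_eventually_const:
  assumes "connected S" "\<And>y. y \<in> S \<Longrightarrow> eventually (\<lambda>x. f x = f y) (nbhds_in S y)" "a \<in> S" "b \<in> S"
  shows "f a = f b"
proof (rule connected_local_const[OF assms(1,3,4)], intro ballI)
  fix y assume "y \<in> S"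
  from assms(2)[OF this] show "\<forall>\<^sub>F b in at y within S. f y = f b"
    unfolding nbhds_in_def eventually_inf_principal eventually_at_filter
    by (elim eventually_mono) auto
qed

text \<open>
  A local system of complex lines, each identified with the complex numbers, given by its parallel
  transport: \<open>T y x\<close> transports from \<open>x\<close> to a nearby \<open>y\<close>. The nested filters
  express that the cocycle identity is required only for \<open>x\<close> near \<open>y\<close> and \<open>z\<close> near \<open>x\<close>; no cover by
  trivialising open sets has to be carried along.
\<close>
definition flat :: "'a::topological_space set \<Rightarrow> ('a \<Rightarrow> 'a \<Rightarrow> complex) \<Rightarrow> bool" where
  "flat S T \<longleftrightarrow> (\<forall>y x. T y x \<noteq> 0) \<and>
     (\<forall>y\<in>S. \<forall>\<^sub>F x in nbhds_in S y. \<forall>\<^sub>F z in nbhds_in S x. T y z = T y x * T x z)"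

definition parallel ::
    "'a::topological_space set \<Rightarrow> ('a \<Rightarrow> 'a \<Rightarrow> complex) \<Rightarrow> ('a \<Rightarrow> complex) \<Rightarrow> bool" where
  "parallel S T s \<longleftrightarrow> (\<forall>y\<in>S. s y \<noteq> 0 \<and> (\<forall>\<^sub>F x in nbhds_in S y. s y = T y x * s x))"

lemma flat_nonzero: "flat S T \<Longrightarrow> T y x \<noteq> 0" by (simp add: flat_def)

lemma flat_refl:
  assumes "flat S T" "y \<in> S" shows "T y y = 1"
proof -
  have "\<forall>\<^sub>F x in nbhds_in S y. \<forall>\<^sub>F z in nbhds_in S x. T y z = T y x * T x z"
    using assms by (auto simp: flat_def)
  from eventually_nbhds_in_self[OF this assms(2)]
  have "T y y = T y y * T y y" using assms(2) by (rule eventually_nbhds_in_self)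
  then show ?thesis using flat_nonzero[OF assms(1), of y y] by simp
qed

lemma flat_pullback:
  assumes "flat S T" "continuous_on Z f" "f ` Z \<subseteq> S"
  shows "flat Z (\<lambda>y x. T (f y) (f x))"
  unfolding flat_def
proof (intro conjI ballI)
  show "\<forall>y x. T (f y) (f x) \<noteq> 0" using flat_nonzero[OF assms(1)] by blast
  fix y assume y: "y \<in> Z"
  then have "\<forall>\<^sub>F x in nbhds_in S (f y). \<forall>\<^sub>F z in nbhds_in S x. T (f y) z = T (f y) x * T x z"
    using assms(1,3) by (auto simp: flat_def)
  from eventually_conj[OF eventually_nbhds_in_mem eventually_nbhds_in_compose[OF this assms(2,3) y]]
  show "\<forall>\<^sub>F x in nbhds_in Z y. \<forall>\<^sub>F z in nbhds_in Z x. T (f y) (f z) = T (f y) (f x) * T (f x) (f z)"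
  proof eventually_elim
    case (elim x)
    then show ?case using eventually_nbhds_in_compose[OF _ assms(2,3), of _ x] by blast
  qed
qed

lemma parallel_pullback:
  assumes "parallel S T s" "continuous_on Z f" "f ` Z \<subseteq> S"
  shows "parallel Z (\<lambda>y x. T (f y) (f x)) (\<lambda>x. s (f x))"
  unfolding parallel_def
proof (intro conjI ballI)
  fix y assume y: "y \<in> Z"
  then show "s (f y) \<noteq> 0" using assms by (auto simp: parallel_def)
  have "\<forall>\<^sub>F x in nbhds_in S (f y). s (f y) = T (f y) x * s x"
    using assms y by (auto simp: parallel_def)
  from eventually_nbhds_in_compose[OF this assms(2,3) y]
  show "\<forall>\<^sub>F x in nbhds_in Z y. s (f y) = T (f y) (f x) * s (f x)" .
qed

lemma parallel_mono: "parallel S T s \<Longrightarrow> R \<subseteq> S \<Longrightarrow> parallel R T s"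
  using parallel_pullback[of S T s R "\<lambda>x. x"] by (simp add: continuous_on_id)

lemma flat_mult:
  assumes "flat S T" "flat S T'" shows "flat S (\<lambda>y x. T y x * T' y x)"
  unfolding flat_def
proof (intro conjI ballI)
  show "\<forall>y x. T y x * T' y x \<noteq> 0" using assms by (simp add: flat_def)
  fix y assume "y \<in> S"
  then have "\<forall>\<^sub>F x in nbhds_in S y. \<forall>\<^sub>F z in nbhds_in S x. T y z = T y x * T x z"
    "\<forall>\<^sub>F x in nbhds_in S y. \<forall>\<^sub>F z in nbhds_in S x. T' y z = T' y x * T' x z"
    using assms by (auto simp: flat_def)
  then show "\<forall>\<^sub>F x in nbhds_in S y. \<forall>\<^sub>F z in nbhds_in S x. T y z * T' y z = T y x * T' y x * (T x z * T' x z)"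
  proof eventually_elim
    case (elim x)
    then show ?case by eventually_elim simp
  qed
qed

lemma flat_inverse:
  assumes "flat S T" shows "flat S (\<lambda>y x. inverse (T y x))"
  unfolding flat_def
proof (intro conjI ballI)
  show "\<forall>y x. inverse (T y x) \<noteq> 0" using assms by (simp add: flat_def)
  fix y assume "y \<in> S"
  then have "\<forall>\<^sub>F x in nbhds_in S y. \<forall>\<^sub>F z in nbhds_in S x. T y z = T y x * T x z"
    using assms by (auto simp: flat_def)
  then show "\<forall>\<^sub>F x in nbhds_in S y. \<forall>\<^sub>F z in nbhds_in S x. inverse (T y z) = inverse (T y x) * inverse (T x z)"
  proof eventually_elim
    case (elim x)
    then show ?case by eventually_elim simp
  qed
qed

lemma parallel_mult:
  assumes "parallel S T s" "parallel S T' s'" shows "parallel S (\<lambda>y x. T y x * T' y x) (\<lambda>x. s x * s' x)"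
  unfolding parallel_def
proof (intro conjI ballI)
  fix y assume "y \<in> S"
  then have *: "s y \<noteq> 0" "s' y \<noteq> 0" "\<forall>\<^sub>F x in nbhds_in S y. s y = T y x * s x"
      "\<forall>\<^sub>F x in nbhds_in S y. s' y = T' y x * s' x"
    using assms by (auto simp: parallel_def)
  show "s y * s' y \<noteq> 0" using * by simp
  show "\<forall>\<^sub>F x in nbhds_in S y. s y * s' y = T y x * T' y x * (s x * s' x)"
    using *(3,4) by eventually_elim simp
qed

lemma parallel_inverse:
  assumes "parallel S T s" shows "parallel S (\<lambda>y x. inverse (T y x)) (\<lambda>x. inverse (s x))"
  unfolding parallel_def
proof (intro conjI ballI)
  fix y assume "y \<in> S"
  then have *: "s y \<noteq> 0" "\<forall>\<^sub>F x in nbhds_in S y. s y = T y x * s x"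
    using assms by (auto simp: parallel_def)
  show "inverse (s y) \<noteq> 0" using * by simp
  show "\<forall>\<^sub>F x in nbhds_in S y. inverse (s y) = inverse (T y x) * inverse (s x)"
    using *(2) by eventually_elim simp
qed

lemma flat_power: "flat S T \<Longrightarrow> flat S (\<lambda>y x. T y x ^ n)"
proof (induction n)
  case 0 then show ?case by (simp add: flat_def)
next
  case (Suc n) then show ?case using flat_mult[of S T "\<lambda>y x. T y x ^ n"] by simp
qed

lemma parallel_power: "parallel S T s \<Longrightarrow> parallel S (\<lambda>y x. T y x ^ n) (\<lambda>x. s x ^ n)"
proof (induction n)
  case 0 then show ?case by (simp add: parallel_def)
next
  case (Suc n) then show ?case using parallel_mult[of S T s "\<lambda>y x. T y x ^ n"] by simp
qed

lemma parallel_scale: "parallel S T s \<Longrightarrow> c \<noteq> 0 \<Longrightarrow> parallel S T (\<lambda>x. c * s x)"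
  unfolding parallel_def by (auto elim!: eventually_mono)

lemma parallel_trivial_const:
  assumes "connected S" "parallel S (\<lambda>_ _. 1) s" "a \<in> S" "b \<in> S"
  shows "s a = s b"
  using assms(1) _ assms(3,4)
proof (rule connected_eventually_const)
  fix y assume "y \<in> S"
  then have "\<forall>\<^sub>F x in nbhds_in S y. s y = 1 * s x" using assms(2) unfolding parallel_def by blast
  then show "\<forall>\<^sub>F x in nbhds_in S y. s x = s y" by eventually_elim simp
qed

text \<open>
  The quotient of two parallel sections is locally constant. The conclusion is the equality of
  \<open>s / s'\<close> at \<open>a\<close> and \<open>b\<close>, without denominators.
\<close>
lemma parallel_unique:
  assumes "connected S" "\<And>y x. T y x \<noteq> 0" "parallel S T s" "parallel S T s'" "a \<in> S" "b \<in> S"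
  shows "s a * s' b = s b * s' a"
proof -
  have "parallel S (\<lambda>_ _. 1) (\<lambda>x. s x * inverse (s' x))"
    using parallel_mult[OF assms(3) parallel_inverse[OF assms(4)]] assms(2) by simp
  from parallel_trivial_const[OF assms(1) this assms(5,6)]
  have "s a * inverse (s' a) = s b * inverse (s' b)" .
  moreover have "s' a \<noteq> 0" "s' b \<noteq> 0" using assms(4-6) unfolding parallel_def by blast+
  ultimately show ?thesis by (simp add: field_simps)
qed

lemma parallel_Un_closed:
  assumes "closedin (top_of_set (A \<union> B)) A" "closedin (top_of_set (A \<union> B)) B"
    "parallel A T s" "parallel B T s"
  shows "parallel (A \<union> B) T s"
  unfolding parallel_def
proof (intro conjI ballI)
  fix y assume y: "y \<in> A \<union> B"
  then show "s y \<noteq> 0" using assms by (auto simp: parallel_def)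
  have "\<forall>\<^sub>F x in nbhds_in A y. s y = T y x * s x"
    using assms(3) eventually_nbhds_in_closedin[OF assms(1) y] by (cases "y \<in> A") (auto simp: parallel_def)
  moreover have "\<forall>\<^sub>F x in nbhds_in B y. s y = T y x * s x"
    using assms(4) eventually_nbhds_in_closedin[OF assms(2) y] by (cases "y \<in> B") (auto simp: parallel_def)
  ultimately show "\<forall>\<^sub>F x in nbhds_in (A \<union> B) y. s y = T y x * s x"
    by (simp add: eventually_nbhds_in_Un)
qed

lemma parallel_cong:
  assumes "parallel S T s" "\<And>x. x \<in> S \<Longrightarrow> s x = s' x" shows "parallel S T s'"
  unfolding parallel_def
proof (intro conjI ballI)
  fix y assume y: "y \<in> S"
  then have *: "s y \<noteq> 0" "\<forall>\<^sub>F x in nbhds_in S y. s y = T y x * s x"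
    using assms(1) by (auto simp: parallel_def)
  then show "s' y \<noteq> 0" using assms(2) y by simp
  show "\<forall>\<^sub>F x in nbhds_in S y. s' y = T y x * s' x"
    using eventually_conj[OF *(2) eventually_nbhds_in_mem]
    by eventually_elim (use assms(2) y in auto)
qed

lemma parallel_glue_connected:
  assumes T: "\<And>y x. T y x \<noteq> 0"
    and cl: "closedin (top_of_set (A \<union> B)) A" "closedin (top_of_set (A \<union> B)) B"
    and s: "parallel A T s" "parallel B T s'" and conn: "connected (A \<inter> B)"
  shows "\<exists>r. parallel (A \<union> B) T r"
proof -
  obtain c where c: "c \<noteq> 0" "\<And>x. x \<in> A \<inter> B \<Longrightarrow> s x = c * s' x"
  proof (cases "A \<inter> B = {}")
    case True then show ?thesis using that[of 1] by auto
  next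
    case False
    then obtain a where a: "a \<in> A" "a \<in> B" by auto
    have "s x = (s a / s' a) * s' x" if "x \<in> A \<inter> B" for x
    proof -
      have "s x * s' a = s a * s' x"
        by (rule parallel_unique[OF conn T parallel_mono[OF s(1)] parallel_mono[OF s(2)]]) (use a that in auto)
      moreover have "s' a \<noteq> 0" using s(2) a unfolding parallel_def by blast
      ultimately show ?thesis by (simp add: field_simps)
    qed
    moreover have "s a / s' a \<noteq> 0" using s a unfolding parallel_def by simp
    ultimately show ?thesis using that[of "s a / s' a"] by blast
  qed
  define r where "r x = (if x \<in> A then s x else c * s' x)" for x
  have "parallel A T r" by (rule parallel_cong[OF s(1)]) (simp add: r_def)
  moreover have "parallel B T r"
    by (rule parallel_cong[OF parallel_scale[OF s(2) c(1)]]) (use c(2) in \<open>auto simp: r_def\<close>)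
  ultimately show ?thesis using parallel_Un_closed[OF cl] by blast
qed

lemma flat_local_parallel:
  assumes "flat S T" "y \<in> S"
  obtains U where "open U" "y \<in> U" "parallel (U \<inter> S) T (\<lambda>x. inverse (T y x))"
proof -
  have "\<forall>\<^sub>F x in nbhds_in S y. \<forall>\<^sub>F z in nbhds_in S x. T y z = T y x * T x z"
    using assms by (auto simp: flat_def)
  then obtain U where U: "open U" "y \<in> U" "\<And>x. x \<in> U \<inter> S \<Longrightarrow> \<forall>\<^sub>F z in nbhds_in S x. T y z = T y x * T x z"
    unfolding eventually_nbhds_in[of _ S y] by blast
  have "parallel (U \<inter> S) T (\<lambda>x. inverse (T y x))"
    unfolding parallel_def
  proof (intro conjI ballI)
    fix x assume x: "x \<in> U \<inter> S"
    show "inverse (T y x) \<noteq> 0" using flat_nonzero[OF assms(1)] by simp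
    from eventually_nbhds_in_subset[OF U(3)[OF x], of "U \<inter> S"]
    show "\<forall>\<^sub>F z in nbhds_in (U \<inter> S) x. inverse (T y x) = T x z * inverse (T y z)"
      using flat_nonzero[OF assms(1)] by (auto elim!: eventually_mono simp: field_simps)
  qed
  then show ?thesis using that U by blast
qed

text \<open>
  Local sections are rescaled to agree where two consecutive intervals meet; Bolzano's bisection
  principle does the bookkeeping.
\<close>
lemma flat_interval_parallel:
  fixes a b :: real
  assumes "a \<le> b" "flat {a..b} T"
  shows "\<exists>s. parallel {a..b} T s"
proof -
  define P where "P c d \<longleftrightarrow> (a \<le> c \<and> d \<le> b \<longrightarrow> (\<exists>s. parallel {c..d} T s))" for c d
  have "P a b"
    using assms(1)
  proof (induction rule: Bolzano)
    case (trans c d e)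
    show ?case unfolding P_def
    proof
      assume ce: "a \<le> c \<and> e \<le> b"
      then obtain s s' where "parallel {c..d} T s" "parallel {d..e} T s'"
        using trans unfolding P_def by (meson order_trans)
      moreover have "{c..d} \<union> {d..e} = {c..e}" "{c..d} \<inter> {d..e} = {d}" using trans by auto
      ultimately show "\<exists>s. parallel {c..e} T s"
        using parallel_glue_connected[of T "{c..d}" "{d..e}" s s'] flat_nonzero[OF assms(2)]
        by (metis closed_subset closed_real_atLeastAtMost connected_sing sup_ge1 sup_ge2)
    qed
  next
    case (local x)
    then have "x \<in> {a..b}" by simp
    from flat_local_parallel[OF assms(2) this]
    obtain U where U: "open U" "x \<in> U" "parallel (U \<inter> {a..b}) T (\<lambda>z. inverse (T x z))" by metis
    then obtain d where d: "d > 0" "\<And>z. \<bar>z - x\<bar> < d \<Longrightarrow> z \<in> U" unfolding open_real by blast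
    show ?case
    proof (intro exI[of _ d] conjI allI impI)
      fix c e assume *: "c \<le> x \<and> x \<le> e \<and> e - c < d"
      have "{c..e} \<subseteq> U" using * by (auto intro!: d(2))
      then show "P c e" unfolding P_def using parallel_mono[OF U(3), of "{c..e}"] by auto
    qed (fact d)
  qed
  then show ?thesis by (simp add: P_def)
qed

text \<open>
  The covering homotopy property. Over each fibre \<open>{z} \<times> [0,1]\<close> there is a parallel section
  starting at \<open>s0 z\<close>. That these sections also fit together in the direction of \<open>z\<close> is true at time
  \<open>0\<close>, and the set of times at which it is true is open and closed.
\<close>
lemma flat_homotopy_lift:
  fixes T :: "'a::topological_space \<times> real \<Rightarrow> 'a \<times> real \<Rightarrow> complex"
  assumes flat: "flat (Z \<times> {0..1}) T" and s0: "parallel Z (\<lambda>y x. T (y, 0) (x, 0)) s0"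
  shows "\<exists>s. parallel (Z \<times> {0..1}) T s \<and> (\<forall>z\<in>Z. s (z, 0) = s0 z)"
proof -
  note T0 = flat_nonzero[OF flat]
  have "\<exists>r. parallel {0..1} (\<lambda>t u. T (z, t) (z, u)) r \<and> r 0 = s0 z" if z: "z \<in> Z" for z
  proof -
    have "flat {0..1} (\<lambda>t u. T (z, t) (z, u))"
      by (rule flat_pullback[OF flat]) (use z in \<open>auto intro!: continuous_intros\<close>)
    from flat_interval_parallel[OF _ this]
    obtain r where r: "parallel {0..1} (\<lambda>t u. T (z, t) (z, u)) r" by auto
    have "r 0 \<noteq> 0" "s0 z \<noteq> 0" using r s0 z unfolding parallel_def by auto
    then show ?thesis using parallel_scale[OF r, of "s0 z / r 0"]
      by (intro exI[of _ "\<lambda>t. s0 z / r 0 * r t"]) simp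
  qed
  then obtain \<sigma> where \<sigma>: "\<And>z. z \<in> Z \<Longrightarrow> parallel {0..1} (\<lambda>t u. T (z, t) (z, u)) (\<sigma> z)"
    "\<And>z. z \<in> Z \<Longrightarrow> \<sigma> z 0 = s0 z" by metis
  \<comment> \<open>Parallel in the direction of \<open>Z\<close>, at the point \<open>(z0, t)\<close>.\<close>
  define Good where "Good z0 t \<longleftrightarrow> (\<forall>\<^sub>F z in nbhds_in Z z0. \<sigma> z0 t = T (z0, t) (z, t) * \<sigma> z t)" for z0 t
  \<comment> \<open>In a local trivialisation around \<open>(z0, t0)\<close>, the section along each fibre is a constant
    \<open>\<kappa> z\<close>. Hence being \<open>Good\<close> at \<open>(z0, t)\<close> does not depend on \<open>t\<close> near \<open>t0\<close>.\<close>
  have local: "\<exists>U J \<kappa>. open U \<and> open J \<and> z0 \<in> U \<and> t0 \<in> J \<and>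
      (\<forall>z\<in>U \<inter> Z. \<forall>t\<in>J \<inter> {0..1}. \<sigma> z t * T (z0, t0) (z, t) = \<kappa> z) \<and>
      (\<forall>t\<in>J \<inter> {0..1}. Good z0 t \<longleftrightarrow> (\<forall>\<^sub>F z in nbhds_in Z z0. \<kappa> z0 = \<kappa> z))"
    if z0: "z0 \<in> Z" and t0: "t0 \<in> {0..1}" for z0 t0
  proof -
    have "(z0, t0) \<in> Z \<times> {0..1}" using z0 t0 by simp
    from flat_local_parallel[OF flat this]
    obtain W where W: "open W" "(z0, t0) \<in> W"
      "parallel (W \<inter> Z \<times> {0..1}) T (\<lambda>x. inverse (T (z0, t0) x))" by metis
    obtain U B where UB: "open U" "open B" "z0 \<in> U" "t0 \<in> B" "U \<times> B \<subseteq> W"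
      using W(1,2) by (rule open_prod_elim) auto
    obtain d where d: "d > 0" "\<And>t. \<bar>t - t0\<bar> < d \<Longrightarrow> t \<in> B" using UB(2,4) unfolding open_real by blast
    define J where "J = {t0 - d<..<t0 + d}"
    have J: "J \<subseteq> B" "open J" "t0 \<in> J" using d by (auto simp: J_def)
    have connJ: "connected (J \<inter> {0..1})"
      unfolding J_def by (intro convex_connected convex_Int) auto
    have par: "parallel ((U \<inter> Z) \<times> (J \<inter> {0..1})) T (\<lambda>x. inverse (T (z0, t0) x))"
      by (rule parallel_mono[OF W(3)]) (use UB J in auto)
    define \<kappa> where "\<kappa> z = \<sigma> z t0 * T (z0, t0) (z, t0)" for z
    have \<kappa>: "\<sigma> z t * T (z0, t0) (z, t) = \<kappa> z" if z: "z \<in> U \<inter> Z" and t: "t \<in> J \<inter> {0..1}" for z t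
    proof -
      have 1: "parallel (J \<inter> {0..1}) (\<lambda>t u. T (z, t) (z, u)) (\<sigma> z)"
        by (rule parallel_mono[OF \<sigma>(1)]) (use z in auto)
      have 2: "parallel (J \<inter> {0..1}) (\<lambda>t u. T (z, t) (z, u)) (\<lambda>t. inverse (T (z0, t0) (z, t)))"
        by (rule parallel_pullback[OF par, of _ "\<lambda>t. (z, t)"]) (use z in \<open>auto intro!: continuous_intros\<close>)
      have "\<sigma> z t * inverse (T (z0, t0) (z, t0)) = \<sigma> z t0 * inverse (T (z0, t0) (z, t))"
        by (rule parallel_unique[OF connJ _ 1 2]) (use t t0 J T0 in auto)
      then show ?thesis using T0 unfolding \<kappa>_def by (simp add: field_simps)
    qed
    have nb: "nbhds_in (U \<inter> Z) z0 = nbhds_in Z z0"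
      by (rule nbhds_in_openin) (use UB z0 in \<open>auto simp: openin_open\<close>)
    have "Good z0 t \<longleftrightarrow> (\<forall>\<^sub>F z in nbhds_in Z z0. \<kappa> z0 = \<kappa> z)" if t: "t \<in> J \<inter> {0..1}" for t
      unfolding Good_def
    proof (rule eventually_subst)
      have "parallel (U \<inter> Z) (\<lambda>y x. T (y, t) (x, t)) (\<lambda>z. inverse (T (z0, t0) (z, t)))"
        by (rule parallel_pullback[OF par, of _ "\<lambda>z. (z, t)"]) (use t in \<open>auto intro!: continuous_intros\<close>)
      then have "\<forall>\<^sub>F z in nbhds_in (U \<inter> Z) z0. inverse (T (z0, t0) (z0, t)) = T (z0, t) (z, t) * inverse (T (z0, t0) (z, t))"
        using z0 UB unfolding parallel_def by blast
      from eventually_conj[OF this eventually_nbhds_in_mem]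
      show "\<forall>\<^sub>F z in nbhds_in Z z0. (\<sigma> z0 t = T (z0, t) (z, t) * \<sigma> z t) = (\<kappa> z0 = \<kappa> z)"
        unfolding nb
      proof eventually_elim
        case (elim z)
        then have e: "T (z0, t0) (z, t) = T (z0, t) (z, t) * T (z0, t0) (z0, t)"
          using T0 by (simp add: field_simps)
        have "\<kappa> z = \<sigma> z t * T (z0, t0) (z, t)" "\<kappa> z0 = \<sigma> z0 t * T (z0, t0) (z0, t)"
          using \<kappa>[OF _ t] elim z0 UB by auto
        moreover have "\<sigma> z t * (T (z0, t) (z, t) * T (z0, t0) (z0, t)) = (T (z0, t) (z, t) * \<sigma> z t) * T (z0, t0) (z0, t)"
          by (simp only: mult_ac)
        ultimately show ?case using T0 by (simp only: e mult_cancel_right) simp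
      qed
    qed
    then show ?thesis using UB J \<kappa> by (intro exI[of _ U] exI[of _ J] exI[of _ \<kappa>]) blast
  qed
  have good: "Good z0 t0" if z0: "z0 \<in> Z" and t0: "t0 \<in> {0..1}" for z0 t0
  proof -
    have "Good z0 t0 = Good z0 0"
    proof (rule connected_eventually_const[of "{0..1}"])
      fix t assume "t \<in> {0..1::real}"
      from local[OF z0 this] obtain J P where "open J" "t \<in> J" "\<forall>t\<in>J \<inter> {0..1}. Good z0 t = P" by blast
      then show "\<forall>\<^sub>F x in nbhds_in {0..1} t. Good z0 x = Good z0 t"
        using \<open>t \<in> {0..1}\<close> unfolding eventually_nbhds_in by (intro exI[of _ J]) auto
    qed (use t0 in auto)
    moreover have "Good z0 0"
    proof -
      have "\<forall>\<^sub>F z in nbhds_in Z z0. s0 z0 = T (z0, 0) (z, 0) * s0 z" using s0 z0 by (auto simp: parallel_def)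
      from eventually_conj[OF this eventually_nbhds_in_mem]
      show ?thesis unfolding Good_def by eventually_elim (use z0 \<sigma>(2) in auto)
    qed
    ultimately show ?thesis by simp
  qed
  have "parallel (Z \<times> {0..1}) T (\<lambda>(z, t). \<sigma> z t)"
    unfolding parallel_def
  proof (intro conjI ballI)
    fix y assume y: "y \<in> Z \<times> {0..1::real}"
    obtain z0 t0 where y_eq: "y = (z0, t0)" by (cases y)
    with y have zt: "z0 \<in> Z" "t0 \<in> {0..1}" by auto
    then show "(case y of (z, t) \<Rightarrow> \<sigma> z t) \<noteq> 0" using \<sigma>(1)[OF zt(1)] y_eq by (auto simp: parallel_def)
    obtain U J \<kappa> where 1: "open U" "open J" "z0 \<in> U" "t0 \<in> J"
      "\<And>z t. z \<in> U \<inter> Z \<Longrightarrow> t \<in> J \<inter> {0..1} \<Longrightarrow> \<sigma> z t * T (z0, t0) (z, t) = \<kappa> z"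
      "\<And>t. t \<in> J \<inter> {0..1} \<Longrightarrow> Good z0 t \<longleftrightarrow> (\<forall>\<^sub>F z in nbhds_in Z z0. \<kappa> z0 = \<kappa> z)"
      using local[OF zt] by metis
    have "\<forall>\<^sub>F z in nbhds_in Z z0. \<kappa> z0 = \<kappa> z" using 1(4,6) good[OF zt] zt by blast
    then obtain V where V: "open V" "z0 \<in> V" "\<And>z. z \<in> V \<inter> Z \<Longrightarrow> \<kappa> z0 = \<kappa> z"
      unfolding eventually_nbhds_in by blast
    have "\<sigma> z0 t0 = T (z0, t0) (z, t) * \<sigma> z t" if "z \<in> U \<inter> V \<inter> Z" "t \<in> J \<inter> {0..1}" for z t
    proof -
      have "\<sigma> z0 t0 * T (z0, t0) (z0, t0) = \<sigma> z t * T (z0, t0) (z, t)"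
        using 1(5)[of z0 t0] 1(5)[of z t] V(3)[of z] that zt 1 by auto
      then show ?thesis using flat_refl[OF flat y] y_eq by (simp add: mult.commute)
    qed
    then show "\<forall>\<^sub>F x in nbhds_in (Z \<times> {0..1}) y. (case y of (z, t) \<Rightarrow> \<sigma> z t) = T y x * (case x of (z, t) \<Rightarrow> \<sigma> z t)"
      unfolding eventually_nbhds_in y_eq using 1 V
      by (intro exI[of _ "(U \<inter> V) \<times> J"]) (auto intro!: open_Times)
  qed
  then show ?thesis using \<sigma>(2) by (intro exI[of _ "\<lambda>(z, t). \<sigma> z t"]) auto
qed

text \<open>
  Whether a local system is trivial after pulling it back along a map depends only on the homotopy
  class of that map. This is the form in which homotopies are used below.
\<close>
lemma flat_homotopic:
  fixes h :: "'b::topological_space \<times> real \<Rightarrow> 'a::topological_space"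
  assumes "flat S T" "continuous_on (Z \<times> {0..1}) h" "h ` (Z \<times> {0..1}) \<subseteq> S"
    and "parallel Z (\<lambda>y x. T (h (y, 0)) (h (x, 0))) s0"
  shows "\<exists>s. parallel Z (\<lambda>y x. T (h (y, 1)) (h (x, 1))) s"
proof -
  obtain s where s: "parallel (Z \<times> {0..1}) (\<lambda>y x. T (h y) (h x)) s"
    using flat_homotopy_lift[OF flat_pullback[OF assms(1-3)] assms(4)] by blast
  have "parallel Z (\<lambda>y x. T (h (y, 1)) (h (x, 1))) (\<lambda>z. s (z, 1))"
    by (rule parallel_pullback[OF s, of Z "\<lambda>z. (z, 1)"]) (auto intro!: continuous_intros)
  then show ?thesis by blast
qed

lemma flat_convex_parallel:
  fixes C :: "'a::real_normed_vector set"
  assumes "convex C" "flat C T"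
  shows "\<exists>s. parallel C T s"
proof (cases "C = {}")
  case True then show ?thesis by (simp add: parallel_def)
next
  case False
  then obtain a where a: "a \<in> C" by blast
  define h where "h = (\<lambda>(z, t). (1 - t) *\<^sub>R a + t *\<^sub>R z)"
  have "\<exists>s. parallel C (\<lambda>y x. T (h (y, 1)) (h (x, 1))) s"
  proof (rule flat_homotopic[OF assms(2)])
    show "continuous_on (C \<times> {0..1}) h"
      unfolding h_def case_prod_unfold by (intro continuous_intros)
    show "h ` (C \<times> {0..1}) \<subseteq> C"
      using assms(1) a unfolding h_def convex_alt by auto
    show "parallel C (\<lambda>y x. T (h (y, 0)) (h (x, 0))) (\<lambda>_. 1)"
      using flat_refl[OF assms(2) a] by (simp add: h_def parallel_def)
  qed
  then show ?thesis by (simp add: h_def)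
qed

text \<open>
  Trivial monodromy once around the circle gives a section on the circle. The angle is inverted by
  \<open>arccos\<close> on the upper and the lower half circle separately, which meet in \<open>1\<close>, where \<open>\<sigma>\<close> is
  assumed to close up, and in \<open>-1\<close>.
\<close>
lemma parallel_circle:
  assumes \<sigma>: "parallel {0..1} (\<lambda>t u. T (cis (2 * pi * t)) (cis (2 * pi * u))) \<sigma>"
    and closed: "\<sigma> 0 = \<sigma> 1"
  shows "\<exists>s. parallel (sphere 0 1) T s"
proof -
  define A where "A = {z \<in> sphere 0 1. Im z \<ge> 0}"
  define B where "B = {z \<in> sphere 0 1. Im z \<le> 0}"
  define f where "f z = arccos (Re z) / (2 * pi)" for z
  have Re: "\<bar>Re z\<bar> \<le> 1" if "z \<in> sphere 0 1" for z
    using that abs_Re_le_cmod[of z] by simp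
  have f01: "f z \<in> {0..1}" "1 - f z \<in> {0..1}" if "z \<in> sphere 0 1" for z
    using Re[OF that] arccos_bounded[of "Re z"] pi_gt_zero by (auto simp: f_def divide_simps abs_le_iff)
  have Im: "sqrt (1 - (Re z)\<^sup>2) = \<bar>Im z\<bar>" if "z \<in> sphere 0 1" for z
  proof -
    have "(Re z)\<^sup>2 + (Im z)\<^sup>2 = 1" using that cmod_power2[of z] by simp
    then have "1 - (Re z)\<^sup>2 = (Im z)\<^sup>2" by simp
    then show ?thesis by simp
  qed
  have fA: "cis (2 * pi * f z) = z" if "z \<in> A" for z
    using that Re[of z] Im[of z] by (auto simp: A_def f_def complex_eq_iff sin_arccos_abs)
  have fB: "cis (2 * pi * (1 - f z)) = z" if "z \<in> B" for z
  proof -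
    have "cis (2 * pi * (1 - f z)) = cnj (cis (2 * pi * f z))"
      by (simp add: right_diff_distrib complex_eq_iff)
    also have "\<dots> = cnj (cnj z)" using fA[of "cnj z"] that by (simp add: A_def B_def f_def)
    finally show ?thesis by simp
  qed
  define s where "s z = (if Im z \<ge> 0 then \<sigma> (f z) else \<sigma> (1 - f z))" for z
  have cont: "continuous_on (sphere 0 1) f"
    unfolding f_def by (intro continuous_intros) (use Re pi_gt_zero in \<open>auto simp: abs_le_iff minus_le_iff\<close>)
  have "parallel A (\<lambda>y x. T (cis (2 * pi * f y)) (cis (2 * pi * f x))) (\<lambda>z. \<sigma> (f z))"
    by (rule parallel_pullback[OF \<sigma>])
      (use f01 in \<open>auto simp: A_def intro: continuous_on_subset[OF cont]\<close>)
  then have A: "parallel A T (\<lambda>z. \<sigma> (f z))"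
    unfolding parallel_def using fA by (smt (verit, best) eventually_elim2 eventually_nbhds_in_mem)
  have "parallel B (\<lambda>y x. T (cis (2 * pi * (1 - f y))) (cis (2 * pi * (1 - f x)))) (\<lambda>z. \<sigma> (1 - f z))"
    by (rule parallel_pullback[OF \<sigma>])
      (use f01 in \<open>auto simp: B_def intro!: continuous_intros intro: continuous_on_subset[OF cont]\<close>)
  then have B: "parallel B T (\<lambda>z. \<sigma> (1 - f z))"
    unfolding parallel_def using fB by (smt (verit, best) eventually_elim2 eventually_nbhds_in_mem)
  have A': "parallel A T s" by (rule parallel_cong[OF A]) (auto simp: A_def s_def)
  have B': "parallel B T s"
  proof (rule parallel_cong[OF B])
    fix z assume z: "z \<in> B"
    show "\<sigma> (1 - f z) = s z"
    proof (cases "Im z = 0")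
      case True
      then have "z = 1 \<or> z = -1" using z by (auto simp: B_def complex_eq_iff cmod_def power2_eq_1_iff)
      then show ?thesis using closed by (auto simp: s_def f_def)
    qed (use z in \<open>auto simp: s_def B_def\<close>)
  qed
  have "sphere 0 1 = A \<union> B" by (auto simp: A_def B_def)
  moreover have "closed A" "closed B"
  proof -
    have "A = sphere 0 1 \<inter> {z. Im z \<ge> 0}" "B = sphere 0 1 \<inter> {z. Im z \<le> 0}" by (auto simp: A_def B_def)
    then show "closed A" "closed B" by (auto intro!: closed_Int closed_halfspace_Im_ge closed_halfspace_Im_le)
  qed
  ultimately show ?thesis using parallel_Un_closed[OF _ _ A' B'] by (metis closed_subset sup_ge1 sup_ge2)
qed

text \<open>
  A substitute for simple connectedness of spheres: the two closed hemispheres project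
  homeomorphically to a convex disc, and they meet in a great sphere, which is connected from
  dimension 3 of the ambient space on.
\<close>
lemma flat_sphere_parallel:
  fixes T :: "'a::euclidean_space \<Rightarrow> 'a \<Rightarrow> complex"
  assumes dim: "DIM('a) \<ge> 3" and T: "flat (sphere 0 1) T"
  shows "\<exists>s. parallel (sphere 0 1) T s"
proof -
  obtain b :: 'a where b: "b \<in> Basis" using nonempty_Basis by blast
  then have bb: "b \<bullet> b = 1" "norm b = 1" "b \<noteq> 0" by (auto simp: inner_same_Basis)
  define D where "D = {y::'a. b \<bullet> y = 0} \<inter> cball 0 1"
  have convD: "convex D" unfolding D_def by (intro convex_Int convex_hyperplane convex_cball)
  define H where "H c = {x \<in> sphere 0 1. c * (b \<bullet> x) \<ge> 0}" for c
  have hemi: "\<exists>s. parallel (H c) T s" if c: "c * c = 1" for c :: real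
  proof -
    define f where "f y = y + (c * sqrt (1 - (norm y)\<^sup>2)) *\<^sub>R b" for y
    define g where "g x = x - (b \<bullet> x) *\<^sub>R b" for x :: 'a
    have gD: "g x \<in> D" and fg: "f (g x) = x" if x: "x \<in> H c" for x
    proof -
      have n: "(norm (g x))\<^sup>2 = 1 - (b \<bullet> x)\<^sup>2"
        using x bb unfolding H_def g_def power2_norm_eq_inner
        by (simp add: inner_diff_left inner_diff_right inner_commute power2_eq_square norm_eq_1)
      then have "(norm (g x))\<^sup>2 \<le> 1\<^sup>2" by simp
      then have "norm (g x) \<le> 1" by (rule power2_le_imp_le) simp
      then show "g x \<in> D" unfolding D_def by (auto simp: g_def inner_diff_right bb)
      have "c * sqrt (1 - (norm (g x))\<^sup>2) = b \<bullet> x"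
      proof -
        have "sqrt (1 - (norm (g x))\<^sup>2) = \<bar>b \<bullet> x\<bar>" using n by simp
        moreover have "c = 1 \<or> c = -1" using c by (simp add: square_eq_1_iff)
        ultimately show ?thesis using x by (auto simp: H_def)
      qed
      then show "f (g x) = x" by (simp add: f_def g_def)
    qed
    have fH: "f y \<in> H c" if y: "y \<in> D" for y
    proof -
      have y: "b \<bullet> y = 0" "norm y \<le> 1" using that by (auto simp: D_def)
      have s: "1 - (norm y)\<^sup>2 \<ge> 0" using y by (simp add: power_le_one)
      have "f y \<bullet> f y = y \<bullet> y + (c * c) * (sqrt (1 - (norm y)\<^sup>2) * sqrt (1 - (norm y)\<^sup>2))"
        unfolding f_def by (simp add: inner_add_left inner_add_right y inner_commute[of y b] bb(1) mult_ac)
      also have "\<dots> = 1" using s c by (simp add: power2_norm_eq_inner)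
      finally have "norm (f y) = 1" by (simp add: norm_eq_1)
      moreover have "c * (b \<bullet> f y) = sqrt (1 - (norm y)\<^sup>2)"
        using c by (simp add: f_def inner_add_right y bb mult.assoc[symmetric])
      ultimately show ?thesis using s by (simp add: H_def)
    qed
    have contf: "continuous_on D f"
      unfolding f_def by (intro continuous_intros)
    have contg: "continuous_on (H c) g" unfolding g_def by (intro continuous_intros)
    have "flat D (\<lambda>y x. T (f y) (f x))"
      by (rule flat_pullback[OF T contf]) (use fH in \<open>auto simp: H_def\<close>)
    from flat_convex_parallel[OF convD this] obtain s where s: "parallel D (\<lambda>y x. T (f y) (f x)) s" by blast
    have *: "parallel (H c) (\<lambda>y x. T (f (g y)) (f (g x))) (\<lambda>x. s (g x))"
      by (rule parallel_pullback[OF s contg]) (use gD in auto)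
    have "parallel (H c) T (\<lambda>x. s (g x))"
      unfolding parallel_def
    proof (intro ballI conjI)
      fix y assume y: "y \<in> H c"
      have **: "s (g y) \<noteq> 0" "\<forall>\<^sub>F x in nbhds_in (H c) y. s (g y) = T (f (g y)) (f (g x)) * s (g x)"
        using * y by (auto simp: parallel_def)
      then show "s (g y) \<noteq> 0" by simp
      from eventually_conj[OF **(2) eventually_nbhds_in_mem]
      show "\<forall>\<^sub>F x in nbhds_in (H c) y. s (g y) = T y x * s (g x)"
        by eventually_elim (use fg y in auto)
    qed
    then show ?thesis by blast
  qed
  obtain s s' where ss: "parallel (H 1) T s" "parallel (H (-1)) T s'" using hemi[of 1] hemi[of "-1"] by auto
  have HH: "H 1 \<union> H (-1) = sphere 0 1" "H 1 \<inter> H (-1) = {x. b \<bullet> x = 0} \<inter> sphere 0 1" by (auto simp: H_def)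
  have "closed (H c)" for c
  proof -
    have "H c = sphere 0 1 \<inter> {x. c * (b \<bullet> x) \<ge> 0}" by (auto simp: H_def)
    then show ?thesis by (auto intro!: closed_Int closed_Collect_le continuous_intros)
  qed
  then have cl: "closedin (top_of_set (H 1 \<union> H (-1))) (H c)" if "c = 1 \<or> c = -1" for c
    using that by (auto intro!: closed_subset)
  have conn: "connected (H 1 \<inter> H (-1))"
  proof -
    let ?P = "{x. b \<bullet> x = 0} - {0::'a}"
    have "aff_dim {x. b \<bullet> x = 0} = DIM('a) - 1" using bb by (rule_tac aff_dim_hyperplane) simp
    then have "path_connected ?P"
      using dim by (intro path_connected_punctured_convex convex_hyperplane) auto
    then have "connected ((\<lambda>x. x /\<^sub>R norm x) ` ?P)"
      by (intro connected_continuous_image path_connected_imp_connected continuous_intros) auto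
    also have "(\<lambda>x. x /\<^sub>R norm x) ` ?P = {x. b \<bullet> x = 0} \<inter> sphere 0 1"
    proof (intro Set.set_eqI iffI)
      fix x assume "x \<in> {x. b \<bullet> x = 0} \<inter> sphere 0 1"
      then show "x \<in> (\<lambda>x. x /\<^sub>R norm x) ` ?P" by (intro image_eqI[of _ _ x]) auto
    qed auto
    finally show ?thesis using HH by simp
  qed
  show ?thesis
    using parallel_glue_connected[OF flat_nonzero[OF T] cl cl ss conn] HH by auto
qed

section \<open>Torus homeomorphisms that fix a meridian\<close>

text \<open>
  The gauge of the solid cylinder \<open>[-1,1] \<times> D\<^sup>2\<close>, which is what remains of the solid torus when it
  is cut along a meridian disc.
\<close>
definition cyl_norm :: "real \<times> complex \<Rightarrow> real" where
  "cyl_norm p = max \<bar>fst p\<bar> (cmod (snd p))"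

lemma cyl_norm_scale: "cyl_norm (r *\<^sub>R p) = \<bar>r\<bar> * cyl_norm p"
  by (simp add: cyl_norm_def abs_mult max_mult_distrib_left)

lemma cyl_norm_nonneg: "cyl_norm p \<ge> 0" by (simp add: cyl_norm_def le_max_iff_disj)

lemma cyl_norm_eq_0: "cyl_norm p = 0 \<longleftrightarrow> p = 0"
proof
  assume "cyl_norm p = 0"
  then have "\<bar>fst p\<bar> \<le> 0" "cmod (snd p) \<le> 0" unfolding cyl_norm_def by linarith+
  then show "p = 0" by (simp add: prod_eq_iff)
qed (simp add: cyl_norm_def)

lemma norm_le_cyl_norm: "norm p \<le> 2 * cyl_norm p"
proof -
  have "norm p \<le> norm (fst p) + norm (snd p)"
    using norm_Pair_le[of "fst p" "snd p"] by simp
  then show ?thesis by (simp add: cyl_norm_def)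
qed

lemma continuous_cyl_norm: "continuous_on S cyl_norm"
  unfolding cyl_norm_def by (intro continuous_intros)

text \<open>
  Alexander's trick: the radial extension of a map of the boundary of the cylinder.
\<close>
definition cone_map :: "(real \<times> complex \<Rightarrow> real \<times> complex) \<Rightarrow> real \<times> complex \<Rightarrow> real \<times> complex" where
  "cone_map \<Phi> p = cyl_norm p *\<^sub>R \<Phi> (p /\<^sub>R cyl_norm p)"

lemma cone_map_extends: "cyl_norm p = 1 \<Longrightarrow> cone_map \<Phi> p = \<Phi> p"
  by (simp add: cone_map_def)

lemma
  assumes cont: "continuous_on {p. cyl_norm p = 1} \<Phi>"
    and bij: "bij_betw \<Phi> {p. cyl_norm p = 1} {p. cyl_norm p = 1}"
  shows continuous_cone_map: "continuous_on UNIV (cone_map \<Phi>)"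
    and cyl_norm_cone_map: "cyl_norm (cone_map \<Phi> p) = cyl_norm p"
    and inj_cone_map: "inj (cone_map \<Phi>)"
    and surj_cone_map: "surj (cone_map \<Phi>)"
proof -
  have unit: "cyl_norm (p /\<^sub>R cyl_norm p) = 1" if "p \<noteq> 0" for p
    using that cyl_norm_eq_0[of p] cyl_norm_nonneg[of p] by (simp add: cyl_norm_scale)
  have \<Phi>: "cyl_norm (\<Phi> p) = 1" if "cyl_norm p = 1" for p
    using bij that by (auto dest: bij_betwE)
  show norm: "cyl_norm (cone_map \<Phi> p) = cyl_norm p" for p
  proof (cases "p = 0")
    case True then show ?thesis by (simp add: cone_map_def cyl_norm_scale cyl_norm_def)
  next
    case False
    then show ?thesis using \<Phi>[OF unit] cyl_norm_nonneg[of p] by (simp add: cone_map_def cyl_norm_scale)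
  qed
  show "inj (cone_map \<Phi>)"
  proof (rule injI)
    fix p p' assume eq: "cone_map \<Phi> p = cone_map \<Phi> p'"
    then have m: "cyl_norm p = cyl_norm p'" by (metis norm)
    show "p = p'"
    proof (cases "cyl_norm p = 0")
      case True then show ?thesis using m cyl_norm_eq_0 by metis
    next
      case False
      then have nz: "p \<noteq> 0" "p' \<noteq> 0" using m by (metis cyl_norm_eq_0)+
      have "\<Phi> (p /\<^sub>R cyl_norm p) = \<Phi> (p' /\<^sub>R cyl_norm p')" using eq m False by (simp add: cone_map_def)
      then have "p /\<^sub>R cyl_norm p = p' /\<^sub>R cyl_norm p'"
        using inj_onD[OF bij_betw_imp_inj_on[OF bij]] unit nz by blast
      then show ?thesis using m False by simp
    qed
  qed
  show "surj (cone_map \<Phi>)"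
    unfolding surj_def
  proof
    fix p
    show "\<exists>x. p = cone_map \<Phi> x"
    proof (cases "p = 0")
      case True
      have "cone_map \<Phi> 0 = 0" using cyl_norm_eq_0[of 0] by (simp add: cone_map_def)
      then show ?thesis using True by metis
    next
      case False
      then have pos: "cyl_norm p > 0" using cyl_norm_eq_0 cyl_norm_nonneg by (metis less_eq_real_def)
      have "p /\<^sub>R cyl_norm p \<in> \<Phi> ` {p. cyl_norm p = 1}"
        using bij_betw_imp_surj_on[OF bij] unit[OF False] by simp
      then obtain b where b: "cyl_norm b = 1" "\<Phi> b = p /\<^sub>R cyl_norm p" by force
      then have "cone_map \<Phi> (cyl_norm p *\<^sub>R b) = p" using pos by (simp add: cone_map_def cyl_norm_scale)
      then show ?thesis by metis
    qed
  qed
  have cont1: "continuous_on (- {0}) (cone_map \<Phi>)"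
    unfolding cone_map_def
    by (intro continuous_intros continuous_on_compose2[OF cont] continuous_cyl_norm)
      (use unit cyl_norm_eq_0 in auto)
  have "isCont (cone_map \<Phi>) p" for p
  proof (cases "p = 0")
    case False
    then show ?thesis using cont1 by (simp add: continuous_on_eq_continuous_at open_Compl)
  next
    case True
    have "(cone_map \<Phi> \<longlongrightarrow> 0) (at 0)"
    proof (rule Lim_null_comparison)
      show "\<forall>\<^sub>F x in at 0. norm (cone_map \<Phi> x) \<le> 2 * cyl_norm x"
        using norm_le_cyl_norm[of "cone_map \<Phi> _"] norm by simp
      have "isCont cyl_norm 0" using continuous_cyl_norm[of UNIV] continuous_on_eq_continuous_at[OF open_UNIV] by blast
      then have "(cyl_norm \<longlongrightarrow> 0) (at 0)" using cyl_norm_eq_0[of 0] by (simp add: isCont_def)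
      then show "((\<lambda>x. 2 * cyl_norm x) \<longlongrightarrow> 0) (at 0)" by (rule tendsto_mult_right_zero)
    qed
    moreover have "cone_map \<Phi> 0 = 0" using cyl_norm_eq_0[of 0] by (simp add: cone_map_def)
    ultimately show ?thesis using True by (simp add: isCont_def)
  qed
  then show "continuous_on UNIV (cone_map \<Phi>)" by (simp add: continuous_on_eq_continuous_at)
qed

lemma continuous_on_compact_quotient:
  fixes q :: "'a::topological_space \<Rightarrow> 'b::t2_space"
  assumes "compact C" "continuous_on C q" "continuous_on C (\<lambda>x. f (q x))"
  shows "continuous_on (q ` C) f"
proof -
  have cl: "closed (q ` C)" using compact_continuous_image[OF assms(2,1)] by (rule compact_imp_closed)
  show ?thesis
    unfolding continuous_on_closed_vimage[OF cl]
  proof (intro allI impI)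
    fix B :: "'c set" assume "closed B"
    then have "closedin (top_of_set C) (C \<inter> (\<lambda>x. f (q x)) -` B)"
      using assms(3) by (rule continuous_closedin_preimage[rotated])
    then have "compact (C \<inter> (\<lambda>x. f (q x)) -` B)" using assms(1) closedin_compact by blast
    then have "compact (q ` (C \<inter> (\<lambda>x. f (q x)) -` B))"
      using assms(2) by (intro compact_continuous_image) (auto elim: continuous_on_subset)
    moreover have "q ` (C \<inter> (\<lambda>x. f (q x)) -` B) = f -` B \<inter> q ` C" by auto
    ultimately show "closed (f -` B \<inter> q ` C)" by (simp add: compact_imp_closed)
  qed
qed

text \<open>
  The two ends of the cylinder are glued along the meridian disc at \<open>u = 1\<close>.
\<close>
definition wrap :: "real \<times> complex \<Rightarrow> complex \<times> complex" where
  "wrap p = (cis (pi * (fst p + 1)), snd p)"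

lemma cis_eq_1_iff: "cis (pi * (x + 1)) = 1 \<longleftrightarrow> (\<exists>n::int. x + 1 = 2 * n)"
proof -
  have "cis (pi * (x + 1)) = 1 \<longleftrightarrow> cos (pi * (x + 1)) = 1"
    by (auto simp: complex_eq_iff) (metis cos_one_sin_zero)
  also have "\<dots> \<longleftrightarrow> (\<exists>n::int. pi * (x + 1) = n * 2 * pi)" by (rule cos_one_2pi_int)
  also have "\<dots> \<longleftrightarrow> (\<exists>n::int. x + 1 = 2 * n)"
    by (intro ex_cong1) (auto simp: mult.commute mult.left_commute)
  finally show ?thesis .
qed

lemma cis_wrap_eq_1: "\<bar>x\<bar> \<le> 1 \<Longrightarrow> cis (pi * (x + 1)) = 1 \<longleftrightarrow> \<bar>x\<bar> = 1"
proof
  assume x: "\<bar>x\<bar> \<le> 1" "cis (pi * (x + 1)) = 1"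
  then obtain n :: int where n: "x + 1 = 2 * n" by (auto simp: cis_eq_1_iff)
  then have "0 \<le> real_of_int n" "real_of_int n \<le> 1" using x by (auto simp: abs_le_iff)
  then have "n = 0 \<or> n = 1" by linarith
  then show "\<bar>x\<bar> = 1" using n by auto
next
  assume "\<bar>x\<bar> = 1"
  then have "x = 1 \<or> x = -1" by linarith
  then show "cis (pi * (x + 1)) = 1" by (auto simp: complex_eq_iff)
qed

lemma wrap_eq_iff:
  assumes "\<bar>fst p\<bar> \<le> 1" "\<bar>fst p'\<bar> \<le> 1"
  shows "wrap p = wrap p' \<longleftrightarrow> snd p = snd p' \<and> (fst p = fst p' \<or> \<bar>fst p\<bar> = 1 \<and> \<bar>fst p'\<bar> = 1)"
proof -
  obtain x w x' w' where p: "p = (x, w)" "p' = (x', w')" by fastforce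
  have "cis (pi * (x + 1)) = cis (pi * (x' + 1)) \<longleftrightarrow> x = x' \<or> \<bar>x\<bar> = 1 \<and> \<bar>x'\<bar> = 1"
  proof
    assume "cis (pi * (x + 1)) = cis (pi * (x' + 1))"
    then have "cis (pi * (x + 1)) / cis (pi * (x' + 1)) = 1" by simp
    then have "cis (pi * ((x - x' - 1) + 1)) = 1" by (simp add: cis_divide algebra_simps)
    then obtain n :: int where n: "x - x' = 2 * n" unfolding cis_eq_1_iff by auto
    have "\<bar>x - x'\<bar> \<le> 2" using assms p by (auto simp: abs_le_iff)
    then have "\<bar>real_of_int n\<bar> \<le> 1" using n by simp
    then have "n = 0 \<or> n = 1 \<or> n = -1" by linarith
    then show "x = x' \<or> \<bar>x\<bar> = 1 \<and> \<bar>x'\<bar> = 1" using n assms p by (auto simp: abs_le_iff)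
  next
    assume "x = x' \<or> \<bar>x\<bar> = 1 \<and> \<bar>x'\<bar> = 1"
    then show "cis (pi * (x + 1)) = cis (pi * (x' + 1))"
      using cis_wrap_eq_1[of x] cis_wrap_eq_1[of x'] by auto
  qed
  then show ?thesis by (auto simp: wrap_def p)
qed

lemma wrap_surj:
  assumes "u \<in> sphere 0 1"
  obtains x where "\<bar>x\<bar> \<le> 1" "\<And>w. wrap (x, w) = (u, w)"
proof -
  have "cis (Arg2pi u) = u" using assms complex_norm_eq_1_exp[of u] by (simp add: cis_conv_exp)
  moreover have "0 \<le> Arg2pi u" "Arg2pi u < 2 * pi" using Arg2pi[of u] by auto
  ultimately show ?thesis
    using that[of "Arg2pi u / pi - 1"] pi_gt_zero by (auto simp: wrap_def abs_le_iff field_simps)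
qed

lemma continuous_wrap: "continuous_on S wrap"
  unfolding wrap_def by (intro continuous_intros)

lemma wrap_cylinder: "wrap ` {p. cyl_norm p \<le> 1} = solid_torus"
proof
  show "wrap ` {p. cyl_norm p \<le> 1} \<subseteq> solid_torus" by (auto simp: wrap_def solid_torus_def cyl_norm_def)
  show "solid_torus \<subseteq> wrap ` {p. cyl_norm p \<le> 1}"
  proof
    fix z assume "z \<in> solid_torus"
    then obtain u w where z: "z = (u, w)" "u \<in> sphere 0 1" "cmod w \<le> 1" by (auto simp: solid_torus_def)
    from wrap_surj[OF z(2)] obtain x where "\<bar>x\<bar> \<le> 1" "wrap (x, w) = (u, w)" by metis
    then show "z \<in> wrap ` {p. cyl_norm p \<le> 1}" using z by (intro image_eqI[of _ _ "(x, w)"]) (auto simp: cyl_norm_def)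
  qed
qed

lemma compact_cylinder: "compact {p. cyl_norm p \<le> 1}"
proof -
  have "{p. cyl_norm p \<le> 1} = {-1..1} \<times> cball 0 1" by (auto simp: cyl_norm_def abs_le_iff)
  then show ?thesis by (simp add: compact_Times)
qed

lemma compact_solid_torus: "compact solid_torus"
  and torus_subset: "torus \<subseteq> solid_torus"
  by (auto simp: solid_torus_def torus_def compact_Times)

text \<open>
  Cut the torus along the meridian \<open>u = 1\<close>, which \<open>h\<close> fixes. The first coordinate of \<open>h\<close> then has
  a continuous angle \<open>\<alpha>\<close>, with \<open>\<alpha> = 0\<close> at the initial meridian. By injectivity of \<open>h\<close>, \<open>\<alpha>\<close>
  takes an integer value only on the two copies of that meridian, so inside it has constant sign and
  stays strictly between \<open>0\<close> and \<open>\<epsilon>\<close>. Surjectivity of \<open>h\<close> forces the value \<open>\<epsilon>\<close> at the far end.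
  Both signs occur, because \<open>h\<close> may reverse the direction of the longitude.
\<close>
lemma torus_map_angle:
  fixes h :: "complex \<times> complex \<Rightarrow> complex \<times> complex"
  assumes cont: "continuous_on torus h" and inj: "inj_on h torus" and surj: "h ` torus = torus"
    and mer': "\<forall>v\<in>sphere 0 1. h (1, v) = (1, v)"
  shows "\<exists>(\<epsilon>::real) (\<phi> :: real \<times> complex \<Rightarrow> real). (\<epsilon> = 1 \<or> \<epsilon> = -1) \<and>
    continuous_on ({0..1} \<times> sphere 0 1) \<phi> \<and>
    (\<forall>t\<in>{0..1}. \<forall>v\<in>sphere 0 1. fst (h (cis (2 * pi * t), v)) = cis (2 * pi * (\<epsilon> * \<phi> (t, v)))) \<and>
    (\<forall>v\<in>sphere 0 1. \<phi> (0, v) = 0 \<and> \<phi> (1, v) = 1) \<and>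
    (\<forall>t\<in>{0<..<1}. \<forall>v\<in>sphere 0 1. 0 < \<phi> (t, v) \<and> \<phi> (t, v) < 1)"
proof -
  note mer = mer'[rule_format]
  let ?S = "sphere (0::complex) 1"
  define g where "g = (\<lambda>(t, v). fst (h (cis (2 * pi * t), v)))"
  have tor: "(cis a, v) \<in> torus" if "v \<in> ?S" for a v using that by (simp add: torus_def)
  have hS: "fst (h (cis a, v)) \<in> ?S" "snd (h (cis a, v)) \<in> ?S" if "v \<in> ?S" for a v
  proof -
    have "h (cis a, v) \<in> torus" using surj tor[OF that] by blast
    then show "fst (h (cis a, v)) \<in> ?S" "snd (h (cis a, v)) \<in> ?S" by (auto simp: torus_def)
  qed
  have contg: "continuous_on ({0..1} \<times> ?S) g"
    unfolding g_def case_prod_unfold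
    by (intro continuous_on_fst continuous_on_compose2[OF cont] continuous_intros) (use tor in auto)
  have g_S: "g \<in> ({0..1} \<times> ?S) \<rightarrow> - {0}"
  proof
    fix p :: "real \<times> complex" assume "p \<in> {0..1} \<times> ?S"
    then show "g p \<in> - {0}" using hS(1)[of "snd p" "2 * pi * fst p"] by (auto simp: g_def case_prod_unfold)
  qed
  obtain \<psi> where \<psi>: "continuous_on ({0..1} \<times> ?S) \<psi>" "\<And>y. y \<in> ?S \<Longrightarrow> \<psi> (0, y) = 0"
      "\<And>z. z \<in> {0..1} \<times> ?S \<Longrightarrow> g z = exp (\<psi> z)"
    by (rule covering_space_lift_homotopy[OF covering_space_exp_punctured_plane contg g_S, of "\<lambda>_. 0"])
      (auto simp: g_def mer)
  define \<alpha> where "\<alpha> z = Im (\<psi> z) / (2 * pi)" for z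
  have cont\<alpha>: "continuous_on ({0..1} \<times> ?S) \<alpha>"
    unfolding \<alpha>_def by (intro continuous_intros \<psi>(1)) simp
  have \<alpha>0: "\<alpha> (0, v) = 0" if "v \<in> ?S" for v using \<psi>(2)[OF that] by (simp add: \<alpha>_def)
  have \<alpha>: "fst (h (cis (2 * pi * t), v)) = cis (2 * pi * \<alpha> (t, v))" if "t \<in> {0..1}" "v \<in> ?S" for t v
  proof -
    have e: "fst (h (cis (2 * pi * t), v)) = exp (\<psi> (t, v))" using \<psi>(3)[of "(t, v)"] that by (simp add: g_def)
    then have "cmod (exp (\<psi> (t, v))) = 1" using hS(1)[OF that(2), of "2 * pi * t"] by simp
    then have "Re (\<psi> (t, v)) = 0" by simp
    then have "\<psi> (t, v) = \<i> * of_real (2 * pi * \<alpha> (t, v))" by (simp add: complex_eq_iff \<alpha>_def)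
    then show ?thesis using e by (simp add: cis_conv_exp)
  qed
  \<comment> \<open>At an integer angle \<open>h\<close> has a value on the fixed meridian, hence the argument is on it.\<close>
  have \<alpha>int: "t = 0 \<or> t = 1" if that': "t \<in> {0..1}" "v \<in> ?S" "\<alpha> (t, v) \<in> \<int>" for t v
  proof -
    note that = that'
    obtain n :: int where n: "\<alpha> (t, v) = n" using that'(3) by (auto elim: Ints_cases)
    have "cis (2 * pi * \<alpha> (t, v)) = 1"
      unfolding n using cis_eq_1_iff[of "2 * n - 1"] by (auto simp: mult_ac)
    then have "fst (h (cis (2 * pi * t), v)) = 1" using \<alpha>[OF that(1,2)] by simp
    then have "h (cis (2 * pi * t), v) = h (1, snd (h (cis (2 * pi * t), v)))"
      using mer[OF hS(2)[OF that(2), of "2 * pi * t"]] by (simp add: prod_eq_iff)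
    then have "cis (2 * pi * t) = 1"
      using inj tor[OF that(2)] tor[OF hS(2)[OF that(2), of "2 * pi * t"], of 0]
      by (auto simp: inj_on_def)
    then have "cis (pi * ((2 * t - 1) + 1)) = 1" by (simp add: mult_ac)
    then have "\<bar>2 * t - 1\<bar> = 1" using that(1) by (subst (asm) cis_wrap_eq_1) auto
    then show ?thesis by auto
  qed
  have conn\<alpha>: "connected (\<alpha> ` (A \<times> B))" if "connected A" "connected B" "A \<subseteq> {0..1}" "B \<subseteq> ?S" for A B
    using that by (intro connected_continuous_image connected_Times continuous_on_subset[OF cont\<alpha>]) auto
  have connS: "connected ?S" by (rule connected_sphere) simp
  have between: "r \<in> \<alpha> ` (A \<times> B)"
    if "connected A" "connected B" "A \<subseteq> {0..1}" "B \<subseteq> ?S" "p \<in> A \<times> B" "p' \<in> A \<times> B" "\<alpha> p \<le> r" "r \<le> \<alpha> p'" for A B r p p'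
    using connected_contains_Icc[OF conn\<alpha>[OF that(1-4)], of "\<alpha> p" "\<alpha> p'"] that(5-8) by auto
  let ?I = "{0<..<1::real} \<times> ?S"
  have noInt: "\<alpha> p \<notin> \<int>" if "p \<in> ?I" for p using \<alpha>int[of "fst p" "snd p"] that by auto
  have small: "\<bar>\<alpha> (t, v)\<bar> < 1" if tv: "(t, v) \<in> ?I" for t v
  proof (rule ccontr)
    assume "\<not> ?thesis"
    then consider "1 \<le> \<alpha> (t, v)" | "\<alpha> (t, v) \<le> -1" by linarith
    then obtain r where r: "r \<in> \<alpha> ` ({0..t} \<times> {v})" "r = 1 \<or> r = -1"
    proof cases
      case 1
      then have "1 \<in> \<alpha> ` ({0..t} \<times> {v})"
        using tv \<alpha>0[of v] by (intro between[of _ _ "(0, v)" "(t, v)"]) auto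
      then show ?thesis using that by blast
    next
      case 2
      then have "-1 \<in> \<alpha> ` ({0..t} \<times> {v})"
        using tv \<alpha>0[of v] by (intro between[of _ _ "(t, v)" "(0, v)"]) auto
      then show ?thesis using that by blast
    qed
    then obtain s where s: "s \<in> {0..t}" "\<alpha> (s, v) = r" by auto
    then have "s = 0 \<or> s = 1" using r(2) tv by (intro \<alpha>int[of s v]) auto
    then show False using s tv r(2) \<alpha>0[of v] by auto
  qed
  define \<epsilon> :: real where "\<epsilon> = (if \<alpha> (1/2, 1) > 0 then 1 else -1)"
  have \<epsilon>: "\<epsilon> = 1 \<or> \<epsilon> = -1" by (simp add: \<epsilon>_def)
  have pos: "\<epsilon> * \<alpha> (t, v) > 0" if tv: "(t, v) \<in> ?I" for t v
  proof (rule ccontr)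
    assume neg: "\<not> ?thesis"
    have "0 \<in> \<alpha> ` ?I"
    proof (cases "\<alpha> (1/2, 1) > 0")
      case True
      then have "\<alpha> (t, v) \<le> 0" using neg by (simp add: \<epsilon>_def)
      then show ?thesis using True tv connS by (intro between[of _ _ "(t, v)" "(1/2, 1)"]) auto
    next
      case False
      then have "\<alpha> (t, v) \<ge> 0" using neg by (simp add: \<epsilon>_def)
      then show ?thesis using False tv connS by (intro between[of _ _ "(1/2, 1)" "(t, v)"]) auto
    qed
    then show False using noInt by (metis (no_types, lifting) Ints_0 imageE)
  qed
  define \<phi> where "\<phi> p = \<epsilon> * \<alpha> p" for p
  have cont\<phi>: "continuous_on ({0..1} \<times> ?S) \<phi>" unfolding \<phi>_def by (intro continuous_intros cont\<alpha>)
  have \<phi>I: "0 < \<phi> (t, v) \<and> \<phi> (t, v) < 1" if "0 < t" "t < 1" "v \<in> ?S" for t v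
    using pos[of t v] small[of t v] that \<epsilon> by (auto simp: \<phi>_def)
  have \<alpha>\<phi>: "\<alpha> p = \<epsilon> * \<phi> p" for p using \<epsilon> by (auto simp: \<phi>_def)
  have end01: "\<phi> (1, v) = 0 \<or> \<phi> (1, v) = 1" if v: "v \<in> ?S" for v
  proof -
    have 1: "continuous_on {0..1} (\<lambda>t. \<phi> (t, v))"
      by (rule continuous_on_compose2[OF cont\<phi>]) (use v in \<open>auto intro!: continuous_intros\<close>)
    have cl: "closure {0<..<1::real} = {0..1}" by (rule closure_greaterThanLessThan) simp
    have "(\<lambda>t. \<phi> (t, v)) ` closure {0<..<1} \<subseteq> {0..1}"
      by (rule image_closure_subset) (use 1 \<phi>I[OF _ _ v] cl in \<open>auto simp: less_imp_le\<close>)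
    then have "\<phi> (1, v) \<in> {0..1}" unfolding cl by (auto simp: image_subset_iff)
    moreover have "cis (2 * pi * \<alpha> (1, v)) = 1" using \<alpha>[of 1 v] mer[OF v] v by (simp flip: cis_2pi)
    then have "cis (pi * ((2 * \<alpha> (1, v) - 1) + 1)) = 1" by (simp add: mult_ac)
    then obtain n :: int where "\<alpha> (1, v) = n" unfolding cis_eq_1_iff by auto
    then have "\<phi> (1, v) \<in> \<int>" using \<epsilon> by (auto simp: \<phi>_def)
    ultimately show ?thesis by (auto elim!: Ints_cases)
  qed
  \<comment> \<open>Otherwise \<open>\<phi>\<close> has a maximum less than \<open>1\<close>, and angles beyond it are not attained.\<close>
  have "\<exists>v\<in>?S. \<phi> (1, v) = 1"
  proof (rule ccontr)
    assume "\<not> ?thesis"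
    then have end0: "\<phi> (1, v) = 0" if "v \<in> ?S" for v using end01 that by blast
    obtain p where p: "p \<in> {0..1} \<times> ?S" "\<And>p'. p' \<in> {0..1} \<times> ?S \<Longrightarrow> \<phi> p' \<le> \<phi> p"
      using continuous_attains_sup[OF _ _ cont\<phi>] by (auto simp: compact_Times)
    have lt: "0 \<le> \<phi> p'" "\<phi> p' < 1" if "p' \<in> {0..1} \<times> ?S" for p'
    proof -
      obtain t v where p': "p' = (t, v)" by fastforce
      then have tv: "v \<in> ?S" "t = 0 \<or> t = 1 \<or> 0 < t \<and> t < 1" using that by auto
      then show "0 \<le> \<phi> p'" "\<phi> p' < 1" using \<phi>I[of t v] end0[of v] \<alpha>0[of v] p' by (auto simp: \<phi>_def)
    qed
    define r where "r = (\<phi> p + 1) / 2"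
    have r: "\<phi> p < r" "r < 1" using lt(2)[OF p(1)] by (auto simp: r_def)
    have "(cis (2 * pi * (\<epsilon> * r)), 1) \<in> h ` torus" unfolding surj by (simp add: torus_def)
    then obtain z where z: "z \<in> torus" "h z = (cis (2 * pi * (\<epsilon> * r)), 1)" by auto
    then obtain u v where uv: "z = (u, v)" "u \<in> ?S" "v \<in> ?S" by (auto simp: torus_def)
    obtain x where x: "\<bar>x\<bar> \<le> 1" "\<And>w. wrap (x, w) = (u, w)" using wrap_surj[OF uv(2)] by metis
    define t where "t = (x + 1) / 2"
    have t: "t \<in> {0..1}" "u = cis (2 * pi * t)" using x by (auto simp: t_def abs_le_iff wrap_def)
    have "cis (2 * pi * \<alpha> (t, v)) = cis (2 * pi * (\<epsilon> * r))" using \<alpha>[OF t(1) uv(3)] z(2) uv t by simp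
    then have "wrap (2 * \<alpha> (t, v) - 1, 0) = wrap (2 * (\<epsilon> * r) - 1, 0)" by (simp add: wrap_def mult_ac)
    then have "cis (2 * pi * \<alpha> (t, v)) / cis (2 * pi * (\<epsilon> * r)) = 1" by (simp add: wrap_def mult_ac)
    then have "cis (pi * ((2 * (\<alpha> (t, v) - \<epsilon> * r) - 1) + 1)) = 1" by (simp add: cis_divide algebra_simps)
    then obtain n :: int where "(2 * (\<alpha> (t, v) - \<epsilon> * r) - 1) + 1 = 2 * real_of_int n" unfolding cis_eq_1_iff by blast
    then have n: "\<alpha> (t, v) - \<epsilon> * r = n" by argo
    have "\<phi> (t, v) - r = \<epsilon> * n" using n[symmetric] \<epsilon> by (auto simp: \<phi>_def)
    moreover have "0 \<le> \<phi> (t, v)" "\<phi> (t, v) \<le> \<phi> p" using lt(1)[of "(t, v)"] p(2)[of "(t, v)"] t uv by auto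
    ultimately have "-1 < \<epsilon> * n" "\<epsilon> * n < 0" using r by linarith+
    then show False using \<epsilon> by auto
  qed
  then obtain v1 where v1: "v1 \<in> ?S" "\<phi> (1, v1) = 1" by blast
  have "\<phi> (1, v) = 1" if v: "v \<in> ?S" for v
  proof (rule ccontr)
    assume "\<phi> (1, v) \<noteq> 1"
    then have "\<phi> (1, v) = 0" using end01[OF v] by simp
    then have *: "\<alpha> (1, v) = 0" "\<alpha> (1, v1) = \<epsilon>" using v1 \<alpha>\<phi> by auto
    have "\<epsilon> / 2 \<in> \<alpha> ` ({1} \<times> ?S)"
      using \<epsilon>
    proof
      assume "\<epsilon> = 1" then show ?thesis using * v v1 connS by (intro between[of _ _ "(1, v)" "(1, v1)"]) auto
    next
      assume "\<epsilon> = -1" then show ?thesis using * v v1 connS by (intro between[of _ _ "(1, v1)" "(1, v)"]) auto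
    qed
    then obtain w where "w \<in> ?S" "\<alpha> (1, w) = \<epsilon> / 2" by auto
    then show False using end01[of w] \<epsilon> by (auto simp: \<phi>_def)
  qed
  moreover have "\<phi> (0, v) = 0" if "v \<in> ?S" for v using \<alpha>0[OF that] by (simp add: \<phi>_def)
  ultimately show ?thesis
    using \<epsilon> cont\<phi> \<alpha>[unfolded \<alpha>\<phi>] \<phi>I by (intro exI[of _ \<epsilon>] exI[of _ \<phi>]) simp
qed

text \<open>
  Cut along the meridian disc, \<open>h\<close> becomes a homeomorphism of the side of the cylinder that is the
  identity on the rims. Extend it by the identity to the two end discs and then radially to the
  cylinder. As the ends stay fixed, the result descends to the solid torus. If \<open>h\<close> reverses the
  longitude, it is composed with the reflection \<open>\<rho>\<close>, so that the interval keeps its direction.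
\<close>
lemma torus_homeo_extends:
  fixes h :: "complex \<times> complex \<Rightarrow> complex \<times> complex"
  assumes cont: "continuous_on torus h" and inj: "inj_on h torus" and surj: "h ` torus = torus"
    and mer: "\<And>v. v \<in> sphere 0 1 \<Longrightarrow> h (1, v) = (1, v)"
  obtains H where "continuous_on solid_torus H" "inj_on H solid_torus" "H ` solid_torus = solid_torus"
    "\<And>z. z \<in> torus \<Longrightarrow> H z = h z"
proof -
  have mer': "\<forall>v\<in>sphere 0 1. h (1, v) = (1, v)" using mer by blast
  let ?S = "sphere (0::complex) 1"
  from torus_map_angle[OF cont inj surj mer'] obtain \<epsilon> \<phi> where \<epsilon>: "\<epsilon> = 1 \<or> \<epsilon> = -1"
    and cont\<phi>: "continuous_on ({0..1} \<times> ?S) \<phi>"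
    and \<phi>': "\<forall>t\<in>{0..1}. \<forall>v\<in>?S. fst (h (cis (2 * pi * t), v)) = cis (2 * pi * (\<epsilon> * \<phi> (t, v)))"
    and \<phi>01': "\<forall>v\<in>?S. \<phi> (0, v) = 0 \<and> \<phi> (1, v) = 1"
    and \<phi>I': "\<forall>t\<in>{0<..<1}. \<forall>v\<in>?S. 0 < \<phi> (t, v) \<and> \<phi> (t, v) < 1"
    by (elim exE conjE) (rule that)
  note \<phi> = \<phi>'[rule_format]
  have \<phi>0: "\<phi> (0, v) = 0" and \<phi>1: "\<phi> (1, v) = 1" if "v \<in> ?S" for v using \<phi>01' that by blast+
  have \<phi>I: "0 < \<phi> (t, v) \<and> \<phi> (t, v) < 1" if "0 < t" "t < 1" "v \<in> ?S" for t v
    using \<phi>I' that by (metis greaterThanLessThan_iff)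
  define \<rho> where "\<rho> z = (if \<epsilon> = 1 then fst z else cnj (fst z), snd z)" for z :: "complex \<times> complex"
  have \<rho>\<rho>: "\<rho> (\<rho> z) = z" for z by (simp add: \<rho>_def)
  have \<rho>_solid: "\<rho> ` solid_torus \<subseteq> solid_torus" by (auto simp: \<rho>_def solid_torus_def)
  have \<rho>_torus: "\<rho> z \<in> torus" if "z \<in> torus" for z using that by (auto simp: \<rho>_def torus_def)
  have cont\<rho>: "continuous_on A \<rho>" for A unfolding \<rho>_def by (cases "\<epsilon> = 1") (auto intro!: continuous_intros)
  define side where "side = {-1..1::real} \<times> ?S"
  define ends where "ends = {-1, 1::real} \<times> cball (0::complex) 1"
  have bd: "{p. cyl_norm p = 1} = side \<union> ends"
    by (auto simp: side_def ends_def cyl_norm_def max_def abs_le_iff split: if_splits)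
  define \<Phi>s where "\<Phi>s p = (2 * \<phi> ((fst p + 1) / 2, snd p) - 1, snd (h (wrap p)))" for p
  define \<Phi> where "\<Phi> p = (if p \<in> ends then p else \<Phi>s p)" for p
  have wrap_side: "wrap p \<in> torus" if "p \<in> side" for p using that by (auto simp: side_def wrap_def torus_def)
  have h_torus: "h z \<in> torus" if "z \<in> torus" for z using surj that by blast
  have \<Phi>s_ends: "\<Phi>s p = p" if p: "p \<in> side" "p \<in> ends" for p
  proof -
    obtain x v where xv: "p = (x, v)" "x = -1 \<or> x = 1" "v \<in> ?S" using p by (auto simp: side_def ends_def)
    then have "wrap p = (1, v)" by (auto simp: wrap_def complex_eq_iff)
    then show ?thesis using xv \<phi>0[of v] \<phi>1[of v] mer[of v] by (auto simp: \<Phi>s_def)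
  qed
  have \<Phi>_side: "\<Phi> p = \<Phi>s p" if "p \<in> side" for p using \<Phi>s_ends that by (auto simp: \<Phi>_def)
  have \<phi>01: "\<phi> (t, v) \<in> {0..1}" if "t \<in> {0..1}" "v \<in> ?S" for t v
  proof -
    have "t = 0 \<or> t = 1 \<or> 0 < t \<and> t < 1" using that by auto
    then show ?thesis using \<phi>0[OF that(2)] \<phi>1[OF that(2)] \<phi>I[of t v] that by auto
  qed
  have \<Phi>s_side: "\<Phi>s p \<in> side" if p: "p \<in> side" for p
    using \<phi>01[of "(fst p + 1) / 2" "snd p"] h_torus[OF wrap_side[OF p]] p
    by (auto simp: \<Phi>s_def side_def torus_def)
  have wrap\<Phi>: "wrap (\<Phi>s p) = \<rho> (h (wrap p))" if p: "p \<in> side" for p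
  proof -
    have "fst (h (wrap p)) = cis (2 * pi * (\<epsilon> * \<phi> ((fst p + 1) / 2, snd p)))"
    proof -
      have "2 * pi * ((fst p + 1) / 2) = pi * (fst p + 1)" by simp
      then show ?thesis using \<phi>[of "(fst p + 1) / 2" "snd p"] p by (auto simp: side_def wrap_def)
    qed
    then show ?thesis using \<epsilon> by (auto simp: wrap_def \<Phi>s_def \<rho>_def cis_cnj mult_ac)
  qed
  have inner: "\<bar>fst (\<Phi>s p)\<bar> < 1" if p: "p \<in> side" "p \<notin> ends" for p
  proof -
    obtain x v where xv: "p = (x, v)" by fastforce
    have "-1 < x \<and> x < 1 \<and> v \<in> ?S" using p unfolding xv side_def ends_def by force
    then have "0 < (x + 1) / 2 \<and> (x + 1) / 2 < 1 \<and> v \<in> ?S" by simp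
    then show ?thesis using \<phi>I[of "(x + 1) / 2" v] by (simp add: xv \<Phi>s_def abs_less_iff)
  qed
  have \<Phi>_ends_iff: "\<bar>fst (\<Phi> p)\<bar> = 1 \<longleftrightarrow> p \<in> ends" if "p \<in> side \<union> ends" for p
    using inner[of p] that by (auto simp: \<Phi>_def ends_def)
  have cont\<Phi>s: "continuous_on side \<Phi>s"
    unfolding \<Phi>s_def
    by (intro continuous_intros continuous_on_compose2[OF cont\<phi>] continuous_on_compose2[OF cont] continuous_wrap)
      (use wrap_side in \<open>auto simp: side_def\<close>)
  have "continuous_on (ends \<union> side) (\<lambda>p. if p \<in> ends then p else \<Phi>s p)"
    by (rule continuous_on_cases) (use cont\<Phi>s \<Phi>s_ends in \<open>auto simp: side_def ends_def closed_Times\<close>)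
  then have cont\<Phi>: "continuous_on {p. cyl_norm p = 1} \<Phi>" unfolding bd \<Phi>_def by (simp add: Un_commute)
  have inj\<Phi>: "inj_on \<Phi> (side \<union> ends)"
  proof (rule inj_onI)
    fix p p' assume p: "p \<in> side \<union> ends" "p' \<in> side \<union> ends" "\<Phi> p = \<Phi> p'"
    show "p = p'"
    proof (cases "p \<in> ends")
      case True
      then have "p' \<in> ends" using \<Phi>_ends_iff p by metis
      then show ?thesis using True p by (simp add: \<Phi>_def)
    next
      case False
      then have "p' \<notin> ends" using \<Phi>_ends_iff p by metis
      then have side: "p \<in> side" "p' \<in> side" using False p by auto
      then have "\<rho> (\<rho> (h (wrap p))) = \<rho> (\<rho> (h (wrap p')))"
        using p(3) \<Phi>_side wrap\<Phi> by metis
      then have "wrap p = wrap p'" using inj wrap_side[OF side(1)] wrap_side[OF side(2)]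
        by (simp add: \<rho>\<rho> inj_on_eq_iff)
      then show ?thesis
        using wrap_eq_iff[of p p'] side False by (auto simp: side_def ends_def abs_le_iff prod_eq_iff)
    qed
  qed
  have surj\<Phi>: "\<Phi> ` (side \<union> ends) = side \<union> ends"
  proof
    show "\<Phi> ` (side \<union> ends) \<subseteq> side \<union> ends" using \<Phi>_side \<Phi>s_side by (auto simp: \<Phi>_def)
    show "side \<union> ends \<subseteq> \<Phi> ` (side \<union> ends)"
    proof
      fix p assume p: "p \<in> side \<union> ends"
      show "p \<in> \<Phi> ` (side \<union> ends)"
      proof (cases "p \<in> ends")
        case True then show ?thesis by (intro image_eqI[of _ _ p]) (auto simp: \<Phi>_def)
      next
        case False
        then have ps: "p \<in> side" using p by auto
        have "\<rho> (wrap p) \<in> h ` torus" using surj \<rho>_torus wrap_side[OF ps] by simp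
        then obtain u v where z: "(u, v) \<in> torus" "h (u, v) = \<rho> (wrap p)" by auto
        then have uv: "u \<in> ?S" "v \<in> ?S" by (auto simp: torus_def)
        obtain x where x: "\<bar>x\<bar> \<le> 1" "\<And>w. wrap (x, w) = (u, w)" using wrap_surj[OF uv(1)] by metis
        have xs: "(x, v) \<in> side" using x uv by (auto simp: side_def abs_le_iff)
        then have "wrap (\<Phi>s (x, v)) = wrap p" using wrap\<Phi>[OF xs] x(2) z(2) \<rho>\<rho> by simp
        moreover have "\<bar>fst p\<bar> < 1" using ps False by (auto simp: side_def ends_def abs_less_iff less_le)
        moreover have "\<bar>fst (\<Phi>s (x, v))\<bar> \<le> 1" using \<Phi>s_side[OF xs] by (auto simp: side_def abs_le_iff)
        ultimately have "\<Phi>s (x, v) = p" using wrap_eq_iff[of "\<Phi>s (x, v)" p] by (auto simp: prod_eq_iff)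
        then show ?thesis using xs \<Phi>_side[OF xs] by (intro image_eqI[of _ _ "(x, v)"]) auto
      qed
    qed
  qed
  have bij: "bij_betw \<Phi> {p. cyl_norm p = 1} {p. cyl_norm p = 1}"
    unfolding bd bij_betw_def using inj\<Phi> surj\<Phi> by blast
  note K = continuous_cone_map[OF cont\<Phi> bij] cyl_norm_cone_map[OF cont\<Phi> bij]
    inj_cone_map[OF cont\<Phi> bij] surj_cone_map[OF cont\<Phi> bij]
  have K_ends: "cone_map \<Phi> p = p" if "p \<in> ends" for p
  proof -
    have "cyl_norm p = 1" using bd that by blast
    then show ?thesis using that by (simp add: cone_map_extends \<Phi>_def)
  qed
  have ends_iff: "p \<in> ends \<longleftrightarrow> \<bar>fst p\<bar> = 1" if "cyl_norm p \<le> 1" for p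
    using that by (cases p) (auto simp: ends_def cyl_norm_def abs_if split: if_splits)
  have K_ends_iff: "cone_map \<Phi> p \<in> ends \<longleftrightarrow> p \<in> ends" if "cyl_norm p \<le> 1" for p
    using K_ends K(3) by (metis injD)
  have fst_le: "\<bar>fst p\<bar> \<le> 1" if "cyl_norm p \<le> 1" for p using that by (simp add: cyl_norm_def)
  have wrapK: "wrap (cone_map \<Phi> p) = wrap (cone_map \<Phi> p') \<longleftrightarrow> wrap p = wrap p'"
    if p: "cyl_norm p \<le> 1" "cyl_norm p' \<le> 1" for p p'
  proof -
    have pK: "cyl_norm (cone_map \<Phi> p) \<le> 1" "cyl_norm (cone_map \<Phi> p') \<le> 1" using p K(2) by auto
    have *: "wrap a = wrap b \<longleftrightarrow> a = b \<or> snd a = snd b \<and> a \<in> ends \<and> b \<in> ends"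
      if "cyl_norm a \<le> 1" "cyl_norm b \<le> 1" for a b
      using that wrap_eq_iff[OF fst_le fst_le, of a b] ends_iff by (auto simp: prod_eq_iff)
    show ?thesis
      unfolding *[OF p] *[OF pK] using K_ends_iff p K_ends K(3) by (metis injD)
  qed
  define \<xi> where "\<xi> z = (SOME p. cyl_norm p \<le> 1 \<and> wrap p = z)" for z
  have \<xi>: "cyl_norm (\<xi> z) \<le> 1 \<and> wrap (\<xi> z) = z" if z: "z \<in> solid_torus" for z
  proof -
    have "z \<in> wrap ` {p. cyl_norm p \<le> 1}" using z by (simp only: wrap_cylinder)
    then have "\<exists>p. cyl_norm p \<le> 1 \<and> wrap p = z" by blast
    then show ?thesis unfolding \<xi>_def by (rule someI_ex)
  qed
  define H where "H z = \<rho> (wrap (cone_map \<Phi> (\<xi> z)))" for z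
  have H_wrap: "H (wrap p) = \<rho> (wrap (cone_map \<Phi> p))" if p: "cyl_norm p \<le> 1" for p
  proof -
    have "wrap p \<in> solid_torus" using wrap_cylinder p by blast
    then show ?thesis unfolding H_def using wrapK[of "\<xi> (wrap p)" p] \<xi> p by simp
  qed
  show ?thesis
  proof
    have "continuous_on {p. cyl_norm p \<le> 1} (\<lambda>p. \<rho> (wrap (cone_map \<Phi> p)))"
      by (intro continuous_on_compose2[OF cont\<rho>[of UNIV]] continuous_on_compose2[OF continuous_wrap[of UNIV]]
          continuous_on_subset[OF K(1)]) auto
    then have "continuous_on {p. cyl_norm p \<le> 1} (\<lambda>p. H (wrap p))"
      by (rule continuous_on_eq) (simp add: H_wrap)
    from continuous_on_compact_quotient[OF compact_cylinder continuous_wrap this]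
    show "continuous_on solid_torus H" unfolding wrap_cylinder .
    show "inj_on H solid_torus"
      unfolding wrap_cylinder[symmetric]
    proof (rule inj_onI, elim imageE, simp)
      fix p p' assume p: "cyl_norm p \<le> 1" "cyl_norm p' \<le> 1" "H (wrap p) = H (wrap p')"
      then have "wrap (cone_map \<Phi> p) = wrap (cone_map \<Phi> p')" unfolding H_wrap[OF p(1)] H_wrap[OF p(2)] by (metis \<rho>\<rho>)
      then show "wrap p = wrap p'" using wrapK p by blast
    qed
    show "H ` solid_torus = solid_torus"
    proof
      show "H ` solid_torus \<subseteq> solid_torus"
      proof
        fix y assume "y \<in> H ` solid_torus"
        then obtain z where z: "z \<in> solid_torus" "y = \<rho> (wrap (cone_map \<Phi> (\<xi> z)))"
          by (auto simp: H_def)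
        have "cyl_norm (cone_map \<Phi> (\<xi> z)) \<le> 1" using \<xi>[OF z(1)] K(2) by simp
        then have "wrap (cone_map \<Phi> (\<xi> z)) \<in> solid_torus" using wrap_cylinder by blast
        then show "y \<in> solid_torus" using \<rho>_solid z(2) by blast
      qed
      show "solid_torus \<subseteq> H ` solid_torus"
      proof
        fix y assume "y \<in> solid_torus"
        then have "\<rho> y \<in> wrap ` {p. cyl_norm p \<le> 1}" using \<rho>_solid unfolding wrap_cylinder by blast
        then obtain p where p: "cyl_norm p \<le> 1" "wrap p = \<rho> y" by fastforce
        obtain p' where p': "p = cone_map \<Phi> p'" using K(4) by (meson surjD)
        then have p'1: "cyl_norm p' \<le> 1" using p K(2) by simp
        have "y = H (wrap p')" using H_wrap[OF p'1] p p' \<rho>\<rho> by simp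
        moreover have "wrap p' \<in> solid_torus" using p'1 wrap_cylinder by blast
        ultimately show "y \<in> H ` solid_torus" by blast
      qed
    qed
    show "H z = h z" if z: "z \<in> torus" for z
    proof -
      obtain u v where uv: "z = (u, v)" "u \<in> ?S" "v \<in> ?S" using z by (auto simp: torus_def)
      obtain x where x: "\<bar>x\<bar> \<le> 1" "\<And>w. wrap (x, w) = (u, w)" using wrap_surj[OF uv(2)] by metis
      have xs: "(x, v) \<in> side" using x uv by (auto simp: side_def abs_le_iff)
      have cn: "cyl_norm (x, v) = 1" using xs bd by blast
      have "H (wrap (x, v)) = \<rho> (wrap (\<Phi> (x, v)))" using H_wrap[of "(x, v)"] cn by (simp add: cone_map_extends)
      also have "\<dots> = h (wrap (x, v))" using \<Phi>_side[OF xs] wrap\<Phi>[OF xs] \<rho>\<rho> by simp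
      finally show ?thesis using x uv by simp
    qed
  qed
qed

text \<open>
  The linear map with matrix rows \<open>(c, b)\<close> and \<open>(d, a)\<close>, in multiplicative notation. It sends the
  meridian \<open>(1, v)\<close> to \<open>(v\<^sup>b, v\<^sup>a)\<close>, hence belongs to the surgery coefficient \<open>a/b\<close>.
\<close>
definition torus_linear :: "int \<Rightarrow> int \<Rightarrow> int \<Rightarrow> int \<Rightarrow> complex \<times> complex \<Rightarrow> complex \<times> complex" where
  "torus_linear c b d a = (\<lambda>(u, v). (u powi c * v powi b, u powi d * v powi a))"

lemma cmod_powi: "cmod (z powi n) = cmod z powi n"
  by (rule norm_power_int)

lemma torus_linear_torus: "z \<in> torus \<Longrightarrow> torus_linear c b d a z \<in> torus"
  by (auto simp: torus_linear_def torus_def norm_mult cmod_powi)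

lemma continuous_torus_linear: "continuous_on torus (torus_linear c b d a)"
  unfolding torus_linear_def case_prod_unfold
  by (intro continuous_intros) (auto simp: torus_def)

lemma torus_linear_compose:
  assumes "z \<in> torus"
  shows "torus_linear c b d a (torus_linear c' b' d' a' z) =
    torus_linear (c * c' + b * d') (c * b' + b * a') (d * c' + a * d') (d * b' + a * a') z"
proof -
  obtain u v where z: "z = (u, v)" "u \<noteq> 0" "v \<noteq> 0" using assms by (force simp: torus_def)
  show ?thesis unfolding z torus_linear_def
    using z(2,3) by (simp add: power_int_mult_distrib power_int_add flip: power_int_mult)
      (simp add: power_int_mult mult_ac power_int_mult_distrib flip: power_int_mult)
qed

lemma torus_linear_id: "torus_linear 1 0 0 1 z = z"
  by (simp add: torus_linear_def case_prod_unfold)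

lemma torus_linear_bij:
  assumes det: "c * a - d * b = 1"
  shows "inj_on (torus_linear c b d a) torus" "torus_linear c b d a ` torus = torus"
proof -
  have 1: "torus_linear a (- b) (- d) c (torus_linear c b d a z) = z" if "z \<in> torus" for z
  proof -
    have "a * c + - b * d = 1" "a * b + - b * a = 0" "- d * c + c * d = 0" "- d * b + c * a = 1"
      using det by (auto simp: algebra_simps)
    then show ?thesis using torus_linear_compose[OF that, of a "-b" "-d" c c b d a] torus_linear_id by simp
  qed
  have 2: "torus_linear c b d a (torus_linear a (- b) (- d) c z) = z" if "z \<in> torus" for z
  proof -
    have "c * a + b * - d = 1" "c * - b + b * c = 0" "d * a + a * - d = 0" "d * - b + a * c = 1"
      using det by (auto simp: algebra_simps)
    then show ?thesis using torus_linear_compose[OF that, of c b d a a "-b" "-d" c] torus_linear_id by simp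
  qed
  show "inj_on (torus_linear c b d a) torus" using 1 by (rule inj_on_inverseI)
  show "torus_linear c b d a ` torus = torus"
    using 2 torus_linear_torus by (metis (no_types, lifting) image_eqI image_subsetI subsetI subset_antisym)
qed

lemma continuous_map_top_of_set:
  "continuous_map (top_of_set A) (top_of_set B) k \<longleftrightarrow> continuous_on A k \<and> k ` A \<subseteq> B"
  by (auto simp: continuous_map_in_subtopology)

lemma homeomorphic_maps_top_of_set:
  "homeomorphic_maps (top_of_set S) (top_of_set T) f g \<longleftrightarrow> homeomorphism S T f g"
proof
  assume "homeomorphic_maps (top_of_set S) (top_of_set T) f g"
  then show "homeomorphism S T f g"
    unfolding homeomorphic_maps_def continuous_map_top_of_set by (intro homeomorphismI) auto
next
  assume "homeomorphism S T f g"
  then show "homeomorphic_maps (top_of_set S) (top_of_set T) f g"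
    unfolding homeomorphic_maps_def continuous_map_top_of_set homeomorphism_def by simp
qed

lemma embedding_map_top_of_set:
  "embedding_map (top_of_set S) (top_of_set Y) g \<longleftrightarrow> g ` S \<subseteq> Y \<and> (\<exists>g'. homeomorphism S (g ` S) g g')"
proof (cases "g ` S \<subseteq> Y")
  case True
  then have "subtopology (top_of_set Y) (g ` S) = top_of_set (g ` S)"
    by (simp add: subtopology_subtopology inf_absorb2)
  moreover have "homeomorphic_maps (top_of_set S) (top_of_set (g ` S)) g = homeomorphism S (g ` S) g"
    by (intro ext) (rule homeomorphic_maps_top_of_set)
  ultimately show ?thesis
    unfolding embedding_map_def homeomorphic_map_maps topspace_euclidean_subtopology
    by (simp only: True simp_thms)
next
  case False
  have "g ` S \<subseteq> Y" if "embedding_map (top_of_set S) (top_of_set Y) g"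
  proof -
    have "g ` topspace (top_of_set S) = topspace (subtopology (top_of_set Y) (g ` topspace (top_of_set S)))"
      by (rule homeomorphic_imp_surjective_map[OF that[unfolded embedding_map_def]])
    from equalityD1[OF this, unfolded topspace_euclidean_subtopology] show ?thesis
      by (rule order_trans) (simp add: le_infI1)
  qed
  then show ?thesis using False by argo
qed

lemma closed_embedding_iff:
  "closed_embedding S Y g \<longleftrightarrow> (\<exists>g'. homeomorphism S (g ` S) g g') \<and> closedin (top_of_set Y) (g ` S)"
proof
  assume *: "closed_embedding S Y g"
  then have "closedin (top_of_set Y) (g ` S)"
    unfolding closed_embedding_def closed_map_def by (metis closedin_subtopology_refl topspace_euclidean subset_UNIV)
  then show "(\<exists>g'. homeomorphism S (g ` S) g g') \<and> closedin (top_of_set Y) (g ` S)"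
    using * unfolding closed_embedding_def embedding_map_top_of_set by blast
next
  assume *: "(\<exists>g'. homeomorphism S (g ` S) g g') \<and> closedin (top_of_set Y) (g ` S)"
  then obtain g' where g': "homeomorphism S (g ` S) g g'" by blast
  have "closed_map (top_of_set S) (top_of_set Y) g"
    unfolding closed_map_def
  proof (intro allI impI)
    fix U assume "closedin (top_of_set S) U"
    then have "closedin (top_of_set (g ` S)) (g ` U)" using g' homeomorphism_imp_closed_map by blast
    then show "closedin (top_of_set Y) (g ` U)" using * closedin_trans by blast
  qed
  then show "closed_embedding S Y g"
    unfolding closed_embedding_def embedding_map_top_of_set using * closedin_imp_subset by blast
qed

text \<open>
  Comparing a given gluing map with a linear one that has the same effect on the meridian yields a
  homeomorphism of the torus that fixes the meridian. Precomposing \<open>g\<close> with its extension to the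
  solid torus changes the parametrisation of the glued-in solid torus, but not its image.
\<close>
lemma linear_gluing:
  assumes g: "closed_embedding solid_torus Y g"
    and f: "continuous_on torus f" "inj_on f torus" "f ` torus = g ` torus"
    and mer: "\<And>v. v \<in> sphere 0 1 \<Longrightarrow> g (1, v) = f (v powi b, v powi a)"
    and det: "c * a - d * b = 1"
  obtains g' where "closed_embedding solid_torus Y g'" "g' ` solid_torus = g ` solid_torus"
    "\<And>z. z \<in> torus \<Longrightarrow> g' z = f (torus_linear c b d a z)"
proof -
  obtain gi where gi: "homeomorphism solid_torus (g ` solid_torus) g gi"
    and gcl: "closedin (top_of_set Y) (g ` solid_torus)"
    using g by (auto simp: closed_embedding_iff)
  have gi_g: "gi (g z) = z" if "z \<in> solid_torus" for z using gi that by (simp add: homeomorphism_def)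
  let ?A = "torus_linear c b d a"
  define h where "h z = gi (f (?A z))" for z
  have fA: "(\<lambda>z. f (?A z)) ` torus = g ` torus"
    using torus_linear_bij(2)[OF det] f(3) by (metis image_image)
  have gt: "g ` torus \<subseteq> g ` solid_torus" using torus_subset by blast
  have conth: "continuous_on torus h"
    unfolding h_def
    by (rule continuous_on_compose2[OF homeomorphism_cont2[OF gi] continuous_on_compose2[OF f(1) continuous_torus_linear]])
      (use torus_linear_torus fA gt in auto)
  have injh: "inj_on h torus"
  proof (rule inj_onI)
    fix z z' assume z: "z \<in> torus" "z' \<in> torus" "h z = h z'"
    have "f (?A z) \<in> g ` torus" "f (?A z') \<in> g ` torus" using fA z by auto
    then have "f (?A z) = f (?A z')" using z(3) gt gi unfolding h_def by (metis homeomorphism_def subsetD)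
    then have "?A z = ?A z'" using f(2) torus_linear_torus z by (simp add: inj_on_eq_iff)
    then show "z = z'" using torus_linear_bij(1)[OF det] z by (simp add: inj_on_eq_iff)
  qed
  have surjh: "h ` torus = torus"
  proof -
    have "h ` torus = gi ` (\<lambda>z. f (?A z)) ` torus" by (simp add: h_def image_image)
    also have "\<dots> = torus" unfolding fA using gi_g torus_subset by (force simp: image_image)
    finally show ?thesis .
  qed
  have merh: "h (1, v) = (1, v)" if v: "v \<in> sphere 0 1" for v
    using mer[OF v] gi_g[of "(1, v)"] v by (simp add: h_def torus_linear_def solid_torus_def)
  obtain H where H: "continuous_on solid_torus H" "inj_on H solid_torus" "H ` solid_torus = solid_torus"
    "\<And>z. z \<in> torus \<Longrightarrow> H z = h z"
    using torus_homeo_extends[OF conth injh surjh merh] by metis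
  obtain Hi where Hi: "homeomorphism solid_torus solid_torus H Hi"
    using homeomorphism_compact[OF compact_solid_torus H(1,3,2)] by blast
  have im: "(g \<circ> H) ` solid_torus = g ` solid_torus" using H(3) by (metis image_comp)
  show ?thesis
  proof
    show "closed_embedding solid_torus Y (g \<circ> H)"
      unfolding closed_embedding_iff im using homeomorphism_compose[OF Hi gi] gcl by blast
    show "(g \<circ> H) ` solid_torus = g ` solid_torus" by (fact im)
    show "(g \<circ> H) z = f (?A z)" if z: "z \<in> torus" for z
    proof -
      have "f (?A z) \<in> g ` solid_torus" using fA gt z by blast
      then have "g (gi (f (?A z))) = f (?A z)" using gi unfolding homeomorphism_def by blast
      then show ?thesis using H(4)[OF z] by (simp add: h_def)
    qed
  qed
qed

section \<open>Quotients by free cyclic actions\<close>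

lemma closed_embeddingD:
  assumes "closed_embedding S Y g"
  shows "continuous_on S g" "inj_on g S" "g ` S \<subseteq> Y" "closedin (top_of_set Y) (g ` S)"
proof -
  obtain g' where g': "homeomorphism S (g ` S) g g'" and cl: "closedin (top_of_set Y) (g ` S)"
    using assms by (auto simp: closed_embedding_iff)
  show "continuous_on S g" using g' by (rule homeomorphism_cont1)
  show "inj_on g S" using g' by (metis homeomorphism_def inj_on_inverseI)
  show "closedin (top_of_set Y) (g ` S)" by fact
  then show "g ` S \<subseteq> Y" by (rule closedin_imp_subset)
qed

lemma closed_embedding_closed_image:
  assumes "closed_embedding S Y g" "closedin (top_of_set S) C"
  shows "closedin (top_of_set Y) (g ` C)"
  using assms unfolding closed_embedding_def closed_map_def by blast

lemma closed_embedding_comp: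
  assumes "closed_embedding S Y g" "closed_embedding Y Z f"
  shows "closed_embedding S Z (f \<circ> g)"
proof -
  obtain g' f' where g': "homeomorphism S (g ` S) g g'" and f': "homeomorphism Y (f ` Y) f f'"
    using assms by (auto simp: closed_embedding_iff)
  have "homeomorphism (g ` S) (f ` g ` S) f f'"
    by (rule homeomorphism_of_subsets[OF f']) (use closed_embeddingD[OF assms(1)] in auto)
  from homeomorphism_compose[OF g' this] show ?thesis
    unfolding closed_embedding_iff
    using closed_embedding_closed_image[OF assms(2) closed_embeddingD(4)[OF assms(1)]]
    by (auto simp: image_comp)
qed

lemma Hausdorff_closed_cover:
  assumes fin: "finite \<A>" and cov: "N = \<Union>\<A>"
    and cl: "\<And>A. A \<in> \<A> \<Longrightarrow> closedin (top_of_set N) A"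
    and H: "\<And>A. A \<in> \<A> \<Longrightarrow> Hausdorff_space (top_of_set A)"
  shows "Hausdorff_space (top_of_set N)"
  unfolding Hausdorff_space_def
proof (intro allI impI)
  fix x y assume "x \<in> topspace (top_of_set N) \<and> y \<in> topspace (top_of_set N) \<and> x \<noteq> y"
  then have xy: "x \<in> N" "y \<in> N" "x \<noteq> y" by auto
  have "\<exists>U V. openin (top_of_set A) U \<and> openin (top_of_set A) V \<and> U \<inter> V = {} \<and> (x \<in> A \<longrightarrow> x \<in> U) \<and> (y \<in> A \<longrightarrow> y \<in> V)"
    if A: "A \<in> \<A>" for A
  proof (cases "x \<in> A \<and> y \<in> A")
    case True
    then obtain U V where "openin (top_of_set A) U" "openin (top_of_set A) V" "x \<in> U" "y \<in> V" "disjnt U V"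
      using H[OF A, unfolded Hausdorff_space_def, rule_format, of x y] xy(3) by auto
    then show ?thesis unfolding disjnt_def by blast
  next
    case False
    then show ?thesis
    proof (cases "x \<in> A")
      case True then show ?thesis using False by (intro exI[of _ A] exI[of _ "{}"]) auto
    next
      case False then show ?thesis by (intro exI[of _ "{}"] exI[of _ A]) auto
    qed
  qed
  then obtain U V where UV: "\<And>A. A \<in> \<A> \<Longrightarrow> openin (top_of_set A) (U A) \<and> openin (top_of_set A) (V A) \<and>
      U A \<inter> V A = {} \<and> (x \<in> A \<longrightarrow> x \<in> U A) \<and> (y \<in> A \<longrightarrow> y \<in> V A)" by metis
  have op: "openin (top_of_set N) (N - (\<Union>A\<in>\<A>. A - W A))" if W: "\<And>A. A \<in> \<A> \<Longrightarrow> openin (top_of_set A) (W A)" for W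
  proof (rule openin_diff)
    show "closedin (top_of_set N) (\<Union>A\<in>\<A>. A - W A)"
    proof (rule closedin_Union)
      fix B assume "B \<in> (\<lambda>A. A - W A) ` \<A>"
      then obtain A where A: "A \<in> \<A>" "B = A - W A" by auto
      have "closedin (top_of_set A) (A - W A)" by (rule closedin_diff) (use W[OF A(1)] in auto)
      then show "closedin (top_of_set N) B" using cl[OF A(1)] A(2) closedin_trans by blast
    qed (use fin in auto)
  qed auto
  show "\<exists>U V. openin (top_of_set N) U \<and> openin (top_of_set N) V \<and> x \<in> U \<and> y \<in> V \<and> disjnt U V"
  proof (intro exI conjI)
    show "openin (top_of_set N) (N - (\<Union>A\<in>\<A>. A - U A))" "openin (top_of_set N) (N - (\<Union>A\<in>\<A>. A - V A))"
      using UV by (auto intro!: op)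
    show "x \<in> N - (\<Union>A\<in>\<A>. A - U A)" "y \<in> N - (\<Union>A\<in>\<A>. A - V A)" using UV xy by auto
    show "disjnt (N - (\<Union>A\<in>\<A>. A - U A)) (N - (\<Union>A\<in>\<A>. A - V A))"
      unfolding disjnt_def using UV cov by blast
  qed
qed

lemma Hausdorff_homeomorphism:
  assumes "homeomorphism S T f g" "Hausdorff_space (top_of_set S)"
  shows "Hausdorff_space (top_of_set T)"
proof -
  have "homeomorphic_map (top_of_set S) (top_of_set T) f"
    using assms(1) homeomorphic_maps_top_of_set homeomorphic_map_maps by blast
  then show ?thesis using assms(2) homeomorphic_map_imp_homeomorphic_space homeomorphic_Hausdorff_space by blast
qed

locale free_cyclic_action =
  fixes k :: nat and N :: "'a::topological_space set" and t :: "'a \<Rightarrow> 'a"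
  assumes k: "k > 0" and cont: "continuous_on N t" and maps: "t ` N \<subseteq> N"
    and period: "\<And>y. y \<in> N \<Longrightarrow> (t ^^ k) y = y"
    and free: "\<And>y i. y \<in> N \<Longrightarrow> 0 < i \<Longrightarrow> i < k \<Longrightarrow> (t ^^ i) y \<noteq> y"
begin

lemma pow_maps: "y \<in> N \<Longrightarrow> (t ^^ i) y \<in> N"
  by (induction i) (use maps in auto)

lemma pow_cont: "continuous_on N (t ^^ i)"
proof (induction i)
  case (Suc i)
  have "continuous_on N (t \<circ> (t ^^ i))"
    by (rule continuous_on_compose[OF Suc]) (rule continuous_on_subset[OF cont], use pow_maps in auto)
  then show ?case by simp
qed (simp add: id_def)

lemma pow_mult_period: "y \<in> N \<Longrightarrow> (t ^^ (k * n)) y = y"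
  by (induction n) (simp_all add: funpow_add period)

lemma pow_mod: "y \<in> N \<Longrightarrow> (t ^^ (i mod k)) y = (t ^^ i) y"
proof -
  assume y: "y \<in> N"
  have "(t ^^ (i mod k + k * (i div k))) y = (t ^^ (i mod k)) y"
    unfolding funpow_add o_def using pow_mult_period[OF y] by simp
  then show ?thesis by (simp add: mult.commute)
qed

lemma pow_inverse: "y \<in> N \<Longrightarrow> (t ^^ (k * i - i)) ((t ^^ i) y) = y" "y \<in> N \<Longrightarrow> (t ^^ i) ((t ^^ (k * i - i)) y) = y"
proof -
  assume y: "y \<in> N"
  have "i \<le> k * i" using k by simp
  then have *: "(k * i - i) + i = k * i" "i + (k * i - i) = k * i" by auto
  show "(t ^^ (k * i - i)) ((t ^^ i) y) = y" "(t ^^ i) ((t ^^ (k * i - i)) y) = y"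
    using pow_mult_period[OF y, of i] funpow_add[of "k * i - i" i t] funpow_add[of i "k * i - i" t]
    unfolding * by (simp_all add: fun_eq_iff)
qed

lemma pow_homeomorphism: "homeomorphism N N (t ^^ i) (t ^^ (k * i - i))"
  by (rule homeomorphismI[OF pow_cont pow_cont]) (auto simp: pow_maps pow_inverse)

lemma pow_eq_iff: "y \<in> N \<Longrightarrow> (t ^^ i) y = (t ^^ j) y \<longleftrightarrow> i mod k = j mod k"
proof
  assume y: "y \<in> N" and eq: "(t ^^ i) y = (t ^^ j) y"
  have "a mod k = b mod k" if ab: "a mod k \<le> b mod k" and e: "(t ^^ a) y = (t ^^ b) y" for a b
  proof (rule ccontr)
    assume "a mod k \<noteq> b mod k"
    then have "0 < b mod k - a mod k" using ab by simp
    moreover have "b mod k - a mod k < k" using k by (meson diff_le_self le_less_trans mod_less_divisor)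
    ultimately have "(t ^^ (b mod k - a mod k)) ((t ^^ (a mod k)) y) \<noteq> (t ^^ (a mod k)) y"
      using free pow_maps[OF y] by blast
    moreover have "(t ^^ (b mod k - a mod k)) ((t ^^ (a mod k)) y) = (t ^^ (b mod k)) y"
      using ab funpow_add[of "b mod k - a mod k" "a mod k" t] by (simp add: fun_eq_iff)
    ultimately show False using e pow_mod[OF y] by metis
  qed
  then show "i mod k = j mod k" using eq by (metis nle_le)
next
  assume "y \<in> N" "i mod k = j mod k"
  then show "(t ^^ i) y = (t ^^ j) y" by (metis pow_mod)
qed

text \<open>
  In a Hausdorff space, \<open>y\<close> can be separated from each of its finitely many translates.
\<close>
lemma disjoint_nbhd:
  assumes H: "Hausdorff_space (top_of_set N)" and y: "y \<in> N"
  obtains U where "openin (top_of_set N) U" "y \<in> U"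
    "\<And>i j. i mod k \<noteq> j mod k \<Longrightarrow> (t ^^ i) ` U \<inter> (t ^^ j) ` U = {}"
proof -
  have "\<exists>A B. openin (top_of_set N) A \<and> openin (top_of_set N) B \<and> y \<in> A \<and> (t ^^ i) y \<in> B \<and> A \<inter> B = {}"
    if "i \<in> {0<..<k}" for i
    using H[unfolded Hausdorff_space_def, rule_format, of y "(t ^^ i) y"] y pow_maps[OF y] free[OF y, of i] that
    by (auto simp: disjnt_def)
  then obtain A B where AB: "\<And>i. i \<in> {0<..<k} \<Longrightarrow> openin (top_of_set N) (A i) \<and> openin (top_of_set N) (B i) \<and>
     y \<in> A i \<and> (t ^^ i) y \<in> B i \<and> A i \<inter> B i = {}" by metis
  define U where "U = N \<inter> (\<Inter>i\<in>{0<..<k}. A i \<inter> (N \<inter> (t ^^ i) -` B i))"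
  have op: "openin (top_of_set N) (A i \<inter> (N \<inter> (t ^^ i) -` B i))" if "i \<in> {0<..<k}" for i
  proof -
    have "openin (top_of_set N) (N \<inter> (t ^^ i) -` B i)"
      by (rule continuous_openin_preimage[OF pow_cont, where T = N]) (use AB[OF that] pow_maps in auto)
    then show ?thesis using AB[OF that] by (metis openin_Int)
  qed
  have U: "openin (top_of_set N) U"
  proof (cases "{0<..<k} = {}")
    case True then show ?thesis by (simp add: U_def)
  next
    case False
    then show ?thesis unfolding U_def by (intro openin_Int openin_INT2 op) auto
  qed
  have Uy: "y \<in> U" using AB y by (auto simp: U_def)
  have self: "(t ^^ i) u \<notin> U" if "u \<in> U" "i \<in> {0<..<k}" for u i
  proof
    assume "(t ^^ i) u \<in> U"
    then have "(t ^^ i) u \<in> A i" "(t ^^ i) u \<in> B i" using that unfolding U_def by blast+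
    then show False using AB[OF that(2)] by blast
  qed
  show ?thesis
  proof
    fix i j assume ij: "i mod k \<noteq> j mod k"
    show "(t ^^ i) ` U \<inter> (t ^^ j) ` U = {}"
    proof (rule ccontr)
      assume "(t ^^ i) ` U \<inter> (t ^^ j) ` U \<noteq> {}"
      then obtain u u' where u: "u \<in> U" "u' \<in> U" "(t ^^ i) u = (t ^^ j) u'" by auto
      have uN: "u \<in> N" "u' \<in> N" using u by (auto simp: U_def)
      define l where "l = k * j - j + i"
      have "u' = (t ^^ l) u" unfolding l_def funpow_add o_def u(3) using pow_inverse(1)[OF uN(2)] by simp
      then have eq: "u' = (t ^^ (l mod k)) u" using pow_mod[OF uN(1)] by simp
      have "l mod k \<noteq> 0"
      proof
        assume "l mod k = 0"
        then have "u' = u" using eq by simp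
        then have "(t ^^ i) u = (t ^^ j) u" using u(3) by simp
        then show False using pow_eq_iff[OF uN(1)] ij by blast
      qed
      then show False using self[OF u(1), of "l mod k"] eq u(2) k by auto
    qed
  qed (use U Uy in auto)
qed

lemma pow_open_map: "openin (top_of_set N) V \<Longrightarrow> openin (top_of_set N) ((t ^^ i) ` V)"
  using pow_homeomorphism[of i] homeomorphism_imp_open_map by blast

end

text \<open>
  A closed map whose fibres are the orbits is a model of the quotient. Images of the neighbourhoods
  of \<open>disjoint_nbhd\<close> are evenly covered; since the total space is connected, a deck transformation
  coincides everywhere with the same power of \<open>t\<close>, so that the deck group is generated by \<open>t\<close>.
\<close>
lemma free_cyclic_quotient:
  assumes act: "free_cyclic_action k N t"
    and H: "Hausdorff_space (top_of_set N)" and conn: "connected N" and ne: "N \<noteq> {}"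
    and \<rho>: "continuous_on N \<rho>" "\<rho> ` N = M"
    and closed: "\<And>C. closedin (top_of_set N) C \<Longrightarrow> closedin (top_of_set M) (\<rho> ` C)"
    and orbits: "\<And>y z. y \<in> N \<Longrightarrow> z \<in> N \<Longrightarrow> \<rho> y = \<rho> z \<longleftrightarrow> (\<exists>i. z = (t ^^ i) y)"
  shows "regular_cyclic_covering k N \<rho> M"
proof -
  interpret free_cyclic_action k N t by fact
  have \<rho>t: "\<rho> ((t ^^ i) y) = \<rho> y" if "y \<in> N" for i y using orbits[OF that pow_maps[OF that]] by metis
  \<comment> \<open>The saturation of an open set is open, so a closed quotient map is also open.\<close>
  have openmap: "openin (top_of_set M) (\<rho> ` V)" if V: "openin (top_of_set N) V" for V
  proof -
    define S where "S = (\<Union>i. (t ^^ i) ` V)"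
    have VN: "V \<subseteq> N" using V openin_imp_subset by blast
    have "openin (top_of_set N) S" unfolding S_def by (intro openin_Union) (use pow_open_map V in auto)
    then have "closedin (top_of_set M) (\<rho> ` (N - S))" by (intro closed closedin_diff) auto
    moreover have "\<rho> ` (N - S) = M - \<rho> ` V"
    proof
      show "\<rho> ` (N - S) \<subseteq> M - \<rho> ` V"
      proof
        fix x assume "x \<in> \<rho> ` (N - S)"
        then obtain y where y: "y \<in> N" "y \<notin> S" "x = \<rho> y" by auto
        have "x \<noteq> \<rho> v" if "v \<in> V" for v
          using orbits[of v y] y that VN unfolding S_def by blast
        then show "x \<in> M - \<rho> ` V" using y \<rho>(2) by blast
      qed
      show "M - \<rho> ` V \<subseteq> \<rho> ` (N - S)"
      proof
        fix x assume x: "x \<in> M - \<rho> ` V"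
        then obtain y where y: "y \<in> N" "x = \<rho> y" using \<rho>(2) by auto
        have "y \<notin> S" unfolding S_def using x y VN \<rho>t by auto
        then show "x \<in> \<rho> ` (N - S)" using y by blast
      qed
    qed
    moreover have "\<rho> ` V \<subseteq> M" using VN \<rho>(2) by blast
    ultimately show ?thesis by (simp add: openin_closedin_eq)
  qed
  have cov: "covering_space N \<rho> M"
  proof (rule covering_spaceI[OF \<rho>])
    fix x assume "x \<in> M"
    then obtain y where y: "y \<in> N" "x = \<rho> y" using \<rho>(2) by auto
    obtain U where U: "openin (top_of_set N) U" "y \<in> U"
      "\<And>i j. i mod k \<noteq> j mod k \<Longrightarrow> (t ^^ i) ` U \<inter> (t ^^ j) ` U = {}"
      using disjoint_nbhd[OF H y(1)] by metis
    have UN: "U \<subseteq> N" using U(1) openin_imp_subset by blast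
    show "\<exists>T. x \<in> T \<and> openin (top_of_set M) T \<and> (\<exists>v. \<Union>v = N \<inter> \<rho> -` T \<and> (\<forall>u\<in>v. openin (top_of_set N) u) \<and>
        pairwise disjnt v \<and> (\<forall>u\<in>v. \<exists>q. homeomorphism u T \<rho> q))"
    proof (intro exI[of _ "\<rho> ` U"] exI[of _ "range (\<lambda>i. (t ^^ i) ` U)"] conjI)
      show "x \<in> \<rho> ` U" using y U by blast
      show "openin (top_of_set M) (\<rho> ` U)" by (rule openmap[OF U(1)])
      show "\<Union> (range (\<lambda>i. (t ^^ i) ` U)) = N \<inter> \<rho> -` \<rho> ` U"
      proof
        show "\<Union> (range (\<lambda>i. (t ^^ i) ` U)) \<subseteq> N \<inter> \<rho> -` \<rho> ` U" using UN pow_maps \<rho>t by auto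
        show "N \<inter> \<rho> -` \<rho> ` U \<subseteq> \<Union> (range (\<lambda>i. (t ^^ i) ` U))"
        proof
          fix z assume "z \<in> N \<inter> \<rho> -` \<rho> ` U"
          then obtain u where "z \<in> N" "u \<in> U" "\<rho> u = \<rho> z" by auto
          then show "z \<in> \<Union> (range (\<lambda>i. (t ^^ i) ` U))" using orbits[of u z] UN by blast
        qed
      qed
      show "\<forall>u\<in>range (\<lambda>i. (t ^^ i) ` U). openin (top_of_set N) u" using pow_open_map U by auto
      show "pairwise disjnt (range (\<lambda>i. (t ^^ i) ` U))"
      proof (rule pairwiseI)
        fix a b assume "a \<in> range (\<lambda>i. (t ^^ i) ` U)" "b \<in> range (\<lambda>i. (t ^^ i) ` U)" "a \<noteq> b"
        then obtain i j where ij: "a = (t ^^ i) ` U" "b = (t ^^ j) ` U" "a \<noteq> b" by blast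
        have "i mod k \<noteq> j mod k"
        proof
          assume "i mod k = j mod k"
          then have "(t ^^ i) ` U = (t ^^ j) ` U" using pow_eq_iff UN by (intro image_cong) auto
          then show False using ij by simp
        qed
        then show "disjnt a b" using U(3) ij by (simp add: disjnt_def)
      qed
      show "\<forall>u\<in>range (\<lambda>i. (t ^^ i) ` U). \<exists>q. homeomorphism u (\<rho> ` U) \<rho> q"
      proof
        fix u assume "u \<in> range (\<lambda>i. (t ^^ i) ` U)"
        then obtain i where u: "u = (t ^^ i) ` U" by auto
        have uN: "u \<subseteq> N" and uo: "openin (top_of_set N) u" using u UN pow_maps pow_open_map[OF U(1)] by auto
        have im: "\<rho> ` u = \<rho> ` U" unfolding u image_image using \<rho>t UN by (intro image_cong) auto
        have "\<exists>q. homeomorphism u (\<rho> ` U) \<rho> q"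
        proof (rule homeomorphism_injective_open_map[of u \<rho> "\<rho> ` U"])
          show "continuous_on u \<rho>" using \<rho>(1) uN continuous_on_subset by blast
          show "inj_on \<rho> u"
          proof (rule inj_onI)
            fix a b assume ab: "a \<in> u" "b \<in> u" "\<rho> a = \<rho> b"
            obtain p p' where p: "p \<in> U" "p' \<in> U" "a = (t ^^ i) p" "b = (t ^^ i) p'" using ab u by auto
            have "p \<in> N" "p' \<in> N" using p UN by auto
            then have "\<rho> p = \<rho> p'" using ab(3) p(3,4) \<rho>t[of p i] \<rho>t[of p' i] by simp
            then obtain j where j: "p' = (t ^^ j) p" using orbits[of p p'] p UN by auto
            then have "(t ^^ j) ` U \<inter> (t ^^ 0) ` U \<noteq> {}" using p by auto
            then have "j mod k = 0 mod k" using U(3) by blast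
            then have "p' = p" using pow_eq_iff[of p j 0] p UN j by auto
            then show "a = b" using p by simp
          qed
          show "openin (top_of_set (\<rho> ` U)) (\<rho> ` W)" if "openin (top_of_set u) W" for W
          proof -
            have "openin (top_of_set N) W" using that uo openin_trans by blast
            then have "openin (top_of_set M) (\<rho> ` W)" by (rule openmap)
            moreover have "\<rho> ` W \<subseteq> \<rho> ` U" using that im openin_imp_subset by blast
            moreover have "\<rho> ` U \<subseteq> M" using UN \<rho>(2) by blast
            ultimately show ?thesis by (meson openin_subset_trans)
          qed
        qed (use im in auto)
        then show "\<exists>q. homeomorphism u (\<rho> ` U) \<rho> q" .
      qed
    qed
  qed
  have card: "card {y \<in> N. \<rho> y = x} = k" if x: "x \<in> M" for x
  proof -
    obtain y where y: "y \<in> N" "x = \<rho> y" using x \<rho>(2) by auto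
    have "{z \<in> N. \<rho> z = x} = (\<lambda>i. (t ^^ i) y) ` {..<k}"
    proof
      show "{z \<in> N. \<rho> z = x} \<subseteq> (\<lambda>i. (t ^^ i) y) ` {..<k}"
      proof
        fix z assume z: "z \<in> {z \<in> N. \<rho> z = x}"
        then obtain i where "z = (t ^^ i) y" using orbits[of y z] y by auto
        then have "z = (t ^^ (i mod k)) y" using pow_mod y by simp
        then show "z \<in> (\<lambda>i. (t ^^ i) y) ` {..<k}" using k by auto
      qed
    qed (use y pow_maps \<rho>t in auto)
    moreover have "inj_on (\<lambda>i. (t ^^ i) y) {..<k}" using pow_eq_iff[OF y(1)] by (auto simp: inj_on_def)
    ultimately show ?thesis by (simp add: card_image)
  qed
  define r where "r i = restrict (t ^^ i) N" for i
  have r_deck: "r i \<in> deck_transformations N \<rho>" for i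
  proof -
    have "homeomorphism N N (r i) (t ^^ (k * i - i))"
      by (rule homeomorphism_cong[OF pow_homeomorphism[of i]]) (auto simp: r_def)
    then show ?thesis using \<rho>t by (auto simp: deck_transformations_def r_def)
  qed
  have deck_r: "\<exists>i<k. s = r i" if s: "s \<in> deck_transformations N \<rho>" for s
  proof -
    obtain s' where s': "homeomorphism N N s s'" and ext: "s \<in> extensional N" and \<rho>s: "\<And>y. y \<in> N \<Longrightarrow> \<rho> (s y) = \<rho> y"
      using s by (auto simp: deck_transformations_def)
    have sN: "s y \<in> N" if "y \<in> N" for y using s' that by (auto simp: homeomorphism_def)
    have "\<exists>i<k. s y = (t ^^ i) y" if y: "y \<in> N" for y
    proof -
      obtain i where "s y = (t ^^ i) y" using orbits[OF y sN[OF y]] \<rho>s[OF y] by auto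
      then have "s y = (t ^^ (i mod k)) y" using pow_mod y by simp
      then show ?thesis using k by (metis mod_less_divisor)
    qed
    then obtain \<iota> where \<iota>: "\<And>y. y \<in> N \<Longrightarrow> \<iota> y < k \<and> s y = (t ^^ \<iota> y) y" by metis
    \<comment> \<open>The power \<open>\<iota> y\<close> of \<open>t\<close> that \<open>s\<close> realises at \<open>y\<close> is locally constant.\<close>
    have const: "\<iota> y = \<iota> z" if "y \<in> N" "z \<in> N" for y z
    proof (rule connected_eventually_const[OF conn _ that])
      fix y assume y: "y \<in> N"
      obtain U where U: "openin (top_of_set N) U" "y \<in> U"
        "\<And>i j. i mod k \<noteq> j mod k \<Longrightarrow> (t ^^ i) ` U \<inter> (t ^^ j) ` U = {}"
        using disjoint_nbhd[OF H y] by metis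
      show "\<forall>\<^sub>F x in nbhds_in N y. \<iota> x = \<iota> y"
      proof (rule eventually_nbhds_in_openin)
        show "openin (top_of_set N) (U \<inter> (N \<inter> s -` ((t ^^ \<iota> y) ` U)))"
        proof (rule openin_Int[OF U(1)], rule continuous_openin_preimage)
          show "openin (top_of_set N) ((t ^^ \<iota> y) ` U)" by (rule pow_open_map[OF U(1)])
        qed (use homeomorphism_cont1[OF s'] sN in auto)
        show "y \<in> U \<inter> (N \<inter> s -` ((t ^^ \<iota> y) ` U))" using U(2) \<iota>[OF y] y by auto
        fix x assume "x \<in> U \<inter> (N \<inter> s -` ((t ^^ \<iota> y) ` U))"
        then have x: "x \<in> U" "x \<in> N" "s x \<in> (t ^^ \<iota> y) ` U" by auto
        then have "s x \<in> (t ^^ \<iota> x) ` U" using \<iota> by auto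
        then have "\<iota> x mod k = \<iota> y mod k" using U(3) x(3) by blast
        then show "\<iota> x = \<iota> y" using \<iota> y x by auto
      qed
    qed
    obtain y0 where y0: "y0 \<in> N" using ne by blast
    have "s = r (\<iota> y0)"
    proof (rule extensionalityI[OF ext])
      fix y assume "y \<in> N" then show "s y = r (\<iota> y0) y" using \<iota> const[of y y0] y0 by (simp add: r_def)
    qed (simp add: r_def)
    then show ?thesis using \<iota> y0 by blast
  qed
  have trans: "\<exists>s\<in>deck_transformations N \<rho>. s y = z" if "y \<in> N" "z \<in> N" "\<rho> y = \<rho> z" for y z
  proof -
    have "\<exists>i. z = (t ^^ i) y" using orbits[of y z] that by simp
    then obtain i where "z = (t ^^ i) y" by blast
    then have "r i y = z" using that by (simp add: r_def)
    then show ?thesis using r_deck by blast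
  qed
  have r_eq: "r i = r j \<longleftrightarrow> i mod k = j mod k" for i j
  proof
    assume "r i = r j"
    obtain y where y: "y \<in> N" using ne by blast
    have "r i y = r j y" using \<open>r i = r j\<close> by simp
    then show "i mod k = j mod k" using pow_eq_iff[OF y] y by (simp add: r_def)
  next
    assume "i mod k = j mod k"
    then show "r i = r j" using pow_eq_iff by (auto simp: r_def restrict_def)
  qed
  have "integer_mod_group k \<cong> deck_group N \<rho>"
  proof (rule is_isoI[of "\<lambda>a. r (nat a)"], rule isoI)
    have r_Bij: "r i \<in> Bij N" for i
    proof -
      have "bij_betw (t ^^ i) N N"
        by (rule bij_betw_byWitness[where f' = "t ^^ (k * i - i)"]) (auto simp: pow_inverse pow_maps)
      then have "bij_betw (r i) N N" unfolding r_def by (simp add: bij_betw_restrict_eq)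
      then show ?thesis by (simp add: Bij_def r_def)
    qed
    show "(\<lambda>a. r (nat a)) \<in> hom (integer_mod_group k) (deck_group N \<rho>)"
    proof (rule homI)
      fix x assume "x \<in> carrier (integer_mod_group k)"
      then show "r (nat x) \<in> carrier (deck_group N \<rho>)" using r_deck by (simp add: deck_group_def)
    next
      fix x y assume "x \<in> carrier (integer_mod_group k)" "y \<in> carrier (integer_mod_group k)"
      then have xy: "0 \<le> x" "x < int k" "0 \<le> y" "y < int k" using k by (auto simp: integer_mod_group_def)
      have "x \<otimes>\<^bsub>integer_mod_group k\<^esub> y = (x + y) mod int k" using k by (simp add: integer_mod_group_def)
      moreover have "nat ((x + y) mod int k) = (nat x + nat y) mod k"
        using xy by (simp add: nat_mod_distrib nat_add_distrib)
      moreover have "r ((nat x + nat y) mod k) = r (nat x + nat y)" by (simp add: r_eq)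
      moreover have "r (nat x + nat y) = compose N (r (nat x)) (r (nat y))"
        by (auto simp: r_def compose_def restrict_def funpow_add pow_maps)
      ultimately show "r (nat (x \<otimes>\<^bsub>integer_mod_group k\<^esub> y)) = r (nat x) \<otimes>\<^bsub>deck_group N \<rho>\<^esub> r (nat y)"
        using r_Bij by (simp add: deck_group_def BijGroup_def)
    qed
    show "bij_betw (\<lambda>a. r (nat a)) (carrier (integer_mod_group k)) (carrier (deck_group N \<rho>))"
      unfolding bij_betw_def
    proof
      have car: "carrier (integer_mod_group k) = {0..<int k}" using k by (auto simp: integer_mod_group_def)
      show "inj_on (\<lambda>a. r (nat a)) (carrier (integer_mod_group k))"
        unfolding car by (rule inj_onI) (auto simp: r_eq nat_less_iff)
      show "(\<lambda>a. r (nat a)) ` carrier (integer_mod_group k) = carrier (deck_group N \<rho>)"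
      proof
        show "carrier (deck_group N \<rho>) \<subseteq> (\<lambda>a. r (nat a)) ` carrier (integer_mod_group k)"
        proof
          fix s assume "s \<in> carrier (deck_group N \<rho>)"
          then obtain i where "i < k" "s = r i" using deck_r by (auto simp: deck_group_def)
          then show "s \<in> (\<lambda>a. r (nat a)) ` carrier (integer_mod_group k)"
            unfolding car by (intro image_eqI[of _ _ "int i"]) auto
        qed
      qed (use r_deck in \<open>auto simp: deck_group_def\<close>)
    qed
  qed
  then have "deck_group N \<rho> \<cong> integer_mod_group k" by (rule group.iso_sym[OF group_integer_mod_group])
  then show ?thesis unfolding regular_cyclic_covering_def using conn cov card trans by blast
qed

section \<open>Filling a space along tori\<close>

text \<open>
  \<open>Y\<close> is \<open>E\<close> with one solid torus for each \<open>j\<close>, attached along the parametrised torus \<open>A j\<close> in \<open>E\<close>.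
  In contrast to a Dehn surgery, the attaching map is given on the whole torus, and several steps of
  surgery can be described as one filling.
\<close>
definition filling ::
    "'a::topological_space set \<Rightarrow> 'j set \<Rightarrow> ('j \<Rightarrow> complex \<times> complex \<Rightarrow> 'a) \<Rightarrow>
     'b::topological_space set \<Rightarrow> ('a \<Rightarrow> 'b) \<Rightarrow> ('j \<Rightarrow> complex \<times> complex \<Rightarrow> 'b) \<Rightarrow> bool" where
  "filling E J A Y \<iota> g \<longleftrightarrow>
     finite J \<and> closed_embedding E Y \<iota> \<and>
     (\<forall>j\<in>J. closed_embedding solid_torus Y (g j) \<and> A j ` torus \<subseteq> E \<and>
        (\<forall>z\<in>torus. g j z = \<iota> (A j z)) \<and> \<iota> ` E \<inter> g j ` solid_torus = g j ` torus) \<and>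
     (\<forall>i\<in>J. \<forall>j\<in>J. i \<noteq> j \<longrightarrow> g i ` solid_torus \<inter> g j ` solid_torus = {}) \<and>
     Y = \<iota> ` E \<union> (\<Union>j\<in>J. g j ` solid_torus)"

lemma fillingD:
  assumes "filling E J A Y \<iota> g"
  shows "finite J" "closed_embedding E Y \<iota>" "\<And>j. j \<in> J \<Longrightarrow> closed_embedding solid_torus Y (g j)"
    "\<And>j z. j \<in> J \<Longrightarrow> z \<in> torus \<Longrightarrow> A j z \<in> E" "\<And>j z. j \<in> J \<Longrightarrow> z \<in> torus \<Longrightarrow> g j z = \<iota> (A j z)"
    "Y = \<iota> ` E \<union> (\<Union>j\<in>J. g j ` solid_torus)"
  using assms unfolding filling_def by blast+

lemma filling_exterior_eq:
  assumes F: "filling E J A Y \<iota> g" and "x \<in> E" "j \<in> J" "z \<in> solid_torus"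
  shows "\<iota> x = g j z \<longleftrightarrow> z \<in> torus \<and> x = A j z"
proof
  assume eq: "\<iota> x = g j z"
  then have "g j z \<in> g j ` torus" using assms unfolding filling_def by (metis IntI imageI)
  then have z: "z \<in> torus"
    using closed_embeddingD(2)[OF fillingD(3)[OF F assms(3)]] assms(4) torus_subset
    by (auto simp: inj_on_def)
  then have "\<iota> x = \<iota> (A j z)" using eq fillingD(5)[OF F assms(3)] by simp
  then have "x = A j z"
    using closed_embeddingD(2)[OF fillingD(2)[OF F]] fillingD(4)[OF F assms(3) z] assms(2) by (simp add: inj_on_eq_iff)
  then show "z \<in> torus \<and> x = A j z" using z by blast
next
  assume "z \<in> torus \<and> x = A j z"
  then show "\<iota> x = g j z" using fillingD(5)[OF F assms(3)] by simp
qed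

lemma filling_torus_eq:
  assumes F: "filling E J A Y \<iota> g" and "i \<in> J" "j \<in> J" "z \<in> solid_torus" "z' \<in> solid_torus"
  shows "g i z = g j z' \<longleftrightarrow> i = j \<and> z = z'"
proof
  assume eq: "g i z = g j z'"
  then have "g i ` solid_torus \<inter> g j ` solid_torus \<noteq> {}" using assms(4,5) by (metis IntI empty_iff imageI)
  then have "i = j" using F assms(2,3) unfolding filling_def by blast
  then show "i = j \<and> z = z'" using eq closed_embeddingD(2)[OF fillingD(3)[OF F assms(2)]] assms(4,5)
    by (simp add: inj_on_eq_iff)
qed auto

lemma filling_closedin:
  assumes F: "filling E J A Y \<iota> g" and "B \<subseteq> Y"
    and "closedin (top_of_set E) (E \<inter> \<iota> -` B)" "\<And>j. j \<in> J \<Longrightarrow> closedin (top_of_set solid_torus) (solid_torus \<inter> g j -` B)"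
  shows "closedin (top_of_set Y) B"
proof -
  have "closedin (top_of_set Y) (\<iota> ` (E \<inter> \<iota> -` B) \<union> (\<Union>j\<in>J. g j ` (solid_torus \<inter> g j -` B)))"
    using fillingD(1)[OF F] assms(3,4)
    by (intro closedin_Un closedin_Union)
      (auto intro: closed_embedding_closed_image[OF fillingD(2)[OF F]] closed_embedding_closed_image[OF fillingD(3)[OF F]])
  also have "\<iota> ` (E \<inter> \<iota> -` B) \<union> (\<Union>j\<in>J. g j ` (solid_torus \<inter> g j -` B)) = B"
    using fillingD(6)[OF F] assms(2) by blast
  finally show ?thesis .
qed

text \<open>
  The universal property of the glued space.
\<close>
lemma filling_map:
  assumes F: "filling E J A Y \<iota> g"
    and f: "continuous_on E f0" "\<And>j. j \<in> J \<Longrightarrow> continuous_on solid_torus (f j)"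
    and compat: "\<And>j z. j \<in> J \<Longrightarrow> z \<in> torus \<Longrightarrow> f j z = f0 (A j z)"
  obtains h where "continuous_on Y h" "\<And>x. x \<in> E \<Longrightarrow> h (\<iota> x) = f0 x"
    "\<And>j z. j \<in> J \<Longrightarrow> z \<in> solid_torus \<Longrightarrow> h (g j z) = f j z"
proof -
  define h where "h y = (if y \<in> \<iota> ` E then f0 (inv_into E \<iota> y)
      else case (SOME p. fst p \<in> J \<and> snd p \<in> solid_torus \<and> y = g (fst p) (snd p)) of (j, z) \<Rightarrow> f j z)" for y
  have h1: "h (\<iota> x) = f0 x" if "x \<in> E" for x
    using that closed_embeddingD(2)[OF fillingD(2)[OF F]] by (simp add: h_def)
  have h2: "h (g j z) = f j z" if j: "j \<in> J" and z: "z \<in> solid_torus" for j z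
  proof (cases "g j z \<in> \<iota> ` E")
    case True
    then obtain x where x: "x \<in> E" "\<iota> x = g j z" by (metis imageE)
    then have "z \<in> torus" "x = A j z" using filling_exterior_eq[OF F x(1) j z] by auto
    then show ?thesis using h1[OF x(1)] x(2) compat[OF j] by simp
  next
    case False
    define p where "p = (SOME p. fst p \<in> J \<and> snd p \<in> solid_torus \<and> g j z = g (fst p) (snd p))"
    have "fst p \<in> J \<and> snd p \<in> solid_torus \<and> g j z = g (fst p) (snd p)"
      unfolding p_def by (rule someI[of _ "(j, z)"]) (use j z in simp)
    then have "p = (j, z)" using filling_torus_eq[OF F j, of "fst p" z "snd p"] z by (simp add: prod_eq_iff)
    then show ?thesis using False unfolding h_def p_def[symmetric] by simp
  qed
  have "continuous_on Y h"
    unfolding continuous_closedin_preimage_eq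
  proof (intro allI impI)
    fix B :: "'d set" assume B: "closed B"
    have "E \<inter> \<iota> -` (Y \<inter> h -` B) = E \<inter> f0 -` B"
      using h1 closed_embeddingD(3)[OF fillingD(2)[OF F]] by auto
    moreover have "solid_torus \<inter> g j -` (Y \<inter> h -` B) = solid_torus \<inter> f j -` B" if "j \<in> J" for j
      using h2[OF that] closed_embeddingD(3)[OF fillingD(3)[OF F that]] by auto
    ultimately show "closedin (top_of_set Y) (Y \<inter> h -` B)"
      using f B by (intro filling_closedin[OF F]) (auto intro: continuous_closedin_preimage)
  qed
  then show ?thesis using that h1 h2 by blast
qed

lemma filling_Hausdorff:
  assumes F: "filling E J A Y \<iota> g" and H: "Hausdorff_space (top_of_set E)"
  shows "Hausdorff_space (top_of_set Y)"
proof (rule Hausdorff_closed_cover[of "insert (\<iota> ` E) ((\<lambda>j. g j ` solid_torus) ` J)"])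
  have st: "Hausdorff_space (top_of_set solid_torus)"
    by (rule Hausdorff_space_subtopology) (rule Hausdorff_space_euclidean)
  have *: "Hausdorff_space (top_of_set (f ` S))" if "closed_embedding S Y f" "Hausdorff_space (top_of_set S)"
    for S :: "'z::topological_space set" and f
    using that Hausdorff_homeomorphism unfolding closed_embedding_iff by metis
  show "Hausdorff_space (top_of_set A)" if "A \<in> insert (\<iota> ` E) ((\<lambda>j. g j ` solid_torus) ` J)" for A
  proof (cases "A = \<iota> ` E")
    case True
    obtain f' where "homeomorphism E (\<iota> ` E) \<iota> f'" using fillingD(2)[OF F] unfolding closed_embedding_iff by blast
    then show ?thesis using Hausdorff_homeomorphism H True by blast
  next
    case False
    then obtain j where j: "j \<in> J" "A = g j ` solid_torus" using \<open>A \<in> _\<close> by blast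
    obtain f' where "homeomorphism solid_torus A (g j) f'"
      using fillingD(3)[OF F j(1)] j(2) unfolding closed_embedding_iff by blast
    then show ?thesis using Hausdorff_homeomorphism st by blast
  qed
  show "closedin (top_of_set Y) A" if "A \<in> insert (\<iota> ` E) ((\<lambda>j. g j ` solid_torus) ` J)" for A
    using that closed_embeddingD(4)[OF fillingD(2)[OF F]] closed_embeddingD(4)[OF fillingD(3)[OF F]] by auto
  show "Y = \<Union> (insert (\<iota> ` E) ((\<lambda>j. g j ` solid_torus) ` J))" using fillingD(6)[OF F] by auto
qed (use fillingD(1)[OF F] in auto)

lemma connected_solid_torus: "connected solid_torus"
  unfolding solid_torus_def by (intro connected_Times connected_sphere convex_connected) auto

lemma filling_connected:
  assumes F: "filling E J A Y \<iota> g" and E: "connected E"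
  shows "connected Y"
proof (cases "J = {}")
  case True
  then have "Y = \<iota> ` E" using fillingD(6)[OF F] by simp
  then show ?thesis using connected_continuous_image[OF closed_embeddingD(1)[OF fillingD(2)[OF F]] E] by simp
next
  case False
  have "Y = (\<Union>j\<in>J. \<iota> ` E \<union> g j ` solid_torus)" using fillingD(6)[OF F] False by auto
  moreover have "connected (\<Union>j\<in>J. \<iota> ` E \<union> g j ` solid_torus)"
  proof (rule connected_Union)
    have "(1, 1) \<in> torus" by (simp add: torus_def)
    then have meet: "A j (1, 1) \<in> E" "g j (1, 1) = \<iota> (A j (1, 1))" "(1, 1) \<in> solid_torus" if "j \<in> J" for j
      using fillingD(4,5)[OF F that] torus_subset by auto
    fix S assume "S \<in> (\<lambda>j. \<iota> ` E \<union> g j ` solid_torus) ` J"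
    then obtain j where j: "j \<in> J" "S = \<iota> ` E \<union> g j ` solid_torus" by auto
    show "connected S" unfolding j(2)
    proof (rule connected_Un)
      show "connected (\<iota> ` E)" by (rule connected_continuous_image[OF closed_embeddingD(1)[OF fillingD(2)[OF F]] E])
      show "connected (g j ` solid_torus)"
        by (rule connected_continuous_image[OF closed_embeddingD(1)[OF fillingD(3)[OF F j(1)]] connected_solid_torus])
      show "\<iota> ` E \<inter> g j ` solid_torus \<noteq> {}" using meet[OF j(1)] by (metis IntI empty_iff imageI)
    qed
  next
    obtain j where "j \<in> J" using False by blast
    then have "A j (1, 1) \<in> E" using fillingD(4)[OF F] by (simp add: torus_def)
    then show "\<Inter> ((\<lambda>j. \<iota> ` E \<union> g j ` solid_torus) ` J) \<noteq> {}" by blast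
  qed
  ultimately show ?thesis by simp
qed

text \<open>
  A free action on \<open>E\<close> with quotient \<open>E'\<close> extends to the fillings \<open>N\<close> and \<open>M\<close> if it does so on
  the solid tori. Here \<open>b\<close> tells over which solid torus of \<open>M\<close> a solid torus of \<open>N\<close> lies, and \<open>R\<close> is
  the projection between them; \<open>\<sigma>\<close> is the permutation of the solid tori of \<open>N\<close> and \<open>S\<close> describes the
  generator on them. The pair is packed into the single map \<open>T\<close> in order to speak about its powers.
\<close>
lemma filling_covering:
  fixes T :: "'j \<times> complex \<times> complex \<Rightarrow> 'j \<times> complex \<times> complex"
  assumes N: "filling E J A N \<iota> g" and M: "filling E' J' A' M \<iota>' g'"
    and H: "Hausdorff_space (top_of_set E)" and E: "connected E" "E \<noteq> {}"
    and act: "free_cyclic_action k E \<tau>"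
    and \<pi>: "continuous_on E \<pi>" "\<pi> ` E = E'" "\<And>C. closedin (top_of_set E) C \<Longrightarrow> closedin (top_of_set E') (\<pi> ` C)"
    and orb: "\<And>x y. x \<in> E \<Longrightarrow> y \<in> E \<Longrightarrow> \<pi> x = \<pi> y \<longleftrightarrow> (\<exists>i. y = (\<tau> ^^ i) x)"
    and b: "b ` J = J'" and \<sigma>: "\<sigma> ` J \<subseteq> J"
    and R: "\<And>j. j \<in> J \<Longrightarrow> continuous_on solid_torus (R j)" "\<And>j. j \<in> J \<Longrightarrow> R j ` solid_torus = solid_torus"
      "\<And>j z. j \<in> J \<Longrightarrow> z \<in> solid_torus \<Longrightarrow> R j z \<in> torus \<longleftrightarrow> z \<in> torus"
    and S: "\<And>j. j \<in> J \<Longrightarrow> continuous_on solid_torus (S j)" "\<And>j z. j \<in> J \<Longrightarrow> z \<in> solid_torus \<Longrightarrow> S j z \<in> solid_torus"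
      "\<And>j z. j \<in> J \<Longrightarrow> z \<in> torus \<Longrightarrow> S j z \<in> torus"
    and T: "\<And>j z. T (j, z) = (\<sigma> j, S j z)"
    and attach: "\<And>j z. j \<in> J \<Longrightarrow> z \<in> torus \<Longrightarrow> \<pi> (A j z) = A' (b j) (R j z)"
      "\<And>j z. j \<in> J \<Longrightarrow> z \<in> torus \<Longrightarrow> \<tau> (A j z) = A (\<sigma> j) (S j z)"
    and inv: "\<And>j. j \<in> J \<Longrightarrow> b (\<sigma> j) = b j" "\<And>j z. j \<in> J \<Longrightarrow> z \<in> solid_torus \<Longrightarrow> R (\<sigma> j) (S j z) = R j z"
    and Tper: "\<And>j z. j \<in> J \<Longrightarrow> z \<in> solid_torus \<Longrightarrow> (T ^^ k) (j, z) = (j, z)"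
    and Tfree: "\<And>j z i. j \<in> J \<Longrightarrow> z \<in> solid_torus \<Longrightarrow> 0 < i \<Longrightarrow> i < k \<Longrightarrow> (T ^^ i) (j, z) \<noteq> (j, z)"
    and Torb: "\<And>j z j' z'. j \<in> J \<Longrightarrow> j' \<in> J \<Longrightarrow> z \<in> solid_torus \<Longrightarrow> z' \<in> solid_torus \<Longrightarrow> b j = b j' \<Longrightarrow>
        R j z = R j' z' \<Longrightarrow> \<exists>i. (j', z') = (T ^^ i) (j, z)"
  shows "\<exists>\<rho>. regular_cyclic_covering k N \<rho> M"
proof -
  interpret act: free_cyclic_action k E \<tau> by fact
  note N0 = fillingD[OF N] and M0 = fillingD[OF M]
  have \<sigma>J: "\<sigma> j \<in> J" if "j \<in> J" for j using \<sigma> that by blast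
  have bJ: "b j \<in> J'" if "j \<in> J" for j using b that by blast
  have Rs: "R j z \<in> solid_torus" if "j \<in> J" "z \<in> solid_torus" for j z using R(2)[OF that(1)] that(2) by blast
  have \<tau>E: "\<tau> x \<in> E" if "x \<in> E" for x using act.maps that by blast
  have \<pi>E: "\<pi> x \<in> E'" if "x \<in> E" for x using \<pi>(2) that by blast
  obtain \<rho> where \<rho>: "continuous_on N \<rho>" "\<And>x. x \<in> E \<Longrightarrow> \<rho> (\<iota> x) = \<iota>' (\<pi> x)"
    "\<And>j z. j \<in> J \<Longrightarrow> z \<in> solid_torus \<Longrightarrow> \<rho> (g j z) = g' (b j) (R j z)"
  proof (rule filling_map[OF N, of "\<lambda>x. \<iota>' (\<pi> x)" "\<lambda>j z. g' (b j) (R j z)"])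
    show "continuous_on E (\<lambda>x. \<iota>' (\<pi> x))"
      using \<pi> by (intro continuous_on_compose2[OF closed_embeddingD(1)[OF M0(2)]]) auto
    show "continuous_on solid_torus (\<lambda>z. g' (b j) (R j z))" if "j \<in> J" for j
      using Rs that by (intro continuous_on_compose2[OF closed_embeddingD(1)[OF M0(3)[OF bJ]] R(1)]) auto
    show "g' (b j) (R j z) = \<iota>' (\<pi> (A j z))" if "j \<in> J" "z \<in> torus" for j z
      using M0(5)[OF bJ[OF that(1)], of "R j z"] R(3)[OF that(1), of z] that attach(1) torus_subset by auto
  qed metis
  obtain t where t: "continuous_on N t" "\<And>x. x \<in> E \<Longrightarrow> t (\<iota> x) = \<iota> (\<tau> x)"
    "\<And>j z. j \<in> J \<Longrightarrow> z \<in> solid_torus \<Longrightarrow> t (g j z) = g (\<sigma> j) (S j z)"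
  proof (rule filling_map[OF N, of "\<lambda>x. \<iota> (\<tau> x)" "\<lambda>j z. g (\<sigma> j) (S j z)"])
    show "continuous_on E (\<lambda>x. \<iota> (\<tau> x))"
      using \<tau>E by (intro continuous_on_compose2[OF closed_embeddingD(1)[OF N0(2)] act.cont]) auto
    show "continuous_on solid_torus (\<lambda>z. g (\<sigma> j) (S j z))" if "j \<in> J" for j
      using S(2) that by (intro continuous_on_compose2[OF closed_embeddingD(1)[OF N0(3)[OF \<sigma>J]] S(1)]) auto
    show "g (\<sigma> j) (S j z) = \<iota> (\<tau> (A j z))" if "j \<in> J" "z \<in> torus" for j z
      using N0(5)[OF \<sigma>J[OF that(1)] S(3)[OF that]] attach(2)[OF that] by simp
  qed metis
  have Tst: "fst ((T ^^ i) (j, z)) \<in> J \<and> snd ((T ^^ i) (j, z)) \<in> solid_torus"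
    if "j \<in> J" "z \<in> solid_torus" for i j z
  proof (induction i)
    case (Suc i)
    then show ?case using T[of "fst ((T ^^ i) (j, z))" "snd ((T ^^ i) (j, z))"] \<sigma>J S(2) by simp
  qed (use that in simp)
  have t\<iota>: "(t ^^ i) (\<iota> x) = \<iota> ((\<tau> ^^ i) x)" if "x \<in> E" for i x
    using that by (induction i) (auto simp: t(2) act.pow_maps)
  have tg: "(t ^^ i) (g j z) = g (fst ((T ^^ i) (j, z))) (snd ((T ^^ i) (j, z)))"
    if jz: "j \<in> J" "z \<in> solid_torus" for i j z
  proof (induction i)
    case (Suc i)
    then show ?case using T[of "fst ((T ^^ i) (j, z))" "snd ((T ^^ i) (j, z))"] Tst[OF jz, of i] t(3) by simp
  qed simp
  have cases: "(\<exists>x\<in>E. y = \<iota> x) \<or> (\<exists>j\<in>J. \<exists>z\<in>solid_torus. y = g j z)" if "y \<in> N" for y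
    using N0(6) that by blast
  have \<iota>N: "\<iota> x \<in> N" if "x \<in> E" for x using N0(6) that by blast
  have gN: "g j z \<in> N" if "j \<in> J" "z \<in> solid_torus" for j z using N0(6) that by blast
  have \<iota>M: "\<iota>' x \<in> M" if "x \<in> E'" for x using M0(6) that by blast
  have gM: "g' j z \<in> M" if "j \<in> J'" "z \<in> solid_torus" for j z using M0(6) that by blast
  have \<iota>inj: "\<iota> x = \<iota> y \<longleftrightarrow> x = y" if "x \<in> E" "y \<in> E" for x y
    using closed_embeddingD(2)[OF N0(2)] that by (simp add: inj_on_eq_iff)
  have \<iota>inj': "\<iota>' x = \<iota>' y \<longleftrightarrow> x = y" if "x \<in> E'" "y \<in> E'" for x y
    using closed_embeddingD(2)[OF M0(2)] that by (simp add: inj_on_eq_iff)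
  have tact: "free_cyclic_action k N t"
  proof
    show "k > 0" by (rule act.k)
    show "continuous_on N t" by (rule t(1))
    show "t ` N \<subseteq> N"
    proof
      fix y assume "y \<in> t ` N"
      then obtain w where w: "w \<in> N" "y = t w" by auto
      from cases[OF w(1)] show "y \<in> N" using w(2)
        by (auto simp: t(2,3) intro!: \<iota>N \<tau>E gN \<sigma>J S(2))
    qed
    show "(t ^^ k) y = y" if "y \<in> N" for y
      using cases[OF that] by (auto simp: t\<iota> tg act.period Tper)
    show "(t ^^ i) y \<noteq> y" if "y \<in> N" "0 < i" "i < k" for y i
      using cases[OF that(1)]
    proof
      assume "\<exists>x\<in>E. y = \<iota> x"
      then obtain x where x: "x \<in> E" "y = \<iota> x" by blast
      then show ?thesis using act.free[OF x(1) that(2,3)] \<iota>inj act.pow_maps t\<iota> by simp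
    next
      assume "\<exists>j\<in>J. \<exists>z\<in>solid_torus. y = g j z"
      then obtain j z where jz: "j \<in> J" "z \<in> solid_torus" "y = g j z" by blast
      show ?thesis using Tfree[OF jz(1,2) that(2,3)] filling_torus_eq[OF N] Tst[OF jz(1,2), of i] jz tg[OF jz(1,2)]
        by (metis prod.collapse)
    qed
  qed
  interpret tact: free_cyclic_action k N t by fact
  have \<rho>t: "\<rho> (t y) = \<rho> y" if "y \<in> N" for y
    using cases[OF that]
  proof
    assume "\<exists>x\<in>E. y = \<iota> x"
    then obtain x where x: "x \<in> E" "y = \<iota> x" by blast
    have "\<pi> (\<tau> x) = \<pi> x" using orb[OF x(1) \<tau>E[OF x(1)]] by (metis funpow_0 funpow.simps(2) o_apply)
    then show ?thesis using x t(2) \<rho>(2) \<tau>E by simp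
  next
    assume "\<exists>j\<in>J. \<exists>z\<in>solid_torus. y = g j z"
    then show ?thesis by (auto simp: t(3) \<rho>(3) \<sigma>J S(2) inv)
  qed
  have \<rho>ti: "\<rho> ((t ^^ i) y) = \<rho> y" if "y \<in> N" for y i
    using that by (induction i) (auto simp: \<rho>t tact.pow_maps)
  have orbits: "\<exists>i. w = (t ^^ i) y" if y: "y \<in> N" and w: "w \<in> N" and eq: "\<rho> y = \<rho> w" for y w
  proof -
    have one: "\<exists>x\<in>E. y = \<iota> x" if "y \<in> N" "w \<in> \<iota> ` E" "\<rho> y = \<rho> w" for y w
    proof (rule ccontr)
      assume *: "\<not> ?thesis"
      then obtain j z where jz: "j \<in> J" "z \<in> solid_torus" "y = g j z" using cases[OF \<open>y \<in> N\<close>] by blast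
      obtain x where x: "x \<in> E" "w = \<iota> x" using \<open>w \<in> \<iota> ` E\<close> by blast
      have "\<iota>' (\<pi> x) = g' (b j) (R j z)" using that(3) jz x \<rho> by simp
      then have "R j z \<in> torus"
        using filling_exterior_eq[OF M \<pi>E[OF x(1)] bJ[OF jz(1)] Rs[OF jz(1,2)]] by blast
      then have "z \<in> torus" using R(3) jz by blast
      then show False using * N0(4,5)[OF jz(1)] jz(3) by blast
    qed
    show ?thesis
    proof (cases "y \<in> \<iota> ` E \<or> w \<in> \<iota> ` E")
      case True
      then obtain x x' where x: "x \<in> E" "y = \<iota> x" "x' \<in> E" "w = \<iota> x'"
        using one[of y w] one[of w y] y w eq by auto
      then have "\<pi> x = \<pi> x'" using eq \<rho>(2) \<iota>inj' \<pi>E by simp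
      then obtain i where "x' = (\<tau> ^^ i) x" using orb x by blast
      then show ?thesis using x t\<iota> by auto
    next
      case False
      then obtain j z j' z' where jz: "j \<in> J" "z \<in> solid_torus" "y = g j z" "j' \<in> J" "z' \<in> solid_torus" "w = g j' z'"
        using cases[OF y] cases[OF w] by blast
      then have "g' (b j) (R j z) = g' (b j') (R j' z')" using eq \<rho>(3) by simp
      then have "b j = b j' \<and> R j z = R j' z'"
        using filling_torus_eq[OF M bJ[OF jz(1)] bJ[OF jz(4)] Rs[OF jz(1,2)] Rs[OF jz(4,5)]] by blast
      then obtain i where "(j', z') = (T ^^ i) (j, z)" using Torb jz by blast
      then show ?thesis using tg[OF jz(1,2), of i] jz by (metis fst_conv snd_conv)
    qed
  qed
  have surj: "\<rho> ` N = M"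
  proof
    show "\<rho> ` N \<subseteq> M"
    proof
      fix y assume "y \<in> \<rho> ` N"
      then obtain w where w: "w \<in> N" "y = \<rho> w" by auto
      from cases[OF w(1)] show "y \<in> M" using w(2)
        by (auto simp: \<rho>(2,3) intro!: \<iota>M gM \<pi>E Rs bJ)
    qed
    show "M \<subseteq> \<rho> ` N"
    proof
      fix y assume "y \<in> M"
      then consider x where "x \<in> E'" "y = \<iota>' x" | j z where "j \<in> J'" "z \<in> solid_torus" "y = g' j z"
        using M0(6) by blast
      then show "y \<in> \<rho> ` N"
      proof cases
        case 1
        then obtain x' where "x' \<in> E" "x = \<pi> x'" using \<pi>(2) by blast
        then show ?thesis using 1 \<rho>(2) \<iota>N by (metis imageI)
      next
        case 2
        then obtain i where i: "i \<in> J" "j = b i" using b by blast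
        then obtain z' where "z' \<in> solid_torus" "z = R i z'" using R(2) 2(2) by blast
        then show ?thesis using 2 i \<rho>(3) gN by (metis imageI)
      qed
    qed
  qed
  have closed: "closedin (top_of_set M) (\<rho> ` C)" if C: "closedin (top_of_set N) C" for C
  proof -
    have CN: "C \<subseteq> N" using C closedin_imp_subset by blast
    have "\<rho> ` C = \<iota>' ` \<pi> ` (E \<inter> \<iota> -` C) \<union> (\<Union>j\<in>J. g' (b j) ` R j ` (solid_torus \<inter> g j -` C))" (is "_ = ?A \<union> ?B")
    proof
      show "\<rho> ` C \<subseteq> ?A \<union> ?B"
      proof
        fix y assume "y \<in> \<rho> ` C"
        then obtain w where w: "w \<in> C" "y = \<rho> w" by auto
        from cases[of w] CN w consider x where "x \<in> E" "w = \<iota> x" | j z where "j \<in> J" "z \<in> solid_torus" "w = g j z" by blast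
        then show "y \<in> ?A \<union> ?B"
        proof cases
          case 1
          then have "y = \<iota>' (\<pi> x)" "x \<in> E \<inter> \<iota> -` C" using w \<rho>(2) by auto
          then show ?thesis by blast
        next
          case 2
          then have "y = g' (b j) (R j z)" "z \<in> solid_torus \<inter> g j -` C"
            using w(2) \<rho>(3)[OF 2(1,2)] w(1) by simp_all
          then show ?thesis using 2(1) by blast
        qed
      qed
      show "?A \<union> ?B \<subseteq> \<rho> ` C"
      proof
        fix y assume "y \<in> ?A \<union> ?B"
        then consider x where "x \<in> E" "\<iota> x \<in> C" "y = \<iota>' (\<pi> x)"
          | j z where "j \<in> J" "z \<in> solid_torus" "g j z \<in> C" "y = g' (b j) (R j z)" by blast
        then show "y \<in> \<rho> ` C"
        proof cases
          case 1 then show ?thesis using \<rho>(2) by (metis imageI)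
        next
          case 2 then show ?thesis using \<rho>(3) by (metis imageI)
        qed
      qed
    qed
    moreover have "closedin (top_of_set M) ?A"
    proof (intro closed_embedding_closed_image[OF M0(2)] \<pi>(3))
      show "closedin (top_of_set E) (E \<inter> \<iota> -` C)"
        by (rule continuous_closedin_preimage_gen[OF closed_embeddingD(1)[OF N0(2)] _ C])
          (use closed_embeddingD(3)[OF N0(2)] in auto)
    qed
    moreover have "closedin (top_of_set M) ?B"
    proof (rule closedin_Union)
      fix D assume "D \<in> (\<lambda>j. g' (b j) ` R j ` (solid_torus \<inter> g j -` C)) ` J"
      then obtain j where j: "j \<in> J" "D = g' (b j) ` R j ` (solid_torus \<inter> g j -` C)" by auto
      have "closedin (top_of_set solid_torus) (solid_torus \<inter> g j -` C)"
        using continuous_closedin_preimage_gen[OF closed_embeddingD(1)[OF N0(3)[OF j(1)]] _ C] closed_embeddingD(3)[OF N0(3)[OF j(1)]] by auto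
      then have "compact (solid_torus \<inter> g j -` C)" using closedin_compact compact_solid_torus by blast
      then have "compact (R j ` (solid_torus \<inter> g j -` C))"
        by (rule compact_continuous_image[rotated]) (rule continuous_on_subset[OF R(1)[OF j(1)]], auto)
      then have "closedin (top_of_set solid_torus) (R j ` (solid_torus \<inter> g j -` C))"
        using Rs[OF j(1)] by (intro closed_subset compact_imp_closed) auto
      then show "closedin (top_of_set M) D"
        unfolding j(2) by (rule closed_embedding_closed_image[OF M0(3)[OF bJ[OF j(1)]]])
    qed (use N0(1) in auto)
    ultimately show ?thesis by (simp only: closedin_Un)
  qed
  have "regular_cyclic_covering k N \<rho> M"
  proof (rule free_cyclic_quotient[OF tact filling_Hausdorff[OF N H] filling_connected[OF N E(1)] _ \<rho>(1) surj closed])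
    show "N \<noteq> {}" using \<iota>N E(2) by blast
    show "\<rho> y = \<rho> w \<longleftrightarrow> (\<exists>i. w = (t ^^ i) y)" if "y \<in> N" "w \<in> N" for y w
      using orbits[OF that] \<rho>ti[OF that(1)] by auto
  qed auto
  then show ?thesis by blast
qed

lemma torus_disjoint_open: "torus \<inter> open_solid_torus = {}"
  by (auto simp: torus_def open_solid_torus_def)

lemma solid_torus_split: "solid_torus = torus \<union> open_solid_torus"
proof -
  have "cball (0::complex) 1 = sphere 0 1 \<union> ball 0 1" by auto
  then show ?thesis unfolding torus_def open_solid_torus_def solid_torus_def by blast
qed

text \<open>
  Two successive surgeries on disjoint solid tori amount to a single filling of the common exterior.
  By \<open>linear_gluing\<close> all attaching maps can be chosen linear; \<open>c\<close>, \<open>d\<close>, \<open>c'\<close>, \<open>d'\<close> are free up to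
  the determinant condition. The index \<open>None\<close> stands for the solid torus of the first surgery.
\<close>
lemma surgery_filling:
  fixes \<nu> :: "complex \<times> complex \<Rightarrow> 'a::topological_space" and \<theta> :: "'j \<Rightarrow> complex \<times> complex \<Rightarrow> 'a"
    and e1 :: "'a \<Rightarrow> 'b::topological_space" and e :: "'b \<Rightarrow> 'c::topological_space"
  assumes surg1: "dehn_surgery X {()} (\<lambda>_. \<nu>) (\<lambda>_. a) (\<lambda>_. b) Y1 e1"
    and surg2: "dehn_surgery Y1 J (\<lambda>j. e1 \<circ> \<theta> j) a' b' Y e"
    and fin: "finite J"
    and \<nu>: "continuous_on solid_torus \<nu>" "inj_on \<nu> solid_torus" "\<nu> ` solid_torus \<subseteq> X"
    and \<theta>: "\<And>j. j \<in> J \<Longrightarrow> continuous_on solid_torus (\<theta> j)" "\<And>j. j \<in> J \<Longrightarrow> inj_on (\<theta> j) solid_torus"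
      "\<And>j. j \<in> J \<Longrightarrow> \<theta> j ` solid_torus \<subseteq> X"
    and disj: "\<And>j. j \<in> J \<Longrightarrow> \<nu> ` solid_torus \<inter> \<theta> j ` solid_torus = {}"
      "\<And>i j. i \<in> J \<Longrightarrow> j \<in> J \<Longrightarrow> i \<noteq> j \<Longrightarrow> \<theta> i ` solid_torus \<inter> \<theta> j ` solid_torus = {}"
    and det: "c * a - d * b = 1" "\<And>j. j \<in> J \<Longrightarrow> c' j * a' j - d' j * b' j = 1"
  shows "\<exists>g. filling (X - \<nu> ` open_solid_torus - (\<Union>j\<in>J. \<theta> j ` open_solid_torus)) (insert None (Some ` J))
     (case_option (\<lambda>z. \<nu> (torus_linear c b d a z)) (\<lambda>j z. \<theta> j (torus_linear (c' j) (b' j) (d' j) (a' j) z)))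
     Y (e \<circ> e1) g"
proof -
  define E1 where "E1 = X - \<nu> ` open_solid_torus"
  define E where "E = X - \<nu> ` open_solid_torus - (\<Union>j\<in>J. \<theta> j ` open_solid_torus)"
  define X1 where "X1 = Y1 - (\<Union>j\<in>J. e1 ` \<theta> j ` open_solid_torus)"
  have ext: "exterior X {()} (\<lambda>_. \<nu>) = E1" "exterior Y1 J (\<lambda>j. e1 \<circ> \<theta> j) = X1"
    by (auto simp: exterior_def E1_def X1_def)
  obtain gK0 where e1: "closed_embedding E1 Y1 e1" and gK0: "closed_embedding solid_torus Y1 gK0"
     "gK0 ` torus = e1 ` \<nu> ` torus" "e1 ` E1 \<inter> gK0 ` solid_torus = gK0 ` torus"
     "\<forall>v\<in>sphere 0 1. gK0 (1, v) = e1 (\<nu> (v powi b, v powi a))" and Y1: "Y1 = e1 ` E1 \<union> gK0 ` solid_torus"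
    using surg1 unfolding dehn_surgery_def ext by auto
  from surg2[unfolded dehn_surgery_def ext] obtain g0 where e: "closed_embedding X1 Y e" and
     g0': "\<forall>j\<in>J. closed_embedding solid_torus Y (g0 j) \<and> g0 j ` torus = e ` (e1 \<circ> \<theta> j) ` torus \<and>
       e ` X1 \<inter> g0 j ` solid_torus = g0 j ` torus \<and> (\<forall>v\<in>sphere 0 1. g0 j (1, v) = e ((e1 \<circ> \<theta> j) (v powi b' j, v powi a' j)))"
     and g0d': "\<forall>i\<in>J. \<forall>j\<in>J. i \<noteq> j \<longrightarrow> g0 i ` solid_torus \<inter> g0 j ` solid_torus = {}"
     and Y: "Y = e ` X1 \<union> (\<Union>j\<in>J. g0 j ` solid_torus)"
    by (elim conjE exE) (rule that)
  note g0 = bspec[OF g0'] and g0d = g0d'[rule_format]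
  have st: "torus \<subseteq> solid_torus" "open_solid_torus \<subseteq> solid_torus" using solid_torus_split by auto
  have \<nu>E: "\<nu> ` torus \<subseteq> E"
  proof -
    have "\<nu> ` torus \<inter> \<nu> ` open_solid_torus = {}"
      using \<nu>(2) torus_disjoint_open st by (metis image_empty inj_on_image_Int)
    then show ?thesis using \<nu>(3) disj(1) st unfolding E_def by blast
  qed
  have \<theta>E1: "\<theta> j ` solid_torus \<subseteq> E1" if "j \<in> J" for j
    using \<theta>(3)[OF that] disj(1)[OF that] st unfolding E1_def by blast
  have \<theta>E: "\<theta> j ` torus \<subseteq> E" if j: "j \<in> J" for j
  proof -
    have "\<theta> j ` torus \<inter> \<theta> j ` open_solid_torus = {}"
      using \<theta>(2)[OF j] torus_disjoint_open st by (metis image_empty inj_on_image_Int)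
    moreover have "\<theta> j ` torus \<inter> \<theta> i ` open_solid_torus = {}" if "i \<in> J" "i \<noteq> j" for i
      using disj(2)[OF j that(1)] that(2) st by blast
    ultimately have "\<theta> j ` torus \<inter> (\<Union>i\<in>J. \<theta> i ` open_solid_torus) = {}" by blast
    then show ?thesis using \<theta>E1[OF j] st unfolding E_def E1_def by blast
  qed
  have EE1: "E \<subseteq> E1" by (auto simp: E_def E1_def)
  have e1inj: "inj_on e1 E1" by (rule closed_embeddingD(2)[OF e1])
  have einj: "inj_on e X1" by (rule closed_embeddingD(2)[OF e])
  have gKX1: "gK0 ` solid_torus \<subseteq> X1"
  proof -
    have "e1 ` \<theta> j ` open_solid_torus \<inter> gK0 ` solid_torus = {}" if j: "j \<in> J" for j
    proof -
      have "\<theta> j ` open_solid_torus \<subseteq> E1" using \<theta>E1[OF j] st by blast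
      then have "e1 ` \<theta> j ` open_solid_torus \<subseteq> e1 ` E1" by (rule image_mono)
      then have "e1 ` \<theta> j ` open_solid_torus \<inter> gK0 ` solid_torus \<subseteq> e1 ` \<theta> j ` open_solid_torus \<inter> gK0 ` torus"
        unfolding gK0(3)[symmetric] by blast
      then have "e1 ` \<theta> j ` open_solid_torus \<inter> gK0 ` solid_torus \<subseteq> e1 ` \<theta> j ` open_solid_torus \<inter> e1 ` \<nu> ` torus"
        unfolding gK0(2) .
      also have "e1 ` \<theta> j ` open_solid_torus \<inter> e1 ` \<nu> ` torus = e1 ` (\<theta> j ` open_solid_torus \<inter> \<nu> ` torus)"
        by (rule inj_on_image_Int[OF e1inj, symmetric]) (use \<theta>E1[OF j] st \<nu>E EE1 in blast)+
      also have "\<dots> = {}" using disj(1)[OF j] st by blast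
      finally show ?thesis by blast
    qed
    then show ?thesis unfolding X1_def Y1 by blast
  qed
  \<comment> \<open>The exterior of the second surgery consists of \<open>E\<close> and the first solid torus.\<close>
  have e1E: "e1 ` E = e1 ` E1 \<inter> X1"
  proof -
    have sub: "\<theta> j ` open_solid_torus \<subseteq> E1" if "j \<in> J" for j using \<theta>E1[OF that] st by blast
    have "E = E1 - (\<Union>j\<in>J. \<theta> j ` open_solid_torus)" by (auto simp: E_def E1_def)
    then have "e1 ` E = e1 ` (E1 - (\<Union>j\<in>J. \<theta> j ` open_solid_torus))" by (rule arg_cong)
    also have "\<dots> = e1 ` E1 - e1 ` (\<Union>j\<in>J. \<theta> j ` open_solid_torus)"
      by (rule inj_on_image_set_diff[OF e1inj]) (use sub in blast)+
    finally have "e1 ` E = e1 ` E1 - (\<Union>j\<in>J. e1 ` \<theta> j ` open_solid_torus)" by (simp only: image_UN)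
    then show ?thesis unfolding X1_def Y1 by blast
  qed
  have X1Y1: "X1 \<subseteq> Y1" unfolding X1_def by (rule Diff_subset)
  then have "X1 = X1 \<inter> (e1 ` E1 \<union> gK0 ` solid_torus)" unfolding Y1 by (simp only: Int_absorb2)
  also have "\<dots> = e1 ` E \<union> gK0 ` solid_torus"
    unfolding Int_Un_distrib e1E Int_commute[of X1] using gKX1 by (simp only: Int_absorb2)
  finally have X1: "X1 = e1 ` E \<union> gK0 ` solid_torus" .
  have "closed_embedding E X1 e1"
    unfolding closed_embedding_iff
  proof
    show "\<exists>g'. homeomorphism E (e1 ` E) e1 g'"
      using e1 homeomorphism_of_subsets[of E1 "e1 ` E1" e1 _ E "e1 ` E"] EE1 unfolding closed_embedding_iff by blast
    show "closedin (top_of_set X1) (e1 ` E)"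
    proof -
      obtain C where "closed C" "e1 ` E1 = Y1 \<inter> C" using closed_embeddingD(4)[OF e1] by (auto simp: closedin_closed)
      then have "e1 ` E = X1 \<inter> C" unfolding e1E using X1Y1 by blast
      then show ?thesis using \<open>closed C\<close> by (auto simp: closedin_closed)
    qed
  qed
  from closed_embedding_comp[OF this e] have \<iota>: "closed_embedding E Y (e \<circ> e1)" .
  have gK0X1: "closed_embedding solid_torus X1 gK0"
    using gK0(1) closedin_subset_trans[OF closed_embeddingD(4)[OF gK0(1)] gKX1 X1Y1]
    unfolding closed_embedding_iff by blast
  from closed_embedding_comp[OF this e] have egK: "closed_embedding solid_torus Y (e \<circ> gK0)" .
  have \<iota>inj: "inj_on (e \<circ> e1) E" by (rule closed_embeddingD(2)[OF \<iota>])
  have contf: "continuous_on torus (\<lambda>z. (e \<circ> e1) (f z))" "inj_on (\<lambda>z. (e \<circ> e1) (f z)) torus"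
    if f: "continuous_on solid_torus f" "inj_on f solid_torus" "f ` torus \<subseteq> E" for f :: "complex \<times> complex \<Rightarrow> 'a"
  proof -
    show "continuous_on torus (\<lambda>z. (e \<circ> e1) (f z))"
      by (rule continuous_on_compose2[OF closed_embeddingD(1)[OF \<iota>] continuous_on_subset[OF f(1) st(1)] f(3)])
    have "inj_on f torus" using f(2) st(1) inj_on_subset by blast
    from comp_inj_on[OF this inj_on_subset[OF \<iota>inj f(3)]]
    show "inj_on (\<lambda>z. (e \<circ> e1) (f z)) torus" by (simp add: o_def)
  qed
  obtain gK where gK: "closed_embedding solid_torus Y gK" "gK ` solid_torus = (e \<circ> gK0) ` solid_torus"
    "\<And>z. z \<in> torus \<Longrightarrow> gK z = (e \<circ> e1) (\<nu> (torus_linear c b d a z))"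
  proof (rule linear_gluing[OF egK contf[OF \<nu>(1,2) \<nu>E] _ _ det(1)])
    show "(\<lambda>z. (e \<circ> e1) (\<nu> z)) ` torus = (e \<circ> gK0) ` torus"
      by (simp only: image_comp[symmetric] gK0(2)) (simp add: image_image)
    show "(e \<circ> gK0) (1, v) = (e \<circ> e1) (\<nu> (v powi b, v powi a))" if "v \<in> sphere 0 1" for v
      using gK0(4) that by simp
  qed blast
  have "\<exists>g. closed_embedding solid_torus Y g \<and> g ` solid_torus = g0 j ` solid_torus \<and>
    (\<forall>z\<in>torus. g z = (e \<circ> e1) (\<theta> j (torus_linear (c' j) (b' j) (d' j) (a' j) z)))" if j: "j \<in> J" for j
  proof (rule linear_gluing[OF _ contf[OF \<theta>(1,2)[OF j] \<theta>E[OF j]] _ _ det(2)[OF j], where g = "g0 j" and Y = Y])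
    show "closed_embedding solid_torus Y (g0 j)" using g0[OF j] by blast
    show "(\<lambda>z. (e \<circ> e1) (\<theta> j z)) ` torus = g0 j ` torus"
      using g0[OF j] by (simp add: image_image)
    show "g0 j (1, v) = (e \<circ> e1) (\<theta> j (v powi b' j, v powi a' j))" if "v \<in> sphere 0 1" for v
      using g0[OF j] that by simp
  qed blast
  then obtain gL where gL: "\<And>j. j \<in> J \<Longrightarrow> closed_embedding solid_torus Y (gL j) \<and> gL j ` solid_torus = g0 j ` solid_torus \<and>
    (\<forall>z\<in>torus. gL j z = (e \<circ> e1) (\<theta> j (torus_linear (c' j) (b' j) (d' j) (a' j) z)))" by metis
  have gLt: "gL j ` torus = (e \<circ> e1) ` \<theta> j ` torus" if j: "j \<in> J" for j
  proof -
    have "gL j ` torus = (\<lambda>z. (e \<circ> e1) (\<theta> j z)) ` torus_linear (c' j) (b' j) (d' j) (a' j) ` torus"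
      unfolding image_image by (rule image_cong) (use gL[OF j] in auto)
    then show ?thesis unfolding torus_linear_bij(2)[OF det(2)[OF j]] by (simp add: image_image)
  qed
  have gKt: "gK ` torus = (e \<circ> e1) ` \<nu> ` torus"
  proof -
    have "gK ` torus = (\<lambda>z. (e \<circ> e1) (\<nu> z)) ` torus_linear c b d a ` torus"
      unfolding image_image by (rule image_cong) (use gK(3) in auto)
    then show ?thesis unfolding torus_linear_bij(2)[OF det(1)] by (simp add: image_image)
  qed
  have gK0t: "gK0 ` torus \<subseteq> e1 ` E" using gK0(2) \<nu>E by blast
  have int1: "(e \<circ> e1) ` E \<inter> gK ` solid_torus = gK ` torus"
  proof -
    have "(e \<circ> e1) ` E \<inter> gK ` solid_torus = e ` (e1 ` E) \<inter> e ` (gK0 ` solid_torus)" by (simp add: gK(2) image_comp)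
    also have "\<dots> = e ` (e1 ` E \<inter> gK0 ` solid_torus)"
      by (rule inj_on_image_Int[OF einj, symmetric]) (use X1 in blast)+
    also have "e1 ` E \<inter> gK0 ` solid_torus = gK0 ` torus" using gK0(3) gK0t EE1 st(1) by blast
    also have "e ` gK0 ` torus = gK ` torus" unfolding gKt gK0(2) by (simp add: image_comp)
    finally show ?thesis .
  qed
  have int2: "(e \<circ> e1) ` E \<inter> gL j ` solid_torus = gL j ` torus" if j: "j \<in> J" for j
  proof -
    have t: "gL j ` torus = g0 j ` torus" using gLt[OF j] g0[OF j] by (simp add: image_comp)
    have "(e \<circ> e1) ` E \<subseteq> e ` X1" unfolding X1 by auto
    then have "(e \<circ> e1) ` E \<inter> gL j ` solid_torus \<subseteq> e ` X1 \<inter> gL j ` solid_torus" by (rule Int_mono) simp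
    also have "\<dots> = gL j ` torus" using g0[OF j] gL[OF j] t by simp
    finally have "(e \<circ> e1) ` E \<inter> gL j ` solid_torus \<subseteq> gL j ` torus" .
    moreover have "gL j ` torus \<subseteq> (e \<circ> e1) ` E" using gLt[OF j] \<theta>E[OF j] by blast
    ultimately show ?thesis using st(1) by blast
  qed
  have int3: "gK ` solid_torus \<inter> gL j ` solid_torus = {}" if j: "j \<in> J" for j
  proof -
    have gKe: "gK ` solid_torus = e ` gK0 ` solid_torus" using gK(2) by (simp add: image_comp)
    then have "gK ` solid_torus \<subseteq> e ` X1" using image_mono[OF gKX1] by simp
    then have "gK ` solid_torus \<inter> gL j ` solid_torus \<subseteq> gK ` solid_torus \<inter> (e ` X1 \<inter> gL j ` solid_torus)" by blast
    also have "\<dots> = e ` gK0 ` solid_torus \<inter> e ` e1 ` \<theta> j ` torus"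
      using g0[OF j] gL[OF j] gKe by (simp add: image_comp)
    finally have "gK ` solid_torus \<inter> gL j ` solid_torus \<subseteq> e ` gK0 ` solid_torus \<inter> e ` e1 ` \<theta> j ` torus" .
    also have "\<dots> = e ` (gK0 ` solid_torus \<inter> e1 ` \<theta> j ` torus)"
      by (rule inj_on_image_Int[OF einj, symmetric]) (use X1 \<theta>E[OF j] in blast)+
    also have "gK0 ` solid_torus \<inter> e1 ` \<theta> j ` torus \<subseteq> e1 ` \<nu> ` torus \<inter> e1 ` \<theta> j ` torus"
      using gK0(2,3) \<theta>E1[OF j] st(1) by blast
    also have "e1 ` \<nu> ` torus \<inter> e1 ` \<theta> j ` torus = e1 ` (\<nu> ` torus \<inter> \<theta> j ` torus)"
      by (rule inj_on_image_Int[OF e1inj, symmetric]) (use \<nu>E \<theta>E[OF j] EE1 in blast)+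
    also have "\<nu> ` torus \<inter> \<theta> j ` torus = {}" using disj(1)[OF j] st(1) by blast
    finally show ?thesis by (simp add: image_mono)
  qed
  define g where "g = case_option gK gL"
  have "filling E (insert None (Some ` J))
     (case_option (\<lambda>z. \<nu> (torus_linear c b d a z)) (\<lambda>j z. \<theta> j (torus_linear (c' j) (b' j) (d' j) (a' j) z)))
     Y (e \<circ> e1) g"
    unfolding filling_def
  proof (intro conjI)
    show "finite (insert None (Some ` J))" using fin by simp
    show "closed_embedding E Y (e \<circ> e1)" by (rule \<iota>)
    show "\<forall>j\<in>insert None (Some ` J). closed_embedding solid_torus Y (g j) \<and>
        (case j of None \<Rightarrow> \<lambda>z. \<nu> (torus_linear c b d a z)
          | Some j \<Rightarrow> \<lambda>z. \<theta> j (torus_linear (c' j) (b' j) (d' j) (a' j) z)) ` torus \<subseteq> E \<and>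
        (\<forall>z\<in>torus. g j z = (e \<circ> e1) ((case j of None \<Rightarrow> \<lambda>z. \<nu> (torus_linear c b d a z)
          | Some j \<Rightarrow> \<lambda>z. \<theta> j (torus_linear (c' j) (b' j) (d' j) (a' j) z)) z)) \<and>
        (e \<circ> e1) ` E \<inter> g j ` solid_torus = g j ` torus"
    proof (intro ballI)
      fix j assume "j \<in> insert None (Some ` J)"
      then consider "j = None" | i where "j = Some i" "i \<in> J" by auto
      then show "closed_embedding solid_torus Y (g j) \<and>
        (case j of None \<Rightarrow> \<lambda>z. \<nu> (torus_linear c b d a z)
          | Some j \<Rightarrow> \<lambda>z. \<theta> j (torus_linear (c' j) (b' j) (d' j) (a' j) z)) ` torus \<subseteq> E \<and>
        (\<forall>z\<in>torus. g j z = (e \<circ> e1) ((case j of None \<Rightarrow> \<lambda>z. \<nu> (torus_linear c b d a z)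
          | Some j \<Rightarrow> \<lambda>z. \<theta> j (torus_linear (c' j) (b' j) (d' j) (a' j) z)) z)) \<and>
        (e \<circ> e1) ` E \<inter> g j ` solid_torus = g j ` torus"
      proof cases
        case 1
        then show ?thesis using gK(1,3) int1 \<nu>E by (auto simp: g_def intro!: subsetD[OF \<nu>E] imageI torus_linear_torus)
      next
        case 2
        then show ?thesis using gL[OF 2(2)] int2[OF 2(2)] \<theta>E[OF 2(2)]
          by (auto simp: g_def intro!: subsetD[OF \<theta>E[OF 2(2)]] imageI torus_linear_torus)
      qed
    qed
    show "\<forall>i\<in>insert None (Some ` J). \<forall>j\<in>insert None (Some ` J). i \<noteq> j \<longrightarrow> g i ` solid_torus \<inter> g j ` solid_torus = {}"
    proof (intro ballI impI)
      fix i j assume ij: "i \<in> insert None (Some ` J)" "j \<in> insert None (Some ` J)" "i \<noteq> j"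
      have gg: "gL l ` solid_torus \<inter> gL m ` solid_torus = {}" if "l \<in> J" "m \<in> J" "l \<noteq> m" for l m
        using g0d[OF that] gL[OF that(1)] gL[OF that(2)] by simp
      show "g i ` solid_torus \<inter> g j ` solid_torus = {}"
      proof (cases "i = None \<or> j = None")
        case True
        then obtain l where l: "l \<in> J" "i = None \<and> j = Some l \<or> i = Some l \<and> j = None" using ij by auto
        have "gL l ` solid_torus \<inter> gK ` solid_torus = {}" using int3[OF l(1)] by (simp only: Int_commute)
        then show ?thesis using l(2) int3[OF l(1)] by (elim disjE) (simp_all add: g_def)
      next
        case False
        then obtain l m where "i = Some l" "j = Some m" "l \<in> J" "m \<in> J" using ij by auto
        then show ?thesis using gg[of l m] ij(3) by (simp add: g_def)
      qed
    qed
    show "Y = (e \<circ> e1) ` E \<union> (\<Union>j\<in>insert None (Some ` J). g j ` solid_torus)"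
    proof -
      have "e ` X1 = (e \<circ> e1) ` E \<union> gK ` solid_torus" unfolding X1 gK(2) by (simp add: image_Un image_comp)
      moreover have "(\<Union>j\<in>J. g0 j ` solid_torus) = (\<Union>j\<in>J. gL j ` solid_torus)" using gL by simp
      ultimately show ?thesis unfolding Y by (simp add: g_def Un_assoc)
    qed
  qed
  then show ?thesis unfolding E_def by blast
qed

section \<open>Seifert surfaces in the 3-sphere\<close>

lemma stereographic:
  assumes "w \<in> S3"
  obtains s s' where "homeomorphism (S3 - {w}) (UNIV :: (real ^ 3) set) s s'"
proof -
  have "(S3 - {w}) homeomorphic (UNIV :: (real ^ 3) set)"
    by (rule homeomorphic_punctured_sphere_affine) (use assms in auto)
  then show ?thesis using that by (auto simp: homeomorphic_def)
qed

lemma two_points_S3: "\<exists>w\<in>S3. w \<noteq> y"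
proof -
  obtain b :: "real ^ 4" where "b \<in> Basis" using nonempty_Basis by blast
  then have b: "b \<in> S3" "- b \<in> S3" "b \<bullet> b = 1" by (auto simp: inner_same_Basis)
  have "b \<noteq> - b"
  proof
    assume "b = - b"
    then have "b \<bullet> b = (- b) \<bullet> b" by (rule arg_cong)
    then show False using b(3) by simp
  qed
  then show ?thesis using b by metis
qed

lemma invariance_of_domain_S3:
  fixes f :: "'a::euclidean_space \<Rightarrow> real ^ 4"
  assumes dim: "DIM('a) = 3" and U: "open U" and f: "continuous_on U f" "inj_on f U" "f ` U \<subseteq> S3"
  shows "openin (top_of_set S3) (f ` U)"
proof (subst openin_subopen, intro ballI)
  fix y assume y: "y \<in> f ` U"
  obtain w where w: "w \<in> S3" "w \<noteq> y" using two_points_S3 by blast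
  obtain s s' where s: "homeomorphism (S3 - {w}) (UNIV :: (real ^ 3) set) s s'" using stereographic[OF w(1)] .
  have opw: "openin (top_of_set S3) (S3 - {w})" by (rule openin_diff) (use w in auto)
  define U' where "U' = U \<inter> f -` (- {w})"
  have "openin (top_of_set U) U'" unfolding U'_def by (rule continuous_openin_preimage_gen[OF f(1)]) auto
  then have U': "open U'" using U openin_open_eq by blast
  have sub: "U' \<subseteq> U" "f ` U' \<subseteq> S3 - {w}" using f(3) by (auto simp: U'_def)
  have "open ((s \<circ> f) ` U')"
  proof (rule invariance_of_domain_gen[OF U'])
    show "continuous_on U' (s \<circ> f)"
      by (rule continuous_on_compose[OF continuous_on_subset[OF f(1) sub(1)] continuous_on_subset[OF homeomorphism_cont1[OF s] sub(2)]])
    have "inj_on s (S3 - {w})" using s unfolding homeomorphism_def by (intro inj_on_inverseI[of _ s']) blast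
    then show "inj_on (s \<circ> f) U'"
      using f(2) sub by (intro comp_inj_on) (auto intro: inj_on_subset)
  qed (use dim in simp)
  then have "openin (top_of_set UNIV) ((s \<circ> f) ` U')" by simp
  from homeomorphism_imp_open_map[OF homeomorphism_symD[OF s] this]
  have "openin (top_of_set (S3 - {w})) (s' ` (s \<circ> f) ` U')" .
  moreover have "s' ` (s \<circ> f) ` U' = f ` U'"
  proof -
    have "s' (s z) = z" if "z \<in> S3 - {w}" for z using s that by (simp add: homeomorphism_def)
    then have "s' (s (f x)) = f x" if "x \<in> U'" for x using sub(2) that by blast
    then have "(\<lambda>x. s' (s (f x))) ` U' = f ` U'" by (intro image_cong) auto
    then show ?thesis by (simp add: image_image)
  qed
  ultimately have "openin (top_of_set S3) (f ` U')" using openin_trans[OF _ opw] by simp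
  moreover have "y \<in> f ` U'" using y w by (auto simp: U'_def)
  ultimately show "\<exists>T. openin (top_of_set S3) T \<and> y \<in> T \<and> T \<subseteq> f ` U" using sub(1) by blast
qed

lemma connected_S3_delete:
  assumes S: "openin (top_of_set S3) S" "connected S" and w2: "w2 \<in> S3" "w2 \<notin> S"
  shows "connected (S - {w})"
proof -
  obtain s s' where s: "homeomorphism (S3 - {w2}) (UNIV :: (real ^ 3) set) s s'" using stereographic[OF w2(1)] .
  have SS: "S \<subseteq> S3 - {w2}" using S(1) w2 openin_imp_subset by blast
  have "openin (top_of_set (S3 - {w2})) S"
    using S(1) SS by (meson Diff_subset openin_subset_trans)
  from homeomorphism_imp_open_map[OF s this] have "open (s ` S)" by simp
  moreover have "connected (s ` S)"
    by (rule connected_continuous_image[OF continuous_on_subset[OF homeomorphism_cont1[OF s] SS] S(2)])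
  ultimately have c: "connected (s ` S - {s w})" by (rule connected_open_delete) simp
  show ?thesis
  proof (cases "w \<in> S")
    case True
    have inv: "s' (s z) = z" if "z \<in> S3 - {w2}" for z using s that by (simp add: homeomorphism_def)
    have "s' ` (s ` S - {s w}) = S - {w}"
    proof
      show "s' ` (s ` S - {s w}) \<subseteq> S - {w}"
      proof
        fix y assume "y \<in> s' ` (s ` S - {s w})"
        then obtain z where z: "z \<in> S" "y = s' (s z)" "s z \<noteq> s w" by blast
        then have "y = z" using inv SS by blast
        then show "y \<in> S - {w}" using z by blast
      qed
      show "S - {w} \<subseteq> s' ` (s ` S - {s w})"
      proof
        fix z assume z: "z \<in> S - {w}"
        have "z \<in> S3 - {w2}" "w \<in> S3 - {w2}" using z SS True by blast+
        then have "s' (s z) = z" "s' (s w) = w" using inv by blast+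
        then have "s z \<noteq> s w" using z by auto
        then have "s z \<in> s ` S - {s w}" using z by auto
        moreover have "z = s' (s z)" using \<open>s' (s z) = z\<close> by simp
        ultimately show "z \<in> s' ` (s ` S - {s w})" by (rule rev_image_eqI)
      qed
    qed
    then show ?thesis
      using connected_continuous_image[OF continuous_on_subset[OF homeomorphism_cont2[OF s]] c] by simp
  qed (use S(2) in simp)
qed

text \<open>
  The chart is restricted to the trace of a closed disc on the half plane, so that its domain is compact;
  the last clause supplies small open neighbourhoods in \<open>F\<close>.
\<close>
lemma surface_chart:
  assumes F: "surface_with_boundary F B" and x: "x \<in> F"
  obtains h h' r where "r > 0" "homeomorphism (h' ` {z. dist (h x) z \<le> r \<and> Im z \<ge> 0}) {z. dist (h x) z \<le> r \<and> Im z \<ge> 0} h h'"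
    "h' (h x) = x" "Im (h x) \<ge> 0" "h' ` {z. dist (h x) z \<le> r \<and> Im z \<ge> 0} \<subseteq> F"
    "\<forall>z. dist (h x) z \<le> r \<longrightarrow> Im z \<ge> 0 \<longrightarrow> (h' z \<in> B \<longleftrightarrow> Im z = 0)"
    "\<forall>W. open W \<longrightarrow> W \<subseteq> ball (h x) r \<longrightarrow> openin (top_of_set F) (h' ` (W \<inter> {z. Im z \<ge> 0}))"
proof -
  obtain U V h h' where U: "x \<in> U" "openin (top_of_set F) U" and V: "openin (top_of_set {z::complex. 0 \<le> Im z}) V"
    and h: "homeomorphism U V h h'" and UB: "U \<inter> B = {y \<in> U. Im (h y) = 0}"
    using F x unfolding surface_with_boundary_def by meson
  obtain V' where V': "open V'" "V = {z. 0 \<le> Im z} \<inter> V'" using V by (auto simp: openin_open)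
  have hx: "h x \<in> V" "h' (h x) = x" using h U by (auto simp: homeomorphism_def)
  obtain r where r: "r > 0" "cball (h x) r \<subseteq> V'" using V' hx open_contains_cball by blast
  let ?H = "{z. dist (h x) z \<le> r \<and> Im z \<ge> 0}"
  have HV: "?H \<subseteq> V" using r V' by auto
  have VU: "h' z \<in> U" "h (h' z) = z" if "z \<in> V" for z using h that by (auto simp: homeomorphism_def)
  have UF: "U \<subseteq> F" using U openin_imp_subset by blast
  show ?thesis
  proof (rule that[OF r(1)])
    show "homeomorphism (h' ` ?H) ?H h h'"
    proof (rule homeomorphism_of_subsets[OF h])
      show "h ` h' ` ?H = ?H" unfolding image_image using VU(2) HV by (force simp: subset_iff)
    qed (use VU HV in auto)
    show "Im (h x) \<ge> 0" using hx V' by auto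
    show "h' ` ?H \<subseteq> F" using VU HV UF by blast
    have "h' z \<in> B \<longleftrightarrow> Im z = 0" if "dist (h x) z \<le> r" "Im z \<ge> 0" for z
    proof -
      have "z \<in> V" using that HV by blast
      then have "h' z \<in> U" "h (h' z) = z" by (rule VU)+
      moreover have "h' z \<in> U \<inter> B \<longleftrightarrow> h' z \<in> {y \<in> U. Im (h y) = 0}" by (simp only: UB)
      ultimately show ?thesis by simp
    qed
    then show "\<forall>z. dist (h x) z \<le> r \<longrightarrow> Im z \<ge> 0 \<longrightarrow> (h' z \<in> B \<longleftrightarrow> Im z = 0)" by blast
    have "openin (top_of_set F) (h' ` (W \<inter> {z. Im z \<ge> 0}))" if W: "open W" "W \<subseteq> ball (h x) r" for W
    proof -
      have "W \<inter> {z. Im z \<ge> 0} = V \<inter> W" using W HV V' by (auto simp: subset_iff less_imp_le)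
      then have "openin (top_of_set V) (W \<inter> {z. Im z \<ge> 0})" using W(1) by (auto simp: openin_open)
      then have "openin (top_of_set U) (h' ` (W \<inter> {z. Im z \<ge> 0}))"
        by (rule homeomorphism_imp_open_map[OF homeomorphism_symD[OF h]])
      then show ?thesis using U(2) openin_trans by blast
    qed
    then show "\<forall>W. open W \<longrightarrow> W \<subseteq> ball (h x) r \<longrightarrow> openin (top_of_set F) (h' ` (W \<inter> {z. Im z \<ge> 0}))" by blast
  qed (use hx in auto)
qed

lemma half_ball_convex: "convex {z. dist a z < r \<and> Im z > 0}" "convex {z. dist a z < r \<and> Im z \<ge> 0}"
proof -
  have "{z. dist a z < r \<and> Im z > 0} = ball a r \<inter> {z. Im z > 0}" "{z. dist a z < r \<and> Im z \<ge> 0} = ball a r \<inter> {z. Im z \<ge> 0}"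
    by auto
  then show "convex {z. dist a z < r \<and> Im z > 0}" "convex {z. dist a z < r \<and> Im z \<ge> 0}"
    by (auto intro!: convex_Int convex_halfspace_Im_gt convex_halfspace_Im_ge)
qed

lemma half_ball_nonempty:
  assumes "r > 0" "Im a \<ge> 0" shows "{z. dist a z < r \<and> Im z > 0} \<noteq> {}"
proof -
  have "a + \<i> * of_real (r / 2) \<in> {z. dist a z < r \<and> Im z > 0}"
    using assms by (auto simp: dist_norm norm_mult)
  then show ?thesis by blast
qed

text \<open>
  Every point has arbitrarily small neighbourhoods \<open>W\<close> for which \<open>W - B\<close> corresponds to a nonempty
  convex set in a chart, even if the point is on the boundary. So a separation of \<open>F - B\<close> would
  extend to one of \<open>F\<close>.
\<close>
lemma surface_interior_connected:
  assumes F: "surface_with_boundary F B" "connected F"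
  shows "connected (F - B)"
proof -
  have nbhd: "\<exists>W. openin (top_of_set F) W \<and> x \<in> W \<and> W \<subseteq> Q \<and> connected (W - B) \<and> W - B \<noteq> {}"
    if x: "x \<in> F" and Q: "openin (top_of_set F) Q" "x \<in> Q" for x Q
  proof -
    obtain h h' r where c0: "r > 0" "homeomorphism (h' ` {z. dist (h x) z \<le> r \<and> Im z \<ge> 0}) {z. dist (h x) z \<le> r \<and> Im z \<ge> 0} h h'"
      "h' (h x) = x" "Im (h x) \<ge> 0" "h' ` {z. dist (h x) z \<le> r \<and> Im z \<ge> 0} \<subseteq> F"
      "\<forall>z. dist (h x) z \<le> r \<longrightarrow> Im z \<ge> 0 \<longrightarrow> (h' z \<in> B \<longleftrightarrow> Im z = 0)"
      "\<forall>W. open W \<longrightarrow> W \<subseteq> ball (h x) r \<longrightarrow> openin (top_of_set F) (h' ` (W \<inter> {z. Im z \<ge> 0}))"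
      by (rule surface_chart[OF F(1) x]) (rule that)
    note c = c0(1-5) c0(6)[rule_format] c0(7)[rule_format]
    let ?H = "{z. dist (h x) z \<le> r \<and> Im z \<ge> 0}"
    have conth': "continuous_on ?H h'" by (rule homeomorphism_cont2[OF c(2)])
    have "openin (top_of_set ?H) (?H \<inter> h' -` Q)"
      by (rule continuous_openin_preimage[OF conth' _ Q(1)]) (use c(5) in auto)
    then obtain G where G: "open G" "?H \<inter> h' -` Q = ?H \<inter> G" by (auto simp: openin_open)
    have "h x \<in> ?H \<inter> h' -` Q" using c(1,3,4) Q(2) by simp
    then have "h x \<in> G" using G(2) by blast
    then obtain e where e: "e > 0" "ball (h x) e \<subseteq> G" using G(1) open_contains_ball by blast
    define d where "d = min e r"
    have d: "d > 0" "d \<le> r" "ball (h x) d \<subseteq> G" using e c(1) by (auto simp: d_def)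
    let ?W = "h' ` (ball (h x) d \<inter> {z. Im z \<ge> 0})"
    have sub: "ball (h x) d \<inter> {z. Im z \<ge> 0} \<subseteq> ?H \<inter> G" using d by auto
    have WB: "?W - B = h' ` {z. dist (h x) z < d \<and> Im z > 0}"
      using c(6) d by (fastforce simp: less_le)
    have "connected (h' ` {z. dist (h x) z < d \<and> Im z > 0})"
      by (rule connected_continuous_image[OF continuous_on_subset[OF conth'] convex_connected[OF half_ball_convex(1)]])
        (use d in auto)
    moreover have "h' ` {z. dist (h x) z < d \<and> Im z > 0} \<noteq> {}" using half_ball_nonempty[OF d(1) c(4)] by blast
    moreover have "?W \<subseteq> Q" using sub G(2) by blast
    moreover have "x \<in> ?W" using c(3,4) d(1) by (intro image_eqI[of _ _ "h x"]) auto
    moreover have "openin (top_of_set F) ?W" by (rule c(7)) (use d in auto)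
    ultimately show ?thesis using WB by metis
  qed
  show ?thesis
    unfolding connected_openin
  proof (rule ccontr, simp only: not_not, elim exE conjE)
    fix A1 A2 assume A: "openin (top_of_set (F - B)) A1" "openin (top_of_set (F - B)) A2" "F - B \<subseteq> A1 \<union> A2"
      "A1 \<inter> A2 = {}" "A1 \<noteq> {}" "A2 \<noteq> {}"
    define E where "E A = \<Union>{W. openin (top_of_set F) W \<and> W - B \<subseteq> A}" for A
    have op: "openin (top_of_set F) (E A)" for A unfolding E_def by (rule openin_Union) auto
    have cov: "F \<subseteq> E A1 \<union> E A2"
    proof
      fix x assume x: "x \<in> F"
      obtain W where W: "openin (top_of_set F) W" "x \<in> W" "connected (W - B)" using nbhd[OF x openin_subtopology_self x] by auto
      have WF: "W - B \<subseteq> F - B" using W(1) openin_imp_subset by blast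
      have "W - B \<subseteq> A1 \<or> W - B \<subseteq> A2"
      proof -
        have "openin (top_of_set (W - B)) ((W - B) \<inter> A1)" "openin (top_of_set (W - B)) ((W - B) \<inter> A2)"
          using A(1,2) WF by (auto simp: openin_open)
        moreover have "W - B \<subseteq> (W - B) \<inter> A1 \<union> (W - B) \<inter> A2" using A(3) WF by blast
        ultimately have "(W - B) \<inter> A1 = {} \<or> (W - B) \<inter> A2 = {}"
          using W(3) A(4) unfolding connected_openin by blast
        then show ?thesis using A(3) WF by blast
      qed
      then show "x \<in> E A1 \<union> E A2" using W unfolding E_def by blast
    qed
    have disj: "E A1 \<inter> E A2 = {}"
    proof (rule ccontr)
      assume "E A1 \<inter> E A2 \<noteq> {}"
      then obtain x W1 W2 where W: "openin (top_of_set F) W1" "W1 - B \<subseteq> A1" "openin (top_of_set F) W2" "W2 - B \<subseteq> A2"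
        "x \<in> W1" "x \<in> W2" unfolding E_def by blast
      have xF: "x \<in> F" using W openin_imp_subset by blast
      obtain W' where "W' \<subseteq> W1 \<inter> W2" "W' - B \<noteq> {}" using nbhd[OF xF openin_Int[OF W(1,3)]] W by blast
      then show False using W A(4) by blast
    qed
    have FB: "openin (top_of_set F) (F - B)"
    proof (subst openin_subopen, intro ballI)
      fix x assume x: "x \<in> F - B"
      obtain U V h h' where U: "x \<in> U" "openin (top_of_set F) U"
         and h: "homeomorphism U V h h'" and UB: "U \<inter> B = {y \<in> U. Im (h y) = 0}"
        using F x unfolding surface_with_boundary_def by (meson DiffD1)
      have "continuous_on U h" using h by (rule homeomorphism_cont1)
      then have "openin (top_of_set U) (U \<inter> h -` {z. Im z \<noteq> 0})"
        by (rule continuous_openin_preimage_gen) (intro open_Collect_neq continuous_intros)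
      then have "openin (top_of_set F) (U \<inter> h -` {z. Im z \<noteq> 0})" using U(2) openin_trans by blast
      moreover have "U \<inter> h -` {z. Im z \<noteq> 0} \<subseteq> F - B" using UB U(2) openin_imp_subset by blast
      moreover have "x \<in> U \<inter> h -` {z. Im z \<noteq> 0}" using U x UB by auto
      ultimately show "\<exists>T. openin (top_of_set F) T \<and> x \<in> T \<and> T \<subseteq> F - B" by blast
    qed
    have "A1 \<subseteq> E A1" "A2 \<subseteq> E A2"
      using openin_trans[OF A(1) FB] openin_trans[OF A(2) FB] unfolding E_def by blast+
    then show False using F(2) op cov disj A(5,6) unfolding connected_openin by blast
  qed
qed

text \<open>
  Away from the boundary, the bicollar is locally a continuous injection of an open subset of a
  3-dimensional space into the sphere, so invariance of domain applies.
\<close>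
lemma collar_open:
  assumes F: "surface_with_boundary F K" and c: "continuous_on (F \<times> {-1..1}) c" "inj_on c (F \<times> {-1..1::real})"
    "c ` (F \<times> {-1..1}) \<subseteq> S3" and W: "open W" "W \<subseteq> {-1..1}"
  shows "openin (top_of_set S3) (c ` ((F - K) \<times> W))"
proof (subst openin_subopen, intro ballI)
  fix y assume "y \<in> c ` ((F - K) \<times> W)"
  then obtain x t where xt: "x \<in> F" "x \<notin> K" "t \<in> W" "y = c (x, t)" by auto
  obtain h h' r where ch0: "r > 0" "homeomorphism (h' ` {z. dist (h x) z \<le> r \<and> Im z \<ge> 0}) {z. dist (h x) z \<le> r \<and> Im z \<ge> 0} h h'"
    "h' (h x) = x" "Im (h x) \<ge> 0" "h' ` {z. dist (h x) z \<le> r \<and> Im z \<ge> 0} \<subseteq> F"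
    "\<forall>z. dist (h x) z \<le> r \<longrightarrow> Im z \<ge> 0 \<longrightarrow> (h' z \<in> K \<longleftrightarrow> Im z = 0)"
    "\<forall>W. open W \<longrightarrow> W \<subseteq> ball (h x) r \<longrightarrow> openin (top_of_set F) (h' ` (W \<inter> {z. Im z \<ge> 0}))"
    by (rule surface_chart[OF F xt(1)]) (rule that)
  note ch = ch0(1-5) ch0(6)[rule_format] ch0(7)[rule_format]
  let ?H = "{z. dist (h x) z \<le> r \<and> Im z \<ge> 0}"
  define V where "V = ball (h x) r \<inter> {z. Im z > 0}"
  have V: "open V" unfolding V_def by (intro open_Int open_ball open_halfspace_Im_gt)
  have VH: "V \<subseteq> ?H" by (auto simp: V_def)
  have h'F: "h' z \<in> F - K" if "z \<in> V" for z using that VH ch(5,6) by (force simp: V_def)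
  define f where "f = (\<lambda>(z, t). c (h' z, t))"
  have "openin (top_of_set S3) (f ` (V \<times> W))"
  proof (rule invariance_of_domain_S3)
    show "open (V \<times> W)" using V W by (simp add: open_Times)
    show "continuous_on (V \<times> W) f"
      unfolding f_def case_prod_unfold
      by (intro continuous_on_compose2[OF c(1)] continuous_intros continuous_on_compose2[OF homeomorphism_cont2[OF ch(2)]])
        (use h'F W VH in auto)
    have injh': "inj_on h' ?H" using homeomorphism_symD[OF ch(2)] unfolding homeomorphism_def by (intro inj_on_inverseI[of _ h]) blast
    show "inj_on f (V \<times> W)"
    proof (rule inj_onI)
      fix p p' assume p: "p \<in> V \<times> W" "p' \<in> V \<times> W" "f p = f p'"
      obtain z t z' t' where eq: "p = (z, t)" "p' = (z', t')" by fastforce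
      have m: "(h' z, t) \<in> F \<times> {-1..1}" "(h' z', t') \<in> F \<times> {-1..1}" using p eq h'F W by auto
      have "c (h' z, t) = c (h' z', t')" using p(3) by (simp add: f_def eq)
      from inj_onD[OF c(2) this m] have "(h' z, t) = (h' z', t')" .
      then show "p = p'" using inj_onD[OF injh', of z z'] VH p eq by auto
    qed
    show "f ` (V \<times> W) \<subseteq> S3" using c(3) h'F W by (force simp: f_def)
  qed simp
  moreover have "y \<in> f ` (V \<times> W)"
  proof (rule image_eqI[of _ _ "(h x, t)"])
    have "Im (h x) \<noteq> 0" using ch(1,3,4) ch(6)[of "h x"] xt by auto
    then show "(h x, t) \<in> V \<times> W" using ch(1,4) xt by (auto simp: V_def)
  qed (simp add: f_def ch xt)
  moreover have "f ` (V \<times> W) \<subseteq> c ` ((F - K) \<times> W)" using h'F by (force simp: f_def)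
  ultimately show "\<exists>T. openin (top_of_set S3) T \<and> y \<in> T \<and> T \<subseteq> c ` ((F - K) \<times> W)" by blast
qed

text \<open>
  A half disc \<open>R\<close> at a boundary point can be pushed out vertically, onto the half circle that bounds
  it in the surface. So deleting a piece of the surface does not change its homotopy type.
\<close>
lemma surface_deletes_disc:
  fixes F :: "'a::euclidean_space set"
  assumes F: "surface_with_boundary F B" "compact F" and b: "b \<in> B"
  obtains R where "openin (top_of_set F) R" "connected R" "R - B \<noteq> {}" "F homotopy_eqv (F - R)" "F - R \<noteq> {}"
proof -
  have bF: "b \<in> F" using F(1) b unfolding surface_with_boundary_def by blast
  obtain h h' r where ch0: "r > 0" "homeomorphism (h' ` {z. dist (h b) z \<le> r \<and> Im z \<ge> 0}) {z. dist (h b) z \<le> r \<and> Im z \<ge> 0} h h'"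
    "h' (h b) = b" "Im (h b) \<ge> 0" "h' ` {z. dist (h b) z \<le> r \<and> Im z \<ge> 0} \<subseteq> F"
    "\<forall>z. dist (h b) z \<le> r \<longrightarrow> Im z \<ge> 0 \<longrightarrow> (h' z \<in> B \<longleftrightarrow> Im z = 0)"
    "\<forall>W. open W \<longrightarrow> W \<subseteq> ball (h b) r \<longrightarrow> openin (top_of_set F) (h' ` (W \<inter> {z. Im z \<ge> 0}))"
    by (rule surface_chart[OF F(1) bF]) (rule that)
  note ch = ch0(1-5) ch0(6)[rule_format] ch0(7)[rule_format]
  define a where "a = Re (h b)"
  define H where "H = {z. dist (h b) z \<le> r \<and> Im z \<ge> 0}"
  define D where "D = ball (h b) r \<inter> {z. Im z \<ge> 0}"
  have hom: "homeomorphism (h' ` H) H h h'" using ch(2) by (simp add: H_def)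
  have hb: "h b = of_real a" using ch(6)[of "h b"] ch(1,3,4) b by (simp add: complex_eq_iff a_def)
  have dst: "dist (h b) z \<le> r \<longleftrightarrow> (Re z - a)\<^sup>2 + (Im z)\<^sup>2 \<le> r\<^sup>2" "dist (h b) z < r \<longleftrightarrow> (Re z - a)\<^sup>2 + (Im z)\<^sup>2 < r\<^sup>2" for z
  proof -
    have "dist (h b) z = sqrt ((Re z - a)\<^sup>2 + (Im z)\<^sup>2)"
      by (simp add: hb dist_norm cmod_def power2_commute)
    then show "dist (h b) z \<le> r \<longleftrightarrow> (Re z - a)\<^sup>2 + (Im z)\<^sup>2 \<le> r\<^sup>2" "dist (h b) z < r \<longleftrightarrow> (Re z - a)\<^sup>2 + (Im z)\<^sup>2 < r\<^sup>2"
      using ch(1) real_sqrt_le_iff[of _ "r\<^sup>2"] real_sqrt_less_iff[of _ "r\<^sup>2"] by auto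
  qed
  \<comment> \<open>The vertical projection of the half disc to its circular arc.\<close>
  define ret where "ret z = Complex (Re z) (sqrt (r\<^sup>2 - (Re z - a)\<^sup>2))" for z
  define m where "m t z = (1 - t) *\<^sub>R z + t *\<^sub>R ret z" for t z
  have Hre: "(Re z - a)\<^sup>2 \<le> r\<^sup>2" if "z \<in> H" for z
  proof -
    have "(Re z - a)\<^sup>2 + (Im z)\<^sup>2 \<le> r\<^sup>2" using that dst unfolding H_def by blast
    then show ?thesis using zero_le_power2[of "Im z"] by linarith
  qed
  have retH: "ret z \<in> H" "ret z \<notin> D" if "z \<in> H" for z
    using Hre[OF that] unfolding H_def D_def by (auto simp: dst(1) ret_def) (simp add: dst(2))
  have convH: "convex H"
  proof -
    have "H = cball (h b) r \<inter> {z. Im z \<ge> 0}" by (auto simp: H_def)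
    then show ?thesis by (auto intro!: convex_Int convex_halfspace_Im_ge)
  qed
  have mH: "m t z \<in> H" if "z \<in> H" "t \<in> {0..1}" for t z
    using convH retH(1)[OF that(1)] that unfolding m_def convex_alt by auto
  have DH: "D \<subseteq> H" by (auto simp: D_def H_def)
  have ret_id: "ret z = z" if "z \<in> H" "z \<notin> D" for z
  proof -
    have "(Re z - a)\<^sup>2 + (Im z)\<^sup>2 = r\<^sup>2" "Im z \<ge> 0" using that dst(1)[of z] dst(2)[of z] by (auto simp: H_def D_def)
    then have "sqrt (r\<^sup>2 - (Re z - a)\<^sup>2) = Im z" by (intro real_sqrt_unique) auto
    then show ?thesis by (simp add: ret_def complex_eq_iff)
  qed
  have contret: "continuous_on H ret"
    unfolding ret_def Complex_eq by (intro continuous_intros)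
  define R where "R = h' ` D"
  define A where "A = F - R"
  define P where "P = h' ` H"
  have HF: "P \<subseteq> F" using ch(5) by (simp add: P_def H_def)
  have hP: "h x \<in> H" "h' (h x) = x" if "x \<in> P" for x using hom that by (auto simp: homeomorphism_def P_def)
  have h'P: "h' z \<in> P" "h (h' z) = z" if "z \<in> H" for z using hom that by (auto simp: homeomorphism_def P_def)
  have R_iff: "h' z \<in> R \<longleftrightarrow> z \<in> D" if "z \<in> H" for z using h'P DH that unfolding R_def by (metis (no_types, lifting) image_iff subsetD)
  have opR: "openin (top_of_set F) R" unfolding R_def D_def by (rule ch(7)) auto
  have compH: "compact H"
  proof -
    have "H = cball (h b) r \<inter> {z. Im z \<ge> 0}" by (auto simp: H_def)
    then show ?thesis by (auto intro!: compact_Int_closed closed_halfspace_Im_ge)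
  qed
  have compP: "compact P" unfolding P_def by (rule compact_continuous_image[OF homeomorphism_cont2[OF hom] compH])
  have compA: "compact A"
  proof -
    have "closedin (top_of_set F) A" unfolding A_def by (rule closedin_diff) (use opR in auto)
    then show ?thesis using closedin_compact F(2) by blast
  qed
  define G where "G = (\<lambda>(t, x). if x \<in> A then x else h' (m t (h x)))"
  have FAP: "F = A \<union> P" using HF DH unfolding A_def R_def P_def by auto
  have APid: "h' (m t (h x)) = x" if "x \<in> A" "x \<in> P" for t x
  proof -
    have "h x \<notin> D" using that hP R_iff by (metis A_def Diff_iff)
    then show ?thesis using ret_id[OF hP(1)[OF that(2)]] hP(2)[OF that(2)] by (simp add: m_def algebra_simps flip: scaleR_add_left)
  qed
  have contG: "continuous_on ({0..1} \<times> F) G"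
  proof -
    have "continuous_on (({0..1} \<times> A) \<union> ({0..1} \<times> P)) (\<lambda>p. if snd p \<in> A then snd p else h' (m (fst p) (h (snd p))))"
    proof (rule continuous_on_cases)
      show "closed ({0..1::real} \<times> A)" "closed ({0..1::real} \<times> P)" using compA compP by (auto intro!: compact_imp_closed compact_Times)
      show "continuous_on ({0..1} \<times> P) (\<lambda>p. h' (m (fst p) (h (snd p))))"
      proof (rule continuous_on_compose2[OF homeomorphism_cont2[OF hom]])
        have "continuous_on ({0..1} \<times> P) (\<lambda>p. h (snd p))"
          by (rule continuous_on_compose2[OF homeomorphism_cont1[OF hom]]) (auto intro!: continuous_intros simp: P_def)
        moreover have "continuous_on ({0..1} \<times> P) (\<lambda>p. ret (h (snd p)))"
          by (rule continuous_on_compose2[OF contret calculation]) (use hP in auto)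
        ultimately show "continuous_on ({0..1} \<times> P) (\<lambda>p. m (fst p) (h (snd p)))"
          unfolding m_def by (intro continuous_intros)
        show "(\<lambda>p. m (fst p) (h (snd p))) ` ({0..1} \<times> P) \<subseteq> H" using mH hP by auto
      qed
    qed (use APid in \<open>auto intro!: continuous_intros\<close>)
    moreover have "{0..1} \<times> F = ({0..1::real} \<times> A) \<union> ({0..1} \<times> P)" using FAP by auto
    ultimately show ?thesis unfolding G_def case_prod_unfold by simp
  qed
  have GF: "G (t, x) \<in> F" if "t \<in> {0..1}" "x \<in> F" for t x
    using that FAP mH hP h'P HF by (auto simp: G_def)
  have G1: "G (1, x) \<in> A" if "x \<in> F" for x
  proof (cases "x \<in> A")
    case False
    then have "x \<in> P" using FAP that by auto
    then have "h' (ret (h x)) \<in> P" "h' (ret (h x)) \<notin> R" using retH[OF hP(1)] h'P R_iff by auto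
    then show ?thesis using False HF by (auto simp: G_def m_def A_def)
  qed (simp add: G_def)
  have eqv: "F homotopy_eqv A"
  proof (rule deformation_retract_imp_homotopy_eqv)
    show "homotopic_with_canon (\<lambda>x. True) F F id (\<lambda>x. G (1, x))"
    proof (subst homotopic_with, simp, intro exI[of _ G] conjI)
      show "continuous_map (prod_topology (top_of_set {0..1}) (top_of_set F)) (top_of_set F) G"
        using contG GF by (auto simp: continuous_map_in_subtopology subtopology_Times[symmetric] euclidean_product_topology)
      show "\<forall>x\<in>topspace (top_of_set F). G (0, x) = id x"
      proof
        fix x assume "x \<in> topspace (top_of_set F)"
        then show "G (0, x) = id x" using FAP hP by (auto simp: G_def m_def)
      qed
    qed auto
    show "retraction F A (\<lambda>x. G (1, x))"
    proof -
      have "continuous_on F (\<lambda>x. G (1, x))"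
        by (rule continuous_on_compose2[OF contG]) (auto intro!: continuous_intros)
      then show ?thesis unfolding retraction_def using G1 by (auto simp: A_def G_def)
    qed
  qed
  show ?thesis
  proof
    show "openin (top_of_set F) R" by (rule opR)
    have "connected D" unfolding D_def by (intro convex_connected convex_Int convex_halfspace_Im_ge convex_ball)
    then show "connected R" unfolding R_def
      by (rule connected_continuous_image[OF continuous_on_subset[OF homeomorphism_cont2[OF hom] DH]])
    obtain z where "dist (h b) z < r" "Im z > 0" using half_ball_nonempty[OF ch(1,4)] by blast
    then have "z \<in> D" "h' z \<notin> B" using ch(6)[of z] by (auto simp: D_def)
    then show "R - B \<noteq> {}" unfolding R_def by blast
    show "F homotopy_eqv (F - R)" using eqv by (simp add: A_def)
    have "h b \<in> H" using ch(1,4) by (simp add: H_def)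
    then have "h' (ret (h b)) \<in> A" using retH h'P R_iff HF unfolding A_def by blast
    then show "F - R \<noteq> {}" unfolding A_def by blast
  qed
qed

text \<open>
  Homotopy equivalent compact subsets of a Euclidean space separate it or fail to separate it
  together. The point \<open>w\<close> is removed in order to get to Euclidean space.
\<close>
lemma homotopy_eqv_complement_S3:
  assumes eqv: "F homotopy_eqv A" and cF: "compact F" and cA: "compact A" and sub: "F \<subseteq> S3 - {w}" "A \<subseteq> S3 - {w}"
    and w: "w \<in> S3" and A: "connected (S3 - {w} - A)"
  shows "connected (S3 - {w} - F)"
proof -
  obtain s s' where s: "homeomorphism (S3 - {w}) (UNIV :: (real ^ 3) set) s s'" using stereographic[OF w] .
  have inv: "s' (s z) = z" if "z \<in> S3 - {w}" for z using s that by (simp add: homeomorphism_def)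
  have im: "compact (s ` C)" "C homeomorphic s ` C" "- s ` C = s ` (S3 - {w} - C)" "s' ` (- s ` C) = S3 - {w} - C"
    if C: "compact C" "C \<subseteq> S3 - {w}" for C
  proof -
    show "compact (s ` C)"
      by (rule compact_continuous_image[OF continuous_on_subset[OF homeomorphism_cont1[OF s] C(2)] C(1)])
    have "homeomorphism C (s ` C) s s'" by (rule homeomorphism_of_subsets[OF s]) (use C in auto)
    then show "C homeomorphic s ` C" by (auto simp: homeomorphic_def)
    have U: "s ` (S3 - {w}) = UNIV" using s by (simp add: homeomorphism_def)
    have "inj_on s (S3 - {w})" by (rule inj_on_inverseI[of _ s']) (rule inv)
    then have "s ` (S3 - {w} - C) = s ` (S3 - {w}) - s ` C" by (rule inj_on_image_set_diff) (use C in auto)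
    then show eq: "- s ` C = s ` (S3 - {w} - C)" using U by auto
    have "(\<lambda>z. s' (s z)) ` (S3 - {w} - C) = S3 - {w} - C"
    proof -
      have "(\<lambda>z. s' (s z)) ` (S3 - {w} - C) = (\<lambda>z. z) ` (S3 - {w} - C)" by (rule image_cong[OF refl]) (use inv in blast)
      then show ?thesis by simp
    qed
    then show "s' ` (- s ` C) = S3 - {w} - C" unfolding eq image_image .
  qed
  have "s ` F homotopy_eqv s ` A"
    using homeomorphic_imp_homotopy_eqv[OF im(2)[OF cA sub(2)]]
      homeomorphic_imp_homotopy_eqv[OF homeomorphic_sym[THEN iffD1, OF im(2)[OF cF sub(1)]]] eqv
    by (meson homotopy_eqv_trans)
  moreover have "connected (- s ` A)"
    unfolding im(3)[OF cA sub(2)]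
    by (rule connected_continuous_image[OF continuous_on_subset[OF homeomorphism_cont1[OF s]] A]) auto
  ultimately have "connected (- s ` F)"
    using homotopy_eqv_separation[of "s ` F" "s ` A"] im(1)[OF cA sub(2)] im(1)[OF cF sub(1)] by blast
  then have "connected (s' ` (- s ` F))"
    by (rule connected_continuous_image[OF continuous_on_subset[OF homeomorphism_cont2[OF s]], rotated]) auto
  then show ?thesis unfolding im(4)[OF cF sub(1)] .
qed

text \<open>
  The cocycle \<open>T\<close> is \<open>\<omega>\<close> between points of \<open>F\<close> and points on its negative side, and \<open>1\<close>
  otherwise. The loop \<open>\<gamma>\<close> crosses \<open>F\<close> once, so that \<open>T\<close> has monodromy \<open>\<omega>\<close>, up to inversion,
  along \<open>\<gamma>\<close>.

  Such a loop exists because \<open>F\<close> does not separate the sphere. To prove this, delete a half disc \<open>R\<close>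
  at the boundary. In the complement of \<open>A = F - R\<close> the two sides of \<open>F\<close> are joined through \<open>R\<close>, so
  a component that does not contain \<open>R\<close> would be disjoint from the bicollar of \<open>F\<close> and would
  separate the complement of \<open>K\<close>, which is connected. Hence \<open>A\<close> does not separate, and neither does
  \<open>F\<close>, which is homotopy equivalent to \<open>A\<close>.
\<close>
lemma seifert_crossing:
  assumes S: "seifert_surface F K" and K: "K \<noteq> {}" and conn: "connected (S3 - K)" and \<omega>: "\<omega> \<noteq> 0"
  shows "\<exists>T \<gamma> \<sigma>. flat (S3 - K) T \<and> parallel (S3 - F) T (\<lambda>_. 1) \<and> (\<forall>y x. T y x \<in> {1, \<omega>}) \<and>
    continuous_on {0..1::real} \<gamma> \<and> \<gamma> ` {0..1} \<subseteq> S3 - K \<and> \<gamma> 0 = \<gamma> 1 \<and>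
    parallel {0..1} (\<lambda>t u. T (\<gamma> t) (\<gamma> u)) \<sigma> \<and> \<sigma> 0 = inverse \<omega> \<and> \<sigma> 1 = 1"
proof -
  obtain c where F: "F \<subseteq> S3" "compact F" "connected F" "surface_with_boundary F K"
    and c: "closed_embedding (F \<times> {-1..1::real}) S3 c" and c0: "\<And>x. x \<in> F \<Longrightarrow> c (x, 0) = x"
    using S unfolding seifert_surface_def by auto
  note cD = closed_embeddingD[OF c]
  have KF: "K \<subseteq> F" using F(4) by (simp add: surface_with_boundary_def)
  define C where "C W = c ` ((F - K) \<times> W)" for W
  \<comment> \<open>The open positive and negative sides of the interior of \<open>F\<close>.\<close>
  define P where "P = C {0<..<1}"
  define Q where "Q = C {-1<..<0}"
  have opC: "openin (top_of_set S3) (C W)" if "open W" "W \<subseteq> {-1..1}" for W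
    unfolding C_def by (rule collar_open[OF F(4) cD(1,2,3) that])
  have op: "openin (top_of_set S3) P" "openin (top_of_set S3) Q" "openin (top_of_set S3) (C {-1<..<1})"
    unfolding P_def Q_def by (auto intro!: opC)
  have cF: "c (x, t) \<notin> F" if "x \<in> F" "t \<in> {-1..1}" "t \<noteq> 0" for x t
  proof
    assume "c (x, t) \<in> F"
    then have "c (c (x, t), 0) = c (x, t)" by (rule c0)
    then have "(c (x, t), 0) = (x, t)" using inj_onD[OF cD(2), of "(c (x, t), 0)" "(x, t)"] that \<open>c (x, t) \<in> F\<close> by auto
    then show False using that by simp
  qed
  have CF: "C W \<inter> F = {}" if "W \<subseteq> {-1..1} - {0}" for W
  proof (rule equals0I)
    fix y assume "y \<in> C W \<inter> F"
    then obtain x t where "x \<in> F" "t \<in> W" "c (x, t) \<in> F" by (auto simp: C_def)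
    then show False using cF[of x t] that by blast
  qed
  have PQF: "P \<inter> F = {}" "Q \<inter> F = {}" unfolding P_def Q_def by (auto intro!: CF)
  have PQ: "P \<inter> Q = {}"
  proof -
    have "c ` ((F - K) \<times> {0<..<1}) \<inter> c ` ((F - K) \<times> {-1<..<0}) = c ` (((F - K) \<times> {0<..<1}) \<inter> ((F - K) \<times> {-1<..<0}))"
      by (rule inj_on_image_Int[OF cD(2), symmetric]) auto
    also have "((F - K) \<times> {0<..<1::real}) \<inter> ((F - K) \<times> {-1<..<0}) = {}" by auto
    finally show ?thesis by (simp add: P_def Q_def C_def)
  qed
  have O: "C {-1<..<1} = P \<union> Q \<union> (F - K)"
  proof -
    have "{-1<..<1::real} = {0<..<1} \<union> {-1<..<0} \<union> {0}" by auto
    then have "C {-1<..<1} = P \<union> Q \<union> c ` ((F - K) \<times> {0})"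
      unfolding C_def P_def Q_def by (simp only: Sigma_Un_distrib2 image_Un)
    also have "c ` ((F - K) \<times> {0}) = F - K" using c0 by force
    finally show ?thesis .
  qed
  have closedF: "closed F" using F(2) by (rule compact_imp_closed)
  have opF: "openin (top_of_set S3) (S3 - F)" using closedF by (auto simp: openin_open)
  have PQS: "P \<subseteq> S3 - F" "Q \<subseteq> S3 - F" using op PQF openin_imp_subset by blast+
  obtain b where b: "b \<in> K" using K by blast
  obtain R where R: "openin (top_of_set F) R" "connected R" "R - K \<noteq> {}" "F homotopy_eqv (F - R)" "F - R \<noteq> {}"
    using surface_deletes_disc[OF F(4,2) b] .
  obtain x0 where x0: "x0 \<in> R" "x0 \<notin> K" using R(3) by blast
  have RF: "R \<subseteq> F" using R(1) openin_imp_subset by blast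
  define A where "A = F - R"
  have compA: "compact A"
  proof -
    have "closedin (top_of_set F) A" unfolding A_def by (rule closedin_diff) (use R in auto)
    then show ?thesis using closedin_compact F(2) by blast
  qed
  have opA: "openin (top_of_set S3) (S3 - A)" using compact_imp_closed[OF compA] by (auto simp: openin_open)
  have connFK: "connected (F - K)" by (rule surface_interior_connected[OF F(4,3)])
  have connC: "connected (C W)" if "connected W" "W \<subseteq> {-1..1}" for W
    unfolding C_def
    by (rule connected_continuous_image[OF continuous_on_subset[OF cD(1)] connected_Times[OF connFK that(1)]]) (use that in auto)
  have connPQ: "connected P" "connected Q" unfolding P_def Q_def by (auto intro!: connC)
  have "x0 \<in> F" using x0 RF by blast
  have near: "\<exists>t. t \<in> W \<and> c (x0, t) \<in> U" if U: "openin (top_of_set S3) U" "x0 \<in> U" and W: "W = {0<..<1} \<or> W = {-1<..<0}" for U W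
  proof -
    have "continuous_on {-1..1} (\<lambda>t. c (x0, t))"
      by (rule continuous_on_compose2[OF cD(1)]) (use \<open>x0 \<in> F\<close> in \<open>auto intro!: continuous_intros\<close>)
    then have "openin (top_of_set {-1..1}) ({-1..1} \<inter> (\<lambda>t. c (x0, t)) -` U)"
      by (rule continuous_openin_preimage[OF _ _ U(1)]) (use cD(3) \<open>x0 \<in> F\<close> in auto)
    then obtain G where G: "open G" "{-1..1} \<inter> (\<lambda>t. c (x0, t)) -` U = {-1..1} \<inter> G" by (auto simp: openin_open)
    have "0 \<in> {-1..1} \<inter> (\<lambda>t. c (x0, t)) -` U" using c0[OF \<open>x0 \<in> F\<close>] U(2) by simp
    then have "0 \<in> G" using G(2) by blast
    then obtain e where e: "e > 0" "ball 0 e \<subseteq> G" using G(1) open_contains_ball by blast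
    define d where "d = min (e / 2) (1 / 2)"
    have d: "0 < d" "d < e" "d < 1" using e by (auto simp: d_def)
    have "d \<in> {-1..1} \<inter> G" "- d \<in> {-1..1} \<inter> G" using d e by (auto simp: subset_iff dist_real_def)
    then have "c (x0, d) \<in> U" "c (x0, - d) \<in> U" using G(2) by blast+
    then show ?thesis using W d by (metis greaterThanLessThan_iff neg_less_0_iff_less neg_less_iff_less)
  qed
  have connA: "connected (S3 - A)"
  proof (rule ccontr)
    assume "\<not> ?thesis"
    then obtain E1 E2 where E0: "openin (top_of_set (S3 - A)) E1" "openin (top_of_set (S3 - A)) E2" "S3 - A \<subseteq> E1 \<union> E2"
      "E1 \<inter> E2 = {}" "E1 \<noteq> {}" "E2 \<noteq> {}" unfolding connected_openin by blast
    have sep: False if E: "openin (top_of_set (S3 - A)) E1" "openin (top_of_set (S3 - A)) E2" "S3 - A \<subseteq> E1 \<union> E2"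
      "E1 \<inter> E2 = {}" "E2 \<noteq> {}" and x0E: "x0 \<in> E1" for E1 E2
    proof -
      have o: "openin (top_of_set S3) E1" "openin (top_of_set S3) E2" using E(1,2) opA openin_trans by blast+
      have sub: "X \<subseteq> E1" if X: "connected X" "X \<subseteq> S3 - A" "X \<inter> E1 \<noteq> {}" for X
      proof -
        have "openin (top_of_set X) (X \<inter> E1)" "openin (top_of_set X) (X \<inter> E2)"
          using E(1,2) X(2) by (auto simp: openin_open)
        moreover have "X \<subseteq> (X \<inter> E1) \<union> (X \<inter> E2)" using E(3) X(2) by blast
        ultimately have "X \<inter> E2 = {}" using X(1,3) E(4) unfolding connected_openin by blast
        then show ?thesis using E(3) X(2) by blast
      qed
      have RE: "R \<subseteq> E1" by (rule sub[OF R(2)]) (use RF F(1) x0 x0E in \<open>auto simp: A_def\<close>)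
      have mem: "c (x0, t) \<in> C W" if "t \<in> W" for t W using that \<open>x0 \<in> F\<close> x0(2) by (auto simp: C_def)
      have PE: "P \<subseteq> E1"
      proof (rule sub[OF connPQ(1)])
        show "P \<subseteq> S3 - A" using PQS by (auto simp: A_def)
        show "P \<inter> E1 \<noteq> {}" using near[OF o(1) x0E, of "{0<..<1}"] mem unfolding P_def by blast
      qed
      have QE: "Q \<subseteq> E1"
      proof (rule sub[OF connPQ(2)])
        show "Q \<subseteq> S3 - A" using PQS by (auto simp: A_def)
        show "Q \<inter> E1 \<noteq> {}" using near[OF o(1) x0E, of "{-1<..<0}"] mem unfolding Q_def by blast
      qed
      have E2S: "E2 \<subseteq> S3 - A" using E(2) openin_imp_subset by blast
      have E2F: "E2 \<inter> F = {}" using E2S RE E(4) unfolding A_def by blast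
      define E3 where "E3 = (S3 - K) \<inter> (E1 \<union> C {-1<..<1})"
      have "openin (top_of_set (S3 - K)) E2"
        using o(2) E2F KF E2S by (intro openin_subset_trans[of S3 E2 "S3 - K"]) auto
      moreover have "openin (top_of_set (S3 - K)) E3"
        unfolding E3_def using openin_Un[OF o(1) op(3)] by (auto simp: openin_open)
      moreover have "S3 - K \<subseteq> E2 \<union> E3" using E(3) O unfolding E3_def A_def by blast
      moreover have "E2 \<inter> E3 = {}" using E(4) PE QE O E2F unfolding E3_def by blast
      moreover have "x0 \<in> E3" using x0 x0E \<open>x0 \<in> F\<close> F(1) unfolding E3_def by blast
      ultimately show False using conn E(5) unfolding connected_openin by blast
    qed
    have "x0 \<in> S3 - A" using x0 RF F(1) by (auto simp: A_def)
    then consider "x0 \<in> E1" | "x0 \<in> E2" using E0(3) by blast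
    then show False
    proof cases
      case 1 then show ?thesis using sep[OF E0(1-4,6)] by blast
    next
      case 2
      have "S3 - A \<subseteq> E2 \<union> E1" "E2 \<inter> E1 = {}" using E0(3,4) by auto
      from sep[OF E0(2,1) this E0(5) 2] show ?thesis .
    qed
  qed
  \<comment> \<open>Pass to Euclidean space by removing a point that avoids the arc \<open>f\<close> across \<open>F\<close> below.\<close>
  define w where "w = c (x0, 1)"
  have cS: "c (x0, t) \<in> S3" if "t \<in> {-1..1}" for t using cD(3) \<open>x0 \<in> F\<close> that by blast
  have w: "w \<in> S3" "w \<notin> F" using cF[OF \<open>x0 \<in> F\<close>, of 1] cS[of 1] by (simp_all only: w_def) auto
  obtain a where a: "a \<in> A" using R(5) by (auto simp: A_def)
  have "connected (S3 - A - {w})"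
    by (rule connected_S3_delete[OF opA connA, of a]) (use a F(1) in \<open>auto simp: A_def\<close>)
  moreover have "S3 - A - {w} = S3 - {w} - A" by blast
  ultimately have connF: "connected (S3 - {w} - F)"
    using w F(1) by (intro homotopy_eqv_complement_S3[OF R(4)[folded A_def] F(2) compA]) (auto simp: A_def)
  have pc: "path_connected (S3 - {w} - F)"
  proof -
    obtain s s' where s: "homeomorphism (S3 - {w}) (UNIV :: (real ^ 3) set) s s'" using stereographic[OF w(1)] .
    have "openin (top_of_set (S3 - {w})) (S3 - {w} - F)" using closedF by (auto simp: openin_open)
    from homeomorphism_imp_open_map[OF s this] have "open (s ` (S3 - {w} - F))" by simp
    moreover have "connected (s ` (S3 - {w} - F))"
      by (rule connected_continuous_image[OF continuous_on_subset[OF homeomorphism_cont1[OF s]] connF]) auto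
    ultimately have "path_connected (s ` (S3 - {w} - F))" by (simp add: connected_open_path_connected)
    then have "path_connected (s' ` s ` (S3 - {w} - F))"
      by (rule path_connected_continuous_image[OF continuous_on_subset[OF homeomorphism_cont2[OF s]], rotated]) auto
    moreover have "s' ` s ` (S3 - {w} - F) = S3 - {w} - F"
    proof -
      have "(\<lambda>z. s' (s z)) ` (S3 - {w} - F) = (\<lambda>z. z) ` (S3 - {w} - F)"
        by (rule image_cong[OF refl]) (use s in \<open>auto simp: homeomorphism_def\<close>)
      then show ?thesis by (simp add: image_image)
    qed
    ultimately show ?thesis by simp
  qed
  have cw: "c (x0, t) \<in> S3 - {w} - F" if "t \<in> {-1..<1}" "t \<noteq> 0" for t
  proof -
    have "c (x0, t) \<noteq> c (x0, 1)" using inj_onD[OF cD(2), of "(x0, t)" "(x0, 1)"] that \<open>x0 \<in> F\<close> by auto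
    moreover have "t \<in> {-1..1}" using that by auto
    ultimately show ?thesis using cF[OF \<open>x0 \<in> F\<close> _ that(2)] cS[of t] unfolding w_def by blast
  qed
  have m: "c (x0, 1/2) \<in> S3 - {w} - F" "c (x0, - 1/2) \<in> S3 - {w} - F" by (rule cw; simp)+
  obtain g where g: "path g" "path_image g \<subseteq> S3 - {w} - F" "pathstart g = c (x0, 1/2)" "pathfinish g = c (x0, - 1/2)"
    using pc[unfolded path_connected_def, rule_format, OF m] by blast
  \<comment> \<open>\<open>\<gamma>\<close> first crosses \<open>F\<close> at \<open>x0\<close>, from the negative to the positive side, and then returns in
    the complement of \<open>F\<close>. The crossing is at time \<open>1/4\<close>.\<close>
  define f where "f t = c (x0, t - 1/2)" for t :: real
  have pathf: "path f"
    unfolding path_def f_def by (rule continuous_on_compose2[OF cD(1)])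
      (use \<open>x0 \<in> F\<close> in \<open>auto intro!: continuous_intros\<close>)
  define \<gamma> where "\<gamma> = f +++ g"
  have path\<gamma>: "path \<gamma>" unfolding \<gamma>_def by (rule path_join_imp[OF pathf g(1)]) (simp add: pathfinish_def f_def g(3))
  define T where "T y x = (if y \<in> F \<and> x \<in> Q then \<omega> else 1)" for y x
  have near_off: "\<forall>\<^sub>F x in nbhds_in S3 y. x \<in> S3 - F" if "y \<in> S3 - F" for y
    by (rule eventually_nbhds_in_openin[OF opF that])
  have nb: "eventually X (nbhds_in (S3 - K) y)" if "eventually X (nbhds_in S3 y)" for X y
    using that by (rule eventually_nbhds_in_subset) auto
  have nbo: "\<forall>\<^sub>F x in nbhds_in (S3 - K) y. x \<in> U" if "openin (top_of_set S3) U" "y \<in> U" for U y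
    by (rule nb, rule eventually_nbhds_in_openin[OF that])
  have flat: "flat (S3 - K) T"
    unfolding flat_def
  proof (intro conjI allI ballI)
    show "T y x \<noteq> 0" for y x using \<omega> by (simp add: T_def)
    fix y assume y: "y \<in> S3 - K"
    show "\<forall>\<^sub>F x in nbhds_in (S3 - K) y. \<forall>\<^sub>F z in nbhds_in (S3 - K) x. T y z = T y x * T x z"
    proof (cases "y \<in> F")
      case False
      then have "\<forall>\<^sub>F x in nbhds_in (S3 - K) y. x \<in> S3 - F" using y by (intro nb near_off) auto
      then show ?thesis
      proof eventually_elim
        case (elim x)
        then show ?case using False by (simp add: T_def)
      qed
    next
      case True
      then have "y \<in> C {-1<..<1}" using y O by blast
      from nbo[OF op(3) this] show ?thesis
      proof eventually_elim
        case (elim x)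
        then consider "x \<in> P" | "x \<in> Q" | "x \<in> F" using O by blast
        then show ?case
        proof cases
          case 1
          from nbo[OF op(1) 1] show ?thesis by eventually_elim (use 1 PQ PQF True in \<open>auto simp: T_def\<close>)
        next
          case 2
          from nbo[OF op(2) 2] show ?thesis by eventually_elim (use 2 PQF True in \<open>auto simp: T_def\<close>)
        next
          case 3
          then have "T y x = 1" using PQF by (auto simp: T_def)
          moreover have "T y z = T x z" for z using 3 True by (simp add: T_def)
          ultimately show ?thesis by simp
        qed
      qed
    qed
  qed
  define \<sigma> where "\<sigma> t = (if t < 1/4 then inverse \<omega> else 1)" for t :: real
  have \<gamma>1: "\<gamma> t = c (x0, 2 * t - 1/2)" if "t \<le> 1/2" for t using that by (simp add: \<gamma>_def joinpaths_def f_def)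
  have \<gamma>2: "\<gamma> t \<in> S3 - F" if "t \<in> {0..1}" "t > 1/2" for t
  proof -
    have "\<gamma> t = g (2 * t - 1)" using that by (simp add: \<gamma>_def joinpaths_def)
    moreover have "g (2 * t - 1) \<in> path_image g" using that by (auto simp: path_image_def)
    ultimately show ?thesis using g(2) by auto
  qed
  have \<gamma>F: "\<gamma> t \<in> S3 - F" if "t \<in> {0..1}" "t \<noteq> 1/4" for t
  proof (cases "t \<le> 1/2")
    case True
    then show ?thesis using cw[of "2 * t - 1/2"] that \<gamma>1 by auto
  qed (use \<gamma>2 that in auto)
  have \<gamma>q: "\<gamma> (1/4) = x0" using \<gamma>1[of "1/4"] c0[OF \<open>x0 \<in> F\<close>] by simp
  have \<gamma>K: "\<gamma> ` {0..1} \<subseteq> S3 - K"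
  proof
    fix y assume "y \<in> \<gamma> ` {0..1}"
    then obtain t where t: "t \<in> {0..1}" "y = \<gamma> t" by auto
    show "y \<in> S3 - K" using \<gamma>F[OF t(1)] \<gamma>q t x0(2) KF \<open>x0 \<in> F\<close> F(1) by (cases "t = 1/4") auto
  qed
  have "parallel {0..1} (\<lambda>t u. T (\<gamma> t) (\<gamma> u)) \<sigma>"
    unfolding parallel_def
  proof (intro ballI conjI)
    fix t :: real assume t: "t \<in> {0..1}"
    show "\<sigma> t \<noteq> 0" using \<omega> by (simp add: \<sigma>_def)
    show "\<forall>\<^sub>F u in nbhds_in {0..1} t. \<sigma> t = T (\<gamma> t) (\<gamma> u) * \<sigma> u"
    proof (cases "t = 1/4")
      case True
      then have gt: "\<gamma> t \<in> F" using \<gamma>q \<open>x0 \<in> F\<close> by (simp only:)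
      have "\<sigma> t = T (\<gamma> t) (\<gamma> u) * \<sigma> u" if u: "u \<in> {0<..<1/2}" for u
      proof (cases "u < 1/4")
        case True
        have "\<gamma> u \<in> Q" using \<gamma>1[of u] u True \<open>x0 \<in> F\<close> x0(2) by (auto simp: Q_def C_def)
        then show ?thesis using \<open>t = 1/4\<close> True gt \<omega> by (simp add: T_def \<sigma>_def)
      next
        case False
        have "\<gamma> u \<notin> Q"
        proof (cases "u = 1/4")
          case True
          then have "\<gamma> u = x0" using \<gamma>q by (simp only:)
          then show ?thesis using PQF \<open>x0 \<in> F\<close> by blast
        next
          case False
          then have "\<gamma> u \<in> P" using \<gamma>1[of u] u \<open>\<not> u < 1/4\<close> \<open>x0 \<in> F\<close> x0(2) by (auto simp: P_def C_def)
          then show ?thesis using PQ by blast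
        qed
        then show ?thesis using \<open>t = 1/4\<close> False by (simp add: T_def \<sigma>_def)
      qed
      moreover have "t \<in> {0<..<1/2}" using True by simp
      ultimately show ?thesis unfolding eventually_nbhds_in
        by (intro exI[of _ "{0<..<1/2}"]) (blast intro: open_greaterThanLessThan)
    next
      case False
      then have F': "\<gamma> t \<notin> F" using \<gamma>F t by blast
      have "\<exists>U. open U \<and> t \<in> U \<and> (\<forall>u\<in>U. \<sigma> u = \<sigma> t)"
      proof (cases "t < 1/4")
        case True then show ?thesis by (intro exI[of _ "{..<1/4}"]) (auto simp: \<sigma>_def)
      next
        case False then show ?thesis using \<open>t \<noteq> 1/4\<close> by (intro exI[of _ "{1/4<..}"]) (auto simp: \<sigma>_def)
      qed
      then obtain U where U: "open U" "t \<in> U" "\<And>u. u \<in> U \<Longrightarrow> \<sigma> u = \<sigma> t" by blast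
      then have "\<forall>\<^sub>F u in nbhds_in {0..1} t. \<sigma> u = \<sigma> t" unfolding eventually_nbhds_in by blast
      then show ?thesis by eventually_elim (use F' in \<open>simp add: T_def\<close>)
    qed
  qed
  moreover have "parallel (S3 - F) T (\<lambda>_. 1)" by (simp add: parallel_def T_def)
  moreover have "\<gamma> 0 = \<gamma> 1"
    using \<gamma>1[of 0] g(4) by (simp add: \<gamma>_def joinpaths_def pathfinish_def)
  moreover have "continuous_on {0..1} \<gamma>" using path\<gamma> by (simp add: path_def)
  moreover have "\<sigma> 0 = inverse \<omega>" "\<sigma> 1 = 1" by (simp_all add: \<sigma>_def)
  moreover have "\<forall>y x. T y x \<in> {1, \<omega>}" by (simp add: T_def)
  ultimately show ?thesis using flat \<gamma>K by blast
qed

section \<open>Extending a local system over a knot\<close>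

lemma Im_Ln_mult_near:
  assumes "Re a > 0" "Re b > 0"
  shows "Im (Ln (a * b)) = Im (Ln a) + Im (Ln b)"
proof -
  have "a \<noteq> 0" "b \<noteq> 0" using assms by auto
  moreover have "\<bar>Im (Ln a)\<bar> < pi / 2" "\<bar>Im (Ln b)\<bar> < pi / 2" using assms Re_Ln_pos_lt \<open>a \<noteq> 0\<close> \<open>b \<noteq> 0\<close> by blast+
  ultimately show ?thesis by (subst Ln_times_simple) auto
qed

text \<open>
  Around the core, the meridian direction carries no monodromy, so the pullback to the universal
  cover of the longitude direction is trivial, with a section \<open>\<sigma>\<close> that is multiplied by a constant
  \<open>\<kappa>\<close> after one turn along the longitude. Multiplying it by \<open>exp (- c \<beta>)\<close>, where
  \<open>exp (2 \<pi> c) = \<kappa>\<close> and \<open>\<beta>\<close> is the longitude angle, gives a single-valued function \<open>g\<close> on the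
  punctured neighbourhood. In the gauge \<open>g\<close>, transport only depends on the increment of \<open>\<beta>\<close>; as the
  angle \<open>\<beta>\<close> is also defined on the core, the local system extends over the core. On the sphere it is
  trivial, and undoing the change of gauge trivialises \<open>T\<close>.
\<close>
lemma extend_over_core:
  assumes tub: "tubular_nbhd S3 K \<nu>" and flat: "flat (S3 - K) T"
    and m: "parallel (sphere 0 1) (\<lambda>v w. T (\<nu> (1, v)) (\<nu> (1, w))) m"
  shows "\<exists>s. parallel (S3 - K) T s"
proof -
  have emb: "closed_embedding solid_torus S3 \<nu>" and opV: "openin (top_of_set S3) (\<nu> ` open_solid_torus)"
    and K: "K = \<nu> ` (sphere 0 1 \<times> {0})" using tub by (auto simp: tubular_nbhd_def)
  obtain \<nu>' where \<nu>': "homeomorphism solid_torus (\<nu> ` solid_torus) \<nu> \<nu>'" using emb by (auto simp: closed_embedding_iff)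
  have \<nu>inv: "\<nu>' (\<nu> z) = z" if "z \<in> solid_torus" for z using \<nu>' that by (simp add: homeomorphism_def)
  have \<nu>S: "\<nu> z \<in> S3" if "z \<in> solid_torus" for z using closed_embeddingD(3)[OF emb] that by blast
  have \<nu>K: "\<nu> z \<in> K \<longleftrightarrow> snd z = 0" if z: "z \<in> solid_torus" for z
  proof
    assume "\<nu> z \<in> K"
    then obtain u where u: "u \<in> sphere 0 1" "\<nu> z = \<nu> (u, 0)" using K by auto
    have "(u, 0) \<in> solid_torus" using u by (simp add: solid_torus_def)
    then have "z = (u, 0)" using u(2) \<nu>inv z by metis
    then show "snd z = 0" by simp
  next
    assume "snd z = 0"
    then show "\<nu> z \<in> K" using z K by (cases z) (auto simp: solid_torus_def)
  qed
  define V where "V = \<nu> ` open_solid_torus"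
  have ost: "open_solid_torus \<subseteq> solid_torus" using solid_torus_split by blast
  \<comment> \<open>The cover of the punctured solid torus that unrolls the longitude.\<close>
  define Z where "Z = (UNIV :: real set) \<times> (ball (0::complex) 1 - {0})"
  define p where "p = (\<lambda>(\<beta>, v). \<nu> (cis \<beta>, v))"
  have "\<exists>\<sigma>. parallel Z (\<lambda>y x. T (p y) (p x)) \<sigma>"
  proof -
    \<comment> \<open>A homotopy from the projection to the meridian at \<open>u = 1\<close> to the covering map \<open>p\<close>.\<close>
    define h where "h = (\<lambda>((\<beta>, v), t). \<nu> (cis (t * \<beta>), ((1 - t) / cmod v + t) *\<^sub>R v))"
    have hst: "(cis (t * \<beta>), ((1 - t) / cmod v + t) *\<^sub>R v) \<in> solid_torus \<and> ((1 - t) / cmod v + t) *\<^sub>R v \<noteq> 0"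
      if "(\<beta>, v) \<in> Z" "t \<in> {0..1}" for \<beta> v t
    proof -
      have v: "0 < cmod v" "cmod v < 1" and t: "0 \<le> t" "t \<le> 1" using that by (auto simp: Z_def)
      have pos: "(1 - t) / cmod v + t > 0" using v t by (cases "t = 0") (auto intro!: add_nonneg_pos)
      then have "cmod (((1 - t) / cmod v + t) *\<^sub>R v) = ((1 - t) / cmod v + t) * cmod v" by (simp only: norm_scaleR abs_of_pos)
      also have "\<dots> = (1 - t) + t * cmod v" using v by (simp add: field_simps)
      also have "\<dots> \<le> 1" using v t mult_left_le[of "cmod v" t] by simp
      finally show ?thesis using pos v by (auto simp: solid_torus_def)
    qed
    have "\<exists>s. parallel Z (\<lambda>y x. T (h (y, 1)) (h (x, 1))) s"
    proof (rule flat_homotopic[OF flat])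
      show "continuous_on (Z \<times> {0..1}) h"
        unfolding h_def case_prod_unfold
      proof (rule continuous_on_compose2[OF closed_embeddingD(1)[OF emb]])
        show "(\<lambda>x. (cis (snd x * fst (fst x)), ((1 - snd x) / cmod (snd (fst x)) + snd x) *\<^sub>R snd (fst x))) ` (Z \<times> {0..1}) \<subseteq> solid_torus"
        proof (rule image_subsetI)
          fix x assume "x \<in> Z \<times> {0..1::real}"
          then have "(fst (fst x), snd (fst x)) \<in> Z" "snd x \<in> {0..1}" by auto
          from hst[OF this] show "(cis (snd x * fst (fst x)), ((1 - snd x) / cmod (snd (fst x)) + snd x) *\<^sub>R snd (fst x)) \<in> solid_torus"
            by blast
        qed
      qed (auto intro!: continuous_intros simp: Z_def)
      show "h ` (Z \<times> {0..1}) \<subseteq> S3 - K"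
      proof
        fix y assume "y \<in> h ` (Z \<times> {0..1})"
        then obtain \<beta> v t where *: "(\<beta>, v) \<in> Z" "t \<in> {0..1}" "y = \<nu> (cis (t * \<beta>), ((1 - t) / cmod v + t) *\<^sub>R v)"
          by (auto simp: h_def)
        show "y \<in> S3 - K" using hst[OF *(1,2)] \<nu>S \<nu>K *(3) by (metis DiffI snd_conv)
      qed
      have "parallel Z (\<lambda>y x. T (\<nu> (1, snd y /\<^sub>R cmod (snd y))) (\<nu> (1, snd x /\<^sub>R cmod (snd x)))) (\<lambda>x. m (snd x /\<^sub>R cmod (snd x)))"
        by (rule parallel_pullback[OF m]) (auto intro!: continuous_intros left_inverse simp: Z_def)
      then show "parallel Z (\<lambda>y x. T (h (y, 0)) (h (x, 0))) (\<lambda>x. m (snd x /\<^sub>R cmod (snd x)))"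
        by (simp add: h_def case_prod_unfold inverse_eq_divide)
    qed
    then show ?thesis by (simp add: h_def p_def case_prod_unfold)
  qed
  then obtain \<sigma> where \<sigma>: "parallel Z (\<lambda>y x. T (p y) (p x)) \<sigma>" by blast
  have \<sigma>0: "\<sigma> z \<noteq> 0" if "z \<in> Z" for z using \<sigma> that by (auto simp: parallel_def)
  have connZ: "connected Z" unfolding Z_def by (intro connected_Times connected_UNIV connected_punctured_ball) simp
  define z0 where "z0 = (0::real, 1 / 2 :: complex)"
  have z0: "z0 \<in> Z" by (simp add: z0_def Z_def)
  define \<kappa> where "\<kappa> = \<sigma> (2 * pi, 1 / 2) / \<sigma> z0"
  have z02: "(2 * pi, 1/2) \<in> Z" by (simp add: Z_def)
  have \<kappa>0: "\<kappa> \<noteq> 0" using \<sigma>0[OF z0] \<sigma>0[OF z02] by (simp add: \<kappa>_def)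
  have per1: "\<sigma> (\<beta> + 2 * pi, v) = \<kappa> * \<sigma> (\<beta>, v)" if "(\<beta>, v) \<in> Z" for \<beta> v
  proof -
    have pp: "p (fst y + 2 * pi, snd y) = p y" for y by (simp add: p_def case_prod_unfold cis.ctr)
    have "parallel Z (\<lambda>y x. T (p (fst y + 2 * pi, snd y)) (p (fst x + 2 * pi, snd x))) (\<lambda>y. \<sigma> (fst y + 2 * pi, snd y))"
      by (rule parallel_pullback[OF \<sigma>, of _ "\<lambda>y. (fst y + 2 * pi, snd y)"]) (auto intro!: continuous_intros simp: Z_def)
    then have "parallel Z (\<lambda>y x. T (p y) (p x)) (\<lambda>y. \<sigma> (fst y + 2 * pi, snd y))" by (simp only: pp)
    from parallel_unique[OF connZ _ \<sigma> this that z0]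
    have "\<sigma> (\<beta>, v) * \<sigma> (2 * pi, 1 / 2) = \<sigma> z0 * \<sigma> (\<beta> + 2 * pi, v)" using flat_nonzero[OF flat] by (simp add: z0_def)
    then show ?thesis using \<sigma>0[OF z0] by (simp add: \<kappa>_def field_simps)
  qed
  define c where "c = Ln \<kappa> / (2 * pi)"
  have expc: "exp (c * (2 * pi)) = \<kappa>" using \<kappa>0 by (simp add: c_def)
  define s where "s = (\<lambda>(\<beta>, v). \<sigma> (\<beta>, v) * exp (- c * of_real \<beta>))"
  have s_per1: "s (\<beta> + 2 * pi, v) = s (\<beta>, v)" if "(\<beta>, v) \<in> Z" for \<beta> v
  proof -
    have "exp (- c * of_real (\<beta> + 2 * pi)) = exp (- c * of_real \<beta>) * exp (- (c * (2 * pi)))"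
      by (simp add: algebra_simps exp_add[symmetric])
    also have "exp (- (c * (2 * pi))) = inverse \<kappa>" using expc by (simp add: exp_minus)
    finally show ?thesis using \<kappa>0 per1[OF that] by (simp add: s_def)
  qed
  have s_pern: "s (\<beta> + 2 * pi * real n, v) = s (\<beta>, v)" if "(\<beta>, v) \<in> Z" for \<beta> v n
  proof (induction n)
    case (Suc n)
    have "s (\<beta> + 2 * pi * real (Suc n), v) = s ((\<beta> + 2 * pi * real n) + 2 * pi, v)" by (simp add: algebra_simps)
    also have "\<dots> = s (\<beta> + 2 * pi * real n, v)" by (rule s_per1) (use that in \<open>simp add: Z_def\<close>)
    finally show ?case using Suc by simp
  qed simp
  have s_cis: "s (\<beta>, v) = s (\<beta>', v)" if "cis \<beta> = cis \<beta>'" "(\<beta>, v) \<in> Z" for \<beta> \<beta>' v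
  proof -
    have "cis (\<beta> - \<beta>') = 1" using that(1) by (simp flip: cis_divide)
    then have "cos (\<beta> - \<beta>') = 1" by (simp add: complex_eq_iff)
    then obtain n :: int where n: "\<beta> - \<beta>' = n * 2 * pi" by (auto simp: cos_one_2pi_int)
    show ?thesis
    proof (cases "n \<ge> 0")
      case True
      then have "\<beta> = \<beta>' + 2 * pi * real (nat n)" using n by (simp add: algebra_simps)
      then show ?thesis using s_pern[of \<beta>' v "nat n"] that(2) by (simp add: Z_def)
    next
      case False
      then have "\<beta>' = \<beta> + 2 * pi * real (nat (- n))" using n by (simp add: algebra_simps)
      then show ?thesis using s_pern[of \<beta> v "nat (- n)"] that(2) by simp
    qed
  qed
  define \<beta> where "\<beta> y = Arg2pi (fst (\<nu>' y))" for y
  define vv where "vv y = snd (\<nu>' y)" for y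
  define uu where "uu y = fst (\<nu>' y)" for y
  have Vst: "\<nu>' y \<in> open_solid_torus" "\<nu> (\<nu>' y) = y" if "y \<in> V" for y
    using that \<nu>inv ost by (auto simp: V_def)
  have uu1: "cmod (uu y) = 1" if "y \<in> V" for y using Vst[OF that] by (auto simp: uu_def open_solid_torus_def)
  have cisb: "cis (\<beta> y) = uu y" if "y \<in> V" for y
    using uu1[OF that] complex_norm_eq_1_exp[of "uu y"] by (simp add: cis_conv_exp \<beta>_def uu_def)
  have V_K: "vv y \<noteq> 0" if "y \<in> V" "y \<notin> K" for y
    using \<nu>K[of "\<nu>' y"] Vst[OF that(1)] ost that(2) by (auto simp: vv_def)
  have VZ: "(b, vv y) \<in> Z" if "y \<in> V" "y \<notin> K" for y b
    using V_K[OF that] Vst[OF that(1)] by (auto simp: Z_def vv_def open_solid_torus_def)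
  have pV: "p (b, vv y) = y" if "y \<in> V" "cis b = uu y" for y b
    using Vst[OF that(1)] that(2) by (simp add: p_def uu_def vv_def)
  have contV: "continuous_on V \<nu>'"
    by (rule continuous_on_subset[OF homeomorphism_cont2[OF \<nu>']]) (use ost in \<open>auto simp: V_def\<close>)
  have contu: "continuous_on V uu" "continuous_on V vv"
    unfolding uu_def vv_def by (intro continuous_intros contV)+
  define g where "g y = (if y \<in> V - K then s (\<beta> y, vv y) else 1)" for y
  have g0: "g y \<noteq> 0" for y using \<sigma>0[OF VZ[of y "\<beta> y"]] by (auto simp: g_def s_def)
  define T' where "T' y x = inverse (g y) * T y x * g x" for y x
  have flat': "flat (S3 - K) T'"
    unfolding flat_def
  proof (intro conjI allI ballI)
    show "T' y x \<noteq> 0" for y x using g0 flat_nonzero[OF flat] by (simp add: T'_def)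
    fix y assume "y \<in> S3 - K"
    then have "\<forall>\<^sub>F x in nbhds_in (S3 - K) y. \<forall>\<^sub>F z in nbhds_in (S3 - K) x. T y z = T y x * T x z"
      using flat by (auto simp: flat_def)
    then show "\<forall>\<^sub>F x in nbhds_in (S3 - K) y. \<forall>\<^sub>F z in nbhds_in (S3 - K) x. T' y z = T' y x * T' x z"
    proof eventually_elim
      case (elim x)
      then show ?case by eventually_elim (use g0 in \<open>simp add: T'_def field_simps\<close>)
    qed
  qed
  \<comment> \<open>Transport by the increment of the longitude angle; \<open>Ln\<close> of the quotient avoids the jump of
    \<open>\<beta>\<close> at \<open>u = 1\<close>.\<close>
  define A where "A y x = exp (- c * of_real (Im (Ln (uu x / uu y))))" for y x
  have nearV: "\<forall>\<^sub>F x in nbhds_in S3 y. x \<in> V \<and> Re (uu x / uu y) > 0" if y: "y \<in> V" for y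
  proof -
    have "continuous_on V (\<lambda>x. uu x / uu y)" using uu1[OF y] by (intro continuous_intros contu) auto
    then have "openin (top_of_set V) (V \<inter> (\<lambda>x. uu x / uu y) -` {z. Re z > 0})"
      by (rule continuous_openin_preimage_gen) (simp add: open_halfspace_Re_gt)
    then have "openin (top_of_set S3) (V \<inter> (\<lambda>x. uu x / uu y) -` {z. Re z > 0})"
      using opV openin_trans unfolding V_def by blast
    then show ?thesis
    proof (rule eventually_nbhds_in_openin)
      have "uu y \<noteq> 0" using uu1[OF y] by auto
      then show "y \<in> V \<inter> (\<lambda>x. uu x / uu y) -` {z. Re z > 0}" using y by simp
    qed auto
  qed
  have nb: "eventually X (nbhds_in (S3 - K) y)" if "eventually X (nbhds_in S3 y)" for X y
    using that by (rule eventually_nbhds_in_subset) auto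
  have T'A: "\<forall>\<^sub>F x in nbhds_in (S3 - K) y. T' y x = A y x" if y: "y \<in> V" "y \<notin> K" for y
  proof -
    define Om where "Om = (V - K) \<inter> {x. Re (uu x / uu y) > 0}"
    define r where "r x = (\<beta> y + Im (Ln (uu x / uu y)), vv x)" for x
    have uy: "cmod (uu y) = 1" "uu y \<noteq> 0" using uu1[OF y(1)] by auto
    have cLn: "continuous_on Om (\<lambda>x. Ln (uu x / uu y))"
    proof (rule continuous_on_compose2[OF continuous_on_Ln[of "{z. Re z > 0}"]])
      show "continuous_on Om (\<lambda>x. uu x / uu y)"
        using uy by (intro continuous_intros continuous_on_subset[OF contu(1)]) (auto simp: Om_def)
    qed (auto simp: Om_def complex_nonpos_Reals_iff)
    have contr: "continuous_on Om r"
      unfolding r_def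
      by (intro continuous_on_Pair continuous_on_add continuous_on_const continuous_on_Im cLn continuous_on_subset[OF contu(2)])
        (auto simp: Om_def)
    have rZ: "r ` Om \<subseteq> Z" using VZ by (auto simp: r_def Om_def)
    have cisr: "cis (fst (r x)) = uu x" if "x \<in> Om" for x
    proof -
      have x: "cmod (uu x) = 1" using uu1 that by (auto simp: Om_def)
      then have q: "uu x / uu y \<noteq> 0" "cmod (uu x / uu y) = 1" using uy by (auto simp: norm_divide)
      have "Re (Ln (uu x / uu y)) = 0" using q by (simp add: Re_Ln)
      then have "Ln (uu x / uu y) = \<i> * of_real (Im (Ln (uu x / uu y)))" by (simp add: complex_eq_iff)
      then have "cis (Im (Ln (uu x / uu y))) = uu x / uu y" using q by (metis cis_conv_exp exp_Ln)
      then show ?thesis using cisb[OF y(1)] uy by (simp add: r_def flip: cis_mult)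
    qed
    have yOm: "y \<in> Om" using y uy by (simp add: Om_def)
    have ry: "r y = (\<beta> y, vv y)" using uy by (simp add: r_def)
    have pr: "p (r x) = x" if "x \<in> Om" for x using pV[of x "fst (r x)"] cisr[OF that] that by (auto simp: Om_def r_def)
    have "parallel Om (\<lambda>a b. T (p (r a)) (p (r b))) (\<lambda>x. \<sigma> (r x))"
      by (rule parallel_pullback[OF \<sigma> contr rZ])
    then have "\<forall>\<^sub>F x in nbhds_in Om y. \<sigma> (r y) = T (p (r y)) (p (r x)) * \<sigma> (r x)" using yOm by (auto simp: parallel_def)
    from eventually_conj[OF this eventually_nbhds_in_mem]
    have ev: "\<forall>\<^sub>F x in nbhds_in Om y. T' y x = A y x"
    proof eventually_elim
      case (elim x)
      then have x: "x \<in> Om" "x \<in> V - K" by (auto simp: Om_def)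
      have eq: "\<sigma> (r y) = T y x * \<sigma> (r x)" using elim pr yOm by auto
      have "g x = s (r x)"
        using x cisr[OF x(1)] cisb[of x] s_cis[of "\<beta> x" "fst (r x)" "vv x"] VZ[of x] by (simp add: g_def r_def)
      moreover have "s (r x) = \<sigma> (r x) * exp (- c * of_real (\<beta> y)) * exp (- c * of_real (Im (Ln (uu x / uu y))))"
        by (simp add: s_def r_def exp_add[symmetric] algebra_simps)
      moreover have "g y = \<sigma> (r y) * exp (- c * of_real (\<beta> y))" using y ry by (simp add: g_def s_def)
      moreover have "\<sigma> (r x) \<noteq> 0" "T y x \<noteq> 0" using \<sigma>0 rZ x flat_nonzero[OF flat] by blast+
      ultimately show ?case unfolding T'_def A_def eq by (simp add: field_simps)
    qed
    have "\<forall>\<^sub>F x in nbhds_in (S3 - K) y. x \<in> Om"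
      using eventually_conj[OF nb[OF nearV[OF y(1)]] eventually_nbhds_in_mem] by eventually_elim (auto simp: Om_def)
    moreover obtain U where U: "open U" "y \<in> U" "\<And>x. x \<in> U \<inter> Om \<Longrightarrow> T' y x = A y x" using ev unfolding eventually_nbhds_in by blast
    moreover have "\<forall>\<^sub>F x in nbhds_in (S3 - K) y. x \<in> U" using U unfolding eventually_nbhds_in by blast
    ultimately show ?thesis by (auto elim: eventually_elim2)
  qed
  \<comment> \<open>The extended cocycle. Inside \<open>V\<close> it has to be \<open>A\<close>, which is defined on the core as well.\<close>
  define TT where "TT y x = (if y \<in> V then A y x else T' y x)" for y x
  have KV: "K \<subseteq> V" unfolding K V_def by (auto simp: open_solid_torus_def)
  have nbK: "nbhds_in (S3 - K) y = nbhds_in S3 y" if "y \<in> S3" "y \<notin> K" for y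
  proof (rule nbhds_in_openin)
    have "compact K" unfolding K
      by (rule compact_continuous_image[OF continuous_on_subset[OF closed_embeddingD(1)[OF emb]]])
        (auto simp: solid_torus_def intro!: compact_Times)
    then have "closed K" by (rule compact_imp_closed)
    then show "openin (top_of_set S3) (S3 - K)" using openin_open_Int[of "- K" S3] by (simp add: Diff_eq open_Compl)
  qed (use that in auto)
  have T'TT: "\<forall>\<^sub>F x in nbhds_in S3 y. T' y x = TT y x" if "y \<in> S3" "y \<notin> K" for y
    using T'A[of y] that unfolding nbK[OF that] TT_def by (cases "y \<in> V") auto
  have flatTT: "flat S3 TT"
    unfolding flat_def
  proof (intro conjI allI ballI)
    show "TT y x \<noteq> 0" for y x using flat_nonzero[OF flat'] by (simp add: TT_def A_def)
    fix y assume y: "y \<in> S3"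
    show "\<forall>\<^sub>F x in nbhds_in S3 y. \<forall>\<^sub>F z in nbhds_in S3 x. TT y z = TT y x * TT x z"
    proof (cases "y \<in> V")
      case True
      from nearV[OF True] show ?thesis
      proof eventually_elim
        case (elim x)
        then have "x \<in> V" by simp
        from nearV[OF this] show ?case
        proof eventually_elim
          case (elim z)
          have "uu x \<noteq> 0" "uu y \<noteq> 0" using uu1[OF True] uu1[OF \<open>x \<in> V\<close>] by auto
          then have "uu z / uu y = (uu x / uu y) * (uu z / uu x)" by simp
          then have "Im (Ln (uu z / uu y)) = Im (Ln (uu x / uu y)) + Im (Ln (uu z / uu x))"
            using Im_Ln_mult_near elim \<open>x \<in> V \<and> 0 < Re (uu x / uu y)\<close> by metis
          then show ?case using True \<open>x \<in> V\<close> by (simp add: TT_def A_def exp_add[symmetric] algebra_simps)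
        qed
      qed
    next
      case False
      then have yK: "y \<notin> K" using KV by blast
      have "\<forall>\<^sub>F x in nbhds_in S3 y. \<forall>\<^sub>F z in nbhds_in (S3 - K) x. T' y z = T' y x * T' x z"
      proof -
        have "y \<in> S3 - K" using y yK by blast
        with flat' have "\<forall>\<^sub>F x in nbhds_in (S3 - K) y. \<forall>\<^sub>F z in nbhds_in (S3 - K) x. T' y z = T' y x * T' x z"
          unfolding flat_def by blast
        then show ?thesis unfolding nbK[OF y yK] .
      qed
      moreover have "\<forall>\<^sub>F x in nbhds_in S3 y. x \<in> S3 - K"
        unfolding nbK[OF y yK, symmetric] by (rule eventually_nbhds_in_mem)
      ultimately show ?thesis
      proof eventually_elim
        case (elim x)
        then have x: "x \<in> S3" "x \<notin> K" by auto
        have "\<forall>\<^sub>F z in nbhds_in S3 x. T' y z = T' y x * T' x z" using elim(1) nbK[OF x] by simp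
        with T'TT[OF x] show ?case by eventually_elim (use False in \<open>simp add: TT_def\<close>)
      qed
    qed
  qed
  obtain q where q: "parallel S3 TT q" using flat_sphere_parallel[OF _ flatTT] by auto
  have "parallel (S3 - K) T (\<lambda>x. g x * q x)"
    unfolding parallel_def
  proof (intro ballI conjI)
    fix y assume y: "y \<in> S3 - K"
    have qy: "q y \<noteq> 0" "\<forall>\<^sub>F x in nbhds_in S3 y. q y = TT y x * q x" using q y by (auto simp: parallel_def)
    show "g y * q y \<noteq> 0" using g0 qy by simp
    have "\<forall>\<^sub>F x in nbhds_in S3 y. g y * q y = T y x * (g x * q x)"
    proof -
      have "\<forall>\<^sub>F x in nbhds_in S3 y. T' y x = TT y x" using T'TT[of y] y by blast
      with qy(2) show ?thesis
      proof eventually_elim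
        case (elim x)
        have "g y * q y = g y * (T' y x * q x)" using elim by simp
        also have "\<dots> = T y x * (g x * q x)" using g0[of y] by (simp add: T'_def)
        finally show ?case .
      qed
    qed
    then show "\<forall>\<^sub>F x in nbhds_in (S3 - K) y. g y * q y = T y x * (g x * q x)" by (rule nb)
  qed
  then show ?thesis by blast
qed

section \<open>Monodromy of cyclic coverings\<close>

text \<open>
  Let \<open>t\<close> correspond to \<open>1\<close> under an isomorphism of the deck group with the integers modulo \<open>k\<close>.
  Every fibre has \<open>k\<close> points and is a single orbit of \<open>t\<close>, so the orbits have full length.
\<close>
lemma regular_cyclic_covering_generator:
  assumes cov: "regular_cyclic_covering k E \<pi> B" and k: "k > 1"
  obtains t where "free_cyclic_action k E t"
    "\<And>y z. y \<in> E \<Longrightarrow> z \<in> E \<Longrightarrow> \<pi> y = \<pi> z \<longleftrightarrow> (\<exists>i. z = (t ^^ i) y)"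
proof -
  have cs: "covering_space E \<pi> B" and card: "\<And>x. x \<in> B \<Longrightarrow> card {y \<in> E. \<pi> y = x} = k"
    and trans: "\<And>y z. y \<in> E \<Longrightarrow> z \<in> E \<Longrightarrow> \<pi> y = \<pi> z \<Longrightarrow> \<exists>s\<in>deck_transformations E \<pi>. s y = z"
    and iso: "deck_group E \<pi> \<cong> integer_mod_group k"
    using cov by (auto simp: regular_cyclic_covering_def)
  have \<pi>B: "\<pi> y \<in> B" if "y \<in> E" for y using covering_space_imp_surjective[OF cs] that by blast
  let ?D = "deck_transformations E \<pi>"
  obtain h where h: "h \<in> iso (deck_group E \<pi>) (integer_mod_group k)" using iso by (auto simp: is_iso_def)
  have bij: "bij_betw h ?D {0..<int k}"
    using h k by (simp add: iso_def deck_group_def integer_mod_group_def)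
  have hmult: "h (compose E s s') = (h s + h s') mod int k" if "s \<in> ?D" "s' \<in> ?D" for s s'
  proof -
    have B: "s \<in> Bij E" if "s \<in> ?D" for s
    proof -
      obtain s' where "homeomorphism E E s s'" "s \<in> extensional E" using \<open>s \<in> ?D\<close> by (auto simp: deck_transformations_def)
      then show ?thesis by (auto simp: Bij_def homeomorphism_def intro!: bij_betw_byWitness[of _ s'])
    qed
    have "h (s \<otimes>\<^bsub>deck_group E \<pi>\<^esub> s') = h s \<otimes>\<^bsub>integer_mod_group k\<^esub> h s'"
      using h that by (auto simp: iso_def hom_def deck_group_def)
    then show ?thesis using B[OF that(1)] B[OF that(2)] k by (simp add: deck_group_def BijGroup_def integer_mod_group_def)
  qed
  define t where "t = inv_into ?D h 1"
  have one: "1 \<in> h ` ?D" using bij k by (auto simp: bij_betw_def)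
  have t: "t \<in> ?D" "h t = 1" unfolding t_def using inv_into_into[OF one] f_inv_into_f[OF one] by auto
  obtain t' where t': "homeomorphism E E t t'" and \<pi>t: "\<And>y. y \<in> E \<Longrightarrow> \<pi> (t y) = \<pi> y"
    using t(1) by (auto simp: deck_transformations_def)
  have tE: "t y \<in> E" if "y \<in> E" for y using t' that by (auto simp: homeomorphism_def)
  have tiE: "(t ^^ i) y \<in> E" "\<pi> ((t ^^ i) y) = \<pi> y" if "y \<in> E" for i y
    using that by (induction i) (auto simp: tE \<pi>t)
  define r where "r i = restrict (t ^^ i) E" for i
  have r: "r i \<in> ?D \<and> h (r i) = int i mod int k" for i
  proof (induction i)
    case 0
    have "homeomorphism E E (r 0) (\<lambda>x. x)" by (rule homeomorphismI) (auto simp: r_def)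
    then have D: "r 0 \<in> ?D" by (auto simp: deck_transformations_def r_def)
    have "compose E (r 0) (r 0) = r 0" by (auto simp: r_def compose_def)
    then have eq: "h (r 0) = (h (r 0) + h (r 0)) mod int k" using hmult[OF D D] by simp
    have rng: "0 \<le> h (r 0)" "h (r 0) < int k" using bij D by (auto dest!: bij_betwE)
    have "h (r 0) = 0"
    proof (cases "h (r 0) + h (r 0) < int k")
      case True
      then have "(h (r 0) + h (r 0)) mod int k = h (r 0) + h (r 0)" using rng by simp
      then show ?thesis using eq by linarith
    next
      case False
      have "(h (r 0) + h (r 0)) mod int k = (h (r 0) + h (r 0) - int k) mod int k" by simp
      also have "\<dots> = h (r 0) + h (r 0) - int k"
        by (rule mod_pos_pos_trivial) (use False rng in linarith)+
      finally show ?thesis using eq rng by linarith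
    qed
    then show ?case using D by simp
  next
    case (Suc i)
    have comp: "r (Suc i) = compose E t (r i)"
      by (auto simp: r_def compose_def)
    obtain ri' where ri': "homeomorphism E E (r i) ri'" using Suc by (auto simp: deck_transformations_def)
    have "homeomorphism E E (t \<circ> r i) (ri' \<circ> t')" by (rule homeomorphism_compose[OF ri' t'])
    then have "homeomorphism E E (r (Suc i)) (ri' \<circ> t')"
      by (rule homeomorphism_cong) (auto simp: r_def)
    then have D: "r (Suc i) \<in> ?D" using tiE[of _ "Suc i"] by (auto simp: deck_transformations_def r_def simp del: funpow.simps)
    have "h (r (Suc i)) = (1 + int i mod int k) mod int k" unfolding comp using hmult[OF t(1), of "r i"] Suc t(2) by simp
    also have "\<dots> = int (Suc i) mod int k" by (simp add: mod_simps)
    finally show ?case using D by simp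
  qed
  have inj: "inj_on h ?D" using bij by (rule bij_betw_imp_inj_on)
  have pow: "\<exists>i<k. \<forall>y\<in>E. s y = (t ^^ i) y" if s: "s \<in> ?D" for s
  proof -
    have hs: "h s \<in> {0..<int k}" using bij s by (auto dest: bij_betwE)
    then have "h (r (nat (h s))) = h s" using r by simp
    moreover have "r (nat (h s)) \<in> ?D" using r by blast
    ultimately have "s = r (nat (h s))" using inj s by (metis inj_onD)
    then have "\<forall>y\<in>E. s y = (t ^^ nat (h s)) y" by (metis r_def restrict_apply')
    then show ?thesis using hs by (intro exI[of _ "nat (h s)"]) auto
  qed
  have per: "(t ^^ k) y = y" if "y \<in> E" for y
  proof -
    have "h (r k) = h (r 0)" using r[of k] r[of 0] by simp
    moreover have "r k \<in> ?D" "r 0 \<in> ?D" using r by blast+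
    ultimately have "r k = r 0" using inj by (metis inj_onD)
    then have "r k y = r 0 y" by simp
    then show ?thesis using that by (simp add: r_def)
  qed
  have orb: "\<exists>i<k. z = (t ^^ i) y" if "y \<in> E" "z \<in> E" "\<pi> y = \<pi> z" for y z
    using trans[OF that] pow that(1) by metis
  have free: "(t ^^ i) y \<noteq> y" if y: "y \<in> E" and i: "0 < i" "i < k" for y i
  proof -
    have "{z \<in> E. \<pi> z = \<pi> y} = (\<lambda>i. (t ^^ i) y) ` {..<k}"
    proof
      show "{z \<in> E. \<pi> z = \<pi> y} \<subseteq> (\<lambda>i. (t ^^ i) y) ` {..<k}"
      proof
        fix z assume "z \<in> {z \<in> E. \<pi> z = \<pi> y}"
        then obtain i where "i < k" "z = (t ^^ i) y" using orb[OF y, of z] by auto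
        then show "z \<in> (\<lambda>i. (t ^^ i) y) ` {..<k}" by blast
      qed
    qed (use tiE[OF y] in auto)
    then have "card ((\<lambda>i. (t ^^ i) y) ` {..<k}) = card {..<k}" using card[OF \<pi>B[OF y]] by simp
    then have "inj_on (\<lambda>i. (t ^^ i) y) {..<k}" by (rule eq_card_imp_inj_on[rotated]) simp
    from inj_onD[OF this, of i 0] show ?thesis using i by auto
  qed
  show ?thesis
  proof
    show "free_cyclic_action k E t"
      by unfold_locales (use k homeomorphism_cont1[OF t'] tE per free in auto)
    show "\<pi> y = \<pi> z \<longleftrightarrow> (\<exists>i. z = (t ^^ i) y)" if "y \<in> E" "z \<in> E" for y z
      using orb[OF that] tiE[OF that(1)] by metis
  qed
qed

text \<open>
  A primitive root of unity \<open>\<zeta>\<close> is used to write the cyclic group multiplicatively inside the complex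
  numbers, so that the monodromy of the covering becomes a flat cocycle.
\<close>
locale cyclic_cover = free_cyclic_action k E t
  for k :: nat and E :: "'a::topological_space set" and t :: "'a \<Rightarrow> 'a" +
  fixes \<pi> :: "'a \<Rightarrow> 'b::topological_space" and B :: "'b set" and \<zeta> :: complex
  assumes cov: "covering_space E \<pi> B"
    and orb: "\<And>y z. y \<in> E \<Longrightarrow> z \<in> E \<Longrightarrow> \<pi> y = \<pi> z \<longleftrightarrow> (\<exists>i. z = (t ^^ i) y)"
    and \<zeta>: "\<zeta> ^ k = 1" "\<And>i. 0 < i \<Longrightarrow> i < k \<Longrightarrow> \<zeta> ^ i \<noteq> 1"
begin

lemma proj_B: "y \<in> E \<Longrightarrow> \<pi> y \<in> B" using covering_space_imp_surjective[OF cov] by blast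

lemma proj_pow: "y \<in> E \<Longrightarrow> \<pi> ((t ^^ i) y) = \<pi> y"
  using orb[of y "(t ^^ i) y"] pow_maps by metis

lemma zeta_mod: "\<zeta> ^ (i mod k) = \<zeta> ^ i"
proof -
  have "\<zeta> ^ i = \<zeta> ^ (k * (i div k) + i mod k)" by simp
  also have "\<dots> = (\<zeta> ^ k) ^ (i div k) * \<zeta> ^ (i mod k)" by (simp only: power_add power_mult)
  finally show ?thesis using \<zeta>(1) by simp
qed

lemma zeta_eq_iff: "\<zeta> ^ i = \<zeta> ^ j \<longleftrightarrow> i mod k = j mod k"
proof
  assume eq: "\<zeta> ^ i = \<zeta> ^ j"
  have "a mod k = b mod k" if "\<zeta> ^ a = \<zeta> ^ b" "a mod k \<le> b mod k" for a b
  proof (rule ccontr)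
    assume ne: "a mod k \<noteq> b mod k"
    have z0: "\<zeta> \<noteq> 0" using \<zeta>(1) k by (metis power_0_left zero_neq_one less_not_refl)
    have "\<zeta> ^ (b mod k) = \<zeta> ^ (a mod k) * \<zeta> ^ (b mod k - a mod k)" using that(2) by (simp flip: power_add)
    moreover have "\<zeta> ^ (b mod k) = \<zeta> ^ (a mod k)" using that(1) zeta_mod by metis
    ultimately have "\<zeta> ^ (b mod k - a mod k) = 1" using z0 by simp
    moreover have "0 < b mod k - a mod k" "b mod k - a mod k < k" using ne that(2) k
      by (auto intro: le_less_trans[OF diff_le_self])
    ultimately show False using \<zeta>(2) by blast
  qed
  then show "i mod k = j mod k" using eq by (metis nle_le)
next
  assume "i mod k = j mod k" then show "\<zeta> ^ i = \<zeta> ^ j" by (metis zeta_mod)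
qed

lemma root_is_zeta_power: "z ^ k = 1 \<Longrightarrow> \<exists>i<k. z = \<zeta> ^ i"
proof -
  assume z: "z ^ k = 1"
  have "inj_on (\<lambda>i. \<zeta> ^ i) {..<k}" by (auto simp: inj_on_def zeta_eq_iff)
  then have c: "card ((\<lambda>i. \<zeta> ^ i) ` {..<k}) = k" by (simp add: card_image)
  have r: "card {z::complex. z ^ k = 1} = k" using card_nth_roots[of 1 k] k by simp
  have "(\<lambda>i. \<zeta> ^ i) ` {..<k} = {z. z ^ k = 1}"
  proof (rule card_subset_eq)
    show "finite {z::complex. z ^ k = 1}" using r k by (metis card.infinite less_not_refl)
    show "(\<lambda>i. \<zeta> ^ i) ` {..<k} \<subseteq> {z. z ^ k = 1}"
      using \<zeta>(1) by (auto simp: power_mult[symmetric] mult.commute) (metis mult.commute power_mult power_one)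
  qed (use c r in simp)
  then show ?thesis using z by blast
qed

text \<open>
  The element of the group that takes \<open>a\<close> to \<open>b\<close>, for two points of one fibre.
\<close>
definition chi :: "'a \<Rightarrow> 'a \<Rightarrow> complex" where
  "chi a b = \<zeta> ^ (SOME i. b = (t ^^ i) a)"

lemma chi_pow:
  assumes "a \<in> E" shows "chi a ((t ^^ i) a) = \<zeta> ^ i"
proof -
  have "(t ^^ i) a = (t ^^ (SOME j. (t ^^ i) a = (t ^^ j) a)) a" by (rule someI[of _ i]) simp
  then show ?thesis unfolding chi_def using pow_eq_iff[OF assms] zeta_eq_iff by metis
qed

lemma chi_cases:
  assumes "a \<in> E" "b \<in> E" "\<pi> a = \<pi> b"
  obtains i where "i < k" "b = (t ^^ i) a" "chi a b = \<zeta> ^ i"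
proof -
  obtain j where "b = (t ^^ j) a" using orb[OF assms(1,2)] assms(3) by blast
  then have "b = (t ^^ (j mod k)) a" using pow_mod[OF assms(1)] by simp
  then show ?thesis using that[of "j mod k"] chi_pow[OF assms(1)] k by auto
qed

lemma chi_mult:
  assumes "a \<in> E" "b \<in> E" "c \<in> E" "\<pi> a = \<pi> b" "\<pi> b = \<pi> c"
  shows "chi a b * chi b c = chi a c"
proof -
  obtain i j where "b = (t ^^ i) a" "chi a b = \<zeta> ^ i" "c = (t ^^ j) b" "chi b c = \<zeta> ^ j"
    using chi_cases[OF assms(1,2,4)] chi_cases[OF assms(2,3,5)] by metis
  moreover from this have "c = (t ^^ (j + i)) a" by (simp add: funpow_add)
  ultimately show ?thesis using chi_pow[OF assms(1), of "j + i"] by (simp add: power_add mult.commute)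
qed

lemma chi_root: "a \<in> E \<Longrightarrow> b \<in> E \<Longrightarrow> \<pi> a = \<pi> b \<Longrightarrow> chi a b ^ k = 1"
  using chi_cases[of a b] \<zeta>(1) by (metis mult.commute power_mult power_one)

lemma chi_refl: "a \<in> E \<Longrightarrow> chi a a = 1" using chi_pow[of a 0] by simp

lemma chi_nonzero: "chi a b \<noteq> 0"
  using \<zeta>(1) k unfolding chi_def by (metis power_0_left power_not_zero zero_neq_one less_not_refl)

lemma chi_inj:
  assumes "a \<in> E" "b \<in> E" "c \<in> E" "\<pi> a = \<pi> b" "\<pi> a = \<pi> c" "chi a b = chi a c"
  shows "b = c"
proof -
  obtain i j where "b = (t ^^ i) a" "chi a b = \<zeta> ^ i" "c = (t ^^ j) a" "chi a c = \<zeta> ^ j"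
    using chi_cases[OF assms(1,2,4)] chi_cases[OF assms(1,3,5)] by metis
  then show ?thesis using assms(6) zeta_eq_iff pow_eq_iff[OF assms(1)] by auto
qed

lemma sheet:
  assumes "e \<in> E"
  obtains u V q where "openin (top_of_set E) u" "e \<in> u" "openin (top_of_set B) V" "\<pi> e \<in> V" "homeomorphism u V \<pi> q"
proof -
  obtain V v where V: "\<pi> e \<in> V" "openin (top_of_set B) V" "\<Union>v = E \<inter> \<pi> -` V"
    "\<forall>u\<in>v. openin (top_of_set E) u" "\<forall>u\<in>v. \<exists>q. homeomorphism u V \<pi> q"
    using cov proj_B[OF assms] unfolding covering_space_def by (metis (no_types, lifting))
  have "e \<in> \<Union>v" unfolding V(3) using V(1) assms by simp
  then obtain u where u: "u \<in> v" "e \<in> u" by (rule UnionE)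
  then show ?thesis using V that by blast
qed

lemma chi_locally_constant:
  assumes g: "continuous_on A g" "g ` A \<subseteq> E" and g': "continuous_on A g'" "g' ` A \<subseteq> E"
    and eq: "\<And>x. x \<in> A \<Longrightarrow> \<pi> (g x) = \<pi> (g' x)" and y: "y \<in> A"
  shows "\<forall>\<^sub>F x in nbhds_in A y. chi (g x) (g' x) = chi (g y) (g' y)"
proof -
  have E: "g x \<in> E" "g' x \<in> E" if "x \<in> A" for x using g g' that by auto
  obtain i where i: "g' y = (t ^^ i) (g y)" "chi (g y) (g' y) = \<zeta> ^ i" using chi_cases[OF E[OF y] eq[OF y]] by metis
  obtain u V q where u: "openin (top_of_set E) u" "g' y \<in> u" "homeomorphism u V \<pi> q" using sheet[OF E(2)[OF y]] by metis
  have ev: "\<forall>\<^sub>F x in nbhds_in E (g' y). x \<in> u" by (rule eventually_nbhds_in_openin[OF u(1,2)])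
  have c: "continuous_on A (\<lambda>x. (t ^^ i) (g x))"
    by (rule continuous_on_compose2[OF pow_cont g(1)]) (use E in auto)
  have "\<forall>\<^sub>F x in nbhds_in A y. g' x \<in> u" by (rule eventually_nbhds_in_compose[OF ev g' y])
  moreover have "\<forall>\<^sub>F x in nbhds_in A y. (t ^^ i) (g x) \<in> u"
    by (rule eventually_nbhds_in_compose[OF _ c _ y]) (use ev i pow_maps E in auto)
  ultimately show ?thesis using eventually_nbhds_in_mem
  proof eventually_elim
    case (elim x)
    have "\<pi> (g' x) = \<pi> ((t ^^ i) (g x))" using eq[OF elim(3)] proj_pow[OF E(1)[OF elim(3)]] by simp
    then have "g' x = (t ^^ i) (g x)" using u(3) elim unfolding homeomorphism_def by metis
    then show ?case using chi_pow[OF E(1)[OF elim(3)]] i by simp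
  qed
qed

lemma chi_constant:
  assumes "connected A" "continuous_on A g" "g ` A \<subseteq> E" "continuous_on A g'" "g' ` A \<subseteq> E"
    and "\<And>x. x \<in> A \<Longrightarrow> \<pi> (g x) = \<pi> (g' x)" "x \<in> A" "y \<in> A"
  shows "chi (g x) (g' x) = chi (g y) (g' y)"
  by (rule connected_eventually_const[OF assms(1) _ assms(7,8)]) (rule chi_locally_constant[OF assms(2-6)])

lemma lifts_differ_by_power:
  assumes "connected A" "continuous_on A g" "g ` A \<subseteq> E" "continuous_on A g'" "g' ` A \<subseteq> E"
    and eq: "\<And>x. x \<in> A \<Longrightarrow> \<pi> (g x) = \<pi> (g' x)" and a: "a \<in> A"
  obtains i where "i < k" "\<And>x. x \<in> A \<Longrightarrow> g' x = (t ^^ i) (g x)"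
proof -
  have E: "g x \<in> E" "g' x \<in> E" if "x \<in> A" for x using assms that by auto
  obtain i where i: "i < k" "chi (g a) (g' a) = \<zeta> ^ i" using chi_cases[OF E[OF a] eq[OF a]] by metis
  have "g' x = (t ^^ i) (g x)" if x: "x \<in> A" for x
  proof (rule chi_inj[OF E[OF x] pow_maps[OF E(1)[OF x]] eq[OF x]])
    show "\<pi> (g x) = \<pi> ((t ^^ i) (g x))" using proj_pow[OF E(1)[OF x]] by simp
    show "chi (g x) (g' x) = chi (g x) ((t ^^ i) (g x))"
      using chi_constant[OF assms(1-5) eq x a] i chi_pow[OF E(1)[OF x]] by simp
  qed
  then show ?thesis using that i by blast
qed

definition pt :: "'b \<Rightarrow> 'a" where "pt x = (SOME y. y \<in> E \<and> \<pi> y = x)"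

definition local_section :: "'b \<Rightarrow> 'b set \<times> ('b \<Rightarrow> 'a) \<Rightarrow> bool" where
  "local_section y p \<longleftrightarrow> openin (top_of_set B) (fst p) \<and> y \<in> fst p \<and> continuous_on (fst p) (snd p) \<and>
     snd p ` fst p \<subseteq> E \<and> (\<forall>x\<in>fst p. \<pi> (snd p x) = x) \<and> snd p y = pt y"

definition sec :: "'b \<Rightarrow> 'b set \<times> ('b \<Rightarrow> 'a)" where "sec y = (SOME p. local_section y p)"

text \<open>
  The covering as a cocycle: choose a point \<open>pt x\<close> in every fibre, and a continuous local section
  through each chosen point. \<open>mon y x\<close> compares the section through \<open>pt y\<close> with the point chosen over
  \<open>x\<close>. The value \<open>1\<close> away from the domain of the section is arbitrary.
\<close>
definition mon :: "'b \<Rightarrow> 'b \<Rightarrow> complex" where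
  "mon y x = (if y \<in> B \<and> x \<in> fst (sec y) then chi (pt x) (snd (sec y) x) else 1)"

lemma pt: "x \<in> B \<Longrightarrow> pt x \<in> E" "x \<in> B \<Longrightarrow> \<pi> (pt x) = x"
proof -
  assume "x \<in> B"
  then have "\<exists>y. y \<in> E \<and> \<pi> y = x" using covering_space_imp_surjective[OF cov] by blast
  then have "pt x \<in> E \<and> \<pi> (pt x) = x" unfolding pt_def by (rule someI_ex)
  then show "pt x \<in> E" "\<pi> (pt x) = x" by auto
qed

lemma local_section: assumes "y \<in> B" shows "local_section y (sec y)"
proof -
  obtain u V q where u: "pt y \<in> u" "openin (top_of_set E) u" "openin (top_of_set B) V" "\<pi> (pt y) \<in> V" "homeomorphism u V \<pi> q"
    using sheet[OF pt(1)[OF assms]] by metis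
  have "local_section y (V, q)"
    unfolding local_section_def fst_conv snd_conv
  proof (intro conjI)
    show "openin (top_of_set B) V" by fact
    show "y \<in> V" using u(4) pt(2)[OF assms] by simp
    show "continuous_on V q" by (rule homeomorphism_cont2[OF u(5)])
    show "q ` V \<subseteq> E" using u(5) openin_imp_subset[OF u(2)] by (auto simp: homeomorphism_def)
    show "\<forall>x\<in>V. \<pi> (q x) = x" using u(5) by (simp add: homeomorphism_def)
    show "q y = pt y" using u(1,5) pt(2)[OF assms] unfolding homeomorphism_def by metis
  qed
  then show ?thesis unfolding sec_def by (rule someI)
qed

lemma section_near:
  assumes "y \<in> B"
  shows "openin (top_of_set B) (fst (sec y))" "y \<in> fst (sec y)" "continuous_on (fst (sec y)) (snd (sec y))"
    "x \<in> fst (sec y) \<Longrightarrow> snd (sec y) x \<in> E" "x \<in> fst (sec y) \<Longrightarrow> \<pi> (snd (sec y) x) = x" "snd (sec y) y = pt y"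
  using local_section[OF assms] unfolding local_section_def by auto

lemma section_B: "y \<in> B \<Longrightarrow> x \<in> fst (sec y) \<Longrightarrow> x \<in> B"
  using section_near(1) openin_imp_subset by blast

lemma mon_root: "mon y x ^ k = 1"
proof (cases "y \<in> B \<and> x \<in> fst (sec y)")
  case True
  then have y: "y \<in> B" and x: "x \<in> fst (sec y)" by auto
  then have xB: "x \<in> B" by (rule section_B)
  show ?thesis using True chi_root[OF pt(1)[OF xB] section_near(4)[OF y x]] pt(2)[OF xB] section_near(5)[OF y x]
    by (simp add: mon_def)
qed (auto simp: mon_def)

lemma mon_flat: "flat B mon"
  unfolding flat_def
proof (intro conjI allI ballI)
  show "mon y x \<noteq> 0" for y x using mon_root[of y x] k by (metis power_0_left zero_neq_one less_not_refl)
  fix y assume y: "y \<in> B"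
  have "\<forall>\<^sub>F x in nbhds_in B y. x \<in> fst (sec y)" by (rule eventually_nbhds_in_openin[OF section_near(1,2)[OF y]])
  then show "\<forall>\<^sub>F x in nbhds_in B y. \<forall>\<^sub>F z in nbhds_in B x. mon y z = mon y x * mon x z"
  proof eventually_elim
    case (elim x)
    have x: "x \<in> B" using section_B[OF y elim] .
    define A where "A = fst (sec y) \<inter> fst (sec x)"
    have opA: "openin (top_of_set B) A" unfolding A_def by (intro openin_Int section_near(1) x y)
    have xA: "x \<in> A" using elim section_near(2)[OF x] by (simp add: A_def)
    have ev: "\<forall>\<^sub>F z in nbhds_in A x. chi (snd (sec x) z) (snd (sec y) z) = chi (snd (sec x) x) (snd (sec y) x)"
      by (rule chi_locally_constant[OF _ _ _ _ _ xA])
        (auto simp: A_def section_near[OF x] section_near[OF y] intro: continuous_on_subset[OF section_near(3)[OF x]] continuous_on_subset[OF section_near(3)[OF y]])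
    have nb: "nbhds_in A x = nbhds_in B x" by (rule nbhds_in_openin[OF opA xA])
    have evA: "\<forall>\<^sub>F z in nbhds_in B x. z \<in> A" by (rule eventually_nbhds_in_openin[OF opA xA])
    from ev have "\<forall>\<^sub>F z in nbhds_in B x. z \<in> A \<and> chi (snd (sec x) z) (snd (sec y) z) = chi (snd (sec x) x) (snd (sec y) x)"
      unfolding nb using eventually_conj[OF evA] by blast
    then show ?case
    proof eventually_elim
      case (elim z)
      then have z: "z \<in> fst (sec y)" "z \<in> fst (sec x)" by (auto simp: A_def)
      have zB: "z \<in> B" by (rule section_B[OF y z(1)])
      have "mon y z = chi (pt z) (snd (sec x) z) * chi (snd (sec x) z) (snd (sec y) z)"
        using y z chi_mult[OF pt(1)[OF zB] section_near(4)[OF x z(2)] section_near(4)[OF y z(1)]]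
          pt(2)[OF zB] section_near(5)[OF x z(2)] section_near(5)[OF y z(1)] by (simp add: mon_def)
      also have "chi (snd (sec x) z) (snd (sec y) z) = mon y x"
        using elim y \<open>x \<in> fst (sec y)\<close> section_near(6)[OF x] by (simp add: mon_def)
      also have "chi (pt z) (snd (sec x) z) = mon x z" using x z by (simp add: mon_def)
      finally show ?case by (simp add: mult.commute)
    qed
  qed
qed

lemma near_section:
  assumes f: "continuous_on A f" "f ` A \<subseteq> B" and y: "y \<in> A"
  obtains U where "openin (top_of_set A) U" "y \<in> U" "\<forall>x\<in>U. f x \<in> fst (sec (f y))"
    "continuous_on U (\<lambda>x. snd (sec (f y)) (f x))"
proof -
  have fy: "f y \<in> B" using f y by auto
  define U where "U = A \<inter> f -` fst (sec (f y))"
  have "openin (top_of_set A) U" unfolding U_def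
    by (rule continuous_openin_preimage[OF f(1) _ section_near(1)[OF fy]]) (use f in auto)
  moreover have "continuous_on U (\<lambda>x. snd (sec (f y)) (f x))"
    by (rule continuous_on_compose2[OF section_near(3)[OF fy] continuous_on_subset[OF f(1)]]) (auto simp: U_def)
  ultimately show ?thesis using that[of U] y section_near(2)[OF fy] by (auto simp: U_def)
qed

text \<open>
  A lift of a map to the covering is the same as a parallel section of the pulled back monodromy
  cocycle with values in the roots of unity; the next lemma is the converse.
\<close>
lemma lift_parallel:
  assumes g: "continuous_on A g" "g ` A \<subseteq> E" and f: "continuous_on A f" "\<And>a. a \<in> A \<Longrightarrow> \<pi> (g a) = f a"
  shows "parallel A (\<lambda>y x. mon (f y) (f x)) (\<lambda>a. chi (g a) (pt (f a)))"
  unfolding parallel_def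
proof (intro ballI conjI)
  fix y assume y: "y \<in> A"
  show "chi (g y) (pt (f y)) \<noteq> 0" by (rule chi_nonzero)
  have gE: "g x \<in> E" if "x \<in> A" for x using g that by auto
  have fB: "f ` A \<subseteq> B" using f(2) proj_B gE by force
  obtain U where U0: "openin (top_of_set A) U" "y \<in> U" "\<forall>x\<in>U. f x \<in> fst (sec (f y))"
    "continuous_on U (\<lambda>x. snd (sec (f y)) (f x))" by (rule near_section[OF f(1) fB y]) (rule that)
  note U = U0(1,2) bspec[OF U0(3)] U0(4)
  have fy: "f y \<in> B" using fB y by auto
  have UA: "U \<subseteq> A" using U(1) openin_imp_subset by blast
  have "\<forall>\<^sub>F x in nbhds_in U y. chi (g x) (snd (sec (f y)) (f x)) = chi (g y) (snd (sec (f y)) (f y))"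
    by (rule chi_locally_constant[OF continuous_on_subset[OF g(1) UA] _ U(4) _ _ U(2)])
      (use UA gE U(3) section_near[OF fy] f(2) in auto)
  moreover have "\<forall>\<^sub>F x in nbhds_in A y. x \<in> U" by (rule eventually_nbhds_in_openin[OF U(1,2)])
  ultimately have "\<forall>\<^sub>F x in nbhds_in A y. x \<in> U \<and> chi (g x) (snd (sec (f y)) (f x)) = chi (g y) (snd (sec (f y)) (f y))"
    unfolding nbhds_in_openin[OF U(1,2)] by (simp add: eventually_conj_iff)
  then show "\<forall>\<^sub>F x in nbhds_in A y. chi (g y) (pt (f y)) = mon (f y) (f x) * chi (g x) (pt (f x))"
  proof eventually_elim
    case (elim x)
    then have x: "x \<in> A" "f x \<in> fst (sec (f y))" using UA U(3) by auto
    have xB: "f x \<in> B" using x(1) fB by auto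
    have "chi (g x) (pt (f x)) * chi (pt (f x)) (snd (sec (f y)) (f x)) = chi (g x) (snd (sec (f y)) (f x))"
      by (rule chi_mult) (use gE x xB pt section_near[OF fy] f(2) in auto)
    then show ?case using elim x fy section_near(6)[OF fy] by (simp add: mon_def mult.commute)
  qed
qed

text \<open>
  The value \<open>s a\<close> prescribes the position of the lift \<open>g a\<close> in the fibre, relative to the chosen
  point. Near \<open>y\<close>, parallelism of \<open>s\<close> makes \<open>g\<close> a fixed power of \<open>t\<close> applied to a continuous local
  section.
\<close>
lemma parallel_lift:
  assumes f: "continuous_on A f" "f ` A \<subseteq> B" and s: "parallel A (\<lambda>y x. mon (f y) (f x)) s"
    and root: "\<And>a. a \<in> A \<Longrightarrow> s a ^ k = 1"
  obtains g where "continuous_on A g" "g ` A \<subseteq> E" "\<And>a. a \<in> A \<Longrightarrow> \<pi> (g a) = f a"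
proof -
  have fB: "f a \<in> B" if "a \<in> A" for a using f that by auto
  have "\<exists>y. y \<in> E \<and> \<pi> y = f a \<and> chi y (pt (f a)) = s a" if a: "a \<in> A" for a
  proof -
    have "(inverse (s a)) ^ k = 1" using root[OF a] by (simp add: power_inverse)
    then obtain i where i: "inverse (s a) = \<zeta> ^ i" using root_is_zeta_power by blast
    let ?y = "(t ^^ i) (pt (f a))"
    have y: "?y \<in> E" "\<pi> ?y = f a" using pow_maps proj_pow pt fB[OF a] by auto
    have "chi (pt (f a)) ?y * chi ?y (pt (f a)) = 1"
      using chi_mult[of "pt (f a)" ?y "pt (f a)"] y pt fB[OF a] chi_refl by auto
    then have "inverse (s a) * chi ?y (pt (f a)) = 1" using chi_pow pt fB[OF a] i by auto
    moreover have "s a \<noteq> 0" using s a by (auto simp: parallel_def)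
    ultimately show ?thesis using y by (intro exI[of _ ?y]) (simp add: field_simps)
  qed
  then obtain g where g: "\<And>a. a \<in> A \<Longrightarrow> g a \<in> E \<and> \<pi> (g a) = f a \<and> chi (g a) (pt (f a)) = s a" by metis
  have "continuous_on A g"
    unfolding continuous_on_def
  proof
    fix y assume y: "y \<in> A"
    obtain U where U0: "openin (top_of_set A) U" "y \<in> U" "\<forall>x\<in>U. f x \<in> fst (sec (f y))"
      "continuous_on U (\<lambda>x. snd (sec (f y)) (f x))" by (rule near_section[OF f y]) (rule that)
  note U = U0(1,2) bspec[OF U0(3)] U0(4)
    let ?q = "\<lambda>x. snd (sec (f y)) (f x)"
    have fy: "f y \<in> B" by (rule fB[OF y])
    have UA: "U \<subseteq> A" using U(1) openin_imp_subset by blast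
    have q: "?q x \<in> E" "\<pi> (?q x) = f x" if "x \<in> U" for x using section_near(4,5)[OF fy U(3)[OF that]] by auto
    obtain i where i: "g y = (t ^^ i) (?q y)" "chi (?q y) (g y) = \<zeta> ^ i"
      using chi_cases[of "?q y" "g y"] q[OF U(2)] g[OF y] by metis
    have "\<forall>\<^sub>F x in nbhds_in A y. s y = mon (f y) (f x) * s x" using s y by (auto simp: parallel_def)
    moreover have "\<forall>\<^sub>F x in nbhds_in A y. x \<in> U" by (rule eventually_nbhds_in_openin[OF U(1,2)])
    ultimately have ev: "\<forall>\<^sub>F x in nbhds_in A y. g x = (t ^^ i) (?q x)"
    proof eventually_elim
      case (elim x)
      then have x: "x \<in> U" "x \<in> A" using UA by auto
      have gq: "chi (g z) (?q z) = chi (g z) (pt (f z)) * chi (pt (f z)) (?q z)" if "z \<in> U" for z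
        by (rule chi_mult[symmetric]) (use g q pt fB UA that in auto)
      have "chi (g x) (?q x) = s x * mon (f y) (f x)" using gq[OF x(1)] g[OF x(2)] U(3)[OF x(1)] fy by (simp add: mon_def)
      also have "\<dots> = chi (g y) (?q y)"
        using gq[OF U(2)] g[OF y] section_near(6)[OF fy] chi_refl pt fy elim by (simp add: mult.commute)
      finally have eq: "chi (g x) (?q x) = chi (g y) (?q y)" .
      have inv: "chi (?q z) (g z) * chi (g z) (?q z) = 1" if "z \<in> U" for z
        using chi_mult[of "?q z" "g z" "?q z"] q[OF that] g[of z] that UA chi_refl by auto
      have "chi (?q x) (g x) = chi (?q y) (g y)"
        using inv[OF x(1)] inv[OF U(2)] eq by (metis mult_right_cancel mult_zero_right zero_neq_one)
      then have "chi (?q x) (g x) = chi (?q x) ((t ^^ i) (?q x))" using i chi_pow q[OF x(1)] by simp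
      then show ?case
        by (rule chi_inj[rotated 5]) (use q[OF x(1)] g[OF x(2)] pow_maps proj_pow in auto)
    qed
    have "continuous_on U (\<lambda>x. (t ^^ i) (?q x))"
      by (rule continuous_on_compose2[OF pow_cont U(4)]) (use q in auto)
    then have lim: "((\<lambda>x. (t ^^ i) (?q x)) \<longlongrightarrow> (t ^^ i) (?q y)) (at y within U)" using U(2) by (auto simp: continuous_on_def)
    obtain W where W: "open W" "U = A \<inter> W" using U(1) by (auto simp: openin_open)
    have "at y within U = at y within A"
      using W U(2) by (intro at_within_nhd[of y W]) auto
    then have "((\<lambda>x. (t ^^ i) (?q x)) \<longlongrightarrow> g y) (at y within A)" using lim i by simp
    moreover have "\<forall>\<^sub>F x in at y within A. (t ^^ i) (?q x) = g x"
      using ev unfolding nbhds_in_def eventually_inf_principal eventually_at_filter by (elim eventually_mono) auto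
    ultimately show "(g \<longlongrightarrow> g y) (at y within A)" by (rule Lim_transform_eventually)
  qed
  then show ?thesis using that g by blast
qed

end

section \<open>Branched cyclic coverings\<close>

lemma primitive_root_cis:
  assumes "k > 0"
  shows "cis (2 * pi / k) ^ k = 1" "\<And>i. 0 < i \<Longrightarrow> i < k \<Longrightarrow> cis (2 * pi / k) ^ i \<noteq> 1"
proof -
  show "cis (2 * pi / k) ^ k = 1" using assms by (simp add: Complex.DeMoivre)
  fix i assume i: "0 < i" "i < k"
  have "cis (2 * pi / k) ^ i = cis (real i * (2 * pi / k))" by (rule Complex.DeMoivre)
  also have "\<dots> = exp (2 * of_real pi * \<i> * of_nat i / of_nat k)"
    unfolding cis_conv_exp by (rule arg_cong[where f = exp]) (simp add: field_simps)
  finally show "cis (2 * pi / k) ^ i \<noteq> 1"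
    using complex_root_unity_eq_1[of k i] i by (auto dest: dvd_imp_le)
qed

lemma tubular_core_iff:
  assumes "tubular_nbhd X K \<nu>" "z \<in> solid_torus"
  shows "\<nu> z \<in> K \<longleftrightarrow> snd z = 0"
proof -
  have emb: "closed_embedding solid_torus X \<nu>" and K: "K = \<nu> ` (sphere 0 1 \<times> {0})" using assms by (auto simp: tubular_nbhd_def)
  have sub: "sphere 0 1 \<times> {0} \<subseteq> solid_torus" by (auto simp: solid_torus_def)
  have "\<nu> z \<in> K \<longleftrightarrow> z \<in> sphere 0 1 \<times> {0}"
    unfolding K using closed_embeddingD(2)[OF emb] assms(2) sub by (auto simp: inj_on_image_mem_iff)
  then show ?thesis using assms(2) by (cases z) (auto simp: solid_torus_def)
qed

locale branched_setup =
  fixes k :: nat and X :: "'a::topological_space set" and \<pi> :: "'a \<Rightarrow> real ^ 4" and K \<nu> \<mu>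
  assumes k1: "k > 1" and branched: "branched_cyclic_cover k X \<pi> K"
    and nbhd: "branch_tubular_nbhd k X \<pi> K \<nu> \<mu>" and tub: "tubular_nbhd S3 K \<nu>"
begin

abbreviation "E \<equiv> X - \<pi> -` K"

lemma regular: "regular_cyclic_covering k E \<pi> (S3 - K)"
  and contX: "continuous_on X \<pi>" and imX: "\<pi> ` X = S3" and HX: "Hausdorff_space (top_of_set X)"
  using branched by (auto simp: branched_cyclic_cover_def)

lemma connE: "connected E" and covE: "covering_space E \<pi> (S3 - K)"
  and card_fibre: "x \<in> S3 - K \<Longrightarrow> card {y \<in> E. \<pi> y = x} = k"
  using regular by (auto simp: regular_cyclic_covering_def)

lemma connB: "connected (S3 - K)"
  using connected_continuous_image[OF covering_space_imp_continuous[OF covE] connE] covering_space_imp_surjective[OF covE] by simp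

lemma emb\<nu>: "closed_embedding solid_torus S3 \<nu>" using tub by (simp add: tubular_nbhd_def)

lemma emb\<mu>: "closed_embedding solid_torus X \<mu>" and op\<mu>: "openin (top_of_set X) (\<mu> ` open_solid_torus)"
  and tub\<mu>: "tubular_nbhd X (X \<inter> \<pi> -` K) \<mu>"
  using nbhd by (auto simp: branch_tubular_nbhd_def tubular_nbhd_def)

lemma proj_\<mu>: "(u, w) \<in> solid_torus \<Longrightarrow> \<pi> (\<mu> (u, w)) = \<nu> (u, w ^ k)"
  using nbhd by (auto simp: branch_tubular_nbhd_def)

lemma power_solid: "(u, w) \<in> solid_torus \<Longrightarrow> (u, w ^ k) \<in> solid_torus"
  by (auto simp: solid_torus_def norm_power power_le_one)

lemma \<mu>_X: "z \<in> solid_torus \<Longrightarrow> \<mu> z \<in> X" using closed_embeddingD(3)[OF emb\<mu>] by blast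
lemma \<nu>_S3: "z \<in> solid_torus \<Longrightarrow> \<nu> z \<in> S3" using closed_embeddingD(3)[OF emb\<nu>] by blast
lemma \<mu>_inj: "z \<in> solid_torus \<Longrightarrow> z' \<in> solid_torus \<Longrightarrow> \<mu> z = \<mu> z' \<longleftrightarrow> z = z'"
  using closed_embeddingD(2)[OF emb\<mu>] by (simp add: inj_on_eq_iff)
lemma \<nu>_inj: "z \<in> solid_torus \<Longrightarrow> z' \<in> solid_torus \<Longrightarrow> \<nu> z = \<nu> z' \<longleftrightarrow> z = z'"
  using closed_embeddingD(2)[OF emb\<nu>] by (simp add: inj_on_eq_iff)

lemma \<mu>_E: "z \<in> solid_torus \<Longrightarrow> \<mu> z \<in> E \<longleftrightarrow> snd z \<noteq> 0"
  using tubular_core_iff[OF tub\<mu>] \<mu>_X by blast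

text \<open>
  Off the knot, both the fibre and the set of \<open>k\<close>-th roots of \<open>y\<close> have \<open>k\<close> elements. So the preimage
  of the tubular neighbourhood of the knot is the tubular neighbourhood of the branch set.
\<close>
lemma fibre_over_nbhd:
  assumes e: "e \<in> X" "\<pi> e = \<nu> (u, y)" and uy: "(u, y) \<in> solid_torus"
  shows "\<exists>w. w ^ k = y \<and> (u, w) \<in> solid_torus \<and> e = \<mu> (u, w)"
proof (cases "y = 0")
  case True
  then have "\<pi> e \<in> K" using tubular_core_iff[OF tub uy] e(2) by simp
  then have "e \<in> \<mu> ` (sphere 0 1 \<times> {0})" using tub\<mu> e(1) by (auto simp: tubular_nbhd_def)
  then obtain u' where u': "u' \<in> sphere 0 1" "e = \<mu> (u', 0)" by auto
  have st: "(u', 0) \<in> solid_torus" using u' by (simp add: solid_torus_def)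
  then have "\<nu> (u', 0) = \<nu> (u, y)" using proj_\<mu>[OF st] e(2) u' k1 by (simp add: power_0_left)
  then have "u' = u" using \<nu>_inj[OF st uy] by simp
  then show ?thesis using True u' st k1 by (intro exI[of _ 0]) (simp add: power_0_left)
next
  case False
  let ?W = "{w. w ^ k = y}"
  have cW: "card ?W = k" using card_nth_roots[OF False, of k] k1 by simp
  have W: "(u, w) \<in> solid_torus" "w \<noteq> 0" if "w ^ k = y" for w
  proof -
    have "cmod w ^ k \<le> 1" using that uy by (auto simp: solid_torus_def norm_power[symmetric])
    then have "cmod w \<le> 1" using k1 by (metis linorder_not_le one_less_power order_less_imp_le less_trans zero_less_one not_le)
    then show "(u, w) \<in> solid_torus" using uy by (simp add: solid_torus_def)
    show "w \<noteq> 0" using that False k1 by (auto simp: power_0_left)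
  qed
  have inj: "inj_on (\<lambda>w. \<mu> (u, w)) ?W" using W \<mu>_inj by (auto simp: inj_on_def)
  have nyK: "\<nu> (u, y) \<in> S3 - K" using tubular_core_iff[OF tub uy] \<nu>_S3[OF uy] False by simp
  have "(\<lambda>w. \<mu> (u, w)) ` ?W = {z \<in> E. \<pi> z = \<nu> (u, y)}"
  proof (rule card_subset_eq)
    show "finite {z \<in> E. \<pi> z = \<nu> (u, y)}" using card_fibre[OF nyK] k1 by (metis card.infinite not_one_less_zero)
    show "card ((\<lambda>w. \<mu> (u, w)) ` ?W) = card {z \<in> E. \<pi> z = \<nu> (u, y)}"
      using card_fibre[OF nyK] card_image[OF inj] cW by simp
    show "(\<lambda>w. \<mu> (u, w)) ` ?W \<subseteq> {z \<in> E. \<pi> z = \<nu> (u, y)}"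
    proof (rule image_subsetI)
      fix w assume "w \<in> ?W"
      then have w: "w ^ k = y" by simp
      have "\<mu> (u, w) \<in> E" using \<mu>_E[OF W(1)[OF w]] W(2)[OF w] by simp
      then show "\<mu> (u, w) \<in> {z \<in> E. \<pi> z = \<nu> (u, y)}" using proj_\<mu>[OF W(1)[OF w]] w by blast
    qed
  qed
  moreover have "e \<in> {z \<in> E. \<pi> z = \<nu> (u, y)}" using e nyK by auto
  ultimately show ?thesis using W by blast
qed

definition "punctured = sphere (0::complex) 1 \<times> (cball (0::complex) 1 - {0})"

lemma punctured: "punctured \<subseteq> solid_torus" "connected punctured" "z \<in> punctured \<Longrightarrow> snd z \<noteq> 0"
  "z \<in> solid_torus \<Longrightarrow> snd z \<noteq> 0 \<Longrightarrow> z \<in> punctured"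
proof -
  have "connected (cball (0::complex) 1 - {0})"
    by (rule connected_punctured_convex) (auto simp: aff_dim_cball)
  then show "connected punctured" unfolding punctured_def by (intro connected_Times connected_sphere) auto
qed (auto simp: punctured_def solid_torus_def)

text \<open>
  Both \<open>t \<circ> \<mu>\<close> and a rotation by the root of unity \<open>\<xi>\<close> that \<open>t\<close> realises at one point lift the
  same map from the connected punctured solid torus. Since \<open>t\<close> acts freely, \<open>\<xi>\<close> is a primitive root.
\<close>
lemma rotation:
  obtains t \<xi> where "cyclic_cover k E t \<pi> (S3 - K) \<xi>"
    "\<forall>u w. (u, w) \<in> solid_torus \<longrightarrow> w \<noteq> 0 \<longrightarrow> t (\<mu> (u, w)) = \<mu> (u, \<xi> * w)" "cmod \<xi> = 1"
proof -
  obtain t where act: "free_cyclic_action k E t"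
    and orb: "\<And>y z. y \<in> E \<Longrightarrow> z \<in> E \<Longrightarrow> \<pi> y = \<pi> z \<longleftrightarrow> (\<exists>i. z = (t ^^ i) y)"
    by (rule regular_cyclic_covering_generator[OF regular k1]) blast
  interpret free_cyclic_action k E t by fact
  interpret c: cyclic_cover k E t \<pi> "S3 - K" "cis (2 * pi / k)"
    by unfold_locales (use covE orb primitive_root_cis k in auto)
  have one: "(1, 1) \<in> solid_torus" by (simp add: solid_torus_def)
  have m1: "\<mu> (1, 1) \<in> E" using \<mu>_E[OF one] by simp
  have "\<pi> (t (\<mu> (1, 1))) = \<nu> (1, 1)" using c.proj_pow[OF m1, of 1] proj_\<mu>[OF one] by simp
  moreover have "t (\<mu> (1, 1)) \<in> X" using maps m1 by blast
  ultimately obtain \<xi> where \<xi>: "\<xi> ^ k = 1" "t (\<mu> (1, 1)) = \<mu> (1, \<xi>)" using fibre_over_nbhd[OF _ _ one] by metis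
  have "cmod \<xi> ^ k = 1" using \<xi>(1) by (metis norm_one norm_power)
  then have n\<xi>: "cmod \<xi> = 1" using power_eq_iff_eq_base[of k "cmod \<xi>" 1] k by simp
  have st: "(u, \<xi> * w) \<in> solid_torus" if "(u, w) \<in> solid_torus" for u w using that n\<xi> by (simp add: solid_torus_def norm_mult)
  have \<xi>0: "\<xi> \<noteq> 0" using n\<xi> by auto
  have E1: "\<mu> z \<in> E" if "z \<in> punctured" for z using \<mu>_E punctured(1,3) that by blast
  have E2: "\<mu> (fst z, \<xi> * snd z) \<in> E" if "z \<in> punctured" for z
  proof -
    have "(fst z, \<xi> * snd z) \<in> solid_torus" using st[of "fst z" "snd z"] punctured(1) that by auto
    then show ?thesis using \<mu>_E[of "(fst z, \<xi> * snd z)"] punctured(3)[OF that] \<xi>0 by simp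
  qed
  have pun1: "(1, 1) \<in> punctured" by (simp add: punctured_def)
  have c1: "continuous_on punctured \<mu>" by (rule continuous_on_subset[OF closed_embeddingD(1)[OF emb\<mu>] punctured(1)])
  have c2: "continuous_on punctured (\<lambda>z. \<mu> (fst z, \<xi> * snd z))"
    by (rule continuous_on_compose2[OF closed_embeddingD(1)[OF emb\<mu>]])
      (use st punctured(1) in \<open>auto intro!: continuous_intros\<close>)
  have pe: "\<pi> (\<mu> z) = \<pi> (\<mu> (fst z, \<xi> * snd z))" if "z \<in> punctured" for z
  proof -
    obtain u w where z: "z = (u, w)" by fastforce
    then have uw: "(u, w) \<in> solid_torus" using that punctured(1) by auto
    show ?thesis using proj_\<mu>[OF uw] proj_\<mu>[OF st[OF uw]] \<xi>(1) z by (simp add: power_mult_distrib)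
  qed
  have sub: "\<mu> ` punctured \<subseteq> E" "(\<lambda>z. \<mu> (fst z, \<xi> * snd z)) ` punctured \<subseteq> E"
    by (rule image_subsetI, erule E1) (rule image_subsetI, erule E2)
  obtain i where i: "i < k" "\<And>z. z \<in> punctured \<Longrightarrow> \<mu> (fst z, \<xi> * snd z) = (t ^^ i) (\<mu> z)"
    by (rule c.lifts_differ_by_power[OF punctured(2) c1 sub(1) c2 sub(2) pe pun1]) blast+
  have "(t ^^ i) (\<mu> (1, 1)) = (t ^^ 1) (\<mu> (1, 1))" using i(2)[OF pun1] \<xi>(2) by simp
  then have im: "i mod k = 1 mod k" using pow_eq_iff[OF m1] by blast
  have rot: "t (\<mu> (u, w)) = \<mu> (u, \<xi> * w)" if uw: "(u, w) \<in> solid_torus" "w \<noteq> 0" for u w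
  proof -
    have z: "(u, w) \<in> punctured" using punctured(4)[OF uw(1)] uw(2) by simp
    have "(t ^^ i) (\<mu> (u, w)) = (t ^^ 1) (\<mu> (u, w))" using pow_eq_iff[OF E1[OF z]] im by blast
    then show ?thesis using i(2)[OF z] by simp
  qed
  have roti: "(t ^^ j) (\<mu> (1, 1)) = \<mu> (1, \<xi> ^ j)" for j
  proof (induction j)
    case (Suc j)
    have "(1, \<xi> ^ j) \<in> solid_torus" using n\<xi> by (simp add: solid_torus_def norm_power)
    from rot[OF this] show ?case using Suc \<xi>0 by simp
  qed simp
  have "\<xi> ^ j \<noteq> 1" if "0 < j" "j < k" for j
    using roti[of j] free[OF m1 that] by auto
  then have "cyclic_cover k E t \<pi> (S3 - K) \<xi>"
    by unfold_locales (use covE orb \<xi>(1) in auto)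
  then show ?thesis using that rot n\<xi> by blast
qed

end

text \<open>
  Read additively: if \<open>c d = -1\<close> modulo the order of \<open>\<omega>\<close>, then \<open>d b = 0\<close> implies \<open>b = 0\<close>.
\<close>
lemma power_root_exponent:
  fixes \<omega> :: complex
  assumes \<omega>: "\<omega> \<noteq> 0" and \<rho>: "\<rho> ^ d = inverse \<omega>" "\<rho> = \<omega> ^ c" and x: "x = \<omega> ^ b" "x ^ d = 1"
  shows "x = 1"
proof -
  have "x ^ (c * d) = (\<omega> ^ b) ^ (c * d)" by (simp add: x)
  also have "\<dots> = ((\<omega> ^ c) ^ d) ^ b" by (simp add: power_mult[symmetric] mult_ac)
  also have "\<dots> = inverse x" using \<rho> by (simp add: x power_inverse)
  finally have "inverse x = (x ^ d) ^ c" by (simp add: power_mult[symmetric] mult.commute)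
  then have "inverse x = 1" using x(2) by simp
  then show ?thesis by simp
qed

text \<open>
  A solid torus lifts to the covering as soon as its core has trivial monodromy. To see that the
  core has, compare the covering with the cocycle \<open>T\<close> of the Seifert surface \<open>F\<close>, which takes the
  primitive root \<open>\<omega>\<close> when \<open>F\<close> is crossed. The covering has monodromy \<open>\<omega>\<close> along the meridian, and \<open>T\<close>
  has some monodromy \<open>\<omega>\<^sup>d\<close> there. Hence \<open>D = mon\<^sup>d / T\<close> has none, and is trivial on the knot
  complement by \<open>extend_over_core\<close>. Applied to the loop that crosses \<open>F\<close> once, this says that \<open>d\<close> is
  invertible modulo \<open>k\<close>; applied to the core, which avoids \<open>F\<close>, that the \<open>d\<close>-th power of its
  monodromy is \<open>1\<close>.
\<close>
lemma (in branched_setup) lift_over_knot: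
  assumes cc: "cyclic_cover k E t \<pi> (S3 - K) \<xi>" and F: "seifert_surface F K"
    and rot: "\<forall>u w. (u, w) \<in> solid_torus \<longrightarrow> w \<noteq> 0 \<longrightarrow> t (\<mu> (u, w)) = \<mu> (u, \<xi> * w)" "cmod \<xi> = 1"
    and \<theta>: "continuous_on solid_torus \<theta>" "\<theta> ` solid_torus \<subseteq> S3 - K"
    and off: "\<And>u. u \<in> sphere 0 1 \<Longrightarrow> \<theta> (u, 0) \<notin> F"
  obtains f where "continuous_on solid_torus f" "f ` solid_torus \<subseteq> E" "\<And>z. z \<in> solid_torus \<Longrightarrow> \<pi> (f z) = \<theta> z"
proof -
  interpret c: cyclic_cover k E t \<pi> "S3 - K" \<xi> by fact
  define \<omega> where "\<omega> = cis (2 * pi / k)"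
  have \<omega>: "\<omega> ^ k = 1" "\<And>i. 0 < i \<Longrightarrow> i < k \<Longrightarrow> \<omega> ^ i \<noteq> 1" "\<omega> \<noteq> 0"
    using primitive_root_cis[OF c.k] by (auto simp: \<omega>_def)
  interpret w: cyclic_cover k E t \<pi> "S3 - K" \<omega>
    by unfold_locales (use covE c.orb \<omega> in auto)
  have Kne: "K \<noteq> {}" using tub by (auto simp: tubular_nbhd_def)
  obtain T \<gamma> \<sigma> where T: "flat (S3 - K) T" and T1: "parallel (S3 - F) T (\<lambda>_. 1)" and Tv: "\<forall>y x. T y x \<in> {1, \<omega>}"
    and \<gamma>: "continuous_on {0..1::real} \<gamma>" "\<gamma> ` {0..1} \<subseteq> S3 - K" "\<gamma> 0 = \<gamma> 1"
    and \<sigma>: "parallel {0..1} (\<lambda>t u. T (\<gamma> t) (\<gamma> u)) \<sigma>" "\<sigma> 0 = inverse \<omega>" "\<sigma> 1 = 1"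
    using seifert_crossing[OF F Kne connB \<omega>(3)] by blast
  have Tk: "T y x ^ k = 1" for y x using Tv \<omega>(1) by (metis insertE power_one singletonD)
  have seg: "\<exists>s. parallel {0..1::real} (\<lambda>t u. Q (g t) (g u)) s"
    if "flat (S3 - K) Q" "continuous_on {0..1} g" "g ` {0..1} \<subseteq> S3 - K" for Q and g :: "real \<Rightarrow> real ^ 4"
    using flat_interval_parallel[OF _ flat_pullback[OF that]] by simp
  have ratio: "\<exists>i<k. s 0 = \<omega> ^ i * s 1"
    if s: "parallel {0..1::real} (\<lambda>t u. Q (g t) (g u)) s" and Q: "\<And>y x. Q y x ^ k = 1" for Q and g :: "real \<Rightarrow> real ^ 4" and s
  proof -
    have "parallel {0..1} (\<lambda>_ _. 1) (\<lambda>x. s x ^ k)" using parallel_power[OF s, of k] Q by simp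
    from parallel_trivial_const[OF _ this, of 0 1] have "s 0 ^ k = s 1 ^ k" by simp
    moreover have "s 0 \<noteq> 0" "s 1 \<noteq> 0" using s by (auto simp: parallel_def)
    ultimately have "(s 0 / s 1) ^ k = 1" by (simp add: power_divide)
    then obtain i where "i < k" "s 0 / s 1 = \<omega> ^ i" using w.root_is_zeta_power by blast
    then show ?thesis using \<open>s 1 \<noteq> 0\<close> by (auto simp: field_simps)
  qed
  define m where "m t = \<nu> (1, cis (2 * pi * t))" for t :: real
  have mst: "(1, cis a) \<in> solid_torus" for a by (simp add: solid_torus_def)
  have contm: "continuous_on {0..1} m" unfolding m_def
    by (rule continuous_on_compose2[OF closed_embeddingD(1)[OF emb\<nu>]]) (use mst in \<open>auto intro!: continuous_intros\<close>)
  have mB: "m ` {0..1} \<subseteq> S3 - K" using \<nu>_S3[OF mst] tubular_core_iff[OF tub mst] by (auto simp: m_def)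
  \<comment> \<open>A lift of the meridian \<open>m\<close>. It ends at the rotation by \<open>\<omega>\<close> of its starting point.\<close>
  define g where "g t = \<mu> (1, cis (2 * pi * t / k))" for t :: real
  have contg: "continuous_on {0..1} g" unfolding g_def
    by (rule continuous_on_compose2[OF closed_embeddingD(1)[OF emb\<mu>]]) (use mst k1 in \<open>auto intro!: continuous_intros\<close>)
  have gE: "g t \<in> E" for t using \<mu>_E[OF mst] by (simp add: g_def)
  have \<pi>g: "\<pi> (g t) = m t" for t
    using proj_\<mu>[OF mst, of "2 * pi * t / k"] k1 by (simp add: g_def m_def Complex.DeMoivre)
  define sE where "sE a = c.chi (g a) (c.pt (m a))" for a
  have sE: "parallel {0..1} (\<lambda>a u. c.mon (m a) (m u)) sE"
    unfolding sE_def by (rule c.lift_parallel[OF contg _ contm]) (use gE \<pi>g in auto)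
  have m01: "m 0 = m 1" by (simp add: m_def)
  have mw: "m a \<in> S3 - K" if "a \<in> {0..1}" for a using mB that by blast
  \<comment> \<open>\<open>\<omega>\<close> need not be the root \<open>\<xi>\<close> by which the generator \<open>t\<close> rotates, only a power of it.\<close>
  have sE01: "sE 0 = \<omega> * sE 1"
  proof -
    obtain b where b: "\<omega> = \<xi> ^ b" using c.root_is_zeta_power \<omega>(1) by blast
    have "(t ^^ j) (\<mu> (1, 1)) = \<mu> (1, \<xi> ^ j)" for j
    proof (induction j)
      case (Suc j)
      have "(1, \<xi> ^ j) \<in> solid_torus" "\<xi> ^ j \<noteq> 0" using rot(2) by (auto simp: solid_torus_def norm_power)
      then show ?case using Suc rot(1) by simp
    qed simp
    moreover have "g 0 = \<mu> (1, 1)" "g 1 = \<mu> (1, \<omega>)" by (simp_all add: g_def \<omega>_def)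
    ultimately have "g 1 = (t ^^ b) (g 0)" using b by simp
    then have "c.chi (g 0) (g 1) = \<omega>" using c.chi_pow[OF gE] b by simp
    moreover have "c.chi (g 0) (g 1) * sE 1 = sE 0"
      unfolding sE_def m01 by (rule c.chi_mult) (use gE \<pi>g m01 c.pt mw in auto)
    ultimately show ?thesis by simp
  qed
  obtain sF where sF: "parallel {0..1} (\<lambda>a u. T (m a) (m u)) sF" using seg[OF T contm mB] by blast
  obtain d where d: "sF 0 = \<omega> ^ d * sF 1" using ratio[OF sF Tk] by blast
  define D where "D y x = c.mon y x ^ d * inverse (T y x)" for y x
  have flatD: "flat (S3 - K) D"
    unfolding D_def by (intro flat_mult flat_power flat_inverse c.mon_flat T)
  have Dpar: "parallel {0..1} (\<lambda>a u. D (h a) (h u)) (\<lambda>a. s a ^ d * inverse (s' a))"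
    if "parallel {0..1} (\<lambda>a u. c.mon (h a) (h u)) s" "parallel {0..1} (\<lambda>a u. T (h a) (h u)) s'"
    for h :: "real \<Rightarrow> real ^ 4" and s s'
    unfolding D_def by (intro parallel_mult parallel_power parallel_inverse that)
  have "\<exists>q. parallel (sphere 0 1) (\<lambda>v w. D (\<nu> (1, v)) (\<nu> (1, w))) q"
  proof (rule parallel_circle)
    show "parallel {0..1} (\<lambda>a u. D (\<nu> (1, cis (2 * pi * a))) (\<nu> (1, cis (2 * pi * u)))) (\<lambda>a. sE a ^ d * inverse (sF a))"
      using Dpar[OF sE sF] by (simp add: m_def)
    have "sF 1 \<noteq> 0" using sF by (auto simp: parallel_def)
    then show "sE 0 ^ d * inverse (sF 0) = sE 1 ^ d * inverse (sF 1)"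
      using \<omega>(3) unfolding d sE01 by (simp add: power_mult_distrib)
  qed
  then obtain q where "parallel (sphere 0 1) (\<lambda>v w. D (\<nu> (1, v)) (\<nu> (1, w))) q" by blast
  from extend_over_core[OF tub flatD this] obtain sD where sD: "parallel (S3 - K) D sD" by blast
  have closed: "s 0 ^ d * inverse (s' 0) = s 1 ^ d * inverse (s' 1)"
    if h: "continuous_on {0..1} h" "h ` {0..1} \<subseteq> S3 - K" "h 0 = h 1"
      and "parallel {0..1} (\<lambda>a u. c.mon (h a) (h u)) s" "parallel {0..1} (\<lambda>a u. T (h a) (h u)) s'"
    for h :: "real \<Rightarrow> real ^ 4" and s s'
  proof -
    have "(s 0 ^ d * inverse (s' 0)) * sD (h 1) = (s 1 ^ d * inverse (s' 1)) * sD (h 0)"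
      by (rule parallel_unique[OF _ _ Dpar[OF that(4,5)] parallel_pullback[OF sD h(1,2)]])
        (use flat_nonzero[OF flatD] in auto)
    moreover have "h 0 \<in> S3 - K" using h(2) by (rule subsetD) auto
    then have "sD (h 0) \<noteq> 0" using sD unfolding parallel_def by blast
    ultimately show ?thesis using h(3) by simp
  qed
  obtain s\<gamma> where s\<gamma>: "parallel {0..1} (\<lambda>a u. c.mon (\<gamma> a) (\<gamma> u)) s\<gamma>" using seg[OF c.mon_flat \<gamma>(1,2)] by blast
  obtain e where e: "s\<gamma> 0 = \<omega> ^ e * s\<gamma> 1" using ratio[OF s\<gamma> c.mon_root] by blast
  have "s\<gamma> 1 \<noteq> 0" using s\<gamma> by (auto simp: parallel_def)
  then have \<rho>: "(\<omega> ^ e) ^ d = inverse \<omega>"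
    using closed[OF \<gamma> s\<gamma> \<sigma>(1)] \<sigma>(2,3) \<omega>(3) unfolding e by (simp add: power_mult_distrib field_simps)
  define l where "l a = \<theta> (cis (2 * pi * a), 0)" for a :: real
  have lst: "(u, 0) \<in> solid_torus" if "u \<in> sphere 0 1" for u using that by (simp add: solid_torus_def)
  have contl: "continuous_on {0..1} l" unfolding l_def
    by (rule continuous_on_compose2[OF \<theta>(1)]) (auto intro!: continuous_intros lst)
  have lB: "l ` {0..1} \<subseteq> S3 - K"
  proof (rule image_subsetI)
    fix a :: real
    have "(cis (2 * pi * a), 0) \<in> solid_torus" by (rule lst) simp
    then show "l a \<in> S3 - K" unfolding l_def using \<theta>(2) by blast
  qed
  have lF: "l ` {0..1} \<subseteq> S3 - F"
  proof (rule image_subsetI)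
    fix a :: real assume "a \<in> {0..1}"
    then have "l a \<in> S3" using lB by blast
    moreover have "l a \<notin> F" unfolding l_def by (rule off) simp
    ultimately show "l a \<in> S3 - F" by blast
  qed
  obtain sL where sL: "parallel {0..1} (\<lambda>a u. c.mon (l a) (l u)) sL" using seg[OF c.mon_flat contl lB] by blast
  obtain b where b: "sL 0 = \<omega> ^ b * sL 1" using ratio[OF sL c.mon_root] by blast
  have sL1: "sL 1 \<noteq> 0" using sL by (auto simp: parallel_def)
  have "parallel {0..1} (\<lambda>a u. T (l a) (l u)) (\<lambda>_. 1)" by (rule parallel_pullback[OF T1 contl lF])
  from closed[OF contl lB _ sL this] have "sL 0 ^ d = sL 1 ^ d" by (simp add: l_def)
  then have "(\<omega> ^ b) ^ d = 1" using sL1 unfolding b by (simp add: power_mult_distrib)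
  then have "\<omega> ^ b = 1" by (rule power_root_exponent[OF \<omega>(3) \<rho> refl refl])
  then have "sL 0 = sL 1" using b by simp
  then obtain sC where sC: "parallel (sphere 0 1) (\<lambda>u v. c.mon (\<theta> (u, 0)) (\<theta> (v, 0))) sC"
    using parallel_circle[of "\<lambda>u v. c.mon (\<theta> (u, 0)) (\<theta> (v, 0))" sL] sL by (auto simp: l_def)
  \<comment> \<open>Spread the section from the core to the solid torus, which contracts to it.\<close>
  define h where "h = (\<lambda>(z, a). \<theta> (fst z, a *\<^sub>R snd z))"
  have hst: "(fst z, a *\<^sub>R snd z) \<in> solid_torus" if "z \<in> solid_torus" "a \<in> {0..1}" for z a
    using that by (auto simp: solid_torus_def intro!: mult_le_one)
  have "\<exists>s. parallel solid_torus (\<lambda>y x. c.mon (h (y, 1)) (h (x, 1))) s"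
  proof (rule flat_homotopic[OF c.mon_flat])
    show "continuous_on (solid_torus \<times> {0..1}) h"
      unfolding h_def case_prod_unfold
    proof (rule continuous_on_compose2[OF \<theta>(1)])
      show "(\<lambda>x. (fst (fst x), snd x *\<^sub>R snd (fst x))) ` (solid_torus \<times> {0..1}) \<subseteq> solid_torus"
        by (rule image_subsetI, rule hst) auto
    qed (auto intro!: continuous_intros)
    show "h ` (solid_torus \<times> {0..1}) \<subseteq> S3 - K"
    proof (rule image_subsetI)
      fix x assume "x \<in> solid_torus \<times> {0..1::real}"
      then have "(fst (fst x), snd x *\<^sub>R snd (fst x)) \<in> solid_torus" by (intro hst) auto
      then show "h x \<in> S3 - K" unfolding h_def case_prod_unfold using \<theta>(2) by blast
    qed
    have "parallel solid_torus (\<lambda>y x. c.mon (\<theta> (fst y, 0)) (\<theta> (fst x, 0))) (\<lambda>x. sC (fst x))"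
      by (rule parallel_pullback[OF sC]) (auto intro!: continuous_intros simp: solid_torus_def)
    then show "parallel solid_torus (\<lambda>y x. c.mon (h (y, 0)) (h (x, 0))) (\<lambda>x. sC (fst x))" by (simp add: h_def)
  qed
  then obtain s where s: "parallel solid_torus (\<lambda>y x. c.mon (\<theta> y) (\<theta> x)) s" by (auto simp: h_def)
  have p: "(1, 1) \<in> solid_torus" by (simp add: solid_torus_def)
  then have s1: "s (1, 1) \<noteq> 0" using s by (auto simp: parallel_def)
  \<comment> \<open>Normalised at one point, the section takes values in the roots of unity.\<close>
  define s' where "s' x = inverse (s (1, 1)) * s x" for x
  have s': "parallel solid_torus (\<lambda>y x. c.mon (\<theta> y) (\<theta> x)) s'"
    unfolding s'_def by (rule parallel_scale[OF s]) (use s1 in simp)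
  have "parallel solid_torus (\<lambda>_ _. 1) (\<lambda>x. s' x ^ k)" using parallel_power[OF s', of k] c.mon_root by simp
  from parallel_trivial_const[OF connected_solid_torus this _ p]
  have root: "s' z ^ k = 1" if "z \<in> solid_torus" for z using that s1 by (simp add: s'_def)
  show ?thesis
    by (rule c.parallel_lift[OF \<theta> s' root]) (auto intro: that)
qed

section \<open>The action on the exterior of the link\<close>

text \<open>
  A separation of the remaining set puts each connected frontier \<open>P j - Q j\<close> on one side, and hence
  extends over the removed pieces.
\<close>
lemma connected_remove_pieces:
  assumes conn: "connected E" and fin: "finite J"
    and P: "\<And>j. j \<in> J \<Longrightarrow> closedin (top_of_set E) (P j)" "\<And>j. j \<in> J \<Longrightarrow> openin (top_of_set E) (Q j)" "\<And>j. j \<in> J \<Longrightarrow> Q j \<subseteq> P j"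
    and disj: "\<And>i j. i \<in> J \<Longrightarrow> j \<in> J \<Longrightarrow> i \<noteq> j \<Longrightarrow> P i \<inter> P j = {}"
    and bd: "\<And>j. j \<in> J \<Longrightarrow> connected (P j - Q j)" "\<And>j. j \<in> J \<Longrightarrow> P j - Q j \<noteq> {}"
  shows "connected (E - (\<Union>j\<in>J. Q j))"
proof (rule ccontr)
  define R where "R = E - (\<Union>j\<in>J. Q j)"
  have clR: "closedin (top_of_set E) R"
    unfolding R_def by (intro closedin_diff openin_Union) (use P in auto)
  assume "\<not> connected (E - (\<Union>j\<in>J. Q j))"
  then obtain A1 A2 where A: "closedin (top_of_set R) A1" "closedin (top_of_set R) A2" "R \<subseteq> A1 \<union> A2" "A1 \<inter> A2 = {}" "A1 \<noteq> {}" "A2 \<noteq> {}"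
    unfolding R_def[symmetric] connected_closedin by blast
  have AR: "A1 \<subseteq> R" "A2 \<subseteq> R" using A(1,2) closedin_imp_subset by blast+
  have bdR: "P j - Q j \<subseteq> R" if j: "j \<in> J" for j
  proof -
    have "P j \<subseteq> E" using P(1)[OF j] closedin_imp_subset by blast
    moreover have "P j \<inter> Q i = {}" if "i \<in> J" "i \<noteq> j" for i using disj[OF that(1) j that(2)] P(3)[OF that(1)] by blast
    ultimately show ?thesis unfolding R_def by blast
  qed
  have side: "P j - Q j \<subseteq> A1 \<or> P j - Q j \<subseteq> A2" if j: "j \<in> J" for j
  proof -
    have "closedin (top_of_set (P j - Q j)) ((P j - Q j) \<inter> A1)" "closedin (top_of_set (P j - Q j)) ((P j - Q j) \<inter> A2)"
      using A(1,2) bdR[OF j] by (auto simp: closedin_closed)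
    moreover have "P j - Q j \<subseteq> ((P j - Q j) \<inter> A1) \<union> ((P j - Q j) \<inter> A2)" using A(3) bdR[OF j] by blast
    ultimately have "(P j - Q j) \<inter> A1 = {} \<or> (P j - Q j) \<inter> A2 = {}"
      using bd(1)[OF j] A(4) unfolding connected_closedin by blast
    then show ?thesis using A(3) bdR[OF j] by blast
  qed
  define G where "G A = A \<union> (\<Union>j\<in>{j\<in>J. P j - Q j \<subseteq> A}. P j)" for A
  have clG: "closedin (top_of_set E) (G A)" if "closedin (top_of_set R) A" for A
    unfolding G_def using that clR fin P(1) closedin_trans
    by (intro closedin_Un closedin_Union) auto
  have cov: "E \<subseteq> G A1 \<union> G A2"
  proof
    fix x assume x: "x \<in> E"
    show "x \<in> G A1 \<union> G A2"
    proof (cases "x \<in> R")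
      case True then show ?thesis using A(3) by (auto simp: G_def)
    next
      case False
      then obtain j where "j \<in> J" "x \<in> Q j" using x by (auto simp: R_def)
      then show ?thesis using side P(3) unfolding G_def by blast
    qed
  qed
  have inR: "x \<in> P j - Q j" if "x \<in> R" "j \<in> J" "x \<in> P j" for x j using that by (auto simp: R_def)
  have "G A1 \<inter> G A2 = {}"
  proof (rule equals0I)
    fix x assume x: "x \<in> G A1 \<inter> G A2"
    have mixed: False if "x \<in> A" "j \<in> J" "P j - Q j \<subseteq> A'" "x \<in> P j" "A \<inter> A' = {}" "A \<subseteq> R" for A A' j
      using inR[of x j] that by blast
    from x consider "x \<in> A1" "x \<in> A2" | j where "x \<in> A1" "j \<in> J" "P j - Q j \<subseteq> A2" "x \<in> P j"
      | j where "x \<in> A2" "j \<in> J" "P j - Q j \<subseteq> A1" "x \<in> P j"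
      | i j where "i \<in> J" "P i - Q i \<subseteq> A1" "x \<in> P i" "j \<in> J" "P j - Q j \<subseteq> A2" "x \<in> P j"
      unfolding G_def by blast
    then show False
    proof cases
      case 1 then show ?thesis using A(4) by blast
    next
      case 2 then show ?thesis using mixed[OF 2 A(4) AR(1)] by blast
    next
      case 3
      have "A2 \<inter> A1 = {}" using A(4) by blast
      then show ?thesis using mixed[OF 3 _ AR(2)] by blast
    next
      case 4
      then have "i = j" using disj by blast
      then show ?thesis using 4 bd(2)[of j] A(4) by blast
    qed
  qed
  moreover have "G A1 \<noteq> {}" "G A2 \<noteq> {}" using A(5,6) by (auto simp: G_def)
  ultimately show False using conn cov clG[OF A(1)] clG[OF A(2)] unfolding connected_closedin by blast
qed

lemma (in cyclic_cover) open_map: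
  assumes V: "openin (top_of_set E) V"
  shows "openin (top_of_set B) (\<pi> ` V)"
proof (subst openin_subopen, intro ballI)
  fix x assume "x \<in> \<pi> ` V"
  then obtain e where e: "e \<in> V" "x = \<pi> e" by blast
  have "V \<subseteq> E" using V openin_imp_subset by blast
  then obtain u W q where u: "openin (top_of_set E) u" "e \<in> u" "openin (top_of_set B) W" "\<pi> e \<in> W" "homeomorphism u W \<pi> q"
    using sheet[of e] e by blast
  have "openin (top_of_set u) (u \<inter> V)"
    using V openin_imp_subset[OF u(1)] by (auto simp: openin_open)
  from homeomorphism_imp_open_map[OF u(5) this] have "openin (top_of_set B) (\<pi> ` (u \<inter> V))"
    using u(3) openin_trans by blast
  then show "\<exists>T. openin (top_of_set B) T \<and> x \<in> T \<and> T \<subseteq> \<pi> ` V" using e u(2) by blast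
qed

lemma (in cyclic_cover) closed_map:
  assumes C: "closedin (top_of_set E) C"
  shows "closedin (top_of_set B) (\<pi> ` C)"
proof -
  have CE: "C \<subseteq> E" using C closedin_imp_subset by blast
  define S where "S = (\<Union>i<k. (t ^^ i) ` C)"
  have "closedin (top_of_set E) ((t ^^ i) ` C)" for i using homeomorphism_imp_closed_map[OF pow_homeomorphism C] .
  then have "closedin (top_of_set E) S" unfolding S_def by (intro closedin_Union) auto
  then have "openin (top_of_set E) (E - S)" by (rule openin_diff[OF openin_subtopology_self])
  then have "openin (top_of_set B) (\<pi> ` (E - S))" by (rule open_map)
  moreover have "\<pi> ` (E - S) = B - \<pi> ` C"
  proof
    show "\<pi> ` (E - S) \<subseteq> B - \<pi> ` C"
    proof (rule image_subsetI)
      fix x assume x: "x \<in> E - S"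
      have "\<pi> x \<noteq> \<pi> c" if c: "c \<in> C" for c
      proof
        assume "\<pi> x = \<pi> c"
        then obtain i where "i < k" "x = (t ^^ i) c" using chi_cases[of c x] c CE x by (metis DiffD1 subsetD)
        then show False using x c unfolding S_def by blast
      qed
      then show "\<pi> x \<in> B - \<pi> ` C" using proj_B x by blast
    qed
    show "B - \<pi> ` C \<subseteq> \<pi> ` (E - S)"
    proof
      fix y assume y: "y \<in> B - \<pi> ` C"
      then obtain x where x: "x \<in> E" "y = \<pi> x" using covering_space_imp_surjective[OF cov] by blast
      have "x \<notin> S" using x y proj_pow CE unfolding S_def by auto
      then show "y \<in> \<pi> ` (E - S)" using x by blast
    qed
  qed
  moreover have "\<pi> ` C \<subseteq> B" using proj_B CE by blast
  ultimately show ?thesis by (simp add: closedin_def double_diff)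
qed

lemma (in cyclic_cover) free_on_subset:
  assumes "D \<subseteq> E" "\<And>x. x \<in> D \<Longrightarrow> t x \<in> D"
  shows "free_cyclic_action k D t"
  by unfold_locales (use assms k period free continuous_on_subset[OF cont] in auto)

text \<open>
  The generator of the deck group, normalised near the branch set as in \<open>rotation\<close>.
\<close>
locale branched_action = branched_setup k X \<pi> K \<nu> \<mu> + cyclic_cover k "X - \<pi> -` K" t \<pi> "S3 - K" \<xi>
  for k and X :: "'a::topological_space set" and \<pi> K \<nu> \<mu> t \<xi> +
  assumes rot: "\<forall>u w. (u, w) \<in> solid_torus \<longrightarrow> w \<noteq> 0 \<longrightarrow> t (\<mu> (u, w)) = \<mu> (u, \<xi> * w)" and norm_\<xi>: "cmod \<xi> = 1"
begin

lemma liftsD: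
  assumes "\<theta> ` solid_torus \<subseteq> S3 - K" "f \<in> lifts X \<pi> \<theta>"
  shows "continuous_on solid_torus f" "f ` solid_torus \<subseteq> E" "\<And>z. z \<in> solid_torus \<Longrightarrow> \<pi> (f z) = \<theta> z" "f \<in> extensional solid_torus"
  using assms by (fastforce simp: lifts_def)+

lemma lifts_act:
  assumes "\<theta> ` solid_torus \<subseteq> S3 - K" "f \<in> lifts X \<pi> \<theta>"
  shows "restrict ((t ^^ i) \<circ> f) solid_torus \<in> lifts X \<pi> \<theta>"
proof -
  note f = liftsD[OF assms]
  have E: "f z \<in> E" if "z \<in> solid_torus" for z using f(2) that by blast
  have "continuous_on solid_torus ((t ^^ i) \<circ> f)"
    by (rule continuous_on_compose[OF f(1) continuous_on_subset[OF pow_cont f(2)]])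
  then have "continuous_on solid_torus (restrict ((t ^^ i) \<circ> f) solid_torus)" by simp
  moreover have "(t ^^ i) (f z) \<in> X" "\<pi> ((t ^^ i) (f z)) = \<theta> z" if "z \<in> solid_torus" for z
    using pow_maps[OF E[OF that]] proj_pow[OF E[OF that]] f(3)[OF that] by auto
  ultimately show ?thesis by (auto simp: lifts_def)
qed

lemma lifts_orbit:
  assumes \<theta>: "\<theta> ` solid_torus \<subseteq> S3 - K" and f: "f \<in> lifts X \<pi> \<theta>" "f' \<in> lifts X \<pi> \<theta>"
  obtains i where "i < k" "f' = restrict ((t ^^ i) \<circ> f) solid_torus"
proof -
  have p: "(1, 1) \<in> solid_torus" by (simp add: solid_torus_def)
  note F = liftsD[OF \<theta> f(1)] liftsD[OF \<theta> f(2)]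
  have eq: "\<pi> (f z) = \<pi> (f' z)" if "z \<in> solid_torus" for z using F(3,7) that by simp
  obtain i where i: "i < k" "\<And>z. z \<in> solid_torus \<Longrightarrow> f' z = (t ^^ i) (f z)"
    by (rule lifts_differ_by_power[OF connected_solid_torus F(1,2,5,6) eq p]) blast+
  have "f' = restrict ((t ^^ i) \<circ> f) solid_torus"
    by (rule extensionalityI[OF F(8)]) (use i in auto)
  then show ?thesis using that i by blast
qed

lemma lifts_disjoint:
  assumes \<theta>: "\<theta> ` solid_torus \<subseteq> S3 - K" "inj_on \<theta> solid_torus" and f: "f \<in> lifts X \<pi> \<theta>" "f' \<in> lifts X \<pi> \<theta>"
    and z: "z \<in> solid_torus" "z' \<in> solid_torus" "f z = f' z'"
  shows "z = z' \<and> f = f'"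
proof -
  note F = liftsD[OF \<theta>(1) f(1)] liftsD[OF \<theta>(1) f(2)]
  have "\<theta> z = \<theta> z'" using F(3)[OF z(1)] F(7)[OF z(2)] z(3) by simp
  then have zz: "z = z'" using inj_onD[OF \<theta>(2) _ z(1,2)] by blast
  obtain i where i: "i < k" "f' = restrict ((t ^^ i) \<circ> f) solid_torus" using lifts_orbit[OF \<theta>(1) f] by metis
  have fE: "f z \<in> E" using F(2) z(1) by blast
  have "(t ^^ i) (f z) = f z" using z zz i(2) by simp
  then have "i = 0" using free[OF fE, of i] i(1) by auto
  then have "f' = restrict f solid_torus" using i by (simp add: o_def)
  then show ?thesis using zz F(4) extensional_restrict by metis
qed

lemma lifts_through:
  assumes \<theta>: "\<theta> ` solid_torus \<subseteq> S3 - K" and f: "f \<in> lifts X \<pi> \<theta>" and e: "e \<in> X" "\<pi> e = \<theta> z" "z \<in> solid_torus"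
  shows "\<exists>f'\<in>lifts X \<pi> \<theta>. f' z = e"
proof -
  note F = liftsD[OF \<theta> f]
  have fE: "f z \<in> E" using F(2) e(3) by blast
  have eE: "e \<in> E" using e \<theta> by auto
  obtain i where "e = (t ^^ i) (f z)" using chi_cases[OF fE eE] F(3)[OF e(3)] e(2) by metis
  then have "restrict ((t ^^ i) \<circ> f) solid_torus z = e" using e(3) by simp
  then show ?thesis using lifts_act[OF \<theta> f] by blast
qed

lemma finite_lifts:
  assumes \<theta>: "\<theta> ` solid_torus \<subseteq> S3 - K" shows "finite (lifts X \<pi> \<theta>)"
proof (cases "lifts X \<pi> \<theta> = {}")
  case False
  then obtain f where f: "f \<in> lifts X \<pi> \<theta>" by blast
  have "lifts X \<pi> \<theta> \<subseteq> (\<lambda>i. restrict ((t ^^ i) \<circ> f) solid_torus) ` {..<k}"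
  proof
    fix f' assume "f' \<in> lifts X \<pi> \<theta>"
    then obtain i where "i < k" "f' = restrict ((t ^^ i) \<circ> f) solid_torus" by (rule lifts_orbit[OF \<theta> f])
    then show "f' \<in> (\<lambda>i. restrict ((t ^^ i) \<circ> f) solid_torus) ` {..<k}" by blast
  qed
  then show ?thesis by (rule finite_subset) simp
qed simp

lemma Hausdorff_subspace: "D \<subseteq> X \<Longrightarrow> Hausdorff_space (top_of_set D)"
  using Hausdorff_space_subtopology[OF HX, of D] by (simp add: subtopology_subtopology inf_absorb2)

lemma lift_closed:
  assumes \<theta>: "\<theta> ` solid_torus \<subseteq> S3 - K" "f \<in> lifts X \<pi> \<theta>"
  shows "closedin (top_of_set E) (f ` solid_torus)"
proof -
  have "compact (f ` solid_torus)" by (rule compact_continuous_image[OF liftsD(1)[OF assms] compact_solid_torus])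
  then have "compactin (top_of_set E) (f ` solid_torus)" using liftsD(2)[OF assms] by (simp add: compactin_subtopology)
  then show ?thesis by (rule compactin_imp_closedin[rotated]) (rule Hausdorff_subspace, blast)
qed

text \<open>
  The lifts of the closed solid torus are finitely many disjoint closed sets. Removing all but one of
  them from the open preimage of \<open>\<theta> ` open_solid_torus\<close> leaves an open set.
\<close>
lemma lift_open:
  assumes \<theta>: "\<theta> ` solid_torus \<subseteq> S3 - K" "inj_on \<theta> solid_torus" "openin (top_of_set S3) (\<theta> ` open_solid_torus)" and f: "f \<in> lifts X \<pi> \<theta>"
  shows "openin (top_of_set E) (f ` open_solid_torus)"
proof -
  have ost: "open_solid_torus \<subseteq> solid_torus" using solid_torus_split by blast
  have "openin (top_of_set (S3 - K)) (\<theta> ` open_solid_torus)"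
    using \<theta>(1,3) ost by (intro openin_subset_trans[of S3 _ "S3 - K"]) auto
  from continuous_openin_preimage[OF covering_space_imp_continuous[OF covE] _ this]
  have 1: "openin (top_of_set E) (E \<inter> \<pi> -` (\<theta> ` open_solid_torus))"
    by (rule meta_mp)
      (use covering_space_imp_surjective[OF covE] in auto)
  have 2: "closedin (top_of_set E) (\<Union>f'\<in>lifts X \<pi> \<theta> - {f}. f' ` solid_torus)"
    using finite_lifts[OF \<theta>(1)] lift_closed[OF \<theta>(1)] by (intro closedin_Union) auto
  have "f ` open_solid_torus = (E \<inter> \<pi> -` (\<theta> ` open_solid_torus)) - (\<Union>f'\<in>lifts X \<pi> \<theta> - {f}. f' ` solid_torus)" (is "_ = ?R")
  proof
    show "f ` open_solid_torus \<subseteq> ?R"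
    proof (rule image_subsetI)
      fix z assume z: "z \<in> open_solid_torus"
      then have zs: "z \<in> solid_torus" using ost by blast
      have "f z \<in> E" "\<pi> (f z) = \<theta> z" using liftsD(2,3)[OF \<theta>(1) f] zs by blast+
      moreover have "f z \<noteq> f' z'" if "f' \<in> lifts X \<pi> \<theta> - {f}" "z' \<in> solid_torus" for f' z'
        using lifts_disjoint[OF \<theta>(1,2) f _ zs that(2)] that(1) by blast
      ultimately show "f z \<in> ?R" using z by auto
    qed
    show "?R \<subseteq> f ` open_solid_torus"
    proof
      fix e assume e: "e \<in> ?R"
      then obtain z where z: "z \<in> open_solid_torus" "\<pi> e = \<theta> z" by auto
      obtain f' where "f' \<in> lifts X \<pi> \<theta>" "f' z = e" using lifts_through[OF \<theta>(1) f _ z(2)] e z(1) ost by blast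
      then show "e \<in> f ` open_solid_torus" using e z(1) ost by blast
    qed
  qed
  then show ?thesis using openin_diff[OF 1 2] by simp
qed

lemma \<mu>_open_iff:
  assumes "x \<in> X" shows "x \<in> \<mu> ` open_solid_torus \<longleftrightarrow> \<pi> x \<in> \<nu> ` open_solid_torus"
proof
  assume "x \<in> \<mu> ` open_solid_torus"
  then obtain u w where uw: "(u, w) \<in> open_solid_torus" "x = \<mu> (u, w)" by auto
  then have "(u, w) \<in> solid_torus" using solid_torus_split by blast
  then have "\<pi> x = \<nu> (u, w ^ k)" using proj_\<mu> uw by simp
  moreover have "(u, w ^ k) \<in> open_solid_torus"
  proof -
    have "cmod w ^ k < 1" using uw(1) k1 by (intro power_less_one_iff[THEN iffD2]) (auto simp: open_solid_torus_def)
    then show ?thesis using uw(1) by (simp add: open_solid_torus_def norm_power)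
  qed
  ultimately show "\<pi> x \<in> \<nu> ` open_solid_torus" by blast
next
  assume "\<pi> x \<in> \<nu> ` open_solid_torus"
  then obtain u y where uy: "(u, y) \<in> open_solid_torus" "\<pi> x = \<nu> (u, y)" by auto
  then have "(u, y) \<in> solid_torus" using solid_torus_split by blast
  from fibre_over_nbhd[OF assms uy(2) this] obtain w where w: "w ^ k = y" "(u, w) \<in> solid_torus" "x = \<mu> (u, w)" by blast
  have "cmod w ^ k < 1" using w(1) uy(1) by (auto simp: open_solid_torus_def norm_power[symmetric])
  then have "cmod w < 1" using power_less_one_iff[of "cmod w" k] k1 by simp
  then show "x \<in> \<mu> ` open_solid_torus" using w uy(1) by (auto simp: open_solid_torus_def)
qed

end

text \<open>
  The gluing matrices with rows \<open>(c k, b)\<close>, \<open>(d, a)\<close> above and \<open>(c, b)\<close>, \<open>(d, k a)\<close> below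
  turn the branched covering \<open>(x, y) \<mapsto> (x, y\<^sup>k)\<close> near the knot into the unbranched covering
  \<open>(u, v) \<mapsto> (u\<^sup>k, v)\<close> of the glued-in solid tori. Their determinants are equal.
\<close>
lemma linear_wrap:
  assumes "z \<in> torus" and z: "z = (u, v)"
  shows "torus_linear (c * int k) b d a (u, v) = (x, y) \<Longrightarrow> torus_linear c b d (int k * a) (u ^ k, v) = (x, y ^ k)"
proof -
  assume "torus_linear (c * int k) b d a (u, v) = (x, y)"
  then have xy: "x = u powi (c * int k) * v powi b" "y = u powi d * v powi a" by (auto simp: torus_linear_def)
  have "y ^ k = (u powi d) ^ k * (v powi a) ^ k" by (simp add: xy power_mult_distrib)
  also have "\<dots> = (u ^ k) powi d * v powi (int k * a)"
    by (simp add: power_int_mult mult.commute[of "int k"] power_int_power' flip: power_int_of_nat)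
      (metis mult.commute power_int_mult power_int_of_nat)
  finally show ?thesis
    by (simp add: torus_linear_def xy mult.commute[of c] power_int_mult)
qed

lemma connected_torus: "connected torus"
  unfolding torus_def by (intro connected_Times connected_sphere) auto

lemma (in branched_action) connected_exterior:
  fixes \<theta> :: "nat \<Rightarrow> complex \<times> complex \<Rightarrow> real ^ 4"
  assumes \<theta>: "\<And>j. j < n \<Longrightarrow> \<theta> j ` solid_torus \<subseteq> S3 - K" "\<And>j. j < n \<Longrightarrow> inj_on (\<theta> j) solid_torus"
      "\<And>j. j < n \<Longrightarrow> openin (top_of_set S3) (\<theta> j ` open_solid_torus)"
    and disj: "\<And>i j. i < n \<Longrightarrow> j < n \<Longrightarrow> i \<noteq> j \<Longrightarrow> \<theta> i ` solid_torus \<inter> \<theta> j ` solid_torus = {}"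
      "\<And>j. j < n \<Longrightarrow> \<nu> ` solid_torus \<inter> \<theta> j ` solid_torus = {}"
    and J: "J = (SIGMA j:{..<n}. lifts X \<pi> (\<theta> j))"
  shows "connected (X - \<mu> ` open_solid_torus - (\<Union>x\<in>J. snd x ` open_solid_torus))"
proof -
  define P where "P = case_option (E \<inter> \<mu> ` solid_torus) (\<lambda>x::nat \<times> (complex \<times> complex \<Rightarrow> 'a). snd x ` solid_torus)"
  define Q where "Q = case_option (E \<inter> \<mu> ` open_solid_torus) (\<lambda>x::nat \<times> (complex \<times> complex \<Rightarrow> 'a). snd x ` open_solid_torus)"
  define J' where "J' = insert None (Some ` J)"
  have ost: "open_solid_torus \<subseteq> solid_torus" "torus \<subseteq> solid_torus" using solid_torus_split by auto
  have J'E: "j = None \<or> (\<exists>i f. j = Some (i, f) \<and> i < n \<and> f \<in> lifts X \<pi> (\<theta> i))" if "j \<in> J'" for j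
    using that unfolding J'_def J by auto
  have diff: "f ` solid_torus - f ` open_solid_torus = f ` torus" if "inj_on f solid_torus" for f :: "complex \<times> complex \<Rightarrow> 'a"
  proof -
    have "f ` solid_torus - f ` open_solid_torus = f ` (solid_torus - open_solid_torus)"
      by (rule inj_on_image_set_diff[OF that, symmetric]) (use ost in auto)
    also have "solid_torus - open_solid_torus = torus" using solid_torus_split torus_disjoint_open by blast
    finally show ?thesis .
  qed
  have inj: "inj_on f solid_torus" if "i < n" "f \<in> lifts X \<pi> (\<theta> i)" for i f
    using lifts_disjoint[OF \<theta>(1,2)[OF that(1)] that(2,2)] by (meson inj_onI)
  have torE: "\<mu> ` torus \<subseteq> E"
  proof (rule image_subsetI)
    fix z assume "z \<in> torus"
    then have "z \<in> solid_torus" "snd z \<noteq> 0" using ost by (auto simp: torus_def)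
    then show "\<mu> z \<in> E" using \<mu>_E by blast
  qed
  have bd: "P j - Q j = (case j of None \<Rightarrow> \<mu> ` torus | Some x \<Rightarrow> snd x ` torus)" if "j \<in> J'" for j
  proof -
    from J'E[OF that] show ?thesis
    proof (elim disjE exE conjE)
      assume j: "j = None"
      have "E \<inter> \<mu> ` solid_torus - E \<inter> \<mu> ` open_solid_torus = E \<inter> (\<mu> ` solid_torus - \<mu> ` open_solid_torus)" by blast
      also have "\<dots> = \<mu> ` torus" using diff[OF closed_embeddingD(2)[OF emb\<mu>]] torE by blast
      finally show ?thesis by (simp add: j P_def Q_def)
    next
      fix i f assume "j = Some (i, f)" "i < n" "f \<in> lifts X \<pi> (\<theta> i)"
      then show ?thesis using diff[OF inj] by (simp add: P_def Q_def)
    qed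
  qed
  have proj: "\<pi> ` P j \<subseteq> (case j of None \<Rightarrow> \<nu> ` solid_torus | Some x \<Rightarrow> \<theta> (fst x) ` solid_torus)" if "j \<in> J'" for j
  proof -
    from J'E[OF that] show ?thesis
    proof (elim disjE exE conjE)
      assume j: "j = None"
      have "\<pi> (\<mu> z) \<in> \<nu> ` solid_torus" if "z \<in> solid_torus" for z
        using that proj_\<mu>[of "fst z" "snd z"] power_solid[of "fst z" "snd z"] by simp
      then show ?thesis by (auto simp: j P_def)
    next
      fix i f assume jf: "j = Some (i, f)" "i < n" "f \<in> lifts X \<pi> (\<theta> i)"
      have "\<pi> (f z) \<in> \<theta> i ` solid_torus" if "z \<in> solid_torus" for z using liftsD(3)[OF \<theta>(1)[OF jf(2)] jf(3) that] that by simp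
      then show ?thesis by (auto simp: jf P_def)
    qed
  qed
  have "connected (E - (\<Union>j\<in>J'. Q j))"
  proof (rule connected_remove_pieces[OF connE, where P = P])
    show "finite J'" unfolding J'_def J using finite_lifts[OF \<theta>(1)] by auto
    fix j assume j: "j \<in> J'"
    show "closedin (top_of_set E) (P j)"
      using J'E[OF j]
    proof (elim disjE exE conjE)
      assume "j = None"
      have "closedin (top_of_set E) (E \<inter> \<mu> ` solid_torus)"
        using closed_embeddingD(4)[OF emb\<mu>] by (auto simp: closedin_closed)
      then show ?thesis by (simp add: P_def \<open>j = None\<close>)
    next
      fix i f assume "j = Some (i, f)" "i < n" "f \<in> lifts X \<pi> (\<theta> i)"
      then show ?thesis using lift_closed[OF \<theta>(1)] by (simp add: P_def)
    qed
    show "openin (top_of_set E) (Q j)"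
      using J'E[OF j]
    proof (elim disjE exE conjE)
      assume "j = None"
      have "openin (top_of_set E) (E \<inter> \<mu> ` open_solid_torus)"
        using op\<mu> by (auto simp: openin_open)
      then show ?thesis by (simp add: Q_def \<open>j = None\<close>)
    next
      fix i f assume "j = Some (i, f)" "i < n" "f \<in> lifts X \<pi> (\<theta> i)"
      then show ?thesis using lift_open[OF \<theta>] by (simp add: Q_def)
    qed
    show "Q j \<subseteq> P j" unfolding P_def Q_def using ost by (cases j) auto
    show "connected (P j - Q j)" "P j - Q j \<noteq> {}"
    proof -
      have "(1, 1) \<in> torus" by (simp add: torus_def)
      then show "P j - Q j \<noteq> {}" unfolding bd[OF j] by (cases j) auto
      show "connected (P j - Q j)"
        unfolding bd[OF j] using J'E[OF j]
      proof (elim disjE exE conjE)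
        assume "j = None"
        then show "connected (case j of None \<Rightarrow> \<mu> ` torus | Some x \<Rightarrow> snd x ` torus)"
          using connected_continuous_image[OF continuous_on_subset[OF closed_embeddingD(1)[OF emb\<mu>] ost(2)] connected_torus] by simp
      next
        fix i f assume jf: "j = Some (i, f)" "i < n" "f \<in> lifts X \<pi> (\<theta> i)"
        then show "connected (case j of None \<Rightarrow> \<mu> ` torus | Some x \<Rightarrow> snd x ` torus)"
          using connected_continuous_image[OF continuous_on_subset[OF liftsD(1)[OF \<theta>(1)[OF jf(2)] jf(3)] ost(2)] connected_torus] by simp
      qed
    qed
  next
    fix i j assume ij: "i \<in> J'" "j \<in> J'" "i \<noteq> j"
    have base: "P i \<inter> P j = {}" if "\<pi> ` P i \<subseteq> U" "\<pi> ` P j \<subseteq> V" "U \<inter> V = {}" for U V using that by blast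
    show "P i \<inter> P j = {}"
    proof (cases "i = None \<or> j = None")
      case True
      then show ?thesis
      proof
        assume "i = None"
        then obtain l f where "j = Some (l, f)" "l < n" using ij J'E by blast
        then show ?thesis using base[OF proj[OF ij(1)] proj[OF ij(2)]] disj(2)[of l] \<open>i = None\<close> by simp
      next
        assume "j = None"
        then obtain l f where "i = Some (l, f)" "l < n" using ij J'E by blast
        then show ?thesis using base[OF proj[OF ij(1)] proj[OF ij(2)]] disj(2)[of l] \<open>j = None\<close> by (simp add: Int_commute)
      qed
    next
      case False
      then obtain l f l' f' where lf: "i = Some (l, f)" "l < n" "f \<in> lifts X \<pi> (\<theta> l)" "j = Some (l', f')" "l' < n" "f' \<in> lifts X \<pi> (\<theta> l')"
        using J'E[OF ij(1)] J'E[OF ij(2)] by blast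
      show ?thesis
      proof (cases "l = l'")
        case False
        then show ?thesis using base[OF proj[OF ij(1)] proj[OF ij(2)]] disj(1)[OF lf(2,5)] lf by simp
      next
        case True
        then have "f \<noteq> f'" using lf ij by auto
        then have "f ` solid_torus \<inter> f' ` solid_torus = {}"
          using lifts_disjoint[OF \<theta>(1,2)[OF lf(2)] lf(3)] lf(6) True by blast
        then show ?thesis by (simp add: lf P_def)
      qed
    qed
  qed
  moreover have "E - (\<Union>j\<in>J'. Q j) = X - \<mu> ` open_solid_torus - (\<Union>x\<in>J. snd x ` open_solid_torus)"
  proof -
    have "X \<inter> \<pi> -` K = \<mu> ` (sphere 0 1 \<times> {0})" using tub\<mu> by (simp add: tubular_nbhd_def)
    also have "\<dots> \<subseteq> \<mu> ` open_solid_torus" by (rule image_mono) (auto simp: open_solid_torus_def)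
    finally have "X \<inter> \<pi> -` K \<subseteq> \<mu> ` open_solid_torus" .
    then show ?thesis unfolding J'_def Q_def by auto
  qed
  ultimately show ?thesis by simp
qed

lemma bezout_surgery:
  assumes "coprime (a::int) b" obtains c d where "c * a - d * b = 1"
proof -
  obtain u v where "u * a + v * b = gcd a b" using bezout_int by blast
  then have "u * a - (- v) * b = 1" using assms by simp
  then show ?thesis by (rule that)
qed

text \<open>
  The powers of the generator on the glued-in solid tori: a rotation of the one at the branch set,
  and the permutation of those at the lifts of the link.
\<close>
lemma act_none_some:
  fixes T :: "(nat \<times> (complex \<times> complex \<Rightarrow> 'a)) option \<times> complex \<times> complex \<Rightarrow> (nat \<times> (complex \<times> complex \<Rightarrow> 'a)) option \<times> complex \<times> complex"
  assumes T1: "\<And>u v. T (None, u, v) = (None, \<omega> * u, v)"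
    and T2: "\<And>j f z. T (Some (j, f), z) = (Some (j, restrict (t \<circ> f) solid_torus), z)"
  shows "(T ^^ i) (None, u, v) = (None, \<omega> ^ i * u, v)"
    and "f \<in> extensional solid_torus \<Longrightarrow> (T ^^ i) (Some (j, f), z) = (Some (j, restrict ((t ^^ i) \<circ> f) solid_torus), z)"
proof -
  show "(T ^^ i) (None, u, v) = (None, \<omega> ^ i * u, v)"
    by (induction i) (simp_all add: T1 mult.assoc)
  show "(T ^^ i) (Some (j, f), z) = (Some (j, restrict ((t ^^ i) \<circ> f) solid_torus), z)" if "f \<in> extensional solid_torus"
  proof (induction i)
    case 0 then show ?case using that by (simp add: extensional_restrict)
  next
    case (Suc i)
    have "restrict (t \<circ> restrict ((t ^^ i) \<circ> f) solid_torus) solid_torus = restrict ((t ^^ Suc i) \<circ> f) solid_torus"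
      by (auto simp: restrict_def)
    moreover have "(T ^^ Suc i) (Some (j, f), z) = T (Some (j, restrict ((t ^^ i) \<circ> f) solid_torus), z)"
      using Suc by (metis funpow.simps(2) comp_apply)
    ultimately show ?case by (simp only: T2)
  qed
qed

theorem theorem1p2:
  fixes K :: "(real ^ 4) set" and L :: "nat \<Rightarrow> (real ^ 4) set"
    and F :: "(real ^ 4) set" and G :: "nat \<Rightarrow> (real ^ 4) set"
    and n k :: nat and p q :: int and I :: "nat \<Rightarrow> int"
    and \<nu> :: "complex \<times> complex \<Rightarrow> real ^ 4"
    and \<theta> :: "nat \<Rightarrow> complex \<times> complex \<Rightarrow> real ^ 4"
    and M1 :: "'a::topological_space set" and e1 :: "real ^ 4 \<Rightarrow> 'a"
    and M :: "'b::topological_space set" and e :: "'a \<Rightarrow> 'b"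
    and X :: "'c::topological_space set" and \<pi> :: "'c \<Rightarrow> real ^ 4"
    and \<mu> :: "complex \<times> complex \<Rightarrow> 'c"
    and N1 :: "'d::topological_space set" and d1 :: "'c \<Rightarrow> 'd"
    and N :: "'e::topological_space set" and d :: "'d \<Rightarrow> 'e"
  assumes knot: "tubular_nbhd S3 K \<nu>"
    and link: "\<forall>j<n. tubular_nbhd S3 (L j) (\<theta> j)"
      "\<forall>i<n. \<forall>j<n. i \<noteq> j \<longrightarrow> \<theta> i ` solid_torus \<inter> \<theta> j ` solid_torus = {}"
      "\<forall>j<n. \<nu> ` solid_torus \<inter> \<theta> j ` solid_torus = {}"
    and seifert: "seifert_surface F K" "\<forall>j<n. seifert_surface (G j) (L j)"
      "\<forall>j<n. \<exists>U. openin (top_of_set S3) U \<and> F \<subseteq> U \<and> G j \<inter> U = {}"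
    and longitudes: "preferred_longitude \<nu>" "\<forall>j<n. surface_longitude (G j) (\<theta> j)"
    and coefficients: "q \<ge> 1" "\<bar>p\<bar> \<ge> 1" "k > 1" "coprime (int k * p) q"
      "\<forall>j<n. I j \<in> {1, -1}"
    and M: "dehn_surgery S3 {()} (\<lambda>_. \<nu>) (\<lambda>_. int k * p) (\<lambda>_. q) M1 e1"
      "dehn_surgery M1 {..<n} (\<lambda>j. e1 \<circ> \<theta> j) I (\<lambda>_. 1) M e"
    and branched_cover: "branched_cyclic_cover k X \<pi> K" "branch_tubular_nbhd k X \<pi> K \<nu> \<mu>"
    and N: "dehn_surgery X {()} (\<lambda>_. \<mu>) (\<lambda>_. p) (\<lambda>_. q) N1 d1"
      "dehn_surgery N1 (SIGMA j:{..<n}. lifts X \<pi> (\<theta> j)) (\<lambda>(j, f). d1 \<circ> f)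
         (\<lambda>(j, f). I j) (\<lambda>_. 1) N d"
  shows "\<exists>\<rho>. regular_cyclic_covering k N \<rho> M"
proof -
  interpret B: branched_setup k X \<pi> K \<nu> \<mu>
    by unfold_locales (use knot branched_cover coefficients in auto)
  obtain t \<xi> where t: "cyclic_cover k B.E t \<pi> (S3 - K) \<xi>"
    "\<forall>u w. (u, w) \<in> solid_torus \<longrightarrow> w \<noteq> 0 \<longrightarrow> t (\<mu> (u, w)) = \<mu> (u, \<xi> * w)" "cmod \<xi> = 1"
    by (rule B.rotation)
  interpret C: cyclic_cover k B.E t \<pi> "S3 - K" \<xi> by (rule t(1))
  interpret A: branched_action k X \<pi> K \<nu> \<mu> t \<xi>
    by unfold_locales (use t in auto)
  have ost: "open_solid_torus \<subseteq> solid_torus" "torus \<subseteq> solid_torus" using solid_torus_split by auto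
  have K\<nu>: "K \<subseteq> \<nu> ` solid_torus" using knot by (auto simp: tubular_nbhd_def solid_torus_def)
  have emb\<theta>: "closed_embedding solid_torus S3 (\<theta> j)" if "j < n" for j using link(1) that by (simp add: tubular_nbhd_def)
  have op\<theta>: "openin (top_of_set S3) (\<theta> j ` open_solid_torus)" if "j < n" for j using link(1) that by (simp add: tubular_nbhd_def)
  have inj\<theta>: "inj_on (\<theta> j) solid_torus" if "j < n" for j by (rule closed_embeddingD(2)[OF emb\<theta>[OF that]])
  have \<theta>B: "\<theta> j ` solid_torus \<subseteq> S3 - K" if "j < n" for j
    using closed_embeddingD(3)[OF emb\<theta>[OF that]] link(3) K\<nu> that by blast
  have disj: "\<nu> ` solid_torus \<inter> \<theta> j ` solid_torus = {}" if "j < n" for j using link(3) that by blast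
  have disj2: "\<theta> i ` solid_torus \<inter> \<theta> j ` solid_torus = {}" if "i < n" "j < n" "i \<noteq> j" for i j using link(2) that by blast
  have ne: "lifts X \<pi> (\<theta> j) \<noteq> {}" if j: "j < n" for j
  proof -
    \<comment> \<open>The core \<open>L j\<close> lies on its Seifert surface \<open>G j\<close>, which avoids \<open>F\<close>.\<close>
    have off: "\<theta> j (u, 0) \<notin> F" if "u \<in> sphere 0 1" for u
    proof -
      have "L j = \<theta> j ` (sphere 0 1 \<times> {0})" using link(1) j by (auto simp: tubular_nbhd_def)
      then have "\<theta> j (u, 0) \<in> L j" using that by blast
      moreover have "L j \<subseteq> G j" using seifert(2) j by (simp add: seifert_surface_def surface_with_boundary_def)
      ultimately show ?thesis using seifert(3) j by blast
    qed
    obtain f where f: "continuous_on solid_torus f" "f ` solid_torus \<subseteq> B.E" "\<And>z. z \<in> solid_torus \<Longrightarrow> \<pi> (f z) = \<theta> j z"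
      by (rule B.lift_over_knot[OF t(1) seifert(1) t(2,3) closed_embeddingD(1)[OF emb\<theta>[OF j]] \<theta>B[OF j] off])
        (assumption, erule (1) that, blast)
    have "restrict f solid_torus \<in> lifts X \<pi> (\<theta> j)" using f by (auto simp: lifts_def)
    then show ?thesis by blast
  qed
  define J where "J = (SIGMA j:{..<n}. lifts X \<pi> (\<theta> j))"
  have finJ: "finite J" unfolding J_def using A.finite_lifts[OF \<theta>B] by auto
  have JD: "fst x < n" "snd x \<in> lifts X \<pi> (\<theta> (fst x))" if "x \<in> J" for x using that by (auto simp: J_def)
  have lf: "continuous_on solid_torus (snd x)" "snd x ` solid_torus \<subseteq> B.E" "\<And>z. z \<in> solid_torus \<Longrightarrow> \<pi> (snd x z) = \<theta> (fst x) z"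
    if "x \<in> J" for x
    using A.liftsD(1-3)[OF \<theta>B[OF JD(1)[OF that]] JD(2)[OF that]] by blast+
  have lift_inj: "inj_on (snd x) solid_torus" if "x \<in> J" for x
    using A.lifts_disjoint[OF \<theta>B[OF JD(1)[OF that]] inj\<theta>[OF JD(1)[OF that]] JD(2)[OF that] JD(2)[OF that]] by (meson inj_onI)
  obtain c0 d0 where det: "c0 * (int k * p) - d0 * q = 1" using bezout_surgery[OF coefficients(4)] .
  \<comment> \<open>The exteriors below and above, and linear attaching maps of the solid tori. For coefficient
    \<open>\<plusminus>1\<close> the rows \<open>(0, 1)\<close>, \<open>(-1, \<plusminus>1)\<close> have determinant \<open>1\<close>. At the knot, the same \<open>c0\<close>, \<open>d0\<close>
    are used on both levels, as required by \<open>linear_wrap\<close>.\<close>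
  define EM where "EM = S3 - \<nu> ` open_solid_torus - (\<Union>j<n. \<theta> j ` open_solid_torus)"
  define EN where "EN = X - \<mu> ` open_solid_torus - (\<Union>x\<in>J. snd x ` open_solid_torus)"
  define AM where "AM = case_option (\<lambda>z. \<nu> (torus_linear c0 q d0 (int k * p) z)) (\<lambda>j z. \<theta> j (torus_linear 0 1 (-1) (I j) z))"
  define AN where "AN = case_option (\<lambda>z. \<mu> (torus_linear (c0 * int k) q d0 p z))
    (\<lambda>x z. snd x (torus_linear 0 1 (-1) (I (fst x)) z))"
  have "\<exists>g. filling EM (insert None (Some ` {..<n})) AM M (e \<circ> e1) g"
    unfolding EM_def AM_def
    by (rule surgery_filling[OF M]) (use closed_embeddingD[OF B.emb\<nu>] closed_embeddingD[OF emb\<theta>] disj disj2 det in auto)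
  then obtain gM where gM: "filling EM (insert None (Some ` {..<n})) AM M (e \<circ> e1) gM" by blast
  have N2: "dehn_surgery N1 J (\<lambda>x. d1 \<circ> snd x) (\<lambda>x. I (fst x)) (\<lambda>_. 1) N d"
    using N(2) by (simp add: J_def case_prod_unfold)
  have \<pi>lift: "\<pi> ` snd x ` solid_torus = \<theta> (fst x) ` solid_torus" if "x \<in> J" for x
    unfolding image_image by (rule image_cong[OF refl]) (rule lf(3)[OF that])
  have \<pi>\<mu>: "\<pi> ` \<mu> ` solid_torus \<subseteq> \<nu> ` solid_torus"
  proof (clarsimp)
    fix u w :: complex assume "(u, w) \<in> solid_torus"
    then show "\<pi> (\<mu> (u, w)) \<in> \<nu> ` solid_torus" using B.proj_\<mu> B.power_solid by simp
  qed
  have djN: "\<mu> ` solid_torus \<inter> snd x ` solid_torus = {}" if "x \<in> J" for x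
    using \<pi>lift[OF that] \<pi>\<mu> disj[OF JD(1)[OF that]] by blast
  have djN2: "snd x ` solid_torus \<inter> snd y ` solid_torus = {}" if xy: "x \<in> J" "y \<in> J" "x \<noteq> y" for x y
  proof (cases "fst x = fst y")
    case False
    then show ?thesis using \<pi>lift[OF xy(1)] \<pi>lift[OF xy(2)] disj2[OF JD(1)[OF xy(1)] JD(1)[OF xy(2)]] by blast
  next
    case True
    then have "snd x \<noteq> snd y" using xy(3) by (simp add: prod_eq_iff)
    then show ?thesis
      using A.lifts_disjoint[OF \<theta>B[OF JD(1)[OF xy(1)]] inj\<theta>[OF JD(1)[OF xy(1)]] JD(2)[OF xy(1)]] JD(2)[OF xy(2)] True by force
  qed
  have "\<exists>g. filling EN (insert None (Some ` J)) AN N (d \<circ> d1) g"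
    unfolding EN_def AN_def
  proof (rule surgery_filling[OF N(1) N2 finJ closed_embeddingD(1-3)[OF B.emb\<mu>]])
    show "continuous_on solid_torus (snd x)" "inj_on (snd x) solid_torus" "snd x ` solid_torus \<subseteq> X" if "x \<in> J" for x
      using lf(1,2)[OF that] lift_inj[OF that] by auto
    show "c0 * int k * p - d0 * q = 1" using det by (simp add: mult.assoc)
    show "\<mu> ` solid_torus \<inter> snd x ` solid_torus = {}" if "x \<in> J" for x by (rule djN[OF that])
    show "snd x ` solid_torus \<inter> snd y ` solid_torus = {}" if "x \<in> J" "y \<in> J" "x \<noteq> y" for x y by (rule djN2[OF that])
  qed auto
  then obtain gN where gN: "filling EN (insert None (Some ` J)) AN N (d \<circ> d1) gN" by blast
  have EN_iff: "x \<in> EN \<longleftrightarrow> \<pi> x \<in> EM" if x: "x \<in> X" for x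
  proof -
    have "(\<exists>y\<in>J. x \<in> snd y ` open_solid_torus) \<longleftrightarrow> (\<exists>j<n. \<pi> x \<in> \<theta> j ` open_solid_torus)"
    proof
      assume "\<exists>y\<in>J. x \<in> snd y ` open_solid_torus"
      then obtain y z where y: "y \<in> J" "z \<in> open_solid_torus" "x = snd y z" by blast
      then have "\<pi> x = \<theta> (fst y) z" using lf(3)[OF y(1)] ost by blast
      then show "\<exists>j<n. \<pi> x \<in> \<theta> j ` open_solid_torus" using JD(1)[OF y(1)] y(2) by blast
    next
      assume "\<exists>j<n. \<pi> x \<in> \<theta> j ` open_solid_torus"
      then obtain j z where j: "j < n" "z \<in> open_solid_torus" "\<pi> x = \<theta> j z" by blast
      obtain f where "f \<in> lifts X \<pi> (\<theta> j)" using ne[OF j(1)] by blast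
      from A.lifts_through[OF \<theta>B[OF j(1)] this x j(3)] obtain f' where f': "f' \<in> lifts X \<pi> (\<theta> j)" "f' z = x" using j(2) ost by blast
      then have "(j, f') \<in> J" using j by (simp add: J_def)
      moreover have "x \<in> snd (j, f') ` open_solid_torus" using f' j(2) by auto
      ultimately show "\<exists>y\<in>J. x \<in> snd y ` open_solid_torus" by blast
    qed
    moreover have "\<pi> x \<in> S3" using B.imX x by blast
    ultimately show ?thesis unfolding EN_def EM_def using A.\<mu>_open_iff[OF x] x by auto
  qed
  have ENX: "EN \<subseteq> X" by (auto simp: EN_def)
  have EMB: "EM \<subseteq> S3 - K"
    unfolding EM_def using knot by (auto simp: tubular_nbhd_def open_solid_torus_def)
  have ENE: "EN \<subseteq> B.E" using EN_iff ENX EMB by auto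
  have \<pi>EN: "\<pi> ` EN = EM"
  proof
    show "\<pi> ` EN \<subseteq> EM" using EN_iff ENX by blast
    show "EM \<subseteq> \<pi> ` EN"
    proof
      fix y assume y: "y \<in> EM"
      then have "y \<in> \<pi> ` X" unfolding B.imX EM_def by blast
      then obtain x where "x \<in> X" "y = \<pi> x" by blast
      then show "y \<in> \<pi> ` EN" using EN_iff y by blast
    qed
  qed
  have tEN: "t x \<in> EN" if "x \<in> EN" for x
  proof -
    have xE: "x \<in> B.E" using ENE that by blast
    then have "t x \<in> B.E" "\<pi> (t x) = \<pi> x" using C.maps C.proj_pow[OF xE, of 1] by auto
    then show ?thesis using EN_iff[of x] EN_iff[of "t x"] that ENX by auto
  qed
  have actEN: "free_cyclic_action k EN t" by (rule C.free_on_subset[OF ENE tEN])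
  have connEN: "connected EN"
    unfolding EN_def by (rule A.connected_exterior[OF \<theta>B inj\<theta> op\<theta> disj2 disj J_def])
  have torEN: "\<mu> z \<in> EN" if "z \<in> torus" for z
  proof -
    have "torus_linear (c0 * int k) q d0 p ` torus = torus"
      by (rule torus_linear_bij(2)) (use det in \<open>simp add: mult.assoc\<close>)
    then have "z \<in> torus_linear (c0 * int k) q d0 p ` torus" using that by simp
    then obtain z' where "z' \<in> torus" "z = torus_linear (c0 * int k) q d0 p z'" by blast
    then show ?thesis using fillingD(4)[OF gN, of None z'] by (simp add: AN_def)
  qed
  have neEN: "EN \<noteq> {}" using torEN[of "(1, 1)"] by (auto simp: torus_def)
  have clEN: "closedin (top_of_set EM) (\<pi> ` D)" if D: "closedin (top_of_set EN) D" for D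
  proof -
    have "closedin (top_of_set B.E) EN"
    proof -
      have 1: "closedin (top_of_set S3) EM"
        unfolding EM_def using knot op\<theta> by (intro closedin_diff openin_Union) (auto simp: tubular_nbhd_def)
      have "EN = B.E \<inter> \<pi> -` EM" using EN_iff ENX ENE by auto
      moreover have "closedin (top_of_set B.E) (B.E \<inter> \<pi> -` EM)"
        by (rule continuous_closedin_preimage_gen[OF continuous_on_subset[OF B.contX] _ 1]) (use B.imX in auto)
      ultimately show ?thesis by simp
    qed
    then have "closedin (top_of_set B.E) D" using D closedin_trans by blast
    then have "closedin (top_of_set (S3 - K)) (\<pi> ` D)" by (rule C.closed_map)
    moreover have "\<pi> ` D \<subseteq> EM" using D closedin_imp_subset \<pi>EN by blast
    ultimately show ?thesis using EMB by (meson closedin_subset_trans)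
  qed
  have norm_\<xi>: "cmod \<xi> = 1" "\<xi> \<noteq> 0" using t(3) by auto
  \<comment> \<open>Seen from the glued-in solid torus, \<open>t\<close> multiplies \<open>u\<close> by \<open>\<omega>\<close>: this fixes \<open>x\<close>, where \<open>u\<close> has
    exponent \<open>k c0\<close>, and multiplies \<open>y\<close>, where it has exponent \<open>d0\<close>, by \<open>\<xi>\<close>.\<close>
  define \<omega> where "\<omega> = \<xi> powi (- q)"
  have \<omega>k: "\<omega> ^ k = 1"
  proof -
    have "\<omega> ^ k = (\<xi> ^ k) powi (- q)" unfolding \<omega>_def by (metis mult.commute power_int_mult power_int_of_nat)
    then show ?thesis using C.\<zeta>(1) by simp
  qed
  have \<omega>d: "\<omega> powi d0 = \<xi>"
  proof -
    have "\<omega> powi d0 = \<xi> powi (1 - int k * (c0 * p))"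
      unfolding \<omega>_def power_int_mult[symmetric] using det by (intro arg_cong[where f = "\<lambda>m. \<xi> powi m"]) (simp add: algebra_simps)
    also have "\<dots> = \<xi> / (\<xi> powi int k) powi (c0 * p)" using norm_\<xi> by (simp add: power_int_diff power_int_mult)
    also have "\<dots> = \<xi>" using C.\<zeta>(1) by simp
    finally show ?thesis .
  qed
  have \<omega>0: "\<omega> \<noteq> 0" "cmod \<omega> = 1" using norm_\<xi> by (auto simp: \<omega>_def norm_power_int)
  have \<omega>prim: "\<omega> ^ i \<noteq> 1" if "0 < i" "i < k" for i
  proof
    assume "\<omega> ^ i = 1"
    then have "(\<omega> powi d0) ^ i = 1" by (metis mult.commute power_int_1_left power_int_mult power_int_of_nat)
    then show False using \<omega>d C.\<zeta>(2)[OF that] by simp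
  qed
  interpret W: cyclic_cover k B.E t \<pi> "S3 - K" \<omega>
    by unfold_locales (use B.covE C.orb \<omega>k \<omega>prim in auto)
  \<comment> \<open>The data of \<open>filling_covering\<close>: the solid torus at a lift \<open>(j, f)\<close> lies over the one at \<open>j\<close>, and
    \<open>t\<close> takes it to the one at \<open>(j, t \<circ> f)\<close>.\<close>
  define bb where "bb = map_option (fst :: nat \<times> (complex \<times> complex \<Rightarrow> 'c) \<Rightarrow> nat)"
  define \<sigma> where "\<sigma> = map_option (\<lambda>x::nat \<times> (complex \<times> complex \<Rightarrow> 'c). (fst x, restrict (t \<circ> snd x) solid_torus))"
  define R where "R j z = (if j = None then (fst z ^ k, snd z) else z)" for j :: "(nat \<times> (complex \<times> complex \<Rightarrow> 'c)) option" and z :: "complex \<times> complex"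
  define S where "S j z = (if j = None then (\<omega> * fst z, snd z) else z)" for j :: "(nat \<times> (complex \<times> complex \<Rightarrow> 'c)) option" and z :: "complex \<times> complex"
  define T where "T w = (\<sigma> (fst w), S (fst w) (snd w))" for w
  let ?J = "insert None (Some ` J)"
  have T1: "T (None, u, v) = (None, \<omega> * u, v)" for u v by (simp add: T_def \<sigma>_def S_def)
  have T2: "T (Some (j, f), z) = (Some (j, restrict (t \<circ> f) solid_torus), z)" for j f z by (simp add: T_def \<sigma>_def S_def)
  note Ti = act_none_some[of T \<omega> t, OF T1 T2]
  have JE: "j = None \<or> (\<exists>i f. j = Some (i, f) \<and> i < n \<and> f \<in> lifts X \<pi> (\<theta> i))" if "j \<in> ?J" for j
    using that by (auto simp: J_def)
  have extl: "f \<in> extensional solid_torus" if "f \<in> lifts X \<pi> (\<theta> i)" for f i using that by (simp add: lifts_def)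
  show ?thesis
  proof (rule filling_covering[OF gN gM A.Hausdorff_subspace[OF ENX] connEN neEN actEN, where b = bb and \<sigma> = \<sigma> and R = R and S = S and T = T and \<pi> = \<pi>])
    show "continuous_on EN \<pi>" by (rule continuous_on_subset[OF B.contX ENX])
    show "\<pi> ` EN = EM" by (rule \<pi>EN)
    show "\<pi> x = \<pi> y \<longleftrightarrow> (\<exists>i. y = (t ^^ i) x)" if "x \<in> EN" "y \<in> EN" for x y using C.orb ENE that by blast
    show "bb ` ?J = insert None (Some ` {..<n})"
    proof -
      have "fst ` J = {..<n}"
      proof
        show "fst ` J \<subseteq> {..<n}" unfolding J_def by auto
        show "{..<n} \<subseteq> fst ` J"
        proof
          fix j assume j: "j \<in> {..<n}"
          then have "(j, g) \<in> J" if "g \<in> lifts X \<pi> (\<theta> j)" for g using that by (simp add: J_def)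
          moreover have "lifts X \<pi> (\<theta> j) \<noteq> {}" using ne j by simp
          ultimately show "j \<in> fst ` J" by (metis ex_in_conv fst_conv image_eqI)
        qed
      qed
      then have "Some ` fst ` J = Some ` {..<n}" by simp
      then show ?thesis by (simp add: bb_def image_image)
    qed
    show "\<sigma> ` ?J \<subseteq> ?J"
    proof -
      have "(fst x, restrict (t \<circ> snd x) solid_torus) \<in> J" if "x \<in> J" for x
        using A.lifts_act[OF \<theta>B[OF JD(1)[OF that]] JD(2)[OF that], of 1] JD(1)[OF that] by (simp add: J_def)
      then show ?thesis by (auto simp: \<sigma>_def)
    qed
    show "T (j, z) = (\<sigma> j, S j z)" for j z by (simp add: T_def)
    show "continuous_on solid_torus (R j)" for j
      unfolding R_def by (cases "j = None") (auto intro!: continuous_intros)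
    show "continuous_on solid_torus (S j)" for j
      unfolding S_def by (cases "j = None") (auto intro!: continuous_intros)
    show "R j ` solid_torus = solid_torus" for j
    proof (cases "j = None")
      case True
      have "R j ` solid_torus \<subseteq> solid_torus" using True by (auto simp: R_def solid_torus_def norm_power)
      moreover have "z \<in> R j ` solid_torus" if z: "z \<in> solid_torus" for z
      proof -
        obtain u v where uv: "z = (u, v)" "cmod u = 1" using z by (cases z) (auto simp: solid_torus_def)
        define r where "r = cis (Arg2pi u / k)"
        have "r ^ k = cis (Arg2pi u)" using coefficients(3) by (simp add: r_def Complex.DeMoivre)
        also have "\<dots> = u" using complex_norm_eq_1_exp[of u] uv(2) by (simp add: cis_conv_exp)
        finally have "z = R j (r, v)" using True uv by (simp add: R_def)
        moreover have "(r, v) \<in> solid_torus" using z uv by (simp add: solid_torus_def r_def)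
        ultimately show ?thesis by blast
      qed
      ultimately show ?thesis by blast
    next
      case False
      then have "R j = (\<lambda>z. z)" by (intro ext) (simp only: R_def if_False)
      then show ?thesis by simp
    qed
    show "R j z \<in> torus \<longleftrightarrow> z \<in> torus" if "z \<in> solid_torus" for j z
      using that by (cases z) (auto simp: R_def torus_def solid_torus_def norm_power)
    show "S j z \<in> solid_torus" if "z \<in> solid_torus" for j z
      using that \<omega>0 by (cases z) (auto simp: S_def solid_torus_def norm_mult)
    show "S j z \<in> torus" if "z \<in> torus" for j z
      using that \<omega>0 by (cases z) (auto simp: S_def torus_def norm_mult)
    show "\<pi> (AN j z) = AM (bb j) (R j z)" if j: "j \<in> ?J" and z: "z \<in> torus" for j z
      using JE[OF j]
    proof (elim disjE exE conjE)
      assume j: "j = None"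
      obtain u v where uv: "z = (u, v)" by fastforce
      obtain x y where xy: "torus_linear (c0 * int k) q d0 p (u, v) = (x, y)" by fastforce
      have "(x, y) \<in> torus" using torus_linear_torus[OF z, of "c0 * int k" q d0 p] xy uv by simp
      then have "\<pi> (\<mu> (x, y)) = \<nu> (x, y ^ k)" using B.proj_\<mu> ost by blast
      then show ?thesis using linear_wrap[OF z uv xy] xy by (simp add: j uv AN_def AM_def bb_def R_def)
    next
      fix i f assume jf: "j = Some (i, f)" "i < n" "f \<in> lifts X \<pi> (\<theta> i)"
      have "torus_linear 0 1 (-1) (I i) z \<in> solid_torus" using torus_linear_torus[OF z] ost by blast
      from A.liftsD(3)[OF \<theta>B[OF jf(2)] jf(3) this] show ?thesis by (simp add: jf(1) AN_def AM_def bb_def R_def)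
    qed
    show "t (AN j z) = AN (\<sigma> j) (S j z)" if j: "j \<in> ?J" and z: "z \<in> torus" for j z
      using JE[OF j]
    proof (elim disjE exE conjE)
      assume j: "j = None"
      obtain u v where uv: "z = (u, v)" by fastforce
      obtain x y where xy: "torus_linear (c0 * int k) q d0 p (u, v) = (x, y)" by fastforce
      have xyt: "(x, y) \<in> torus" using torus_linear_torus[OF z, of "c0 * int k" q d0 p] xy uv by simp
      have "\<omega> powi (c0 * int k) = 1" using \<omega>k by (metis mult.commute power_int_1_left power_int_mult power_int_of_nat)
      then have "torus_linear (c0 * int k) q d0 p (\<omega> * u, v) = (x, \<xi> * y)"
        using xy \<omega>d by (auto simp: torus_linear_def power_int_mult_distrib)
      moreover have "(x, y) \<in> solid_torus" "y \<noteq> 0" using xyt ost by (auto simp: torus_def)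
      ultimately show ?thesis using t(2) xy by (simp add: j uv AN_def \<sigma>_def S_def)
    next
      fix i f assume jf: "j = Some (i, f)" "i < n" "f \<in> lifts X \<pi> (\<theta> i)"
      have "torus_linear 0 1 (-1) (I i) z \<in> solid_torus" using torus_linear_torus[OF z] ost by blast
      then show ?thesis by (simp add: jf(1) AN_def \<sigma>_def S_def)
    qed
    show "bb (\<sigma> j) = bb j" for j by (cases j) (auto simp: bb_def \<sigma>_def)
    show "R (\<sigma> j) (S j z) = R j z" for j z
      using \<omega>k by (cases j) (auto simp: R_def S_def \<sigma>_def power_mult_distrib)
    show "(T ^^ k) (j, z) = (j, z)" if j: "j \<in> ?J" and z: "z \<in> solid_torus" for j z
      using JE[OF j]
    proof (elim disjE exE conjE)
      assume "j = None" then show ?thesis using Ti(1)[of k "fst z" "snd z"] \<omega>k by simp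
    next
      fix i f assume jf: "j = Some (i, f)" "i < n" "f \<in> lifts X \<pi> (\<theta> i)"
      have "restrict ((t ^^ k) \<circ> f) solid_torus = f"
      proof (rule extensionalityI[OF _ extl[OF jf(3)]])
        fix y assume y: "y \<in> solid_torus"
        then have "f y \<in> B.E" using A.liftsD(2)[OF \<theta>B[OF jf(2)] jf(3)] by blast
        then show "restrict ((t ^^ k) \<circ> f) solid_torus y = f y" using C.period y by simp
      qed simp
      then show ?thesis using Ti(2)[OF extl[OF jf(3)], of k i z] jf(1) by simp
    qed
    show "(T ^^ l) (j, z) \<noteq> (j, z)" if j: "j \<in> ?J" and z: "z \<in> solid_torus" and l: "0 < l" "l < k" for j z l
      using JE[OF j]
    proof (elim disjE exE conjE)
      assume "j = None"
      moreover have "fst z \<noteq> 0" using z by (auto simp: solid_torus_def)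
      ultimately show ?thesis using Ti(1)[of l "fst z" "snd z"] \<omega>prim[OF l] by (cases z) auto
    next
      fix i f assume jf: "j = Some (i, f)" "i < n" "f \<in> lifts X \<pi> (\<theta> i)"
      have fz: "f z \<in> B.E" using A.liftsD(2)[OF \<theta>B[OF jf(2)] jf(3)] z by blast
      have "restrict ((t ^^ l) \<circ> f) solid_torus z \<noteq> f z" using C.free[OF fz l] z by simp
      then have "restrict ((t ^^ l) \<circ> f) solid_torus \<noteq> f" by metis
      then show ?thesis using Ti(2)[OF extl[OF jf(3)], of l i z] jf(1) by simp
    qed
    show "\<exists>l. (j', z') = (T ^^ l) (j, z)"
      if j: "j \<in> ?J" "j' \<in> ?J" and z: "z \<in> solid_torus" "z' \<in> solid_torus" and eq: "bb j = bb j'" "R j z = R j' z'" for j z j' z'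
      using JE[OF j(1)]
    proof (elim disjE exE conjE)
      assume n: "j = None"
      then have n': "j' = None" using eq(1) by (simp add: bb_def)
      have "fst z \<noteq> 0" using z by (auto simp: solid_torus_def)
      have e: "fst z ^ k = fst z' ^ k" "snd z = snd z'" using eq(2) n n' by (auto simp: R_def)
      have "(fst z' / fst z) ^ k = 1" unfolding power_divide e(1)[symmetric] using \<open>fst z \<noteq> 0\<close> by simp
      then obtain l where "fst z' / fst z = \<omega> ^ l" using W.root_is_zeta_power by blast
      then have "fst z' = \<omega> ^ l * fst z" using \<open>fst z \<noteq> 0\<close> by (simp add: field_simps)
      then show ?thesis using Ti(1)[of l "fst z" "snd z"] e(2) n n' by (intro exI[of _ l]) (cases z; cases z'; simp)
    next
      fix i f assume jf: "j = Some (i, f)" "i < n" "f \<in> lifts X \<pi> (\<theta> i)"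
      then obtain f' where jf': "j' = Some (i, f')" "f' \<in> lifts X \<pi> (\<theta> i)"
        using JE[OF j(2)] eq(1) by (auto simp: bb_def)
      have "z' = z" using eq(2) jf jf' by (simp add: R_def)
      obtain l where "f' = restrict ((t ^^ l) \<circ> f) solid_torus" by (rule A.lifts_orbit[OF \<theta>B[OF jf(2)] jf(3) jf'(2)])
      then show ?thesis using Ti(2)[OF extl[OF jf(3)], of l i z] jf(1) jf'(1) \<open>z' = z\<close> by (intro exI[of _ l]) simp
    qed
  qed (use clEN in auto)
qed

end
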